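(* Let $1<p<+\infty$, $\varepsilon_0>0$, $\lambda>0$, and let $a\in L^\infty(\mathbb{R}_+\times(0,1))$ be such that $a\ge 0$ and $a\ge\lambda>0$ in $\mathbb{R}_+\times(x_0-\varepsilon_0,x_0+\varepsilon_0)\subset\mathbb{R}_+\times(0,1)$ for some $x_0\in(0,1)$. There exist positive constants $C$ and $\gamma$ depending only on $p$, $\|a\|_{L^\infty(\mathbb{R}_+\times(0,1))}$, $\varepsilon_0$, and $\lambda$ such that for all $\rho_0,\xi_0\in L^p(0,1)$ the unique (broad) solution $(\rho,\xi)$ of $$\begin{cases}\rho_t-\rho_x=-\tfrac12 a(\rho-\xi) & \text{in }\mathbb{R}_+\times(0,1),\\ \xi_t+\xi_x=\tfrac12 a(\rho-\xi) & \text{in }\mathbb{R}_+\times(0,1),\\ \rho(t,0)-\xi(t,0)=\rho(t,1)-\xi(t,1)=0 & \text{in }\mathbb{R}_+,\end{cases}$$ with the initial condition $\rho(0,\cdot)=\rho_0$ and $\xi(0,\cdot)=\xi_0$ satisfies $$\|(\rho-c_0,\xi-c_0)(t,\cdot)\|_{L^p(0,1)}\le C e^{-\gamma t}\,\|(\rho(0,\cdot)-c_0,\xi(0,\cdot)-c_0)\|_{L^p(0,1)},\qquad t\ge 0,$$ where $$c_0:=\frac12\int_0^1\big(\rho(0,x)+\xi(0,x)\big)\,dx.$$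
   Context: $\mathbb{R}_+=(0,+\infty)$, and $\|(f,g)\|_{L^p(0,1)}^p=\int_0^1(|f|^p+|g|^p)\,dx$. Broad solution: for $T>0$, a broad solution on $(0,T)$ of the system is a pair $(\rho,\xi)\in C([0,T];[L^p(0,1)]^2)\cap C([0,1];[L^p(0,T)]^2)$ that obeys the characteristic rules, i.e. with $F=-\tfrac12a(\rho-\xi)$ and $G=\tfrac12a(\rho-\xi)$, for a.e. $(t,x)\in(0,T)\times(0,1)$: $\rho(t,x)=\rho_0(x+t)+\int_0^tF(s,x+t-s)\,ds$ if $x+t<1$, and $\rho(t,x)=\rho(t+x-1,1)+\int_{t+x-1}^tF(s,x+t-s)\,ds$ if $x+t>1$; $\xi(t,x)=\xi_0(x-t)+\int_0^tG(s,x-t+s)\,ds$ if $x>t$, and $\xi(t,x)=\xi(t-x,0)+\int_{t-x}^tG(s,x-t+s)\,ds$ if $x<t$; and the boundary conditions $\rho(\cdot,0)=\xi(\cdot,0)$, $\rho(\cdot,1)=\xi(\cdot,1)$ hold a.e. in $(0,T)$. A solution on $\mathbb{R}_+$ is one whose restriction to $(0,T)$ is a broad solution for every $T>0$. *)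

theory Defs
  imports "HOL-Probability.Essential_Supremum"
begin

text \<open>
  Elements of Lebesgue spaces are represented by functions, for Lebesgue (not merely Borel)
  measurability. All integrals are therefore taken with respect to the completed measure.
\<close>

definition in_Lp :: "real \<Rightarrow> 'a measure \<Rightarrow> ('a \<Rightarrow> real) \<Rightarrow> bool" where
  "in_Lp p M f \<longleftrightarrow> f \<in> borel_measurable M \<and> integrable M (\<lambda>x. \<bar>f x\<bar> powr p)"

definition Lp2_norm :: "real \<Rightarrow> 'a measure \<Rightarrow> ('a \<Rightarrow> real) \<Rightarrow> ('a \<Rightarrow> real) \<Rightarrow> real" where
  "Lp2_norm p M f g = (LINT x|M. \<bar>f x\<bar> powr p + \<bar>g x\<bar> powr p) powr (1 / p)"

text \<open>\<open>(u, v) \<in> C(S; [L\<^sup>p(M)]\<^sup>2)\<close>, where \<open>u s\<close> and \<open>v s\<close> represent the values at \<open>s\<close>.\<close>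

definition cont_Lp2 ::
  "real \<Rightarrow> real set \<Rightarrow> 'a measure \<Rightarrow> (real \<Rightarrow> 'a \<Rightarrow> real) \<Rightarrow> (real \<Rightarrow> 'a \<Rightarrow> real) \<Rightarrow> bool" where
  "cont_Lp2 p S M u v \<longleftrightarrow>
     (\<forall>s\<in>S. in_Lp p M (u s) \<and> in_Lp p M (v s)) \<and>
     (\<forall>s\<in>S. ((\<lambda>r. Lp2_norm p M (\<lambda>y. u r y - u s y) (\<lambda>y. v r y - v s y)) \<longlongrightarrow> 0)
              (at s within S))"

definition in_Linf :: "'a measure \<Rightarrow> ('a \<Rightarrow> real) \<Rightarrow> bool" where
  "in_Linf M f \<longleftrightarrow> f \<in> borel_measurable M \<and> esssup M (\<lambda>z. ereal \<bar>f z\<bar>) < \<infinity>"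

definition Linf_norm :: "'a measure \<Rightarrow> ('a \<Rightarrow> real) \<Rightarrow> real" where
  "Linf_norm M f = real_of_ereal (esssup M (\<lambda>z. ereal \<bar>f z\<bar>))"

definition F_term ::
  "(real \<Rightarrow> real \<Rightarrow> real) \<Rightarrow> (real \<Rightarrow> real \<Rightarrow> real) \<Rightarrow> (real \<Rightarrow> real \<Rightarrow> real) \<Rightarrow> real \<Rightarrow> real \<Rightarrow> real" where
  "F_term a \<rho> \<xi> t x = - (1 / 2) * a t x * (\<rho> t x - \<xi> t x)"

definition G_term ::
  "(real \<Rightarrow> real \<Rightarrow> real) \<Rightarrow> (real \<Rightarrow> real \<Rightarrow> real) \<Rightarrow> (real \<Rightarrow> real \<Rightarrow> real) \<Rightarrow> real \<Rightarrow> real \<Rightarrow> real" where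
  "G_term a \<rho> \<xi> t x = (1 / 2) * a t x * (\<rho> t x - \<xi> t x)"

definition characteristic_rules ::
  "(real \<Rightarrow> real \<Rightarrow> real) \<Rightarrow> (real \<Rightarrow> real) \<Rightarrow> (real \<Rightarrow> real) \<Rightarrow>
   (real \<Rightarrow> real \<Rightarrow> real) \<Rightarrow> (real \<Rightarrow> real \<Rightarrow> real) \<Rightarrow> real \<Rightarrow> real \<Rightarrow> bool" where
  "characteristic_rules a \<rho>0 \<xi>0 \<rho> \<xi> t x \<longleftrightarrow>
     (x + t < 1 \<longrightarrow>
        \<rho> t x = \<rho>0 (x + t) + (LINT s|lebesgue_on {0<..<t}. F_term a \<rho> \<xi> s (x + t - s))) \<and>
     (x + t > 1 \<longrightarrow>
        \<rho> t x = \<rho> (t + x - 1) 1 +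
          (LINT s|lebesgue_on {t + x - 1<..<t}. F_term a \<rho> \<xi> s (x + t - s))) \<and>
     (x > t \<longrightarrow>
        \<xi> t x = \<xi>0 (x - t) + (LINT s|lebesgue_on {0<..<t}. G_term a \<rho> \<xi> s (x - t + s))) \<and>
     (x < t \<longrightarrow>
        \<xi> t x = \<xi> (t - x) 0 + (LINT s|lebesgue_on {t - x<..<t}. G_term a \<rho> \<xi> s (x - t + s)))"

text \<open>
  An element of \<open>C([0,T]; [L\<^sup>p(0,1)]\<^sup>2) \<inter> C([0,1]; [L\<^sup>p(0,T)]\<^sup>2)\<close> is represented by one pair of
  functions on \<open>[0,T] \<times> [0,1]\<close> whose slices in \<open>t\<close> and in \<open>x\<close> represent its values as a
  continuous map of \<open>t\<close> and of \<open>x\<close>, respectively. Such a representative always exists: a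
  jointly measurable one has the right slices outside null sets of \<open>t\<close> and of \<open>x\<close>, and can be
  corrected there without affecting the other slices. Joint measurability cannot be dropped,
  as it makes the two continuous maps define the same class on \<open>(0,T) \<times> (0,1)\<close>.
\<close>

definition broad_solution ::
  "real \<Rightarrow> real \<Rightarrow> (real \<Rightarrow> real \<Rightarrow> real) \<Rightarrow> (real \<Rightarrow> real) \<Rightarrow> (real \<Rightarrow> real) \<Rightarrow>
   (real \<Rightarrow> real \<Rightarrow> real) \<Rightarrow> (real \<Rightarrow> real \<Rightarrow> real) \<Rightarrow> bool" where
  "broad_solution p T a \<rho>0 \<xi>0 \<rho> \<xi> \<longleftrightarrow>
     (\<lambda>(t, x). \<rho> t x) \<in> borel_measurable (lebesgue_on ({0<..<T} \<times> {0<..<1})) \<and>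
     (\<lambda>(t, x). \<xi> t x) \<in> borel_measurable (lebesgue_on ({0<..<T} \<times> {0<..<1})) \<and>
     cont_Lp2 p {0..T} (lebesgue_on {0<..<1}) \<rho> \<xi> \<and>
     cont_Lp2 p {0..1} (lebesgue_on {0<..<T}) (\<lambda>x t. \<rho> t x) (\<lambda>x t. \<xi> t x) \<and>
     (AE (t, x) in lebesgue_on ({0<..<T} \<times> {0<..<1}). characteristic_rules a \<rho>0 \<xi>0 \<rho> \<xi> t x) \<and>
     (AE t in lebesgue_on {0<..<T}. \<rho> t 0 = \<xi> t 0 \<and> \<rho> t 1 = \<xi> t 1)"

definition global_broad_solution ::
  "real \<Rightarrow> (real \<Rightarrow> real \<Rightarrow> real) \<Rightarrow> (real \<Rightarrow> real) \<Rightarrow> (real \<Rightarrow> real) \<Rightarrow>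
   (real \<Rightarrow> real \<Rightarrow> real) \<Rightarrow> (real \<Rightarrow> real \<Rightarrow> real) \<Rightarrow> bool" where
  "global_broad_solution p a \<rho>0 \<xi>0 \<rho> \<xi> \<longleftrightarrow>
     (\<forall>T>0. broad_solution p T a \<rho>0 \<xi>0 \<rho> \<xi>) \<and>
     (AE x in lebesgue_on {0<..<1}. \<rho> 0 x = \<rho>0 x \<and> \<xi> 0 x = \<xi>0 x)"

definition mean_state :: "(real \<Rightarrow> real \<Rightarrow> real) \<Rightarrow> (real \<Rightarrow> real \<Rightarrow> real) \<Rightarrow> real" where
  "mean_state \<rho> \<xi> = (1 / 2) * (LINT x|lebesgue_on {0<..<1}. \<rho> 0 x + \<xi> 0 x)"

end

theory Submission
  imports Defs
begin

text \<open>
  The system becomes a jump process on a circle. Put \<open>u(t,y) = \<xi>(t,y)\<close> and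
  \<open>u(t,-y) = \<rho>(t,y)\<close> for \<open>0 < y < 1\<close> and extend \<open>u\<close>
  with period \<open>2\<close>; the boundary conditions say that \<open>u\<close> is continuous
  across the integers. With the even extension \<open>\<alpha>\<close> of \<open>a\<close> the
  system turns into \<open>u\<^sub>t + u\<^sub>y = \<alpha> (u(t,-y) - u(t,y)) / 2\<close>, and
  in the coordinate \<open>z = y - t\<close>, for \<open>v(t,z) = u(t,z+t)\<close>, into the
  ordinary differential equation \<open>v\<^sub>t = k(t,z) (v(t,-z-2t) - v(t,z))\<close> with
  \<open>k(t,z) = \<alpha>(t,z+t)/2\<close>. Everything is done for this equation.

  Since \<open>0 \<le> k \<le> c\<close>, the function \<open>e\<^sup>c\<^sup>t v\<close> solves
  an integral equation with a positive kernel. Its solution \<open>evol\<close> is the limit of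
  an increasing iteration on \<open>[0,\<infinity>]\<close>-valued functions, and least among
  all supersolutions. Linearity, the semigroup law \<open>evol_evol\<close> and pointwise bounds
  \<open>evol_bound\<close> follow from that. The rate is invariant under \<open>z \<mapsto>
  -z-2t\<close>, so the integral over a period is multiplied exactly by
  \<open>e\<^sup>c\<^sup>t\<close> (\<open>per_evol\<close>), and so are constants
  (\<open>evol_one\<close>): the damped evolution preserves the mean and the constant state
  \<open>c\<^sub>0\<close>.

  The decay is a Doeblin argument. Where \<open>\<alpha> \<ge> \<lambda>\<close>, near
  \<open>x\<^sub>0\<close> and near \<open>-x\<^sub>0\<close>, the process jumps from the
  characteristic \<open>z\<close> to \<open>-z-2r\<close> at a rate of at least
  \<open>\<lambda>/2\<close>. Two jumps, one in each window, move \<open>z\<close> by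
  \<open>-2(h + h')\<close>, where \<open>h, h'\<close> are the offsets of the jump times inside
  the windows; the positions \<open>\<plusminus>x\<^sub>0\<close> cancel. Repeating this covers
  the circle after a time \<open>T\<^sub>0\<close> that depends only on
  \<open>\<epsilon>\<^sub>0\<close>, which gives \<open>evol f \<ge> \<kappa>
  \<integral>f\<close> (\<open>evol_minorization\<close>). For data of mean zero one may
  subtract \<open>\<kappa> \<integral>f\<close>; what is left is again a positive operator, and
  its mass and its value at the constant \<open>1\<close> are both \<open>e\<^sup>c\<^sup>T -
  2\<kappa>\<close>, where \<open>T = T\<^sub>0\<close>. By Hoelder's inequality its norm on
  \<open>L\<^sup>p\<close> is at most that number (\<open>evol_diff_Lp\<close>), and at most
  \<open>1 - 2\<kappa> e\<^sup>-\<^sup>c\<^sup>T < 1\<close> after damping. Iterating over time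
  steps of length \<open>T\<^sub>0\<close> gives \<open>flow_decay\<close>.

  The rest relates the equation to broad solutions. The flow yields a broad solution
  (\<open>wave_broad_solution\<close>), the continuity coming from that of translations in
  \<open>L\<^sup>p\<close>. Conversely a broad solution satisfies the integral equation only
  between two visits of a characteristic to the boundary; continuity in \<open>x\<close>
  identifies the boundary value with the limit from the inside, so the pieces can be joined
  (\<open>lagrangian_from_segments\<close>), and Gronwall's inequality in
  \<open>L\<^sup>1\<close> shows that the solution is the flow
  (\<open>lagrangian_unique\<close>).
\<close>

section \<open>Integrals over one period\<close>

definition periodic2 :: "(real \<Rightarrow> 'a) \<Rightarrow> bool" where
  "periodic2 f \<longleftrightarrow> (\<forall>z. f (z + 2) = f z)"

definition per :: "(real \<Rightarrow> ennreal) \<Rightarrow> ennreal" where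
  "per f = (\<integral>\<^sup>+z\<in>{-1..<1}. f z \<partial>lborel)"

lemma periodic2_int:
  assumes "periodic2 f"
  shows "f (z + 2 * real_of_int m) = f z"
proof -
  have nat: "f (z + 2 * real n) = f z" for n z
    by (induction n) (use assms in \<open>auto simp: periodic2_def algebra_simps, metis add.assoc add.commute\<close>)
  show ?thesis
  proof (cases "m \<ge> 0")
    case True
    then show ?thesis using nat[of z "nat m"] by simp
  next
    case False
    then show ?thesis using nat[of "z + 2 * real_of_int m" "nat (- m)"] by simp
  qed
qed

lemma nn_integral_interval_shift:
  fixes f :: "real \<Rightarrow> ennreal"
  assumes [measurable]: "f \<in> borel_measurable borel"
  shows "(\<integral>\<^sup>+z\<in>{a..<b}. f (z + h) \<partial>lborel) = (\<integral>\<^sup>+z\<in>{a + h..<b + h}. f z \<partial>lborel)"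
  by (subst nn_integral_real_affine[of "\<lambda>z. f z * indicator {a + h..<b + h} z" 1 h])
     (auto intro!: nn_integral_cong simp: indicator_def add.commute)

lemma nn_integral_interval_split:
  fixes f :: "real \<Rightarrow> ennreal"
  assumes [measurable]: "f \<in> borel_measurable borel" and "a \<le> b" "b \<le> c"
  shows "(\<integral>\<^sup>+z\<in>{a..<c}. f z \<partial>lborel) = (\<integral>\<^sup>+z\<in>{a..<b}. f z \<partial>lborel) + (\<integral>\<^sup>+z\<in>{b..<c}. f z \<partial>lborel)"
  using assms(2,3)
  by (subst nn_integral_add[symmetric]) (auto intro!: nn_integral_cong simp: indicator_def)

lemma per_interval:
  assumes f [measurable]: "f \<in> borel_measurable borel" and "periodic2 f"
  shows "(\<integral>\<^sup>+z\<in>{a..<a+2}. f z \<partial>lborel) = per f"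
proof -
  define m where "m = \<lfloor>(a + 1) / 2\<rfloor>"
  define b where "b = a - 2 * real_of_int m"
  have b: "-1 \<le> b" "b < 1"
    unfolding b_def m_def using floor_correct[of "(a + 1) / 2"] by (simp_all add: field_simps)
  have P: "f (z + 2 * real_of_int i) = f z" for z i
    using periodic2_int[OF assms(2)] .
  have "(\<integral>\<^sup>+z\<in>{a..<a+2}. f z \<partial>lborel) = (\<integral>\<^sup>+z\<in>{b..<b+2}. f z \<partial>lborel)"
    using nn_integral_interval_shift[OF f, of "2 * real_of_int m" b "b+2"]
    by (simp add: P) (simp add: b_def algebra_simps)
  also have "\<dots> = (\<integral>\<^sup>+z\<in>{b..<1}. f z \<partial>lborel) + (\<integral>\<^sup>+z\<in>{1..<b+2}. f z \<partial>lborel)"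
    using b by (intro nn_integral_interval_split) auto
  also have "(\<integral>\<^sup>+z\<in>{1..<b+2}. f z \<partial>lborel) = (\<integral>\<^sup>+z\<in>{-1..<b}. f z \<partial>lborel)"
    using nn_integral_interval_shift[OF f, of 2 "-1" b] P[of _ 1] by simp
  also have "(\<integral>\<^sup>+z\<in>{b..<1}. f z \<partial>lborel) + (\<integral>\<^sup>+z\<in>{-1..<b}. f z \<partial>lborel) = per f"
    unfolding per_def using nn_integral_interval_split[of f "-1" b 1] b by (simp add: add.commute)
  finally show ?thesis .
qed

lemma per_reflect:
  assumes f [measurable]: "f \<in> borel_measurable borel" and "periodic2 f"
  shows "per (\<lambda>z. f (b - z)) = per f"
proof -
  have "per f = (\<integral>\<^sup>+z\<in>{b-1..<b-1+2}. f z \<partial>lborel)"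
    using per_interval[OF assms, of "b - 1"] by simp
  also have "\<dots> = (\<integral>\<^sup>+z. f (b - z) * indicator {b-1..<b+1} (b - z) \<partial>lborel)"
    by (subst nn_integral_real_affine[of _ "-1" b]) (auto simp: algebra_simps)
  also have "\<dots> = (\<integral>\<^sup>+z. f (b - z) * indicator {-1..<1} z \<partial>lborel)"
  proof (intro nn_integral_cong_AE)
    show "AE z in lborel. f (b - z) * indicator {b - 1..<b + 1} (b - z) = f (b - z) * indicator {-1..<1} z"
      using AE_lborel_singleton[of "1::real"] AE_lborel_singleton[of "-1::real"]
      by eventually_elim (auto simp: indicator_def)
  qed
  finally show ?thesis by (simp add: per_def)
qed

lemma per_shift:
  assumes f [measurable]: "f \<in> borel_measurable borel" and "periodic2 f"
  shows "per (\<lambda>z. f (z + b)) = per f"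
proof -
  have "per (\<lambda>z. f (z + b)) = (\<integral>\<^sup>+z\<in>{b-1..<b-1+2}. f z \<partial>lborel)"
    unfolding per_def using nn_integral_interval_shift[OF f, of b "-1" 1]
    by (simp add: add.commute)
  then show ?thesis
    using per_interval[OF assms, of "b - 1"] by simp
qed

lemma per_add:
  "f \<in> borel_measurable borel \<Longrightarrow> g \<in> borel_measurable borel \<Longrightarrow>
    per (\<lambda>z. f z + g z) = per f + per g"
  unfolding per_def by (simp add: distrib_right nn_integral_add)

lemma per_cmult:
  "f \<in> borel_measurable borel \<Longrightarrow> per (\<lambda>z. a * f z) = a * per f"
  unfolding per_def by (simp add: nn_integral_cmult mult.assoc)

lemma per_mono: "(\<And>z. f z \<le> g z) \<Longrightarrow> per f \<le> per g"
  unfolding per_def by (intro nn_integral_mono mult_right_mono) auto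

lemma per_const: "per (\<lambda>z. a) = 2 * a"
  unfolding per_def by (subst nn_integral_cmult_indicator) (auto simp: mult.commute)

lemma per_cong: "(\<And>z. f z = g z) \<Longrightarrow> per f = per g"
  by (auto simp: per_def)

section \<open>The exchange equation and its positive evolution\<close>

definition exp_partial :: "real \<Rightarrow> nat \<Rightarrow> real \<Rightarrow> real" where
  "exp_partial c n x = (\<Sum>i<n. (c * x) ^ i / fact i)"

lemma exp_partial_deriv:
  "((\<lambda>r. exp_partial c (Suc n) (r - s)) has_real_derivative c * exp_partial c n (r - s)) (at r)"
proof -
  have "((\<lambda>r. (c * (r - s)) ^ Suc i / fact (Suc i)) has_real_derivative c * ((c * (r - s)) ^ i / fact i)) (at r)" for i
    by (rule derivative_eq_intros refl | simp)+ 
  then have "((\<lambda>r. 1 + (\<Sum>i<n. (c * (r - s)) ^ Suc i / fact (Suc i))) has_real_derivative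
      0 + (\<Sum>i<n. c * ((c * (r - s)) ^ i / fact i))) (at r)"
    by (intro derivative_intros)
  then show ?thesis
    unfolding exp_partial_def sum.lessThan_Suc_shift by (simp add: sum_distrib_left)
qed

lemma exp_partial_nonneg: "0 \<le> c \<Longrightarrow> 0 \<le> x \<Longrightarrow> 0 \<le> exp_partial c n x"
  by (auto simp: exp_partial_def intro!: sum_nonneg)

lemma exp_partial_measurable [measurable]: "exp_partial c n \<in> borel_measurable borel"
  unfolding exp_partial_def by measurable

text \<open>
  The integrals over a period of the iterates that define \<open>evol\<close> obey this
  recursion, so they are partial sums of the exponential series.
\<close>

lemma exp_partial_integral:
  assumes "0 \<le> c" "s \<le> t"
  shows "ennreal (exp_partial c (Suc n) (t - s)) =
    1 + (\<integral>\<^sup>+r\<in>{s..t}. ennreal c * ennreal (exp_partial c n (r - s)) \<partial>lborel)"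
proof -
  have "(\<integral>\<^sup>+r\<in>{s..t}. ennreal (c * exp_partial c n (r - s)) \<partial>lborel) =
      ennreal (exp_partial c (Suc n) (t - s) - exp_partial c (Suc n) (s - s))"
    using assms
    by (intro nn_integral_FTC_Icc)
       (auto intro!: mult_nonneg_nonneg exp_partial_nonneg DERIV_subset[OF exp_partial_deriv]
             simp flip: has_real_derivative_iff_has_vector_derivative)
  moreover have "exp_partial c (Suc n) (s - s) = 1"
    unfolding exp_partial_def sum.lessThan_Suc_shift by simp
  moreover have "exp_partial c (Suc n) (t - s) \<ge> 1"
    unfolding exp_partial_def sum.lessThan_Suc_shift using assms by (auto intro!: sum_nonneg)
  moreover have "(\<integral>\<^sup>+r\<in>{s..t}. ennreal c * ennreal (exp_partial c n (r - s)) \<partial>lborel)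
     = (\<integral>\<^sup>+r\<in>{s..t}. ennreal (c * exp_partial c n (r - s)) \<partial>lborel)"
    using assms by (intro nn_integral_cong) (auto simp: indicator_def ennreal_mult exp_partial_nonneg)
  ultimately have "1 + (\<integral>\<^sup>+r\<in>{s..t}. ennreal c * ennreal (exp_partial c n (r - s)) \<partial>lborel)
      = ennreal 1 + ennreal (exp_partial c (Suc n) (t - s) - 1)"
    by simp
  also have "\<dots> = ennreal (exp_partial c (Suc n) (t - s))"
    using \<open>exp_partial c (Suc n) (t - s) \<ge> 1\<close> by (subst ennreal_plus[symmetric]) auto
  finally show ?thesis ..
qed

lemma exp_partial_sup:
  assumes "0 \<le> c" "0 \<le> x"
  shows "(SUP n. ennreal (exp_partial c n x)) = ennreal (exp (c * x))"
proof (rule SUP_Lim)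
  show "incseq (\<lambda>n. ennreal (exp_partial c n x))"
    using assms by (auto simp: incseq_def exp_partial_def intro!: ennreal_leI sum_mono2)
  have "(\<lambda>n. (c * x) ^ n / fact n) sums exp (c * x)"
    using exp_converges[of "c * x"] by (simp add: field_simps)
  then show "(\<lambda>n. ennreal (exp_partial c n x)) \<longlonglongrightarrow> ennreal (exp (c * x))"
    unfolding sums_def exp_partial_def by (rule tendsto_ennrealI)
qed

lemma borel_pair_compose:
  assumes "case_prod f \<in> borel_measurable (borel \<Otimes>\<^sub>M borel)"
    and "g \<in> borel_measurable M" "h \<in> borel_measurable M"
  shows "(\<lambda>x. f (g x) (h x)) \<in> borel_measurable M"
  using measurable_compose[OF measurable_Pair[OF assms(2,3)] assms(1)] by simp

lemma nn_integral_Icc_split: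
  fixes f :: "real \<Rightarrow> ennreal"
  assumes [measurable]: "f \<in> borel_measurable borel" and "a \<le> b" "b \<le> c"
  shows "(\<integral>\<^sup>+z\<in>{a..c}. f z \<partial>lborel) = (\<integral>\<^sup>+z\<in>{a..b}. f z \<partial>lborel) + (\<integral>\<^sup>+z\<in>{b..c}. f z \<partial>lborel)"
proof -
  have "(\<integral>\<^sup>+z\<in>{a..c}. f z \<partial>lborel) = (\<integral>\<^sup>+z. f z * indicator {a..b} z + f z * indicator {b..c} z \<partial>lborel)"
  proof (rule nn_integral_cong_AE)
    show "AE z in lborel. f z * indicator {a..c} z = f z * indicator {a..b} z + f z * indicator {b..c} z"
      using AE_lborel_singleton[of b] by eventually_elim (use assms(2,3) in \<open>auto simp: indicator_def\<close>)
  qed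
  then show ?thesis by (simp add: nn_integral_add)
qed

text \<open>
  The points \<open>z\<close> and \<open>-z-2r\<close> are the two characteristics that sit at
  opposite points \<open>y\<close> and \<open>-y\<close> of the circle at time \<open>r\<close>.
  That both jump with the same rate, \<open>rate_reflect\<close>, is what makes the Lebesgue
  measure invariant.
\<close>

locale exchange =
  fixes c :: real and k :: "real \<Rightarrow> real \<Rightarrow> real"
  assumes rate_measurable: "case_prod k \<in> borel_measurable (borel \<Otimes>\<^sub>M borel)"
    and rate_nonneg: "0 \<le> k r z" and rate_le: "k r z \<le> c"
    and rate_reflect: "k r (- z - 2 * r) = k r z"
    and rate_periodic: "k r (z + 2) = k r z"
begin

lemma bound_nonneg: "0 \<le> c"
  using rate_nonneg rate_le order_trans by blast

lemmas rate_compose [measurable] = borel_pair_compose[OF rate_measurable]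

text \<open>
  For \<open>w = e\<^sup>c\<^sup>t v\<close> the loss term of \<open>v\<^sub>t = k (v(-z-2t) -
  v(z))\<close> is absorbed, and the right-hand side is a combination of values of
  \<open>w\<close> with nonnegative coefficients.
\<close>

definition gain :: "(real \<Rightarrow> real \<Rightarrow> ennreal) \<Rightarrow> real \<Rightarrow> real \<Rightarrow> ennreal" where
  "gain w r z = ennreal (c - k r z) * w r z + ennreal (k r z) * w r (- z - 2 * r)"

primrec iter :: "real \<Rightarrow> (real \<Rightarrow> ennreal) \<Rightarrow> nat \<Rightarrow> real \<Rightarrow> real \<Rightarrow> ennreal" where
  "iter s f 0 t z = 0"
| "iter s f (Suc n) t z = f z + (\<integral>\<^sup>+r\<in>{s..t}. gain (iter s f n) r z \<partial>lborel)"

definition evol :: "real \<Rightarrow> (real \<Rightarrow> ennreal) \<Rightarrow> real \<Rightarrow> real \<Rightarrow> ennreal" where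
  "evol s f t z = (SUP n. iter s f n t z)"

lemma gain_mono: "(\<And>z. w r z \<le> w' r z) \<Longrightarrow> gain w r z \<le> gain w' r z"
  unfolding gain_def by (intro add_mono mult_left_mono) auto

lemma gain_measurable:
  assumes "case_prod w \<in> borel_measurable (borel \<Otimes>\<^sub>M borel)"
  shows "case_prod (gain w) \<in> borel_measurable (borel \<Otimes>\<^sub>M borel)"
proof -
  note [measurable] = borel_pair_compose[OF assms]
  show ?thesis unfolding gain_def by measurable
qed

lemma integral_measurable:
  fixes w :: "real \<Rightarrow> real \<Rightarrow> ennreal"
  assumes "case_prod w \<in> borel_measurable (borel \<Otimes>\<^sub>M borel)"
  shows "case_prod (\<lambda>t z. \<integral>\<^sup>+r\<in>{s..t}. w r z \<partial>lborel) \<in> borel_measurable (borel \<Otimes>\<^sub>M borel)"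
proof -
  note [measurable] = borel_pair_compose[OF assms]
  have "(\<lambda>(t, z). \<integral>\<^sup>+r. w r z * (if s \<le> r \<and> r \<le> t then 1 else 0) \<partial>lborel) \<in> borel_measurable (borel \<Otimes>\<^sub>M borel)"
    by measurable
  then show ?thesis by (simp add: indicator_def)
qed

lemma iter_measurable:
  assumes [measurable]: "f \<in> borel_measurable borel"
  shows "case_prod (iter s f n) \<in> borel_measurable (borel \<Otimes>\<^sub>M borel)"
proof (induction n)
  case (Suc n)
  note [measurable] = borel_pair_compose[OF integral_measurable[OF gain_measurable[OF Suc]]]
  show ?case by simp
qed simp

lemma evol_measurable:
  assumes [measurable]: "f \<in> borel_measurable borel"
  shows "case_prod (evol s f) \<in> borel_measurable (borel \<Otimes>\<^sub>M borel)"
proof -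
  note [measurable] = borel_pair_compose[OF iter_measurable[OF assms]]
  show ?thesis unfolding evol_def by measurable
qed

lemma iter_le_Suc: "iter s f n t z \<le> iter s f (Suc n) t z"
proof (induction n arbitrary: t z)
  case (Suc n)
  have "iter s f (Suc m) t z = f z + (\<integral>\<^sup>+r\<in>{s..t}. gain (iter s f m) r z \<partial>lborel)" for m
    by (rule iter.simps(2))
  note eq = this[of n] this[of "Suc n"]
  show ?case
    unfolding eq
    by (rule add_left_mono, rule nn_integral_mono, rule mult_right_mono, rule gain_mono, rule Suc, simp)
qed simp

lemma iter_incseq: "incseq (\<lambda>n. iter s f n t z)"
  by (intro incseq_SucI iter_le_Suc)

lemma gain_SUP:
  "gain (evol s f) r z = (SUP n. gain (iter s f n) r z)"
proof -
  have inc: "incseq (\<lambda>n. a * iter s f n t z)" for a t z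
    using iter_incseq by (auto simp: incseq_def intro!: mult_left_mono)
  show ?thesis
    unfolding gain_def evol_def by (simp add: SUP_mult_left_ennreal ennreal_SUP_add[OF inc inc])
qed

lemma evol_eq:
  assumes [measurable]: "f \<in> borel_measurable borel"
  shows "evol s f t z = f z + (\<integral>\<^sup>+r\<in>{s..t}. gain (evol s f) r z \<partial>lborel)"
proof -
  note [measurable] = borel_pair_compose[OF gain_measurable[OF iter_measurable[OF assms]]]
  have "evol s f t z = (SUP n. iter s f (Suc n) t z)"
    unfolding evol_def
    by (rule antisym; rule SUP_mono) (blast intro: iter_le_Suc)+
  also have "\<dots> = f z + (SUP n. \<integral>\<^sup>+r\<in>{s..t}. gain (iter s f n) r z \<partial>lborel)"
    by (simp add: ennreal_SUP_add_right)
  also have "(SUP n. \<integral>\<^sup>+r\<in>{s..t}. gain (iter s f n) r z \<partial>lborel) =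
      (\<integral>\<^sup>+r. (SUP n. gain (iter s f n) r z * indicator {s..t} r) \<partial>lborel)"
    by (rule nn_integral_monotone_convergence_SUP[symmetric])
       (auto simp: incseq_def le_fun_def intro!: mult_right_mono gain_mono incseqD[OF iter_incseq])
  also have "\<dots> = (\<integral>\<^sup>+r\<in>{s..t}. gain (evol s f) r z \<partial>lborel)"
    unfolding gain_SUP by (intro nn_integral_cong) (simp add: SUP_mult_right_ennreal)
  finally show ?thesis .
qed

text \<open>
  An induction over the iterates bounds the evolution by any supersolution. The pointwise upper
  bounds for \<open>evol\<close> and the semigroup law come from here.
\<close>

lemma evol_least:
  assumes "\<And>t z. s \<le> t \<Longrightarrow> t \<le> T \<Longrightarrow> f z + (\<integral>\<^sup>+r\<in>{s..t}. gain g r z \<partial>lborel) \<le> g t z"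
    and "s \<le> t" "t \<le> T"
  shows "evol s f t z \<le> g t z"
  unfolding evol_def
proof (rule SUP_least)
  fix n
  show "iter s f n t z \<le> g t z"
    using assms(2,3)
  proof (induction n arbitrary: t z)
    case (Suc n)
    have "iter s f (Suc n) t z \<le> f z + (\<integral>\<^sup>+r\<in>{s..t}. gain g r z \<partial>lborel)"
      unfolding iter.simps
      by (intro add_left_mono nn_integral_mono)
         (use Suc in \<open>auto simp: indicator_def intro!: gain_mono\<close>)
    also have "\<dots> \<le> g t z" using Suc.prems by (rule assms(1))
    finally show ?case .
  qed simp
qed

lemma evol_periodic:
  assumes "periodic2 f"
  shows "periodic2 (evol s f t)"
proof -
  have it: "iter s f n t (z + 2) = iter s f n t z" for n t z
  proof (induction n arbitrary: t z)
    case (Suc n)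
    have "iter s f n r (- (z + 2) - 2 * r) = iter s f n r (- z - 2 * r)" for r
      using Suc[of r "- (z + 2) - 2 * r"] by (simp add: algebra_simps)
    then show ?case
      using assms by (simp add: gain_def Suc rate_periodic periodic2_def)
  qed simp
  then show ?thesis by (simp add: evol_def periodic2_def)
qed

lemma evol_add:
  assumes [measurable]: "f \<in> borel_measurable borel" "g \<in> borel_measurable borel"
  shows "evol s (\<lambda>z. f z + g z) t z = evol s f t z + evol s g t z"
proof -
  note [measurable] = borel_pair_compose[OF gain_measurable[OF iter_measurable[OF assms(1)]]]
    borel_pair_compose[OF gain_measurable[OF iter_measurable[OF assms(2)]]]
  have "iter s (\<lambda>z. f z + g z) n t z = iter s f n t z + iter s g n t z" for n t z
  proof (induction n arbitrary: t z)
    case (Suc n)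
    have "gain (iter s (\<lambda>z. f z + g z) n) r z = gain (iter s f n) r z + gain (iter s g n) r z" for r z
      by (simp add: gain_def Suc distrib_left ac_simps)
    moreover have "(\<integral>\<^sup>+r\<in>{s..t}. gain (iter s f n) r z + gain (iter s g n) r z \<partial>lborel) =
        (\<integral>\<^sup>+r\<in>{s..t}. gain (iter s f n) r z \<partial>lborel) + (\<integral>\<^sup>+r\<in>{s..t}. gain (iter s g n) r z \<partial>lborel)"
      by (subst nn_integral_add[symmetric]) (auto simp: distrib_right)
    ultimately show ?case
      by (simp add: ac_simps)
  qed simp
  then show ?thesis
    unfolding evol_def by (simp add: ennreal_SUP_add iter_incseq)
qed

lemma evol_cmult:
  assumes [measurable]: "f \<in> borel_measurable borel"
  shows "evol s (\<lambda>z. a * f z) t z = a * evol s f t z"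
proof -
  note [measurable] = borel_pair_compose[OF gain_measurable[OF iter_measurable[OF assms(1)]]]
  have "iter s (\<lambda>z. a * f z) n t z = a * iter s f n t z" for n t z
  proof (induction n arbitrary: t z)
    case (Suc n)
    have "gain (iter s (\<lambda>z. a * f z) n) r z = a * gain (iter s f n) r z" for r z
      by (simp add: gain_def Suc distrib_left ac_simps)
    then show ?case
      by (simp add: distrib_left nn_integral_cmult mult.assoc)
  qed simp
  then show ?thesis
    unfolding evol_def by (simp add: SUP_mult_left_ennreal)
qed

lemma evol_split:
  assumes f: "f \<in> borel_measurable borel" and "s \<le> t" "t \<le> t'"
  shows "evol s f t' z = evol s f t z + (\<integral>\<^sup>+r\<in>{t..t'}. gain (evol s f) r z \<partial>lborel)"
proof -
  note [measurable] = borel_pair_compose[OF gain_measurable[OF evol_measurable[OF f]]]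
  show ?thesis
    using evol_eq[OF f, of s t z] evol_eq[OF f, of s t' z]
      nn_integral_Icc_split[of "\<lambda>r. gain (evol s f) r z" s t t'] assms(2,3)
    by (simp add: add.assoc)
qed

lemma evol_start: "f \<in> borel_measurable borel \<Longrightarrow> t \<le> s \<Longrightarrow> evol s f t z = f z"
proof -
  assume f: "f \<in> borel_measurable borel" and "t \<le> s"
  have "(\<integral>\<^sup>+r\<in>{s..t}. gain (evol s f) r z \<partial>lborel) = (\<integral>\<^sup>+r. 0 \<partial>(lborel :: real measure))"
    using AE_lborel_singleton[of s] \<open>t \<le> s\<close>
    by (intro nn_integral_cong_AE) (auto elim!: eventually_mono simp: indicator_def)
  then show ?thesis using evol_eq[OF f, of s t z] by simp
qed

lemma evol_mono_time:
  "f \<in> borel_measurable borel \<Longrightarrow> s \<le> t \<Longrightarrow> t \<le> t' \<Longrightarrow> evol s f t z \<le> evol s f t' z"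
  by (subst (2) evol_split) auto

text \<open>
  Both sides are least solutions: restarting at time \<open>t\<close> gives a solution on
  \<open>[t,t']\<close> below the one started at \<open>s\<close>, and glueing the two pieces
  gives a supersolution on \<open>[s,t']\<close>.
\<close>

lemma evol_evol:
  assumes f: "f \<in> borel_measurable borel" and "s \<le> t" "t \<le> t'"
  shows "evol t (evol s f t) t' z = evol s f t' z"
proof (rule antisym)
  note [measurable] = borel_pair_compose[OF evol_measurable[OF f]]
  have F [measurable]: "evol s f t \<in> borel_measurable borel" by measurable
  show "evol t (evol s f t) t' z \<le> evol s f t' z"
  proof (rule evol_least[where T = t'])
    fix t'' z assume "t \<le> t''"
    then show "evol s f t z + (\<integral>\<^sup>+r\<in>{t..t''}. gain (evol s f) r z \<partial>lborel) \<le> evol s f t'' z"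
      using evol_split[OF f \<open>s \<le> t\<close>, of t'' z] by simp
  qed (use assms in auto)
  define g where "g r z = (if r \<le> t then evol s f r z else evol t (evol s f t) r z)" for r z
  note [measurable] = borel_pair_compose[OF evol_measurable[OF F]]
  have "case_prod g \<in> borel_measurable (borel \<Otimes>\<^sub>M borel)"
    unfolding g_def by measurable
  note [measurable] = borel_pair_compose[OF gain_measurable[OF this]]
  have "evol s f t' z \<le> g t' z"
  proof (rule evol_least[where T = t'])
    fix r z assume "s \<le> r" "r \<le> t'"
    have 1: "(\<integral>\<^sup>+q\<in>{s..r'}. gain g q z \<partial>lborel) = (\<integral>\<^sup>+q\<in>{s..r'}. gain (evol s f) q z \<partial>lborel)"
      if "r' \<le> t" for r'
      using that by (intro nn_integral_cong) (auto simp: indicator_def gain_def g_def)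
    show "f z + (\<integral>\<^sup>+q\<in>{s..r}. gain g q z \<partial>lborel) \<le> g r z"
    proof (cases "r \<le> t")
      case True
      then show ?thesis using 1[of r] evol_eq[OF f, of s r z] by (simp add: g_def)
    next
      case False
      have 2: "(\<integral>\<^sup>+q\<in>{t..r}. gain g q z \<partial>lborel) = (\<integral>\<^sup>+q\<in>{t..r}. gain (evol t (evol s f t)) q z \<partial>lborel)"
        using AE_lborel_singleton[of t]
        by (intro nn_integral_cong_AE) (auto elim!: eventually_mono simp: indicator_def gain_def g_def)
      have "(\<integral>\<^sup>+q\<in>{s..r}. gain g q z \<partial>lborel) =
          (\<integral>\<^sup>+q\<in>{s..t}. gain g q z \<partial>lborel) + (\<integral>\<^sup>+q\<in>{t..r}. gain g q z \<partial>lborel)"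
        by (rule nn_integral_Icc_split) (use False \<open>s \<le> t\<close> in auto)
      then show ?thesis
        using 1[of t] 2 evol_eq[OF f, of s t z] evol_eq[OF F, of t r z] False
        by (simp add: g_def add.assoc[symmetric])
    qed
  qed (use assms in auto)
  also have "g t' z = evol t (evol s f t) t' z"
    using evol_start[OF F, of t t z] assms(3) by (simp add: g_def)
  finally show "evol s f t' z \<le> evol t (evol s f t) t' z" .
qed

lemma rate_add: "ennreal (c - k r z) + ennreal (k r z) = ennreal c"
  using rate_nonneg rate_le by (subst ennreal_plus[symmetric]) auto

text \<open>
  The substitution \<open>z \<mapsto> -z-2r\<close> preserves integrals over a period and the
  rate, so what is lost at \<open>z\<close> is gained at \<open>-z-2r\<close>.
\<close>

lemma per_gain:
  assumes [measurable]: "w r \<in> borel_measurable borel" and "periodic2 (w r)"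
  shows "per (gain w r) = ennreal c * per (w r)"
proof -
  have "per (\<lambda>z. ennreal (k r z) * w r (- z - 2 * r)) = per (\<lambda>z. ennreal (k r z) * w r z)"
  proof -
    have "periodic2 (\<lambda>z. ennreal (k r z) * w r z)"
      using assms(2) by (simp add: periodic2_def rate_periodic)
    then have "per (\<lambda>z. ennreal (k r (- 2 * r - z)) * w r (- 2 * r - z)) = per (\<lambda>z. ennreal (k r z) * w r z)"
      using per_reflect[of "\<lambda>z. ennreal (k r z) * w r z" "- 2 * r"] by simp
    moreover have "k r (- 2 * r - z) = k r z" for z
    proof -
      have "- 2 * r - z = - z - 2 * r" by simp
      then show ?thesis by (simp only: rate_reflect)
    qed
    moreover have "- 2 * r - z = - z - 2 * r" for z by simp
    ultimately show ?thesis by (simp only:)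
  qed
  then have "per (gain w r) = per (\<lambda>z. ennreal (c - k r z) * w r z) + per (\<lambda>z. ennreal (k r z) * w r z)"
    unfolding gain_def by (subst per_add) auto
  also have "\<dots> = per (\<lambda>z. (ennreal (c - k r z) + ennreal (k r z)) * w r z)"
    by (subst per_add[symmetric]) (auto simp: distrib_right)
  finally show ?thesis by (simp add: rate_add per_cmult)
qed

lemma per_integral:
  fixes w :: "real \<Rightarrow> real \<Rightarrow> ennreal"
  assumes "case_prod w \<in> borel_measurable (borel \<Otimes>\<^sub>M borel)"
  shows "per (\<lambda>z. \<integral>\<^sup>+r\<in>{s..t}. w r z \<partial>lborel) = (\<integral>\<^sup>+r\<in>{s..t}. per (w r) \<partial>lborel)"
proof -
  note [measurable] = borel_pair_compose[OF assms]
  have "per (\<lambda>z. \<integral>\<^sup>+r\<in>{s..t}. w r z \<partial>lborel) =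
      (\<integral>\<^sup>+z. (\<integral>\<^sup>+r. w r z * indicator {s..t} r * indicator {-1..<1} z \<partial>lborel) \<partial>lborel)"
    unfolding per_def by (simp add: nn_integral_multc)
  also have "\<dots> = (\<integral>\<^sup>+r. (\<integral>\<^sup>+z. w r z * indicator {s..t} r * indicator {-1..<1} z \<partial>lborel) \<partial>lborel)"
    by (rule lborel_pair.Fubini') measurable
  also have "\<dots> = (\<integral>\<^sup>+r. (\<integral>\<^sup>+z. w r z * indicator {-1..<1} z * indicator {s..t} r \<partial>lborel) \<partial>lborel)"
    by (simp add: ac_simps)
  also have "\<dots> = (\<integral>\<^sup>+r\<in>{s..t}. per (w r) \<partial>lborel)"
    unfolding per_def by (simp add: nn_integral_multc)
  finally show ?thesis .
qed

text \<open>
  The iterates have integral \<open>exp_partial\<close> times that of \<open>f\<close>, and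
  monotone convergence passes to the limit.
\<close>

lemma per_evol:
  assumes f: "f \<in> borel_measurable borel" "periodic2 f" and "s \<le> t"
  shows "per (evol s f t) = ennreal (exp (c * (t - s))) * per f"
proof -
  note [measurable] = f(1) borel_pair_compose[OF evol_measurable[OF f(1)]]
    borel_pair_compose[OF iter_measurable[OF f(1)]]
  note gm = gain_measurable[OF iter_measurable[OF f(1)]]
  note [measurable] = borel_pair_compose[OF gm] borel_pair_compose[OF integral_measurable[OF gm]]
  have itp: "periodic2 (iter s f n t)" for n t
  proof (induction n arbitrary: t)
    case (Suc n)
    have "iter s f n r (- (z + 2) - 2 * r) = iter s f n r (- z - 2 * r)" for r z
      using Suc[of r, unfolded periodic2_def, rule_format, of "- (z + 2) - 2 * r"] by (simp add: algebra_simps)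
    then show ?case
      using f(2) Suc by (simp add: gain_def rate_periodic periodic2_def)
  qed (simp add: periodic2_def)
  have it: "per (iter s f n t) = ennreal (exp_partial c n (t - s)) * per f" if "s \<le> t" for n t
    using that
  proof (induction n arbitrary: t)
    case 0
    then show ?case by (simp add: per_def exp_partial_def)
  next
    case (Suc n)
    have "per (iter s f (Suc n) t) = per f + (\<integral>\<^sup>+r\<in>{s..t}. per (gain (iter s f n) r) \<partial>lborel)"
    proof -
      have "per (iter s f (Suc n) t) = per (\<lambda>z. f z + (\<integral>\<^sup>+r\<in>{s..t}. gain (iter s f n) r z \<partial>lborel))"
        by (rule per_cong) simp
      then show ?thesis by (subst (asm) per_add) (simp_all add: per_integral[OF gm])
    qed
    also have "(\<integral>\<^sup>+r\<in>{s..t}. per (gain (iter s f n) r) \<partial>lborel) =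
        (\<integral>\<^sup>+r. (ennreal c * ennreal (exp_partial c n (r - s)) * indicator {s..t} r) * per f \<partial>lborel)"
      by (intro nn_integral_cong) (auto simp: per_gain itp Suc indicator_def ac_simps)
    also have "\<dots> = (\<integral>\<^sup>+r\<in>{s..t}. ennreal c * ennreal (exp_partial c n (r - s)) \<partial>lborel) * per f"
      by (subst nn_integral_multc) auto
    finally show ?case
      using exp_partial_integral[OF bound_nonneg Suc.prems] by (simp add: distrib_right)
  qed
  have "per (evol s f t) = (SUP n. per (iter s f n t))"
    unfolding per_def evol_def
    by (subst nn_integral_monotone_convergence_SUP[symmetric])
       (auto simp: incseq_def le_fun_def SUP_mult_right_ennreal intro!: mult_right_mono incseqD[OF iter_incseq])
  also have "\<dots> = (SUP n. ennreal (exp_partial c n (t - s))) * per f"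
    using it[OF \<open>s \<le> t\<close>] by (simp add: SUP_mult_right_ennreal)
  finally show ?thesis
    using exp_partial_sup[OF bound_nonneg, of "t - s"] \<open>s \<le> t\<close> by simp
qed

lemma evol_one:
  assumes "s \<le> t"
  shows "evol s (\<lambda>z. 1) t z = ennreal (exp (c * (t - s)))"
proof -
  have it: "iter s (\<lambda>z. 1) n t z = ennreal (exp_partial c n (t - s))" if "s \<le> t" for n t z
    using that
  proof (induction n arbitrary: t z)
    case 0
    then show ?case by (simp add: exp_partial_def)
  next
    case (Suc n)
    have "(\<integral>\<^sup>+r\<in>{s..t}. gain (iter s (\<lambda>z. 1) n) r z \<partial>lborel) =
        (\<integral>\<^sup>+r\<in>{s..t}. ennreal c * ennreal (exp_partial c n (r - s)) \<partial>lborel)"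
      by (intro nn_integral_cong)
         (auto simp: gain_def Suc indicator_def distrib_right[symmetric] rate_add)
    then show ?case
      using exp_partial_integral[OF bound_nonneg Suc.prems] by simp
  qed
  show ?thesis
    using exp_partial_sup[OF bound_nonneg, of "t - s"] assms it by (simp add: evol_def)
qed

text \<open>
  As \<open>r\<close> runs through an interval of length \<open>1\<close>, the point
  \<open>-z-2r\<close> runs once through a period. This turns the integral over time of the
  values gained from other characteristics into the mass of the datum, which makes a bound at a
  single point \<open>z\<close> possible.
\<close>

lemma reflected_integral_le:
  assumes [measurable]: "f \<in> borel_measurable borel" and "periodic2 f"
  shows "(\<integral>\<^sup>+r\<in>{s..<s + real n}. f (- z - 2 * r) \<partial>lborel) \<le> of_nat n * per f"
proof (induction n)
  case (Suc n)
  define b where "b = s + real n"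
  have P: "periodic2 (\<lambda>y. f (- z - y))"
    unfolding periodic2_def
  proof
    fix y
    show "f (- z - (y + 2)) = f (- z - y)"
    proof -
      have "- z - y = (- z - (y + 2)) + 2" by simp
      then show ?thesis using assms(2) unfolding periodic2_def by (simp only:)
    qed
  qed
  have "per f = per (\<lambda>y. f (- z - y))"
    using per_reflect[OF assms] by simp
  also have "\<dots> = (\<integral>\<^sup>+y\<in>{2 * b..<2 * b + 2}. f (- z - y) \<partial>lborel)"
    by (rule per_interval[symmetric, OF _ P]) measurable
  also have "\<dots> = 2 * (\<integral>\<^sup>+r. f (- z - 2 * r) * indicator {2 * b..<2 * b + 2} (2 * r) \<partial>lborel)"
    by (subst nn_integral_real_affine[of _ 2 0]) auto
  also have "(\<integral>\<^sup>+r. f (- z - 2 * r) * indicator {2 * b..<2 * b + 2} (2 * r) \<partial>lborel) =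
      (\<integral>\<^sup>+r\<in>{b..<b + 1}. f (- z - 2 * r) \<partial>lborel)"
    by (intro nn_integral_cong) (auto simp: indicator_def)
  finally have eq: "per f = 2 * (\<integral>\<^sup>+r\<in>{b..<b + 1}. f (- z - 2 * r) \<partial>lborel)" .
  have "(\<integral>\<^sup>+r\<in>{b..<b + 1}. f (- z - 2 * r) \<partial>lborel) \<le> per f"
    unfolding eq mult_2 by (rule order_trans[OF eq_refl add_left_mono[OF zero_le]]) simp
  moreover have "(\<integral>\<^sup>+r\<in>{s..<s + real (Suc n)}. f (- z - 2 * r) \<partial>lborel) =
      (\<integral>\<^sup>+r\<in>{s..<b}. f (- z - 2 * r) \<partial>lborel) + (\<integral>\<^sup>+r\<in>{b..<s + real (Suc n)}. f (- z - 2 * r) \<partial>lborel)"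
    by (rule nn_integral_interval_split) (auto simp: b_def)
  ultimately show ?case
    using add_mono[OF Suc[folded b_def]] by (simp add: b_def distrib_right add.assoc add.commute[of 1] add.commute[of "per f"])
qed simp

lemma exp_integral_bound:
  assumes "0 \<le> a" "0 < \<mu>" "a * 4 \<le> \<mu>" "s \<le> t"
  shows "(\<integral>\<^sup>+r\<in>{s..t}. ennreal (a * exp (\<mu> * (r - s))) \<partial>lborel) \<le> ennreal ((exp (\<mu> * (t - s)) - 1) / 4)"
proof -
  have "(\<integral>\<^sup>+r\<in>{s..t}. ennreal (a * exp (\<mu> * (r - s))) \<partial>lborel) =
      ennreal (a / \<mu> * exp (\<mu> * (t - s)) - a / \<mu> * exp (\<mu> * (s - s)))"
    using assms
    by (intro nn_integral_FTC_Icc)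
       (auto intro!: derivative_eq_intros simp flip: has_real_derivative_iff_has_vector_derivative)
  also have "\<dots> = ennreal ((a / \<mu>) * (exp (\<mu> * (t - s)) - 1))"
    by (simp add: algebra_simps)
  also have "\<dots> \<le> ennreal ((1 / 4) * (exp (\<mu> * (t - s)) - 1))"
    using assms by (intro ennreal_leI mult_right_mono) (auto simp: field_simps)
  finally show ?thesis by simp
qed

text \<open>
  The function \<open>e\<^sup>\<mu>\<^sup>(\<^sup>t\<^sup>-\<^sup>s\<^sup>) (f + M)\<close> is a
  supersolution for \<open>\<mu>\<close> and \<open>M\<close> large enough. The values
  \<open>f(-z-2r)\<close> cannot be compared with \<open>f(z)\<close>; they enter through their
  integral over \<open>r\<close>, which is at most a multiple of the mass of \<open>f\<close>
  and is absorbed by \<open>M\<close>.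
\<close>

lemma evol_bound:
  assumes f [measurable]: "f \<in> borel_measurable borel" and per: "periodic2 f" and fin: "per f < \<infinity>" and "s \<le> T"
  obtains K M :: real where "0 \<le> K" "0 \<le> M"
    "\<And>t z. s \<le> t \<Longrightarrow> t \<le> T \<Longrightarrow> evol s f t z \<le> ennreal K * (f z + ennreal M)"
proof -
  \<comment> \<open>The constant M is twice the bound c n N for the integral of the gained
    values, and the choice of \<mu> makes the integral of c E at most (E - 1) / 4; together
    they leave room for both terms.\<close>
  define n where "n = Suc (nat \<lceil>T - s\<rceil>)"
  define N where "N = enn2real (per f)"
  define M where "M = 2 * c * real n * N"
  define \<mu> where "\<mu> = 4 * c + 1"
  define E where "E t = exp (\<mu> * (t - s))" for t
  have N: "per f = ennreal N" "0 \<le> N" unfolding N_def using fin by (auto simp: less_top)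
  have c: "0 \<le> c" by (rule bound_nonneg)
  have M: "0 \<le> M" unfolding M_def using c N by auto
  have \<mu>: "0 < \<mu>" "c * 4 \<le> \<mu>" using c by (auto simp: \<mu>_def)
  define g where "g t z = ennreal (E t) * (f z + ennreal M)" for t z
  have main: "evol s f t z \<le> g t z" if "s \<le> t" "t \<le> T" for t z
  proof (rule evol_least[OF _ that])
    fix t z assume t: "s \<le> t" "t \<le> T"
    have E1: "1 \<le> E r" "E r \<le> E t" if "s \<le> r" "r \<le> t" for r
      using that \<mu> by (auto simp: E_def)
    have Em [measurable]: "E \<in> borel_measurable borel" unfolding E_def by measurable
    have pt: "gain g r z \<le> ennreal (c * E r) * (f z + 2 * ennreal M) + ennreal (c * E t) * f (- z - 2 * r)"
      if r: "r \<in> {s..t}" for r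
    proof -
      have "gain g r z \<le> ennreal c * g r z + ennreal c * g r (- z - 2 * r)"
        unfolding gain_def using rate_nonneg rate_le
        by (intro add_mono mult_right_mono ennreal_leI) auto
      also have "\<dots> = ennreal (c * E r) * (f z + 2 * ennreal M) + ennreal (c * E r) * f (- z - 2 * r)"
        unfolding g_def mult_2[of "ennreal M"] using c E1(1)[of r] r by (simp add: ennreal_mult distrib_left ac_simps)
      also have "\<dots> \<le> ennreal (c * E r) * (f z + 2 * ennreal M) + ennreal (c * E t) * f (- z - 2 * r)"
        using c E1(2)[of r] r by (intro add_left_mono mult_right_mono ennreal_leI mult_left_mono) auto
      finally show ?thesis .
    qed
    have "(\<integral>\<^sup>+r\<in>{s..t}. gain g r z \<partial>lborel) \<le>
       (\<integral>\<^sup>+r. ennreal (c * E r) * indicator {s..t} r * (f z + 2 * ennreal M) +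
          ennreal (c * E t) * (f (- z - 2 * r) * indicator {s..<s + real n} r) \<partial>lborel)"
    proof (rule nn_integral_mono)
      fix r
      have "r < s + real n" if "r \<le> t"
        using that t unfolding n_def by linarith
      then show "gain g r z * indicator {s..t} r \<le> ennreal (c * E r) * indicator {s..t} r * (f z + 2 * ennreal M) +
          ennreal (c * E t) * (f (- z - 2 * r) * indicator {s..<s + real n} r)"
        using pt[of r] by (cases "r \<in> {s..t}") auto
    qed
    also have "\<dots> = (\<integral>\<^sup>+r\<in>{s..t}. ennreal (c * E r) \<partial>lborel) * (f z + 2 * ennreal M) +
        ennreal (c * E t) * (\<integral>\<^sup>+r\<in>{s..<s + real n}. f (- z - 2 * r) \<partial>lborel)"
      by (subst nn_integral_add, measurable) (simp add: nn_integral_multc nn_integral_cmult)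
    also have "\<dots> \<le> ennreal ((E t - 1) / 4) * (f z + 2 * ennreal M) + ennreal (c * E t) * (of_nat n * per f)"
      unfolding E_def using exp_integral_bound[OF c \<mu> t(1)] reflected_integral_le[OF f per]
      by (intro add_mono mult_right_mono mult_left_mono) auto
    also have "f z + \<dots> \<le> ennreal (E t) * f z + ennreal (E t * M)"
    proof -
      have "f z + ennreal ((E t - 1) / 4) * f z \<le> ennreal (E t) * f z"
      proof -
        have "f z + ennreal ((E t - 1) / 4) * f z = ennreal (1 + (E t - 1) / 4) * f z"
          using E1(1)[of t] t by (simp add: ennreal_plus distrib_right)
        also have "\<dots> \<le> ennreal (E t) * f z"
          using E1(1)[of t] t by (intro mult_right_mono ennreal_leI) (auto simp: field_simps)
        finally show ?thesis .
      qed
      moreover have "ennreal ((E t - 1) / 4) * (2 * ennreal M) + ennreal (c * E t) * (of_nat n * per f) \<le> ennreal (E t * M)"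
      proof -
        have "ennreal ((E t - 1) / 4) * (2 * ennreal M) + ennreal (c * E t) * (of_nat n * per f) =
            ennreal ((E t - 1) / 4 * (2 * M) + c * E t * (real n * N))"
        proof -
          have "2 * ennreal M = ennreal (2 * M)"
            using M by (simp add: ennreal_mult)
          then have "ennreal ((E t - 1) / 4) * (2 * ennreal M) = ennreal ((E t - 1) / 4 * (2 * M))"
            using E1(1)[of t] t M ennreal_mult[of "(E t - 1) / 4" "2 * M"] by simp
          moreover have "ennreal (c * E t) * (of_nat n * per f) = ennreal (c * E t * (real n * N))"
            using E1(1)[of t] t N c by (simp add: ennreal_mult ennreal_of_nat_eq_real_of_nat)
          ultimately show ?thesis
            using E1(1)[of t] t M N c by (subst ennreal_plus) auto
        qed
        also have "\<dots> \<le> ennreal (E t * M)"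
          using M by (intro ennreal_leI) (simp add: M_def field_simps)
        finally show ?thesis .
      qed
      ultimately have "(f z + ennreal ((E t - 1) / 4) * f z) +
          (ennreal ((E t - 1) / 4) * (2 * ennreal M) + ennreal (c * E t) * (of_nat n * per f)) \<le>
          ennreal (E t) * f z + ennreal (E t * M)"
        by (rule add_mono)
      then show ?thesis by (simp add: distrib_left add.assoc)
    qed
    also have "\<dots> = g t z"
      unfolding g_def using M E1(1)[of t] t by (simp add: distrib_left ennreal_mult)
    finally show "f z + (\<integral>\<^sup>+r\<in>{s..t}. gain g r z \<partial>lborel) \<le> g t z"
      by (simp add: add_left_mono)
  qed
  show ?thesis
  proof (rule that[of "E T" M])
    fix t z assume t: "s \<le> t" "t \<le> T"
    have "E t \<le> E T" using t \<mu> by (auto simp: E_def)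
    then have "g t z \<le> ennreal (E T) * (f z + ennreal M)"
      unfolding g_def by (intro mult_right_mono ennreal_leI) auto
    then show "evol s f t z \<le> ennreal (E T) * (f z + ennreal M)"
      using main[OF t, of z] by (rule order_trans[rotated])
  qed (use M in \<open>auto simp: E_def\<close>)
qed

lemma evol_finite:
  assumes "f \<in> borel_measurable borel" "periodic2 f" "per f < \<infinity>" "s \<le> t" "f z < \<infinity>"
  shows "evol s f t z < \<infinity>"
proof -
  obtain K M :: real where "0 \<le> K" "0 \<le> M" and b: "\<And>t' z. s \<le> t' \<Longrightarrow> t' \<le> t \<Longrightarrow> evol s f t' z \<le> ennreal K * (f z + ennreal M)"
    using evol_bound[OF assms(1-4)] by blast
  have "evol s f t z \<le> ennreal K * (f z + ennreal M)"
    by (rule b[OF assms(4) order_refl])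
  also have "\<dots> < \<infinity>" using assms(5) by (auto simp: ennreal_mult_less_top)
  finally show ?thesis .
qed

section \<open>A uniform lower bound for the evolution\<close>

text \<open>
  The factor \<open>2\<close> is the speed at which the characteristic opposite to a given one
  moves along the circle of characteristics: a jump that happens \<open>h\<close> later lands
  \<open>2h\<close> further back.
\<close>

definition ave :: "real \<Rightarrow> (real \<Rightarrow> ennreal) \<Rightarrow> real \<Rightarrow> ennreal" where
  "ave \<epsilon> g z = (\<integral>\<^sup>+h\<in>{-\<epsilon><..<\<epsilon>}. g (z - 2 * h) \<partial>lborel)"

definition window :: "(real \<Rightarrow> ennreal) \<Rightarrow> real \<Rightarrow> real \<Rightarrow> ennreal" where
  "window f R z = (\<integral>\<^sup>+y\<in>{z - R..z + R}. f y \<partial>lborel)"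

text \<open>
  In a time \<open>3\<close> the characteristic \<open>z\<close> runs through the whole circle
  and through a complete window of radius \<open>\<epsilon>\<close> around \<open>y\<close>. If
  it meets the centre of the window at time \<open>b\<close>, a jump at time \<open>b +
  h\<close> leads to \<open>-z - 2(b+h)\<close>, which is \<open>z - 2y - 2h\<close> up to
  multiples of the period. Such jumps have rate at least \<open>l\<close>, and the value found
  there does not decrease in time.
\<close>

lemma evol_ge_shifted_ave:
  assumes f: "f \<in> borel_measurable borel" "periodic2 f" and "s \<le> t" and \<epsilon>: "0 < \<epsilon>" "\<epsilon> \<le> 1 / 2"
    and rate: "\<And>r z. \<bar>z + r - y\<bar> < \<epsilon> \<Longrightarrow> l \<le> k r z"
  shows "ennreal l * ave \<epsilon> (evol s f t) (z - 2 * y) \<le> evol s f (t + 3) z"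
proof -
  note [measurable] = borel_pair_compose[OF evol_measurable[OF f(1)]] borel_pair_compose[OF gain_measurable[OF evol_measurable[OF f(1)]]]
  \<comment> \<open>b is the first time with z + b congruent to y modulo the period and t
    \<le> b - \<epsilon>.\<close>
  define m where "m = \<lceil>(t + z + \<epsilon> - y) / 2\<rceil>"
  define b where "b = 2 * real_of_int m + y - z"
  have b: "t \<le> b - \<epsilon>" "b + \<epsilon> \<le> t + 3"
  proof -
    have "(t + z + \<epsilon> - y) / 2 \<le> real_of_int m" "real_of_int m < (t + z + \<epsilon> - y) / 2 + 1"
      unfolding m_def by linarith+
    then show "t \<le> b - \<epsilon>" "b + \<epsilon> \<le> t + 3"
      using \<epsilon> unfolding b_def by (simp_all add: field_simps)
  qed
  have rate': "l \<le> k r z" if "\<bar>r - b\<bar> < \<epsilon>" for r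
  proof -
    have "periodic2 (k r)" by (simp add: periodic2_def rate_periodic)
    then have "k r (z + 2 * real_of_int (- m)) = k r z" by (rule periodic2_int)
    moreover have "l \<le> k r (z + 2 * real_of_int (- m))"
      using that by (intro rate) (simp add: b_def algebra_simps)
    ultimately show ?thesis by simp
  qed
  have P: "evol s f t (y' + 2 * real_of_int j) = evol s f t y'" for y' j
    by (rule periodic2_int[OF evol_periodic[OF f(2)]])
  have "ennreal l * ave \<epsilon> (evol s f t) (z - 2 * y) = ennreal l * (\<integral>\<^sup>+h\<in>{-\<epsilon><..<\<epsilon>}. evol s f t (- z - 2 * (b + h)) \<partial>lborel)"
  proof -
    have "evol s f t (z - 2 * y - 2 * h) = evol s f t (- z - 2 * (b + h))" for h
      using P[of "- z - 2 * (b + h)" "2 * m"] by (simp add: b_def algebra_simps)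
    then show ?thesis by (simp add: ave_def)
  qed
  also have "\<dots> = (\<integral>\<^sup>+h. ennreal l * (evol s f t (- z - 2 * (b + h)) * indicator {b-\<epsilon><..<b+\<epsilon>} (b + h)) \<partial>lborel)"
    by (subst nn_integral_cmult[symmetric]) (auto intro!: nn_integral_cong simp: indicator_def)
  also have "\<dots> = (\<integral>\<^sup>+r. ennreal l * (evol s f t (- z - 2 * r) * indicator {b-\<epsilon><..<b+\<epsilon>} r) \<partial>lborel)"
    by (subst (2) nn_integral_real_affine[of _ 1 b]) auto
  also have "\<dots> \<le> (\<integral>\<^sup>+r\<in>{t..t + 3}. gain (evol s f) r z \<partial>lborel)"
  proof (rule nn_integral_mono)
    fix r
    show "ennreal l * (evol s f t (- z - 2 * r) * indicator {b-\<epsilon><..<b+\<epsilon>} r) \<le> gain (evol s f) r z * indicator {t..t + 3} r"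
    proof (cases "r \<in> {b-\<epsilon><..<b+\<epsilon>}")
      case True
      then have "ennreal l * evol s f t (- z - 2 * r) \<le> ennreal (k r z) * evol s f r (- z - 2 * r)"
        using b by (intro mult_mono ennreal_leI rate' evol_mono_time f(1) \<open>s \<le> t\<close>) auto
      then show ?thesis using True b by (auto simp: gain_def intro: add_increasing)
    qed simp
  qed
  also have "\<dots> \<le> evol s f (t + 3) z"
    using evol_split[OF f(1) \<open>s \<le> t\<close>, of "t + 3" z] by simp
  finally show ?thesis .
qed

text \<open>
  A jump in the window around \<open>-x0\<close> shifts by \<open>2 x0\<close> and one in the
  window around \<open>x0\<close> shifts by \<open>-2 x0\<close>, so the two averages are
  centred at \<open>z\<close> itself. The window around \<open>-x0\<close> inherits its rate by
  reflection.
\<close>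

lemma evol_ge_ave_ave:
  assumes f: "f \<in> borel_measurable borel" "periodic2 f" and "s \<le> t" and \<epsilon>: "0 < \<epsilon>" "\<epsilon> \<le> 1 / 2" and "0 \<le> l"
    and rate: "\<And>r z. \<bar>z + r - x0\<bar> < \<epsilon> \<Longrightarrow> l \<le> k r z"
  shows "ennreal (l\<^sup>2) * ave \<epsilon> (ave \<epsilon> (evol s f t)) z \<le> evol s f (t + 6) z"
proof -
  note em = borel_pair_compose[OF evol_measurable[OF f(1)]]
  note [measurable] = em
  have rate': "l \<le> k r z" if "\<bar>z + r - (- x0)\<bar> < \<epsilon>" for r z
    using rate[of "- z - 2 * r" r] that rate_reflect[of r z] by (simp add: algebra_simps abs_if split: if_splits)
  have shift: "ennreal l * ave \<epsilon> (evol s f t) z' \<le> evol s f (t + 3) (z' - 2 * x0)" for z'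
    using evol_ge_shifted_ave[of f s t \<epsilon> "- x0" l "z' - 2 * x0", OF f \<open>s \<le> t\<close> \<epsilon> rate'] by simp
  have "ave \<epsilon> (\<lambda>z'. ennreal l * ave \<epsilon> (evol s f t) z') z \<le> ave \<epsilon> (evol s f (t + 3)) (z - 2 * x0)"
    unfolding ave_def[of \<epsilon> "\<lambda>z'. ennreal l * ave \<epsilon> (evol s f t) z'"] ave_def[of \<epsilon> "evol s f (t + 3)"]
  proof (rule nn_integral_mono, rule mult_right_mono)
    fix h
    have "z - 2 * x0 - 2 * h = z - 2 * h - 2 * x0" by simp
    then show "ennreal l * ave \<epsilon> (evol s f t) (z - 2 * h) \<le> evol s f (t + 3) (z - 2 * x0 - 2 * h)"
      using shift[of "z - 2 * h"] by (simp only:)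
  qed simp
  moreover have "ave \<epsilon> (\<lambda>z'. ennreal l * ave \<epsilon> (evol s f t) z') z = ennreal l * ave \<epsilon> (ave \<epsilon> (evol s f t)) z"
    unfolding ave_def by (subst nn_integral_cmult[symmetric]) (auto simp: mult.assoc)
  moreover have "ennreal l * ave \<epsilon> (evol s f (t + 3)) (z - 2 * x0) \<le> evol s f (t + 3 + 3) z"
    using evol_ge_shifted_ave[of f s "t + 3" \<epsilon> x0 l z, OF f _ \<epsilon> rate] \<open>s \<le> t\<close> by simp
  ultimately have "ennreal l * ave \<epsilon> (ave \<epsilon> (evol s f t)) z \<le> ave \<epsilon> (evol s f (t + 3)) (z - 2 * x0)"
    and 2: "ennreal l * ave \<epsilon> (evol s f (t + 3)) (z - 2 * x0) \<le> evol s f (t + 3 + 3) z"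
    by simp_all
  then have "ennreal l * (ennreal l * ave \<epsilon> (ave \<epsilon> (evol s f t)) z) \<le> ennreal l * ave \<epsilon> (evol s f (t + 3)) (z - 2 * x0)"
    by (intro mult_left_mono) auto
  also note 2
  finally show ?thesis using \<open>0 \<le> l\<close> by (simp add: power2_eq_square ennreal_mult mult.assoc add.commute[of 6])
qed

text \<open>
  The offsets \<open>h\<close> in \<open>[\<epsilon>/2, \<epsilon>)\<close> move the window far
  enough to reach the left end of the larger one, those in \<open>(-\<epsilon>,
  -\<epsilon>/2]\<close> far enough to reach the right end, and the two positions cover the
  larger window because \<open>2\<epsilon> \<le> R\<close>. Both sets of offsets have measure
  \<open>\<epsilon>/2\<close>.
\<close>

lemma ave_spread:
  assumes f [measurable]: "f \<in> borel_measurable borel" and "0 < \<epsilon>" "2 * \<epsilon> \<le> R"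
    and g: "\<And>z. ennreal \<kappa> * window f R z \<le> g z" and "0 \<le> \<kappa>"
  shows "ennreal (\<kappa> * \<epsilon> / 2) * window f (R + \<epsilon>) z \<le> ave \<epsilon> g z"
proof -
  define I where "I a b = (\<integral>\<^sup>+y\<in>{a..b}. f y \<partial>lborel)" for a b
  have Imono: "I a b \<le> I a' b'" if "a' \<le> a" "b \<le> b'" for a a' b b'
    unfolding I_def using that by (intro nn_integral_mono) (auto simp: indicator_def)
  define L where "L = I (z - \<epsilon> - R) (z - 2 * \<epsilon> + R)"
  define U where "U = I (z + 2 * \<epsilon> - R) (z + \<epsilon> + R)"
  have gL: "ennreal \<kappa> * L \<le> g (z - 2 * h)" if "h \<in> {\<epsilon> / 2..<\<epsilon>}" for h
    using that
    by (intro order_trans[OF mult_left_mono g]) (auto simp: L_def window_def I_def[symmetric] intro!: Imono)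
  have gU: "ennreal \<kappa> * U \<le> g (z - 2 * h)" if "h \<in> {-\<epsilon><..-(\<epsilon> / 2)}" for h
    using that
    by (intro order_trans[OF mult_left_mono g]) (auto simp: U_def window_def I_def[symmetric] intro!: Imono)
  have "window f (R + \<epsilon>) z \<le> (\<integral>\<^sup>+y. f y * indicator {z - \<epsilon> - R..z - 2 * \<epsilon> + R} y +
       f y * indicator {z + 2 * \<epsilon> - R..z + \<epsilon> + R} y \<partial>lborel)"
    unfolding window_def using assms(2,3) by (intro nn_integral_mono) (auto simp: indicator_def)
  also have "\<dots> = L + U"
    unfolding L_def U_def I_def by (rule nn_integral_add) auto
  finally have "ennreal (\<kappa> * \<epsilon> / 2) * window f (R + \<epsilon>) z \<le> ennreal (\<kappa> * \<epsilon> / 2) * (L + U)"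
    by (rule mult_left_mono) simp
  also have "\<dots> = (\<integral>\<^sup>+h. ennreal \<kappa> * L * indicator {\<epsilon> / 2..<\<epsilon>} h + ennreal \<kappa> * U * indicator {-\<epsilon><..-(\<epsilon> / 2)} h \<partial>lborel)"
    using assms(2,5)
  proof -
    have "(\<integral>\<^sup>+h. ennreal \<kappa> * L * indicator {\<epsilon> / 2..<\<epsilon>} h \<partial>lborel) = ennreal (\<kappa> * \<epsilon> / 2) * L"
      "(\<integral>\<^sup>+h. ennreal \<kappa> * U * indicator {-\<epsilon><..-(\<epsilon> / 2)} h \<partial>lborel) = ennreal (\<kappa> * \<epsilon> / 2) * U"
      using assms(2,5) ennreal_mult[of \<kappa> "\<epsilon> / 2"]
      by (subst nn_integral_cmult_indicator; simp add: ac_simps)+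
    then show ?thesis by (subst nn_integral_add) (auto simp: distrib_left)
  qed
  also have "\<dots> \<le> ave \<epsilon> g z"
    unfolding ave_def
  proof (rule nn_integral_mono)
    fix h
    show "ennreal \<kappa> * L * indicator {\<epsilon> / 2..<\<epsilon>} h + ennreal \<kappa> * U * indicator {-\<epsilon><..-(\<epsilon> / 2)} h
        \<le> g (z - 2 * h) * indicator {-\<epsilon><..<\<epsilon>} h"
      using gL[of h] gU[of h] assms(2) by (auto simp: indicator_def)
  qed
  finally show ?thesis .
qed

lemma ave_eq_window:
  assumes [measurable]: "f \<in> borel_measurable borel" and "0 < \<epsilon>"
  shows "ave \<epsilon> f z = ennreal (1 / 2) * window f (2 * \<epsilon>) z"
proof -
  have "window f (2 * \<epsilon>) z = (\<integral>\<^sup>+y\<in>{z - 2 * \<epsilon><..<z + 2 * \<epsilon>}. f y \<partial>lborel)"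
    unfolding window_def
  proof (rule nn_integral_cong_AE)
    show "AE y in lborel. f y * indicator {z - 2 * \<epsilon>..z + 2 * \<epsilon>} y = f y * indicator {z - 2 * \<epsilon><..<z + 2 * \<epsilon>} y"
      using AE_lborel_singleton[of "z - 2 * \<epsilon>"] AE_lborel_singleton[of "z + 2 * \<epsilon>"]
      by eventually_elim (auto simp: indicator_def)
  qed
  also have "\<dots> = 2 * (\<integral>\<^sup>+h. f (z - 2 * h) * indicator {z - 2 * \<epsilon><..<z + 2 * \<epsilon>} (z - 2 * h) \<partial>lborel)"
    by (subst nn_integral_real_affine[of _ "-2" z]) auto
  also have "(\<integral>\<^sup>+h. f (z - 2 * h) * indicator {z - 2 * \<epsilon><..<z + 2 * \<epsilon>} (z - 2 * h) \<partial>lborel) = ave \<epsilon> f z"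
    unfolding ave_def by (intro nn_integral_cong) (auto simp: indicator_def)
  finally have "ennreal (1 / 2) * window f (2 * \<epsilon>) z = ennreal (1 / 2) * ennreal 2 * ave \<epsilon> f z"
    by (simp add: mult.assoc)
  also have "ennreal (1 / 2) * ennreal 2 = 1"
    by (subst ennreal_mult[symmetric]) auto
  finally show ?thesis by simp
qed

text \<open>
  Each round of two jumps takes a time \<open>6\<close> and widens the window by
  \<open>2\<epsilon>\<close>, at the cost of a factor \<open>l\<^sup>2
  (\<epsilon>/2)\<^sup>2\<close>. In the first round the first average produces the window of
  radius \<open>2\<epsilon>\<close> and the second one widens it to \<open>3\<epsilon>\<close>.
\<close>

lemma evol_ge_window:
  assumes f: "f \<in> borel_measurable borel" "periodic2 f" and \<epsilon>: "0 < \<epsilon>" "\<epsilon> \<le> 1 / 2" and "0 \<le> l"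
    and rate: "\<And>r z. \<bar>z + r - x0\<bar> < \<epsilon> \<Longrightarrow> l \<le> k r z"
  shows "ennreal ((l\<^sup>2 * \<epsilon>\<^sup>2 / 4) ^ Suc n / \<epsilon>) * window f (\<epsilon> + 2 * \<epsilon> * real (Suc n)) z \<le> evol s f (s + 6 * real (Suc n)) z"
proof (induction n arbitrary: z)
  case 0
  have "ennreal (1 / 2) * window f (2 * \<epsilon>) z \<le> ave \<epsilon> f z" for z
    using ave_eq_window[OF f(1) \<epsilon>(1)] by simp
  then have "ennreal (1 / 2 * \<epsilon> / 2) * window f (2 * \<epsilon> + \<epsilon>) z \<le> ave \<epsilon> (ave \<epsilon> f) z"
    by (intro ave_spread[OF f(1) \<epsilon>(1)]) auto
  then have "ennreal (l\<^sup>2) * (ennreal (1 / 2 * \<epsilon> / 2) * window f (2 * \<epsilon> + \<epsilon>) z) \<le> ennreal (l\<^sup>2) * ave \<epsilon> (ave \<epsilon> f) z"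
    by (rule mult_left_mono) simp
  also have "\<dots> \<le> evol s f (s + 6) z"
    using evol_ge_ave_ave[OF f order_refl \<epsilon> \<open>0 \<le> l\<close> rate] evol_start[OF f(1) order_refl]
    by (simp add: ave_def)
  finally show ?case
    using \<epsilon> by (simp add: mult.assoc[symmetric] ennreal_mult[symmetric] power2_eq_square)
next
  case (Suc n)
  define \<kappa> where "\<kappa> = (l\<^sup>2 * \<epsilon>\<^sup>2 / 4) ^ Suc n / \<epsilon>"
  define R where "R = \<epsilon> + 2 * \<epsilon> * real (Suc n)"
  define t where "t = s + 6 * real (Suc n)"
  have \<kappa>: "0 \<le> \<kappa>" and R: "2 * \<epsilon> \<le> R" using \<epsilon> by (auto simp: \<kappa>_def R_def)
  have "ennreal (\<kappa> * \<epsilon> / 2) * window f (R + \<epsilon>) z \<le> ave \<epsilon> (evol s f t) z" for z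
    by (intro ave_spread f(1) \<epsilon> \<kappa> R) (use Suc in \<open>simp only: \<kappa>_def R_def t_def\<close>)
  then have "ennreal (\<kappa> * \<epsilon> / 2 * \<epsilon> / 2) * window f (R + \<epsilon> + \<epsilon>) z \<le> ave \<epsilon> (ave \<epsilon> (evol s f t)) z"
    by (rule ave_spread[OF f(1), rotated 2]) (use \<epsilon> \<kappa> R in auto)
  then have "ennreal (l\<^sup>2) * (ennreal (\<kappa> * \<epsilon> / 2 * \<epsilon> / 2) * window f (R + \<epsilon> + \<epsilon>) z) \<le>
      ennreal (l\<^sup>2) * ave \<epsilon> (ave \<epsilon> (evol s f t)) z"
    by (rule mult_left_mono) simp
  also have "\<dots> \<le> evol s f (t + 6) z"
    by (rule evol_ge_ave_ave[OF f _ \<epsilon> \<open>0 \<le> l\<close> rate]) (auto simp: t_def)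
  also have "ennreal (l\<^sup>2) * (ennreal (\<kappa> * \<epsilon> / 2 * \<epsilon> / 2) * window f (R + \<epsilon> + \<epsilon>) z) =
      ennreal (l\<^sup>2 * (\<kappa> * \<epsilon> / 2 * \<epsilon> / 2)) * window f (R + \<epsilon> + \<epsilon>) z"
    using \<epsilon> \<kappa> ennreal_mult[of "l\<^sup>2" "\<kappa> * \<epsilon> / 2 * \<epsilon> / 2"] by (simp add: mult.assoc)
  also have "l\<^sup>2 * (\<kappa> * \<epsilon> / 2 * \<epsilon> / 2) = (l\<^sup>2 * \<epsilon>\<^sup>2 / 4) ^ Suc (Suc n) / \<epsilon>"
    by (simp add: \<kappa>_def power2_eq_square)
  also have "R + \<epsilon> + \<epsilon> = \<epsilon> + 2 * \<epsilon> * real (Suc (Suc n))"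
    by (simp add: R_def algebra_simps)
  also have "t + 6 = s + 6 * real (Suc (Suc n))"
    by (simp add: t_def)
  finally show ?case .
qed

text \<open>
  Once the radius of the window is at least \<open>1\<close>, it contains a full period. The
  constant and the waiting time do not depend on \<open>x0\<close>, on \<open>f\<close> or on
  \<open>z\<close>.
\<close>

lemma evol_minorization:
  assumes f: "f \<in> borel_measurable borel" "periodic2 f" and \<epsilon>: "0 < \<epsilon>" "\<epsilon> \<le> 1 / 2" and "0 \<le> l"
    and rate: "\<And>r z. \<bar>z + r - x0\<bar> < \<epsilon> \<Longrightarrow> l \<le> k r z"
    and n: "1 \<le> 2 * \<epsilon> * real (Suc n)"
  shows "ennreal ((l\<^sup>2 * \<epsilon>\<^sup>2 / 4) ^ Suc n / \<epsilon>) * per f \<le> evol s f (s + 6 * real (Suc n)) z"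
proof -
  have "per f = (\<integral>\<^sup>+y\<in>{z-1..<z-1+2}. f y \<partial>lborel)"
    using per_interval[OF f, of "z - 1"] by simp
  also have "\<dots> \<le> window f (\<epsilon> + 2 * \<epsilon> * real (Suc n)) z"
    unfolding window_def using n \<epsilon> by (intro nn_integral_mono) (auto simp: indicator_def)
  finally have "per f \<le> window f (\<epsilon> + 2 * \<epsilon> * real (Suc n)) z" .
  then have "ennreal ((l\<^sup>2 * \<epsilon>\<^sup>2 / 4) ^ Suc n / \<epsilon>) * per f \<le>
      ennreal ((l\<^sup>2 * \<epsilon>\<^sup>2 / 4) ^ Suc n / \<epsilon>) * window f (\<epsilon> + 2 * \<epsilon> * real (Suc n)) z"
    by (rule mult_left_mono) simp
  also have "\<dots> \<le> evol s f (s + 6 * real (Suc n)) z"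
    by (rule evol_ge_window[OF assms(1-6)])
  finally show ?thesis .
qed

end

section \<open>Integrable data of both signs\<close>

lemma set_lebesgue_integral_eq_nn:
  fixes f :: "real \<Rightarrow> real"
  assumes [measurable]: "f \<in> borel_measurable borel" "A \<in> sets borel"
    and nonneg: "\<And>r. r \<in> A \<Longrightarrow> 0 \<le> f r"
    and fin: "(\<integral>\<^sup>+r\<in>A. ennreal (f r) \<partial>lborel) < \<infinity>"
  shows "set_integrable lborel A f"
    and "(\<integral>\<^sup>+r\<in>A. ennreal (f r) \<partial>lborel) = ennreal (LINT r:A|lborel. f r)"
    and "0 \<le> (LINT r:A|lborel. f r)"
proof -
  have eq: "(\<integral>\<^sup>+r\<in>A. ennreal (f r) \<partial>lborel) = (\<integral>\<^sup>+r. ennreal (indicator A r *\<^sub>R f r) \<partial>lborel)"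
    by (intro nn_integral_cong) (auto simp: indicator_def)
  have nn: "0 \<le> indicator A r *\<^sub>R f r" for r using nonneg by (auto simp: indicator_def)
  show int: "set_integrable lborel A f"
    unfolding set_integrable_def using fin nn unfolding eq by (intro integrableI_nonneg) auto
  show "(\<integral>\<^sup>+r\<in>A. ennreal (f r) \<partial>lborel) = ennreal (LINT r:A|lborel. f r)"
    unfolding eq set_lebesgue_integral_def
    using int nn by (intro nn_integral_eq_integral) (auto simp: set_integrable_def)
  show "0 \<le> (LINT r:A|lborel. f r)"
    unfolding set_lebesgue_integral_def using nn by (rule Bochner_Integration.integral_nonneg)
qed

context exchange
begin

text \<open>
  This is the integral equation for \<open>e\<^sup>-\<^sup>c\<^sup>t evol\<close>, obtained
  without differentiating in time: the equation for \<open>evol\<close> is multiplied by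
  \<open>c e\<^sup>-\<^sup>c\<^sup>r\<close> and integrated, and the order of the integrations
  is exchanged. The loss term stands on the left because the values are in
  \<open>[0,\<infinity>]\<close>.
\<close>

lemma evol_damped:
  assumes f: "f \<in> borel_measurable borel" and "0 \<le> t"
  shows "ennreal (exp (- c * t)) * evol 0 f t z + (\<integral>\<^sup>+r\<in>{0..t}. ennreal (c * exp (- c * r)) * evol 0 f r z \<partial>lborel) =
    f z + (\<integral>\<^sup>+r\<in>{0..t}. ennreal (exp (- c * r)) * gain (evol 0 f) r z \<partial>lborel)"
proof -
  define G where "G q = gain (evol 0 f) q z" for q
  note [measurable] = borel_pair_compose[OF gain_measurable[OF evol_measurable[OF f]]]
  have G [measurable]: "G \<in> borel_measurable borel" unfolding G_def by measurable
  have E: "evol 0 f r z = f z + (\<integral>\<^sup>+q\<in>{0..r}. G q \<partial>lborel)" for r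
    unfolding G_def by (rule evol_eq[OF f])
  \<comment> \<open>After exchanging the integrals, the inner one is over the times r after q.\<close>
  have ex: "(\<integral>\<^sup>+r\<in>{q..t}. ennreal (c * exp (- c * r)) \<partial>lborel) = ennreal (exp (- c * q) - exp (- c * t))"
    if "q \<le> t" for q
  proof -
    have "(\<integral>\<^sup>+r\<in>{q..t}. ennreal (c * exp (- c * r)) \<partial>lborel) = ennreal (- exp (- c * t) - (- exp (- c * q)))"
      using that bound_nonneg
      by (intro nn_integral_FTC_Icc)
         (auto intro!: derivative_eq_intros simp flip: has_real_derivative_iff_has_vector_derivative)
    then show ?thesis by simp
  qed
  have split: "ennreal (exp (- c * t)) + ennreal (exp (- c * q) - exp (- c * t)) = ennreal (exp (- c * q))"
    if "q \<le> t" for q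
    using that bound_nonneg by (subst ennreal_plus[symmetric]) (auto intro: mult_left_mono)
  have "(\<integral>\<^sup>+r\<in>{0..t}. ennreal (c * exp (- c * r)) * evol 0 f r z \<partial>lborel) =
     (\<integral>\<^sup>+r. f z * (ennreal (c * exp (- c * r)) * indicator {0..t} r) +
        ennreal (c * exp (- c * r)) * indicator {0..t} r * (\<integral>\<^sup>+q\<in>{0..r}. G q \<partial>lborel) \<partial>lborel)"
    unfolding E by (intro nn_integral_cong) (simp add: algebra_simps)
  also have "\<dots> = f z * (\<integral>\<^sup>+r\<in>{0..t}. ennreal (c * exp (- c * r)) \<partial>lborel) +
     (\<integral>\<^sup>+r. ennreal (c * exp (- c * r)) * indicator {0..t} r * (\<integral>\<^sup>+q\<in>{0..r}. G q \<partial>lborel) \<partial>lborel)"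
  proof (subst nn_integral_add)
    have "(\<lambda>r. \<integral>\<^sup>+q. G q * (if 0 \<le> q \<and> q \<le> r then 1 else 0) \<partial>lborel) \<in> borel_measurable borel"
      by measurable
    then have [measurable]: "(\<lambda>r. \<integral>\<^sup>+q\<in>{0..r}. G q \<partial>lborel) \<in> borel_measurable borel"
      by (simp add: indicator_def)
    show "(\<lambda>r. ennreal (c * exp (- c * r)) * indicator {0..t} r * (\<integral>\<^sup>+q\<in>{0..r}. G q \<partial>lborel)) \<in> borel_measurable lborel"
      by measurable
  qed (auto simp: nn_integral_cmult)
  also have "(\<integral>\<^sup>+r\<in>{0..t}. ennreal (c * exp (- c * r)) \<partial>lborel) = ennreal (1 - exp (- c * t))"
    using ex[OF \<open>0 \<le> t\<close>] by simp
  also have "(\<integral>\<^sup>+r. ennreal (c * exp (- c * r)) * indicator {0..t} r * (\<integral>\<^sup>+q\<in>{0..r}. G q \<partial>lborel) \<partial>lborel) =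
      (\<integral>\<^sup>+r. (\<integral>\<^sup>+q. ennreal (c * exp (- c * r)) * G q * (if 0 \<le> q \<and> q \<le> r \<and> r \<le> t then 1 else 0) \<partial>lborel) \<partial>lborel)"
    by (subst nn_integral_cmult[symmetric]) (auto intro!: nn_integral_cong simp: indicator_def)
  also have "\<dots> = (\<integral>\<^sup>+q. (\<integral>\<^sup>+r. ennreal (c * exp (- c * r)) * G q * (if 0 \<le> q \<and> q \<le> r \<and> r \<le> t then 1 else 0) \<partial>lborel) \<partial>lborel)"
    by (rule lborel_pair.Fubini') measurable
  also have "\<dots> = (\<integral>\<^sup>+q. G q * indicator {0..t} q * (\<integral>\<^sup>+r\<in>{q..t}. ennreal (c * exp (- c * r)) \<partial>lborel) \<partial>lborel)"
  proof (intro nn_integral_cong)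
    fix q
    show "(\<integral>\<^sup>+r. ennreal (c * exp (- c * r)) * G q * (if 0 \<le> q \<and> q \<le> r \<and> r \<le> t then 1 else 0) \<partial>lborel) =
        G q * indicator {0..t} q * (\<integral>\<^sup>+r\<in>{q..t}. ennreal (c * exp (- c * r)) \<partial>lborel)"
    proof (cases "0 \<le> q \<and> q \<le> t")
      case True
      then show ?thesis
        by (subst nn_integral_cmult[symmetric]) (auto intro!: nn_integral_cong simp: indicator_def mult.commute)
    next
      case False
      then have "(\<integral>\<^sup>+r. ennreal (c * exp (- c * r)) * G q * (if 0 \<le> q \<and> q \<le> r \<and> r \<le> t then 1 else 0) \<partial>lborel) =
          (\<integral>\<^sup>+r. 0 \<partial>(lborel :: real measure))"
        by (intro nn_integral_cong) auto
      then show ?thesis using False by (auto simp: indicator_def)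
    qed
  qed
  also have "\<dots> = (\<integral>\<^sup>+q\<in>{0..t}. G q * ennreal (exp (- c * q) - exp (- c * t)) \<partial>lborel)"
  proof (intro nn_integral_cong)
    fix q
    show "G q * indicator {0..t} q * (\<integral>\<^sup>+r\<in>{q..t}. ennreal (c * exp (- c * r)) \<partial>lborel) =
        G q * ennreal (exp (- c * q) - exp (- c * t)) * indicator {0..t} q"
      using ex[of q] by (cases "q \<in> {0..t}") auto
  qed
  finally have I: "(\<integral>\<^sup>+r\<in>{0..t}. ennreal (c * exp (- c * r)) * evol 0 f r z \<partial>lborel) =
      f z * ennreal (1 - exp (- c * t)) + (\<integral>\<^sup>+q\<in>{0..t}. G q * ennreal (exp (- c * q) - exp (- c * t)) \<partial>lborel)" .
  have "ennreal (exp (- c * t)) * (\<integral>\<^sup>+q\<in>{0..t}. G q \<partial>lborel) + (\<integral>\<^sup>+q\<in>{0..t}. G q * ennreal (exp (- c * q) - exp (- c * t)) \<partial>lborel)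
     = (\<integral>\<^sup>+q. ennreal (exp (- c * t)) * (G q * indicator {0..t} q) + G q * ennreal (exp (- c * q) - exp (- c * t)) * indicator {0..t} q \<partial>lborel)"
    by (subst nn_integral_add) (auto simp: nn_integral_cmult)
  also have "\<dots> = (\<integral>\<^sup>+q\<in>{0..t}. ennreal (exp (- c * q)) * G q \<partial>lborel)"
  proof (intro nn_integral_cong)
    fix q
    have "ennreal (exp (- c * t)) * G q + G q * ennreal (exp (- c * q) - exp (- c * t)) =
       (ennreal (exp (- c * t)) + ennreal (exp (- c * q) - exp (- c * t))) * G q"
      by (simp add: distrib_left distrib_right mult.commute)
    then show "ennreal (exp (- c * t)) * (G q * indicator {0..t} q) + G q * ennreal (exp (- c * q) - exp (- c * t)) * indicator {0..t} q
        = ennreal (exp (- c * q)) * G q * indicator {0..t} q"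
      using split[of q] by (auto simp: indicator_def)
  qed
  finally have II: "ennreal (exp (- c * t)) * (\<integral>\<^sup>+q\<in>{0..t}. G q \<partial>lborel) +
     (\<integral>\<^sup>+q\<in>{0..t}. G q * ennreal (exp (- c * q) - exp (- c * t)) \<partial>lborel) = (\<integral>\<^sup>+q\<in>{0..t}. ennreal (exp (- c * q)) * G q \<partial>lborel)" .
  have III: "ennreal (exp (- c * t)) * f z + f z * ennreal (1 - exp (- c * t)) = f z"
  proof -
    have "ennreal (exp (- c * t)) * f z + f z * ennreal (1 - exp (- c * t)) =
       (ennreal (exp (- c * t)) + ennreal (exp (- c * 0) - exp (- c * t))) * f z"
      by (simp add: distrib_left distrib_right mult.commute)
    then show ?thesis using split[OF \<open>0 \<le> t\<close>] by simp
  qed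
  have "ennreal (exp (- c * t)) * evol 0 f t z + (\<integral>\<^sup>+r\<in>{0..t}. ennreal (c * exp (- c * r)) * evol 0 f r z \<partial>lborel) =
    (ennreal (exp (- c * t)) * f z + f z * ennreal (1 - exp (- c * t))) +
    (ennreal (exp (- c * t)) * (\<integral>\<^sup>+q\<in>{0..t}. G q \<partial>lborel) +
     (\<integral>\<^sup>+q\<in>{0..t}. G q * ennreal (exp (- c * q) - exp (- c * t)) \<partial>lborel))"
    unfolding I by (subst E) (simp only: distrib_left ac_simps)
  then show ?thesis unfolding II III by (simp only: G_def)
qed

end

definition datum :: "(real \<Rightarrow> real) \<Rightarrow> bool" where
  "datum f \<longleftrightarrow> f \<in> borel_measurable borel \<and> periodic2 f \<and> per (\<lambda>z. ennreal \<bar>f z\<bar>) < \<infinity>"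

lemma datum_abs_le:
  assumes "datum f" "g \<in> borel_measurable borel" "periodic2 g" "\<And>z. \<bar>g z\<bar> \<le> \<bar>f z\<bar> + a"
  shows "datum g"
proof -
  have "0 \<le> \<bar>a\<bar>" by simp
  have "per (\<lambda>z. ennreal \<bar>g z\<bar>) \<le> per (\<lambda>z. ennreal \<bar>f z\<bar> + ennreal \<bar>a\<bar>)"
    using assms(4) by (intro per_mono) (auto simp flip: ennreal_plus intro!: ennreal_leI order_trans[OF assms(4)])
  also have "\<dots> = per (\<lambda>z. ennreal \<bar>f z\<bar>) + 2 * ennreal \<bar>a\<bar>"
    using assms(1) by (subst per_add) (auto simp: per_const datum_def)
  also have "\<dots> < \<infinity>" using assms(1) by (auto simp: datum_def ennreal_mult_less_top)
  finally show ?thesis using assms by (auto simp: datum_def)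
qed

lemma datum_uminus: "datum f \<Longrightarrow> datum (\<lambda>z. - f z)"
  by (auto simp: datum_def periodic2_def)

lemma datum_add:
  assumes "datum f" "datum g"
  shows "datum (\<lambda>z. f z + g z)"
proof -
  have "per (\<lambda>z. ennreal \<bar>f z + g z\<bar>) \<le> per (\<lambda>z. ennreal \<bar>f z\<bar> + ennreal \<bar>g z\<bar>)"
    by (intro per_mono) (auto simp flip: ennreal_plus intro!: ennreal_leI)
  also have "\<dots> = per (\<lambda>z. ennreal \<bar>f z\<bar>) + per (\<lambda>z. ennreal \<bar>g z\<bar>)"
    using assms by (subst per_add) (auto simp: datum_def)
  also have "\<dots> < \<infinity>" using assms by (auto simp: datum_def)
  finally show ?thesis using assms by (auto simp: datum_def periodic2_def)
qed

lemma datum_const: "datum (\<lambda>z. a)"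
  by (auto simp: datum_def periodic2_def per_const ennreal_mult_less_top)

lemma datum_per: "datum f \<Longrightarrow> per (\<lambda>z. ennreal (f z)) < \<infinity>"
  by (rule order_le_less_trans[of _ "per (\<lambda>z. ennreal \<bar>f z\<bar>)"])
     (auto simp: datum_def intro!: per_mono ennreal_leI)

lemma datum_ennreal:
  assumes "datum f"
  shows "(\<lambda>z. ennreal (f z)) \<in> borel_measurable borel" "periodic2 (\<lambda>z. ennreal (f z))"
    "per (\<lambda>z. ennreal (f z)) < \<infinity>"
  using assms datum_per[OF assms] by (auto simp: datum_def periodic2_def)

context exchange
begin

text \<open>
  Since \<open>ennreal\<close> sends negative numbers to \<open>0\<close>, this is the damped
  evolution of the positive part of \<open>f\<close>. The datum is kept for negative times, so
  that the flow is defined and continuous on the whole line.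
\<close>

definition pflow :: "(real \<Rightarrow> real) \<Rightarrow> real \<Rightarrow> real \<Rightarrow> real" where
  "pflow f t z = exp (- c * max 0 t) * enn2real (evol 0 (\<lambda>z. ennreal (f z)) t z)"

definition flow :: "(real \<Rightarrow> real) \<Rightarrow> real \<Rightarrow> real \<Rightarrow> real" where
  "flow f t z = pflow f t z - pflow (\<lambda>z. - f z) t z"

lemma evol_datum_finite:
  assumes "datum f"
  shows "evol s (\<lambda>z. ennreal (f z)) t z < \<infinity>"
proof (cases "s \<le> t")
  case True
  then show ?thesis using datum_ennreal[OF assms] by (intro evol_finite) auto
next
  case False
  then show ?thesis using datum_ennreal[OF assms] by (subst evol_start) auto
qed

lemma ennreal_pflow:
  assumes "datum f"
  shows "ennreal (pflow f t z) = ennreal (exp (- c * max 0 t)) * evol 0 (\<lambda>z. ennreal (f z)) t z"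
  unfolding pflow_def using evol_datum_finite[OF assms] by (simp add: ennreal_mult)

lemma pflow_nonneg: "0 \<le> pflow f t z"
  by (simp add: pflow_def)

lemma pflow_measurable:
  assumes "datum f"
  shows "case_prod (pflow f) \<in> borel_measurable (borel \<Otimes>\<^sub>M borel)"
proof -
  note [measurable] = borel_pair_compose[OF evol_measurable[OF datum_ennreal(1)[OF assms]]]
  show ?thesis unfolding pflow_def by measurable
qed

lemma flow_measurable:
  assumes "datum f"
  shows "case_prod (flow f) \<in> borel_measurable (borel \<Otimes>\<^sub>M borel)"
proof -
  note [measurable] = borel_pair_compose[OF pflow_measurable[OF assms]]
    borel_pair_compose[OF pflow_measurable[OF datum_uminus[OF assms]]]
  show ?thesis unfolding flow_def by measurable
qed

lemma pflow_periodic: "datum f \<Longrightarrow> periodic2 (pflow f t)"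
  using evol_periodic[OF datum_ennreal(2)] by (auto simp: pflow_def periodic2_def)

lemma flow_periodic: "datum f \<Longrightarrow> periodic2 (flow f t)"
  using pflow_periodic[of f t] pflow_periodic[OF datum_uminus, of f t] by (auto simp: flow_def periodic2_def)

lemma pflow_start: "datum f \<Longrightarrow> t \<le> 0 \<Longrightarrow> pflow f t z = max 0 (f z)"
  using evol_start[OF datum_ennreal(1), of f t 0 z] by (auto simp: pflow_def enn2real_ennreal max_def ennreal_neg)

lemma flow_start: "datum f \<Longrightarrow> t \<le> 0 \<Longrightarrow> flow f t z = f z"
  using pflow_start[of f t z] pflow_start[OF datum_uminus, of f t z] by (auto simp: flow_def max_def)

text \<open>
  All terms of \<open>evol_damped\<close> are finite, so the loss term can be moved to the other
  side and combined with the gain.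
\<close>

lemma pflow_eq:
  assumes "datum f" "0 \<le> t"
  shows "set_integrable lborel {0..t} (\<lambda>r. k r z * (pflow f r (- z - 2 * r) - pflow f r z))"
    and "pflow f t z = max 0 (f z) + (LINT r:{0..t}|lborel. k r z * (pflow f r (- z - 2 * r) - pflow f r z))"
proof -
  define E where "E r z = evol 0 (\<lambda>z. ennreal (f z)) r z" for r z
  note d = datum_ennreal[OF assms(1)]
  note [measurable] = borel_pair_compose[OF pflow_measurable[OF assms(1)]]
  define A1 where "A1 r = c * pflow f r z" for r
  define A2 where "A2 r = (c - k r z) * pflow f r z + k r z * pflow f r (- z - 2 * r)" for r
  have [measurable]: "A1 \<in> borel_measurable borel" "A2 \<in> borel_measurable borel"
    unfolding A1_def A2_def by measurable
  have nonneg: "0 \<le> A1 r" "0 \<le> A2 r" for r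
    using bound_nonneg rate_nonneg rate_le by (auto simp: A1_def A2_def pflow_nonneg)
  have A1: "ennreal (A1 r) = ennreal (c * exp (- c * r)) * E r z" if "0 \<le> r" for r
    using that ennreal_pflow[OF assms(1), of r z] bound_nonneg pflow_nonneg[of f r z]
    by (simp add: A1_def E_def ennreal_mult mult.assoc)
  have A2: "ennreal (A2 r) = ennreal (exp (- c * r)) * gain E r z" if "0 \<le> r" for r
  proof -
    have "ennreal (A2 r) = ennreal (c - k r z) * ennreal (pflow f r z) + ennreal (k r z) * ennreal (pflow f r (- z - 2 * r))"
      using rate_nonneg rate_le by (simp add: A2_def ennreal_mult[symmetric] ennreal_plus[symmetric] pflow_nonneg del: ennreal_plus)
    then show ?thesis
      using that by (simp add: ennreal_pflow[OF assms(1)] gain_def E_def distrib_left ac_simps)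
  qed
  have fin: "E t z < \<infinity>" unfolding E_def by (rule evol_datum_finite[OF assms(1)])
  have eq: "ennreal (pflow f t z) + (\<integral>\<^sup>+r\<in>{0..t}. ennreal (A1 r) \<partial>lborel) =
      ennreal (f z) + (\<integral>\<^sup>+r\<in>{0..t}. ennreal (A2 r) \<partial>lborel)"
  proof -
    have "(\<integral>\<^sup>+r\<in>{0..t}. ennreal (A1 r) \<partial>lborel) = (\<integral>\<^sup>+r\<in>{0..t}. ennreal (c * exp (- c * r)) * E r z \<partial>lborel)"
      by (intro nn_integral_cong) (auto simp: indicator_def A1)
    moreover have "(\<integral>\<^sup>+r\<in>{0..t}. ennreal (A2 r) \<partial>lborel) = (\<integral>\<^sup>+r\<in>{0..t}. ennreal (exp (- c * r)) * gain E r z \<partial>lborel)"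
      by (intro nn_integral_cong) (auto simp: indicator_def A2)
    moreover have "ennreal (pflow f t z) = ennreal (exp (- c * t)) * E t z"
      using ennreal_pflow[OF assms(1), of t z] \<open>0 \<le> t\<close> by (simp add: E_def)
    ultimately show ?thesis
      using evol_damped[OF d(1) \<open>0 \<le> t\<close>, of z] by (simp add: E_def[abs_def])
  qed
  have fin1: "(\<integral>\<^sup>+r\<in>{0..t}. ennreal (A1 r) \<partial>lborel) < \<infinity>"
  proof -
    have "(\<integral>\<^sup>+r\<in>{0..t}. ennreal (A1 r) \<partial>lborel) \<le> (\<integral>\<^sup>+r\<in>{0..t}. ennreal c * E t z \<partial>lborel)"
    proof (intro nn_integral_mono)
      fix r
      have "ennreal (A1 r) \<le> ennreal c * E t z" if "r \<in> {0..t}"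
      proof -
        have "ennreal (c * exp (- c * r)) * E r z \<le> ennreal c * E t z"
          using that bound_nonneg unfolding E_def
          by (intro mult_mono ennreal_leI evol_mono_time d(1)) (auto intro: mult_left_le)
        then show ?thesis using A1 that by simp
      qed
      then show "ennreal (A1 r) * indicator {0..t} r \<le> ennreal c * E t z * indicator {0..t} r"
        by (auto simp: indicator_def)
    qed
    also have "\<dots> = ennreal c * E t z * ennreal t"
      using \<open>0 \<le> t\<close> by (simp add: nn_integral_cmult_indicator)
    also have "\<dots> < \<infinity>" using fin by (auto simp: ennreal_mult_less_top)
    finally show ?thesis .
  qed
  then have "ennreal (f z) + (\<integral>\<^sup>+r\<in>{0..t}. ennreal (A2 r) \<partial>lborel) < \<infinity>"
    unfolding eq[symmetric] by simp
  then have fin2: "(\<integral>\<^sup>+r\<in>{0..t}. ennreal (A2 r) \<partial>lborel) < \<infinity>"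
    by (simp add: less_top)
  note I1 = set_lebesgue_integral_eq_nn[of A1 "{0..t}", OF _ _ nonneg(1) fin1]
  note I2 = set_lebesgue_integral_eq_nn[of A2 "{0..t}", OF _ _ nonneg(2) fin2]
  have diff: "k r z * (pflow f r (- z - 2 * r) - pflow f r z) = A2 r - A1 r" for r
    by (simp add: A1_def A2_def algebra_simps)
  show "set_integrable lborel {0..t} (\<lambda>r. k r z * (pflow f r (- z - 2 * r) - pflow f r z))"
    unfolding diff using I1(1) I2(1) by (intro set_integral_diff) auto
  have "ennreal (pflow f t z + (LINT r:{0..t}|lborel. A1 r)) = ennreal (max 0 (f z) + (LINT r:{0..t}|lborel. A2 r))"
    using eq I1(2,3) I2(2,3) by (simp add: ennreal_plus pflow_nonneg max_def ennreal_neg)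
  then have "pflow f t z + (LINT r:{0..t}|lborel. A1 r) = max 0 (f z) + (LINT r:{0..t}|lborel. A2 r)"
    using I1(3) I2(3) pflow_nonneg by (subst (asm) ennreal_inj) auto
  moreover have "(LINT r:{0..t}|lborel. A2 r - A1 r) = (LINT r:{0..t}|lborel. A2 r) - (LINT r:{0..t}|lborel. A1 r)"
    using I1(1) I2(1) by (intro set_integral_diff) auto
  ultimately show "pflow f t z = max 0 (f z) + (LINT r:{0..t}|lborel. k r z * (pflow f r (- z - 2 * r) - pflow f r z))"
    unfolding diff by simp
qed

lemma flow_eq:
  assumes "datum f" "0 \<le> t"
  shows "set_integrable lborel {0..t} (\<lambda>r. k r z * (flow f r (- z - 2 * r) - flow f r z))"
    and "flow f t z = f z + (LINT r:{0..t}|lborel. k r z * (flow f r (- z - 2 * r) - flow f r z))"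
proof -
  note P = pflow_eq[OF assms] and N = pflow_eq[OF datum_uminus[OF assms(1)] assms(2)]
  let ?P = "\<lambda>r. k r z * (pflow f r (- z - 2 * r) - pflow f r z)"
  let ?N = "\<lambda>r. k r z * (pflow (\<lambda>z. - f z) r (- z - 2 * r) - pflow (\<lambda>z. - f z) r z)"
  have diff: "(\<lambda>r. k r z * (flow f r (- z - 2 * r) - flow f r z)) = (\<lambda>r. ?P r - ?N r)"
    by (simp add: flow_def algebra_simps)
  show "set_integrable lborel {0..t} (\<lambda>r. k r z * (flow f r (- z - 2 * r) - flow f r z))"
    unfolding diff using P(1)[of z] N(1)[of z] by (intro set_integral_diff) auto
  have "(LINT r:{0..t}|lborel. ?P r - ?N r) = (LINT r:{0..t}|lborel. ?P r) - (LINT r:{0..t}|lborel. ?N r)"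
    using P(1)[of z] N(1)[of z] by (intro set_integral_diff) auto
  then show "flow f t z = f z + (LINT r:{0..t}|lborel. k r z * (flow f r (- z - 2 * r) - flow f r z))"
    unfolding diff using P(2)[of z] N(2)[of z] by (simp add: flow_def max_def)
qed

lemma pflow_add:
  assumes "datum f" "datum g" "\<And>z. 0 \<le> f z" "\<And>z. 0 \<le> g z"
  shows "pflow (\<lambda>z. f z + g z) t z = pflow f t z + pflow g t z"
proof -
  have "(\<lambda>z. ennreal (f z + g z)) = (\<lambda>z. ennreal (f z) + ennreal (g z))"
    using assms by auto
  then have "evol 0 (\<lambda>z. ennreal (f z + g z)) t z = evol 0 (\<lambda>z. ennreal (f z)) t z + evol 0 (\<lambda>z. ennreal (g z)) t z"
    using evol_add[OF datum_ennreal(1)[OF assms(1)] datum_ennreal(1)[OF assms(2)]] by simp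
  then show ?thesis
    using evol_datum_finite[OF assms(1), of 0 t z] evol_datum_finite[OF assms(2), of 0 t z]
    by (simp add: pflow_def enn2real_plus less_top distrib_left)
qed

lemma pflow_max: "pflow (\<lambda>z. max 0 (f z)) = pflow f"
proof -
  have "(\<lambda>z. ennreal (max 0 (f z))) = (\<lambda>z. ennreal (f z))"
    by (auto simp: max_def ennreal_neg)
  then show ?thesis by (simp add: pflow_def[abs_def])
qed

lemma datum_max: "datum f \<Longrightarrow> datum (\<lambda>z. max 0 (f z))"
  by (rule datum_abs_le[of f _ 0]) (auto simp: datum_def periodic2_def)

lemma flow_diff:
  assumes "datum f" "datum g" "\<And>z. 0 \<le> f z" "\<And>z. 0 \<le> g z"
  shows "flow (\<lambda>z. f z - g z) t z = pflow f t z - pflow g t z"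
proof -
  define h where "h z = f z - g z" for z
  have h: "datum h" using datum_add[OF assms(1) datum_uminus[OF assms(2)]] by (simp add: h_def[abs_def])
  have "(\<lambda>z. max 0 (h z) + g z) = (\<lambda>z. max 0 (- h z) + f z)"
    by (auto simp: h_def max_def)
  then have "pflow (\<lambda>z. max 0 (h z) + g z) t z = pflow (\<lambda>z. max 0 (- h z) + f z) t z" by simp
  then have "pflow h t z + pflow g t z = pflow (\<lambda>z. - h z) t z + pflow f t z"
    using assms datum_max[OF h] datum_max[OF datum_uminus[OF h]]
    by (simp add: pflow_add) (simp add: pflow_max)
  then show ?thesis by (simp add: flow_def h_def[abs_def])
qed

lemma pflow_const: "0 \<le> a \<Longrightarrow> pflow (\<lambda>z. a) t z = a"
proof (cases "0 \<le> t")
  case True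
  assume "0 \<le> a"
  have "evol 0 (\<lambda>z. ennreal a * 1) t z = ennreal a * ennreal (exp (c * t))"
    using evol_cmult[of "\<lambda>z. 1" 0 "ennreal a" t z] evol_one[OF True] by simp
  then show ?thesis
    using True \<open>0 \<le> a\<close> by (simp add: pflow_def ennreal_mult[symmetric] exp_minus)
qed (simp add: pflow_start datum_const)

text \<open>
  Constants are stationary. Subtracting the mean state from a solution therefore gives the
  solution with the shifted datum.
\<close>

lemma flow_shift:
  assumes "datum f"
  shows "flow (\<lambda>z. f z - a) t z = flow f t z - a"
proof -
  note df = datum_max[OF assms] datum_max[OF datum_uminus[OF assms]]
  have "(\<lambda>z. f z - a) = (\<lambda>z. (max 0 (f z) + max 0 (- a)) - (max 0 (- f z) + max 0 a))"
    by (auto simp: max_def)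
  then have "flow (\<lambda>z. f z - a) t z = pflow (\<lambda>z. max 0 (f z) + max 0 (- a)) t z - pflow (\<lambda>z. max 0 (- f z) + max 0 a) t z"
    using flow_diff[OF datum_add[OF df(1) datum_const[of "max 0 (- a)"]] datum_add[OF df(2) datum_const[of "max 0 a"]]] by simp
  also have "\<dots> = pflow f t z + max 0 (- a) - (pflow (\<lambda>z. - f z) t z + max 0 a)"
    using df by (simp add: pflow_add datum_const pflow_const) (simp add: pflow_max)
  finally show ?thesis by (simp add: flow_def max_def)
qed

lemma flow_abs_le:
  assumes "datum f"
  shows "\<bar>flow f t z\<bar> \<le> pflow (\<lambda>z. \<bar>f z\<bar>) t z"
proof -
  have "(\<lambda>z. \<bar>f z\<bar>) = (\<lambda>z. max 0 (f z) + max 0 (- f z))" by auto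
  then have "pflow (\<lambda>z. \<bar>f z\<bar>) t z = pflow f t z + pflow (\<lambda>z. - f z) t z"
    using datum_max[OF assms] datum_max[OF datum_uminus[OF assms]] by (simp add: pflow_add) (simp add: pflow_max)
  then show ?thesis
    using pflow_nonneg[of f t z] pflow_nonneg[of "\<lambda>z. - f z" t z] by (simp add: flow_def abs_le_iff)
qed

lemma flow_bound:
  assumes "datum f" "0 \<le> T"
  obtains K M where "1 \<le> K" "0 \<le> M" "\<And>t z. t \<le> T \<Longrightarrow> \<bar>flow f t z\<bar> \<le> K * (\<bar>f z\<bar> + M)"
proof -
  have da: "datum (\<lambda>z. \<bar>f z\<bar>)" using assms(1) by (auto simp: datum_def periodic2_def)
  obtain K M :: real where KM: "0 \<le> K" "0 \<le> M"
    and b: "\<And>t z. 0 \<le> t \<Longrightarrow> t \<le> T \<Longrightarrow> evol 0 (\<lambda>z. ennreal \<bar>f z\<bar>) t z \<le> ennreal K * (ennreal \<bar>f z\<bar> + ennreal M)"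
    using evol_bound[OF datum_ennreal[OF da] assms(2)] by blast
  have "\<bar>flow f t z\<bar> \<le> max 1 K * (\<bar>f z\<bar> + M)" if "t \<le> T" for t z
  proof (cases "0 \<le> t")
    case True
    have "ennreal (pflow (\<lambda>z. \<bar>f z\<bar>) t z) \<le> 1 * evol 0 (\<lambda>z. ennreal \<bar>f z\<bar>) t z"
      unfolding ennreal_pflow[OF da] using True bound_nonneg by (intro mult_right_mono) auto
    also have "\<dots> \<le> ennreal K * (ennreal \<bar>f z\<bar> + ennreal M)"
      using b[OF True that] by simp
    also have "\<dots> = ennreal (K * (\<bar>f z\<bar> + M))"
      using KM by (simp add: ennreal_mult)
    finally have "pflow (\<lambda>z. \<bar>f z\<bar>) t z \<le> K * (\<bar>f z\<bar> + M)"
      using KM by (simp add: ennreal_le_iff)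
    also have "\<dots> \<le> max 1 K * (\<bar>f z\<bar> + M)"
      using KM by (intro mult_right_mono) auto
    finally show ?thesis using flow_abs_le[OF assms(1), of t z] by simp
  next
    case False
    have "\<bar>f z\<bar> \<le> 1 * (\<bar>f z\<bar> + M)" using KM by simp
    also have "\<dots> \<le> max 1 K * (\<bar>f z\<bar> + M)" using KM by (intro mult_right_mono) auto
    finally show ?thesis using False flow_start[OF assms(1), of t z] by simp
  qed
  then show ?thesis using that[of "max 1 K" M] KM by auto
qed

end

section \<open>Contraction in \<open>L\<^sup>p\<close>\<close>

text \<open>
  Young's inequality with a free parameter \<open>r\<close>. Positive operators preserve affine
  bounds of this kind, and \<open>powr_le_of_affine_bounds\<close> recovers Hoelder's inequality
  from them.
\<close>

lemma le_powr_affine: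
  fixes d r p :: real
  assumes "0 \<le> d" "0 < r" "1 < p"
  shows "d \<le> r powr (1 - p) / p * d powr p + (1 - 1 / p) * r"
proof (cases "d = 0")
  case True
  then show ?thesis using assms by simp
next
  case False
  then have d: "0 < d" using assms by simp
  have "(d powr p * r powr (1 - p)) powr (1 / p) * r powr (1 - 1 / p) \<le>
      (1 / p) * (d powr p * r powr (1 - p)) + (1 - 1 / p) * r"
    using assms d by (intro Youngs_inequality_0) auto
  also have "(d powr p * r powr (1 - p)) powr (1 / p) * r powr (1 - 1 / p) = d * r powr ((1 - p) / p + (1 - 1 / p))"
    using assms d by (simp add: powr_mult powr_powr powr_add)
  also have "(1 - p) / p + (1 - 1 / p) = 0" using assms by (simp add: field_simps)
  finally show ?thesis using assms by (simp add: mult.commute)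
qed

text \<open>
  The right-hand side is smallest at \<open>r = (Y/K)\<^sup>1\<^sup>/\<^sup>p\<close>. If
  \<open>K\<close> or \<open>Y\<close> vanishes there is no minimum, and \<open>X = 0\<close>
  follows from \<open>r \<rightarrow> \<infinity>\<close> or from a suitably small
  \<open>r\<close>.
\<close>

lemma powr_le_of_affine_bounds:
  fixes X Y K p :: real
  assumes "0 \<le> X" "0 \<le> Y" "0 \<le> K" "1 < p"
    and le: "\<And>r. 0 < r \<Longrightarrow> X \<le> r powr (1 - p) / p * Y + (1 - 1 / p) * r * K"
  shows "X powr p \<le> K powr (p - 1) * Y"
proof (cases "X = 0")
  case True
  then show ?thesis using assms by simp
next
  case False
  with assms have X: "0 < X" by simp
  have K: "0 < K"
  proof (rule ccontr)
    assume "\<not> 0 < K"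
    then have K0: "K = 0" using assms by simp
    have "((\<lambda>r. r powr (1 - p) / p * Y) \<longlongrightarrow> 0 / p * Y) at_top"
      using \<open>1 < p\<close> by (intro tendsto_intros tendsto_neg_powr filterlim_ident) auto
    then have "((\<lambda>r. r powr (1 - p) / p * Y) \<longlongrightarrow> 0) at_top" by simp
    then have "X \<le> 0"
      using le[unfolded K0] by (intro tendsto_lowerbound) (auto simp: eventually_at_top_dense intro!: exI[of _ 0])
    then show False using X by simp
  qed
  show ?thesis
  proof (cases "Y = 0")
    case True
    \<comment> \<open>With r = X / (2 K) the bound reads X \<le> (1 - 1/p) X / 2, which forces
      X = 0.\<close>
    have "X \<le> (1 - 1 / p) * (X / (2 * K)) * K"
      using le[of "X / (2 * K)"] X K True by simp
    also have "\<dots> = (1 - 1 / p) * (X / 2)" using K by simp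
    also have "\<dots> \<le> 1 * (X / 2)" using X \<open>1 < p\<close> by (intro mult_right_mono) auto
    finally show ?thesis using X by simp
  next
    case False
    then have Y: "0 < Y" using assms by simp
    define r where "r = (Y / K) powr (1 / p)"
    have r: "0 < r" unfolding r_def using Y K by simp
    have rp: "r powr p = Y / K" unfolding r_def using Y K \<open>1 < p\<close> by (simp add: powr_powr)
    have "r powr (1 - p) * Y = r * K"
      using rp r Y K by (simp add: powr_diff field_simps)
    then have "r powr (1 - p) / p * Y + (1 - 1 / p) * r * K = r * K"
      using \<open>1 < p\<close> by (simp add: field_simps)
    then have "X \<le> r * K" using le[OF r] by simp
    then have "X powr p \<le> (r * K) powr p" using X \<open>1 < p\<close> by (intro powr_mono2) auto
    also have "\<dots> = K powr (p - 1) * Y"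
      using rp r K by (simp add: powr_mult powr_diff field_simps)
    finally show ?thesis .
  qed
qed

context exchange
begin

text \<open>
  For \<open>F\<close> and \<open>G\<close> of equal mass the multiple \<open>\<kappa>
  per\<close> may be subtracted from the evolution without changing the difference. The operator
  that remains is positive and linear; it multiplies masses, and the constant \<open>1\<close>,
  by \<open>exp (c (t - s)) - 2 \<kappa>\<close>, the \<open>2\<close> being the length of a
  period. A positive operator with these two properties has at most that norm on
  \<open>L\<^sup>p\<close>: Hoelder's inequality bounds the power of the image by the image of
  the power, whose mass is known.
\<close>

lemma evol_diff_Lp:
  fixes F G :: "real \<Rightarrow> real"
  assumes F: "datum F" "\<And>z. 0 \<le> F z" and G: "datum G" "\<And>z. 0 \<le> G z"
    and mass: "per (\<lambda>z. ennreal (F z)) = per (\<lambda>z. ennreal (G z))"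
    and "s \<le> t" "1 < p" "0 \<le> \<kappa>"
    and minor: "\<And>h z. h \<in> borel_measurable borel \<Longrightarrow> periodic2 h \<Longrightarrow> ennreal \<kappa> * per h \<le> evol s h t z"
    and fin: "per (\<lambda>z. ennreal (\<bar>F z - G z\<bar> powr p)) < \<infinity>"
  shows "per (\<lambda>z. ennreal (\<bar>enn2real (evol s (\<lambda>z. ennreal (F z)) t z) - enn2real (evol s (\<lambda>z. ennreal (G z)) t z)\<bar> powr p))
    \<le> ennreal ((exp (c * (t - s)) - 2 * \<kappa>) powr p) * per (\<lambda>z. ennreal (\<bar>F z - G z\<bar> powr p))"
    and "2 * \<kappa> \<le> exp (c * (t - s))"
proof -
  define S where "S h z = evol s (\<lambda>z. ennreal (h z)) t z" for h :: "real \<Rightarrow> real" and z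
  define R where "R h z = enn2real (S h z)" for h z
  define N where "N h = enn2real (per (\<lambda>z. ennreal (h z)))" for h :: "real \<Rightarrow> real"
  define q where "q = exp (c * (t - s))"
  have SR: "S h z = ennreal (R h z)" if "datum h" for h z
    using evol_datum_finite[OF that, of s t z] by (simp add: S_def R_def)
  have PN: "per (\<lambda>z. ennreal (h z)) = ennreal (N h)" if "datum h" for h
    using datum_per[OF that] by (simp add: N_def)
  have Rnn: "0 \<le> R h z" and Nnn: "0 \<le> N h" for h z by (auto simp: R_def N_def)
  have radd: "R (\<lambda>z. g z + h z) z = R g z + R h z" "N (\<lambda>z. g z + h z) = N g + N h"
    if gh: "datum g" "datum h" "\<And>z. 0 \<le> g z" "\<And>z. 0 \<le> h z" for g h z
  proof -
    have eq: "(\<lambda>z. ennreal (g z + h z)) = (\<lambda>z. ennreal (g z) + ennreal (h z))" using gh by auto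
    have "S (\<lambda>z. g z + h z) z = S g z + S h z"
      unfolding S_def eq by (rule evol_add) (use gh in \<open>auto simp: datum_def\<close>)
    then show "R (\<lambda>z. g z + h z) z = R g z + R h z"
      using SR[OF gh(1)] SR[OF gh(2)] SR[OF datum_add[OF gh(1,2)]] Rnn
      by (metis add_nonneg_nonneg ennreal_inj ennreal_plus)
    have "per (\<lambda>z. ennreal (g z + h z)) = per (\<lambda>z. ennreal (g z)) + per (\<lambda>z. ennreal (h z))"
      unfolding eq by (rule per_add) (use gh in \<open>auto simp: datum_def\<close>)
    then show "N (\<lambda>z. g z + h z) = N g + N h"
      unfolding PN[OF gh(1)] PN[OF gh(2)] PN[OF datum_add[OF gh(1,2)]]
      using Nnn by (metis add_nonneg_nonneg ennreal_inj ennreal_plus)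
  qed
  have rmin: "\<kappa> * N h \<le> R h z" if "datum h" for h z
  proof -
    have "ennreal \<kappa> * per (\<lambda>z. ennreal (h z)) \<le> S h z"
      unfolding S_def using datum_ennreal[OF that] by (intro minor) auto
    then show ?thesis
      unfolding SR[OF that] PN[OF that] using \<open>0 \<le> \<kappa>\<close> Nnn Rnn by (simp add: ennreal_mult[symmetric])
  qed
  have rcm: "R (\<lambda>z. a * h z) z = a * R h z" "N (\<lambda>z. a * h z) = a * N h" "datum (\<lambda>z. a * h z)"
    if h: "datum h" and a: "0 \<le> a" for a h z
  proof -
    have eq: "(\<lambda>z. ennreal (a * h z)) = (\<lambda>z. ennreal a * ennreal (h z))"
      using a by (auto simp: ennreal_mult')
    have "S (\<lambda>z. a * h z) z = ennreal a * S h z"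
      unfolding S_def eq by (rule evol_cmult) (use h datum_ennreal in auto)
    then show "R (\<lambda>z. a * h z) z = a * R h z"
      using a by (simp add: R_def enn2real_mult)
    have "per (\<lambda>z. ennreal (a * h z)) = ennreal a * per (\<lambda>z. ennreal (h z))"
      unfolding eq by (rule per_cmult) (use h datum_ennreal in auto)
    then show "N (\<lambda>z. a * h z) = a * N h"
      using a by (simp add: N_def enn2real_mult)
    have "per (\<lambda>z. ennreal \<bar>a * h z\<bar>) = per (\<lambda>z. ennreal a * ennreal \<bar>h z\<bar>)"
      using a by (intro per_cong) (simp add: abs_mult ennreal_mult')
    also have "\<dots> = ennreal a * per (\<lambda>z. ennreal \<bar>h z\<bar>)"
      using h by (intro per_cmult) (auto simp: datum_def)
    finally show "datum (\<lambda>z. a * h z)"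
      using h by (auto simp: datum_def periodic2_def ennreal_mult_less_top)
  qed
  have rone: "R (\<lambda>z. 1) z = q" "N (\<lambda>z. 1) = 2" for z
    using evol_one[OF \<open>s \<le> t\<close>] by (auto simp: R_def S_def q_def N_def per_const)
  have q2: "2 * \<kappa> \<le> q"
    using rmin[OF datum_const[of 1]] rone by simp
  then show "2 * \<kappa> \<le> exp (c * (t - s))" by (simp add: q_def)
  have [measurable]: "F \<in> borel_measurable borel" "G \<in> borel_measurable borel"
    and Fp: "\<And>z. F (z + 2) = F z" and Gp: "\<And>z. G (z + 2) = G z"
    using F G by (auto simp: datum_def periodic2_def)
  \<comment> \<open>Only the disjoint parts F - min F G and G - min F G differ; they have
    equal mass.\<close>
  define m where "m z = min (F z) (G z)" for z
  define F' where "F' z = F z - m z" for z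
  define G' where "G' z = G z - m z" for z
  define d where "d z = \<bar>F z - G z\<bar>" for z
  have [measurable]: "m \<in> borel_measurable borel" unfolding m_def[abs_def] by measurable
  have [measurable]: "F' \<in> borel_measurable borel" "G' \<in> borel_measurable borel" "d \<in> borel_measurable borel"
    unfolding F'_def[abs_def] G'_def[abs_def] d_def[abs_def] by measurable
  have d_le: "\<bar>d z\<bar> \<le> \<bar>F z + G z\<bar> + 0" for z
    using F(2)[of z] G(2)[of z] by (simp add: d_def abs_if)
  have dm: "datum m" "datum F'" "datum G'" "datum d"
  proof -
    show "datum m" by (rule datum_abs_le[OF F(1), of _ 0]) (use F(2) G(2) in \<open>auto simp: m_def periodic2_def Fp Gp\<close>)
    show "datum F'" by (rule datum_abs_le[OF F(1), of _ 0]) (use F(2) G(2) in \<open>auto simp: F'_def m_def periodic2_def Fp Gp\<close>)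
    show "datum G'" by (rule datum_abs_le[OF G(1), of _ 0]) (use F(2) G(2) in \<open>auto simp: G'_def m_def periodic2_def Fp Gp\<close>)
    show "datum d" by (rule datum_abs_le[OF datum_add[OF F(1) G(1)], of _ 0]) (use d_le in \<open>auto simp: periodic2_def d_def Fp Gp\<close>)
  qed
  have nn: "0 \<le> m z" "0 \<le> F' z" "0 \<le> G' z" "0 \<le> d z" for z
    using F(2)[of z] G(2)[of z] by (auto simp: m_def F'_def G'_def d_def)
  have eqs: "F = (\<lambda>z. m z + F' z)" "G = (\<lambda>z. m z + G' z)" "d = (\<lambda>z. F' z + G' z)"
    by (auto simp: m_def F'_def G'_def d_def)
  have RF: "R F z = R m z + R F' z" "R G z = R m z + R G' z" "R d z = R F' z + R G' z" for z
    unfolding eqs using dm nn by (auto intro!: radd)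
  have NF: "N F = N m + N F'" "N G = N m + N G'" "N d = N F' + N G'"
    unfolding eqs using dm nn by (auto intro!: radd)
  have "N F = N G" using mass by (simp add: N_def)
  with NF have NFG: "N F' = N G'" "N d = 2 * N G'" by auto
  have key: "\<bar>R F z - R G z\<bar> \<le> R d z - \<kappa> * N d" for z
    using rmin[OF dm(2), of z] rmin[OF dm(3), of z] unfolding RF NFG by (auto simp: abs_le_iff)
  define dp where "dp z = d z powr p" for z
  have ddp: "datum dp"
  proof -
    have "per (\<lambda>z. ennreal \<bar>dp z\<bar>) < \<infinity>" using fin by (simp add: dp_def d_def)
    moreover have "dp \<in> borel_measurable borel" unfolding dp_def d_def by measurable
    ultimately show ?thesis by (auto simp: datum_def periodic2_def dp_def d_def Fp Gp)
  qed
  have dpnn: "0 \<le> dp z" for z by (simp add: dp_def)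
  \<comment> \<open>The operator R h z - \<kappa> N h is applied to Young's inequality d \<le>
    A1 d^p + B1. Its positivity on the nonnegative difference e of the two sides is the lower
    bound minor.\<close>
  have hoelder: "(R d z - \<kappa> * N d) powr p \<le> (q - 2 * \<kappa>) powr (p - 1) * (R dp z - \<kappa> * N dp)" for z
  proof (rule powr_le_of_affine_bounds)
    show "0 \<le> R d z - \<kappa> * N d" "0 \<le> R dp z - \<kappa> * N dp" "0 \<le> q - 2 * \<kappa>" "1 < p"
      using rmin[OF dm(4)] rmin[OF ddp] q2 \<open>1 < p\<close> by auto
    fix r :: real assume r: "0 < r"
    define A1 where "A1 = r powr (1 - p) / p"
    define B1 where "B1 = (1 - 1 / p) * r"
    have AB: "0 \<le> A1" "0 \<le> B1" using r \<open>1 < p\<close> by (auto simp: A1_def B1_def)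
    define u where "u z = A1 * dp z + B1 * 1" for z
    define e where "e z = u z - d z" for z
    have u: "datum u" unfolding u_def by (intro datum_add rcm(3) ddp datum_const AB)
    have e: "datum e" using datum_add[OF u datum_uminus[OF dm(4)]] by (simp add: e_def[abs_def])
    have enn: "0 \<le> e z" for z
      using le_powr_affine[OF nn(4) r \<open>1 < p\<close>, of z] by (simp add: e_def u_def A1_def B1_def dp_def)
    have "R (\<lambda>z. B1) z = B1 * q" "N (\<lambda>z. B1) = B1 * 2"
      using rcm(1,2)[OF datum_const[of 1] AB(2)] rone by auto
    then have "R u z = A1 * R dp z + B1 * q" "N u = A1 * N dp + B1 * 2"
      unfolding u_def using AB dpnn by (simp_all add: radd rcm ddp datum_const rone)
    moreover have "R u z = R d z + R e z" "N u = N d + N e"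
    proof -
      have "u = (\<lambda>z. d z + e z)" by (auto simp: e_def)
      then show "R u z = R d z + R e z" "N u = N d + N e"
        using radd[OF dm(4) e nn(4) enn] by auto
    qed
    moreover have "\<kappa> * N e \<le> R e z" by (rule rmin[OF e])
    moreover have "\<kappa> * N u = \<kappa> * N d + \<kappa> * N e" using \<open>N u = N d + N e\<close> by (simp add: distrib_left)
    moreover have "\<kappa> * N u = A1 * (\<kappa> * N dp) + B1 * (2 * \<kappa>)" using \<open>N u = A1 * N dp + B1 * 2\<close> by (simp add: algebra_simps)
    ultimately have "R d z - \<kappa> * N d \<le> A1 * (R dp z - \<kappa> * N dp) + B1 * (q - 2 * \<kappa>)"
      by (simp add: right_diff_distrib)
    then show "R d z - \<kappa> * N d \<le> r powr (1 - p) / p * (R dp z - \<kappa> * N dp) + (1 - 1 / p) * r * (q - 2 * \<kappa>)"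
      by (simp add: A1_def B1_def)
  qed
  note [measurable] = borel_pair_compose[OF evol_measurable[OF datum_ennreal(1)[OF ddp]]]
  have Rm [measurable]: "R dp \<in> borel_measurable borel"
    unfolding R_def S_def by measurable
  have mass_dp: "per (\<lambda>z. ennreal (R dp z - \<kappa> * N dp)) = ennreal ((q - 2 * \<kappa>) * N dp)"
  proof -
    have "per (\<lambda>z. ennreal (R dp z - \<kappa> * N dp)) + per (\<lambda>z. ennreal (\<kappa> * N dp)) =
        per (\<lambda>z. ennreal (R dp z - \<kappa> * N dp) + ennreal (\<kappa> * N dp))"
      by (intro per_add[symmetric]) auto
    also have "\<dots> = per (\<lambda>z. ennreal (R dp z))"
      using rmin[OF ddp] \<open>0 \<le> \<kappa>\<close> Nnn by (intro per_cong) (simp add: ennreal_plus[symmetric] del: ennreal_plus)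
    also have "\<dots> = per (evol s (\<lambda>z. ennreal (dp z)) t)"
      using SR[OF ddp] by (intro per_cong) (simp add: S_def)
    also have "\<dots> = ennreal q * ennreal (N dp)"
      unfolding q_def PN[OF ddp, symmetric] using datum_ennreal[OF ddp] \<open>s \<le> t\<close> by (intro per_evol) auto
    also have "\<dots> = ennreal ((q - 2 * \<kappa>) * N dp) + ennreal (2 * (\<kappa> * N dp))"
    proof -
      have "0 \<le> (q - 2 * \<kappa>) * N dp" "0 \<le> 2 * (\<kappa> * N dp)" using q2 Nnn \<open>0 \<le> \<kappa>\<close> by auto
      then have "ennreal ((q - 2 * \<kappa>) * N dp) + ennreal (2 * (\<kappa> * N dp)) =
          ennreal ((q - 2 * \<kappa>) * N dp + 2 * (\<kappa> * N dp))"
        by (rule ennreal_plus[symmetric])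
      also have "(q - 2 * \<kappa>) * N dp + 2 * (\<kappa> * N dp) = q * N dp" by (simp add: algebra_simps)
      finally show ?thesis using Nnn by (simp add: q_def ennreal_mult)
    qed
    also have "ennreal (2 * (\<kappa> * N dp)) = per (\<lambda>z. ennreal (\<kappa> * N dp))"
      using Nnn \<open>0 \<le> \<kappa>\<close> by (simp add: per_const ennreal_mult)
    finally have "per (\<lambda>z. ennreal (\<kappa> * N dp)) + per (\<lambda>z. ennreal (R dp z - \<kappa> * N dp)) =
        per (\<lambda>z. ennreal (\<kappa> * N dp)) + ennreal ((q - 2 * \<kappa>) * N dp)"
      by (simp only: add.commute)
    moreover have "per (\<lambda>z. ennreal (\<kappa> * N dp)) \<noteq> \<infinity>"
      by (simp add: per_const ennreal_mult_eq_top_iff)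
    ultimately show ?thesis by (simp only: ennreal_add_left_cancel simp_thms)
  qed
  have "per (\<lambda>z. ennreal (\<bar>R F z - R G z\<bar> powr p)) \<le>
      per (\<lambda>z. ennreal ((q - 2 * \<kappa>) powr (p - 1)) * ennreal (R dp z - \<kappa> * N dp))"
  proof (rule per_mono)
    fix z
    have "\<bar>R F z - R G z\<bar> powr p \<le> (R d z - \<kappa> * N d) powr p"
      using key[of z] \<open>1 < p\<close> by (intro powr_mono2) auto
    also note hoelder
    finally show "ennreal (\<bar>R F z - R G z\<bar> powr p) \<le> ennreal ((q - 2 * \<kappa>) powr (p - 1)) * ennreal (R dp z - \<kappa> * N dp)"
      using rmin[OF ddp, of z] by (simp add: ennreal_mult[symmetric] ennreal_leI)
  qed
  also have "\<dots> = ennreal ((q - 2 * \<kappa>) powr (p - 1)) * ennreal ((q - 2 * \<kappa>) * N dp)"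
    by (subst per_cmult) (auto simp: mass_dp)
  also have "\<dots> = ennreal ((q - 2 * \<kappa>) powr p) * ennreal (N dp)"
    using q2 Nnn[of dp] by (cases "q = 2 * \<kappa>") (auto simp: ennreal_mult[symmetric] powr_diff)
  also have "ennreal (N dp) = per (\<lambda>z. ennreal (\<bar>F z - G z\<bar> powr p))"
    using PN[OF ddp] by (simp add: dp_def d_def)
  finally show "per (\<lambda>z. ennreal (\<bar>enn2real (evol s (\<lambda>z. ennreal (F z)) t z) - enn2real (evol s (\<lambda>z. ennreal (G z)) t z)\<bar> powr p))
    \<le> ennreal ((exp (c * (t - s)) - 2 * \<kappa>) powr p) * per (\<lambda>z. ennreal (\<bar>F z - G z\<bar> powr p))"
    by (simp add: R_def S_def q_def)
qed

text \<open>
  Removing the factor \<open>exp (c t)\<close> from \<open>evol_diff_Lp\<close>, applied to the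
  evolutions up to time \<open>s\<close> of the positive and the negative part of
  \<open>f\<close>. They have equal mass, as \<open>f\<close> has mean zero.
\<close>

lemma flow_contract:
  assumes f: "datum f" and mass: "per (\<lambda>z. ennreal (f z)) = per (\<lambda>z. ennreal (- f z))"
    and "0 \<le> s" "s \<le> t" "1 < p" "0 \<le> \<kappa>"
    and minor: "\<And>h z. h \<in> borel_measurable borel \<Longrightarrow> periodic2 h \<Longrightarrow> ennreal \<kappa> * per h \<le> evol s h t z"
    and fin: "per (\<lambda>z. ennreal (\<bar>flow f s z\<bar> powr p)) < \<infinity>"
  shows "per (\<lambda>z. ennreal (\<bar>flow f t z\<bar> powr p))
    \<le> ennreal ((1 - 2 * \<kappa> * exp (- c * (t - s))) powr p) * per (\<lambda>z. ennreal (\<bar>flow f s z\<bar> powr p))"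
    and "2 * \<kappa> * exp (- c * (t - s)) \<le> 1"
proof -
  define F where "F z = enn2real (evol 0 (\<lambda>z. ennreal (f z)) s z)" for z
  define G where "G z = enn2real (evol 0 (\<lambda>z. ennreal (- f z)) s z)" for z
  note mf = datum_uminus[OF f]
  have Fe: "ennreal (F z) = evol 0 (\<lambda>z. ennreal (f z)) s z" "ennreal (G z) = evol 0 (\<lambda>z. ennreal (- f z)) s z" for z
    using evol_datum_finite[OF f, of 0 s z] evol_datum_finite[OF mf, of 0 s z] by (auto simp: F_def G_def)
  note [measurable] = borel_pair_compose[OF evol_measurable[OF datum_ennreal(1)[OF f]]]
    borel_pair_compose[OF evol_measurable[OF datum_ennreal(1)[OF mf]]]
  have nn: "0 \<le> F z" "0 \<le> G z" for z by (auto simp: F_def G_def)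
  have perF: "per (\<lambda>z. ennreal (F z)) = ennreal (exp (c * s)) * per (\<lambda>z. ennreal (f z))"
    "per (\<lambda>z. ennreal (G z)) = ennreal (exp (c * s)) * per (\<lambda>z. ennreal (- f z))"
    unfolding Fe using per_evol[OF datum_ennreal(1,2)[OF f] \<open>0 \<le> s\<close>] per_evol[OF datum_ennreal(1,2)[OF mf] \<open>0 \<le> s\<close>]
    by auto
  have dF: "datum F" "datum G"
    using evol_periodic[OF datum_ennreal(2)[OF f], of 0 s] evol_periodic[OF datum_ennreal(2)[OF mf], of 0 s]
      perF datum_per[OF f] datum_per[OF mf] nn
    by (auto simp: datum_def periodic2_def F_def[abs_def] G_def[abs_def] ennreal_mult_less_top)
  have flow_s: "F z - G z = exp (c * s) * flow f s z" for z
    using \<open>0 \<le> s\<close> by (simp add: flow_def pflow_def F_def G_def exp_minus field_simps)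
  have flow_t: "enn2real (evol s (\<lambda>z. ennreal (F z)) t z) - enn2real (evol s (\<lambda>z. ennreal (G z)) t z) = exp (c * t) * flow f t z" for z
  proof -
    have "evol s (\<lambda>z. ennreal (F z)) t z = evol 0 (\<lambda>z. ennreal (f z)) t z"
      "evol s (\<lambda>z. ennreal (G z)) t z = evol 0 (\<lambda>z. ennreal (- f z)) t z"
      unfolding Fe using assms(3,4) datum_ennreal(1)[OF f] datum_ennreal(1)[OF mf] by (auto intro!: evol_evol)
    then show ?thesis
      using assms(3,4) by (simp add: flow_def pflow_def exp_minus field_simps)
  qed
  have norm: "per (\<lambda>z. ennreal (\<bar>exp (c * r) * flow f r z\<bar> powr p)) = ennreal (exp (c * r) powr p) * per (\<lambda>z. ennreal (\<bar>flow f r z\<bar> powr p))" for r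
  proof -
    note [measurable] = borel_pair_compose[OF flow_measurable[OF f]]
    have "per (\<lambda>z. ennreal (\<bar>exp (c * r) * flow f r z\<bar> powr p)) = per (\<lambda>z. ennreal (exp (c * r) powr p) * ennreal (\<bar>flow f r z\<bar> powr p))"
      by (intro per_cong) (simp add: abs_mult powr_mult ennreal_mult)
    then show ?thesis by (simp add: per_cmult)
  qed
  have fin': "per (\<lambda>z. ennreal (\<bar>F z - G z\<bar> powr p)) < \<infinity>"
    unfolding flow_s norm using fin by (auto simp: ennreal_mult_less_top)
  note main = evol_diff_Lp[OF dF(1) nn(1) dF(2) nn(2) _ \<open>s \<le> t\<close> \<open>1 < p\<close> \<open>0 \<le> \<kappa>\<close> minor fin']
  have E: "exp (c * (t - s)) * exp (- c * (t - s)) = 1" by (simp add: exp_minus)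
  have "2 * \<kappa> \<le> exp (c * (t - s))" using main(2) perF mass by simp
  then have "2 * \<kappa> * exp (- c * (t - s)) \<le> exp (c * (t - s)) * exp (- c * (t - s))"
    by (intro mult_right_mono) auto
  then show le1: "2 * \<kappa> * exp (- c * (t - s)) \<le> 1" by (simp only: E)
  have "ennreal (exp (c * t) powr p) * per (\<lambda>z. ennreal (\<bar>flow f t z\<bar> powr p))
    \<le> ennreal ((exp (c * (t - s)) - 2 * \<kappa>) powr p) * (ennreal (exp (c * s) powr p) * per (\<lambda>z. ennreal (\<bar>flow f s z\<bar> powr p)))"
    using main(1) perF mass unfolding flow_t flow_s norm by simp
  then have "ennreal (exp (c * t) powr - p) * (ennreal (exp (c * t) powr p) * per (\<lambda>z. ennreal (\<bar>flow f t z\<bar> powr p)))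
    \<le> ennreal (exp (c * t) powr - p) * (ennreal ((exp (c * (t - s)) - 2 * \<kappa>) powr p) * (ennreal (exp (c * s) powr p) * per (\<lambda>z. ennreal (\<bar>flow f s z\<bar> powr p))))"
    by (rule mult_left_mono) simp
  moreover have "ennreal (exp (c * t) powr - p) * ennreal (exp (c * t) powr p) = 1"
    by (simp add: ennreal_mult[symmetric] powr_add[symmetric])
  moreover have "ennreal (exp (c * t) powr - p) * (ennreal ((exp (c * (t - s)) - 2 * \<kappa>) powr p) * ennreal (exp (c * s) powr p)) =
      ennreal ((1 - 2 * \<kappa> * exp (- c * (t - s))) powr p)"
  proof -
    have "exp (c * t) powr - p = exp (- c * t) powr p"
      by (simp add: exp_powr_real)
    then have "exp (c * t) powr - p * ((exp (c * (t - s)) - 2 * \<kappa>) powr p * exp (c * s) powr p) =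
        (exp (- c * t) * ((exp (c * (t - s)) - 2 * \<kappa>) * exp (c * s))) powr p"
      using \<open>2 * \<kappa> \<le> exp (c * (t - s))\<close> by (simp add: powr_mult)
    also have "exp (- c * t) * ((exp (c * (t - s)) - 2 * \<kappa>) * exp (c * s)) = 1 - 2 * \<kappa> * exp (- c * (t - s))"
    proof -
      have "exp (- c * t) * ((exp (c * (t - s)) - 2 * \<kappa>) * exp (c * s)) =
         exp (- c * t + c * (t - s) + c * s) - 2 * \<kappa> * exp (- c * t + c * s)"
        by (simp only: exp_add) (simp add: algebra_simps)
      also have "- c * t + c * (t - s) + c * s = 0" by (simp add: algebra_simps)
      also have "- c * t + c * s = - c * (t - s)" by (simp add: algebra_simps)
      finally show ?thesis by simp
    qed
    finally show ?thesis by (simp add: ennreal_mult[symmetric])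
  qed
  ultimately show "per (\<lambda>z. ennreal (\<bar>flow f t z\<bar> powr p))
    \<le> ennreal ((1 - 2 * \<kappa> * exp (- c * (t - s))) powr p) * per (\<lambda>z. ennreal (\<bar>flow f s z\<bar> powr p))"
    by (simp only: mult.assoc[symmetric] mult_1)
qed

text \<open>
  The flow contracts by a fixed factor in each interval of length \<open>T0\<close> and does not
  expand in the remaining time, which is \<open>flow_contract\<close> with \<open>\<kappa> =
  0\<close>.
\<close>

lemma flow_decay:
  assumes f: "datum f" and mass: "per (\<lambda>z. ennreal (f z)) = per (\<lambda>z. ennreal (- f z))"
    and "1 < p" "0 \<le> \<kappa>" "0 \<le> T0"
    and minor: "\<And>s h z. h \<in> borel_measurable borel \<Longrightarrow> periodic2 h \<Longrightarrow> ennreal \<kappa> * per h \<le> evol s h (s + T0) z"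
    and fin: "per (\<lambda>z. ennreal (\<bar>f z\<bar> powr p)) < \<infinity>"
    and "real n * T0 \<le> t"
  shows "per (\<lambda>z. ennreal (\<bar>flow f t z\<bar> powr p))
    \<le> ennreal (((1 - 2 * \<kappa> * exp (- c * T0)) powr p) ^ n) * per (\<lambda>z. ennreal (\<bar>f z\<bar> powr p))"
  using \<open>real n * T0 \<le> t\<close>
proof (induction n arbitrary: t)
  case 0
  have f0: "per (\<lambda>z. ennreal (\<bar>flow f 0 z\<bar> powr p)) = per (\<lambda>z. ennreal (\<bar>f z\<bar> powr p))"
    by (simp add: flow_start[OF f])
  show ?case
    using flow_contract(1)[OF f mass order_refl _ \<open>1 < p\<close>, of t 0] 0 fin f0 by simp
next
  case (Suc n)
  define s where "s = real n * T0"
  have s: "0 \<le> s" "s + T0 \<le> t" using Suc.prems \<open>0 \<le> T0\<close> by (auto simp: s_def algebra_simps)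
  have IH: "per (\<lambda>z. ennreal (\<bar>flow f s z\<bar> powr p))
    \<le> ennreal (((1 - 2 * \<kappa> * exp (- c * T0)) powr p) ^ n) * per (\<lambda>z. ennreal (\<bar>f z\<bar> powr p))"
    by (rule Suc.IH) (simp add: s_def)
  have fins: "per (\<lambda>z. ennreal (\<bar>flow f s z\<bar> powr p)) < \<infinity>"
    using fin by (intro order_le_less_trans[OF IH]) (auto simp: ennreal_mult_less_top)
  have step: "per (\<lambda>z. ennreal (\<bar>flow f (s + T0) z\<bar> powr p))
    \<le> ennreal ((1 - 2 * \<kappa> * exp (- c * T0)) powr p) * per (\<lambda>z. ennreal (\<bar>flow f s z\<bar> powr p))"
    using flow_contract(1)[OF f mass s(1) _ \<open>1 < p\<close> \<open>0 \<le> \<kappa>\<close> _ fins, of "s + T0"] minor \<open>0 \<le> T0\<close> by simp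
  have finT: "per (\<lambda>z. ennreal (\<bar>flow f (s + T0) z\<bar> powr p)) < \<infinity>"
    using fins by (intro order_le_less_trans[OF step]) (auto simp: ennreal_mult_less_top)
  have "per (\<lambda>z. ennreal (\<bar>flow f t z\<bar> powr p)) \<le> per (\<lambda>z. ennreal (\<bar>flow f (s + T0) z\<bar> powr p))"
    using flow_contract(1)[OF f mass _ s(2) \<open>1 < p\<close> order_refl _ finT] s \<open>0 \<le> T0\<close> by simp
  also note step
  also have "ennreal ((1 - 2 * \<kappa> * exp (- c * T0)) powr p) * per (\<lambda>z. ennreal (\<bar>flow f s z\<bar> powr p)) \<le>
     ennreal ((1 - 2 * \<kappa> * exp (- c * T0)) powr p) * (ennreal (((1 - 2 * \<kappa> * exp (- c * T0)) powr p) ^ n) * per (\<lambda>z. ennreal (\<bar>f z\<bar> powr p)))"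
    by (intro mult_left_mono IH) simp
  finally show ?case
    by (simp add: ennreal_mult mult.assoc)
qed

end

section \<open>Continuity of translations in \<open>L\<^sup>p\<close>\<close>

lemma tendsto_zero_ennrealI:
  fixes f :: "'a \<Rightarrow> ennreal"
  assumes "\<And>e::real. 0 < e \<Longrightarrow> \<forall>\<^sub>F x in F. f x \<le> ennreal e"
  shows "(f \<longlongrightarrow> 0) F"
proof (rule order_tendstoI)
  fix u :: ennreal assume "0 < u"
  then obtain v where v: "0 < v" "v < u" using dense by blast
  then obtain e where e: "v = ennreal e" "0 < e"
    by (cases v) (auto simp: top_unique less_top[symmetric])
  show "\<forall>\<^sub>F x in F. f x < u"
    using assms[OF e(2)] by eventually_elim (use v e in auto)
qed simp

text \<open>
  A quasi-triangle inequality for the \<open>p\<close>-th power of the norm, which suffices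
  where only convergence to zero matters.
\<close>

lemma powr_add_le:
  fixes x y p :: real
  assumes "1 \<le> p"
  shows "ennreal (\<bar>x + y\<bar> powr p) \<le> ennreal (2 powr p) * (ennreal (\<bar>x\<bar> powr p) + ennreal (\<bar>y\<bar> powr p))"
proof -
  have "\<bar>x + y\<bar> powr p \<le> (2 * max \<bar>x\<bar> \<bar>y\<bar>) powr p"
    using assms by (intro powr_mono2) auto
  also have "\<dots> = 2 powr p * (max \<bar>x\<bar> \<bar>y\<bar>) powr p"
    by (simp add: powr_mult)
  also have "\<dots> \<le> 2 powr p * (\<bar>x\<bar> powr p + \<bar>y\<bar> powr p)"
    by (intro mult_left_mono) (auto simp: max_def)
  finally show ?thesis by (simp add: ennreal_mult[symmetric] ennreal_plus[symmetric] ennreal_leI del: ennreal_plus)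
qed

definition locally_Lp :: "real \<Rightarrow> (real \<Rightarrow> real) \<Rightarrow> bool" where
  "locally_Lp p f \<longleftrightarrow> f \<in> borel_measurable borel \<and> (\<forall>a b. (\<integral>\<^sup>+x\<in>{a..b}. ennreal (\<bar>f x\<bar> powr p) \<partial>lborel) < \<infinity>)"

lemma Lp_dominated_convergence:
  fixes F :: "nat \<Rightarrow> real \<Rightarrow> real"
  assumes [measurable]: "\<And>n. F n \<in> borel_measurable borel" "f \<in> borel_measurable borel" "g \<in> borel_measurable borel" "A \<in> sets borel"
    and "1 \<le> p"
    and bound: "\<And>n x. x \<in> A \<Longrightarrow> \<bar>F n x\<bar> \<le> g x" "\<And>x. x \<in> A \<Longrightarrow> \<bar>f x\<bar> \<le> g x"
    and fin: "(\<integral>\<^sup>+x\<in>A. ennreal (\<bar>g x\<bar> powr p) \<partial>lborel) < \<infinity>"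
    and lim: "AE x in lborel. x \<in> A \<longrightarrow> (\<lambda>n. F n x) \<longlonglongrightarrow> f x"
  shows "(\<lambda>n. \<integral>\<^sup>+x\<in>A. ennreal (\<bar>F n x - f x\<bar> powr p) \<partial>lborel) \<longlonglongrightarrow> 0"
proof -
  have "(\<lambda>n. \<integral>\<^sup>+x. ennreal (\<bar>F n x - f x\<bar> powr p) * indicator A x \<partial>lborel) \<longlonglongrightarrow> (\<integral>\<^sup>+x. 0 \<partial>(lborel::real measure))"
  proof (rule nn_integral_dominated_convergence[where w = "\<lambda>x. ennreal (2 powr p) * (ennreal (\<bar>g x\<bar> powr p) * indicator A x)"])
    show "AE x in lborel. ennreal (\<bar>F n x - f x\<bar> powr p) * indicator A x \<le> ennreal (2 powr p) * (ennreal (\<bar>g x\<bar> powr p) * indicator A x)" for n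
    proof (rule AE_I2)
      fix x
      have "\<bar>F n x - f x\<bar> powr p \<le> (2 * \<bar>g x\<bar>) powr p" if "x \<in> A"
        using bound(1)[OF that, of n] bound(2)[OF that] \<open>1 \<le> p\<close> by (intro powr_mono2) auto
      then show "ennreal (\<bar>F n x - f x\<bar> powr p) * indicator A x \<le> ennreal (2 powr p) * (ennreal (\<bar>g x\<bar> powr p) * indicator A x)"
        by (auto simp: indicator_def powr_mult ennreal_mult[symmetric] intro!: ennreal_leI)
    qed
    show "(\<integral>\<^sup>+x. ennreal (2 powr p) * (ennreal (\<bar>g x\<bar> powr p) * indicator A x) \<partial>lborel) < \<infinity>"
      using fin by (simp add: nn_integral_cmult ennreal_mult_less_top)
    show "AE x in lborel. (\<lambda>n. ennreal (\<bar>F n x - f x\<bar> powr p) * indicator A x) \<longlonglongrightarrow> 0"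
      using lim
    proof eventually_elim
      case (elim x)
      show ?case
      proof (cases "x \<in> A")
        case True
        then have "(\<lambda>n. \<bar>F n x - f x\<bar>) \<longlonglongrightarrow> 0"
          using elim by (simp add: tendsto_rabs_zero_iff LIM_zero_iff)
        then have "(\<lambda>n. \<bar>F n x - f x\<bar> powr p) \<longlonglongrightarrow> 0"
          using \<open>1 \<le> p\<close> by (intro tendsto_zero_powrI[OF _ tendsto_const]) auto
        then have "(\<lambda>n. ennreal (\<bar>F n x - f x\<bar> powr p)) \<longlonglongrightarrow> ennreal 0"
          by (rule tendsto_ennrealI)
        then show ?thesis using True by simp
      qed simp
    qed
  qed auto
  then show ?thesis by simp
qed

text \<open>
  A measurable function is almost everywhere a limit of continuous functions. Clipping first the
  function and then the approximations at a common level makes dominated convergence available.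
\<close>

lemma Lp_continuous_approximation:
  assumes f: "locally_Lp p f" and "1 \<le> p" "0 < e"
  shows "\<exists>g. continuous_on UNIV g \<and> (\<integral>\<^sup>+x\<in>{a..b}. ennreal (\<bar>f x - g x\<bar> powr p) \<partial>lborel) \<le> ennreal e"
proof -
  have fm [measurable]: "f \<in> borel_measurable borel"
    and fin: "(\<integral>\<^sup>+x\<in>{a..b}. ennreal (\<bar>f x\<bar> powr p) \<partial>lborel) < \<infinity>"
    using f by (auto simp: locally_Lp_def)
  have "f \<in> borel_measurable lebesgue" using fm by (simp add: measurable_completion)
  then have "f measurable_on UNIV" by (rule lebesgue_measurable_imp_measurable_on_real) simp
  then obtain N G where N: "negligible N" and G: "\<And>n. continuous_on UNIV (G n)"
    "\<And>x. x \<notin> N \<Longrightarrow> (\<lambda>n. G n x) \<longlonglongrightarrow> f x"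
    unfolding measurable_on_def by auto
  have aeN: "AE x in lborel. x \<notin> N"
  proof -
    have "AE x in lebesgue. x \<notin> N"
      using N by (intro AE_not_in) (simp add: negligible_iff_null_sets)
    then show ?thesis by (simp only: AE_completion_iff)
  qed
  have [measurable]: "G n \<in> borel_measurable borel" for n
    using G(1) by (rule borel_measurable_continuous_onI)
  define clip where "clip m y = max (- real m) (min y (real m))" for m :: nat and y :: real
  have clip_meas [measurable]: "clip m \<in> borel_measurable borel" for m unfolding clip_def by measurable
  have clip_le: "\<bar>clip m y\<bar> \<le> \<bar>y\<bar>" "\<bar>clip m y\<bar> \<le> real m" for m y by (auto simp: clip_def)
  have clip_lim: "(\<lambda>m. clip m y) \<longlonglongrightarrow> y" for y
  proof (rule tendsto_eventually)
    obtain m0 where "\<bar>y\<bar> \<le> real m0" using real_arch_simple by blast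
    then show "\<forall>\<^sub>F m in sequentially. clip m y = y"
      by (auto simp: eventually_sequentially clip_def intro!: exI[of _ m0])
  qed
  define \<delta> where "\<delta> = e / (2 * 2 powr p)"
  have \<delta>: "0 < \<delta>" using \<open>0 < e\<close> by (simp add: \<delta>_def)
  have "(\<lambda>m. \<integral>\<^sup>+x\<in>{a..b}. ennreal (\<bar>clip m (f x) - f x\<bar> powr p) \<partial>lborel) \<longlonglongrightarrow> 0"
    by (rule Lp_dominated_convergence[where g = "\<lambda>x. \<bar>f x\<bar>"]) (use fin \<open>1 \<le> p\<close> in \<open>auto simp: clip_le clip_lim\<close>)
  then have "\<forall>\<^sub>F m in sequentially. (\<integral>\<^sup>+x\<in>{a..b}. ennreal (\<bar>clip m (f x) - f x\<bar> powr p) \<partial>lborel) < ennreal \<delta>"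
    by (rule order_tendstoD) (use \<delta> in simp)
  then obtain m where m: "(\<integral>\<^sup>+x\<in>{a..b}. ennreal (\<bar>clip m (f x) - f x\<bar> powr p) \<partial>lborel) < ennreal \<delta>"
    by (auto dest: eventually_happens)
  have "(\<lambda>n. \<integral>\<^sup>+x\<in>{a..b}. ennreal (\<bar>clip m (G n x) - clip m (f x)\<bar> powr p) \<partial>lborel) \<longlonglongrightarrow> 0"
  proof (rule Lp_dominated_convergence[where g = "\<lambda>x. real m"])
    show "AE x in lborel. x \<in> {a..b} \<longrightarrow> (\<lambda>n. clip m (G n x)) \<longlonglongrightarrow> clip m (f x)"
      using aeN by eventually_elim (auto simp: clip_def intro!: tendsto_intros G(2))
    show "(\<integral>\<^sup>+x\<in>{a..b}. ennreal (\<bar>real m\<bar> powr p) \<partial>lborel) < \<infinity>"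
      by (subst nn_integral_cmult_indicator) (auto simp: ennreal_mult_less_top emeasure_lborel_Icc_eq)
  qed (use \<open>1 \<le> p\<close> in \<open>auto simp: clip_le\<close>)
  then have "\<forall>\<^sub>F n in sequentially. (\<integral>\<^sup>+x\<in>{a..b}. ennreal (\<bar>clip m (G n x) - clip m (f x)\<bar> powr p) \<partial>lborel) < ennreal \<delta>"
    by (rule order_tendstoD) (use \<delta> in simp)
  then obtain n where n: "(\<integral>\<^sup>+x\<in>{a..b}. ennreal (\<bar>clip m (G n x) - clip m (f x)\<bar> powr p) \<partial>lborel) < ennreal \<delta>"
    by (auto dest: eventually_happens)
  define g where "g x = clip m (G n x)" for x
  have "(\<integral>\<^sup>+x\<in>{a..b}. ennreal (\<bar>f x - g x\<bar> powr p) \<partial>lborel) \<le>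
      (\<integral>\<^sup>+x. ennreal (2 powr p) * (ennreal (\<bar>clip m (f x) - f x\<bar> powr p) * indicator {a..b} x +
        ennreal (\<bar>clip m (G n x) - clip m (f x)\<bar> powr p) * indicator {a..b} x) \<partial>lborel)"
  proof (rule nn_integral_mono)
    fix x
    show "ennreal (\<bar>f x - g x\<bar> powr p) * indicator {a..b} x \<le> ennreal (2 powr p) * (ennreal (\<bar>clip m (f x) - f x\<bar> powr p) * indicator {a..b} x +
        ennreal (\<bar>clip m (G n x) - clip m (f x)\<bar> powr p) * indicator {a..b} x)"
      using powr_add_le[OF \<open>1 \<le> p\<close>, of "clip m (f x) - f x" "clip m (G n x) - clip m (f x)"]
      by (auto simp: g_def indicator_def abs_minus_commute)
  qed
  also have "\<dots> = ennreal (2 powr p) * ((\<integral>\<^sup>+x\<in>{a..b}. ennreal (\<bar>clip m (f x) - f x\<bar> powr p) \<partial>lborel) +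
      (\<integral>\<^sup>+x\<in>{a..b}. ennreal (\<bar>clip m (G n x) - clip m (f x)\<bar> powr p) \<partial>lborel))"
    by (simp add: nn_integral_cmult nn_integral_add)
  also have "\<dots> \<le> ennreal (2 powr p) * (ennreal \<delta> + ennreal \<delta>)"
    using m n by (intro mult_left_mono add_mono) auto
  also have "\<dots> = ennreal e"
    using \<delta> by (simp add: ennreal_mult[symmetric] ennreal_plus[symmetric] \<delta>_def field_simps del: ennreal_plus)
  finally have "(\<integral>\<^sup>+x\<in>{a..b}. ennreal (\<bar>f x - g x\<bar> powr p) \<partial>lborel) \<le> ennreal e" .
  moreover have "continuous_on UNIV g"
    unfolding g_def clip_def by (intro continuous_intros G(1))
  ultimately show ?thesis by blast
qed

lemma nn_integral_Icc_shift:
  fixes f :: "real \<Rightarrow> ennreal"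
  assumes [measurable]: "f \<in> borel_measurable borel"
  shows "(\<integral>\<^sup>+z\<in>{a..b}. f (z + h) \<partial>lborel) = (\<integral>\<^sup>+z\<in>{a + h..b + h}. f z \<partial>lborel)"
  by (subst nn_integral_real_affine[of "\<lambda>z. f z * indicator {a + h..b + h} z" 1 h])
     (auto intro!: nn_integral_cong simp: indicator_def add.commute)

text \<open>
  This holds for continuous functions by uniform continuity on a compact interval, and the
  \<open>p\<close>-th power integral of the error of a continuous approximation is invariant
  under translation.
\<close>

lemma Lp_translation_continuous:
  assumes f: "locally_Lp p f" and "1 \<le> p"
  shows "((\<lambda>h. \<integral>\<^sup>+x\<in>{a..b}. ennreal (\<bar>f (x + h) - f x\<bar> powr p) \<partial>lborel) \<longlongrightarrow> 0) (at 0)"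
proof (rule tendsto_zero_ennrealI)
  fix e :: real assume "0 < e"
  have fm [measurable]: "f \<in> borel_measurable borel" using f by (auto simp: locally_Lp_def)
  define C where "C = (2::real) powr p"
  have C: "0 < C" by (simp add: C_def)
  define L where "L = max 1 (b - a)"
  \<comment> \<open>With d as the error of the approximation and of the oscillation of g, the
    two applications of the quasi-triangle inequality add up to e.\<close>
  define d where "d = e / (C * (1 + C * (1 + L)))"
  have L: "1 \<le> L" "b - a \<le> L" by (auto simp: L_def)
  then have pos: "0 < 1 + C * (1 + L)" using C by (simp add: add_pos_pos)
  have d: "0 < d" using \<open>0 < e\<close> C pos by (simp add: d_def)
  obtain g where g: "continuous_on UNIV g"
    and fg: "(\<integral>\<^sup>+x\<in>{a-1..b+1}. ennreal (\<bar>f x - g x\<bar> powr p) \<partial>lborel) \<le> ennreal d"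
    using Lp_continuous_approximation[OF f \<open>1 \<le> p\<close> d] by blast
  have gm [measurable]: "g \<in> borel_measurable borel" using g by (rule borel_measurable_continuous_onI)
  have "uniformly_continuous_on {a-1..b+1} g"
    using g by (intro compact_uniformly_continuous) (auto intro: continuous_on_subset)
  then obtain \<delta> where \<delta>: "0 < \<delta>" "\<And>x y. x \<in> {a-1..b+1} \<Longrightarrow> y \<in> {a-1..b+1} \<Longrightarrow> dist y x < \<delta> \<Longrightarrow> dist (g y) (g x) < d powr (1 / p)"
    unfolding uniformly_continuous_on_def using d by (metis powr_gt_zero less_irrefl)
  have main: "(\<integral>\<^sup>+x\<in>{a..b}. ennreal (\<bar>f (x + h) - f x\<bar> powr p) \<partial>lborel) \<le> ennreal e"
    if h: "\<bar>h\<bar> < min 1 \<delta>" for h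
  proof -
    define I1 where "I1 = (\<integral>\<^sup>+x\<in>{a..b}. ennreal (\<bar>f (x + h) - g (x + h)\<bar> powr p) \<partial>lborel)"
    define I2 where "I2 = (\<integral>\<^sup>+x\<in>{a..b}. ennreal (\<bar>g (x + h) - g x\<bar> powr p) \<partial>lborel)"
    define I3 where "I3 = (\<integral>\<^sup>+x\<in>{a..b}. ennreal (\<bar>g x - f x\<bar> powr p) \<partial>lborel)"
    have "I1 = (\<integral>\<^sup>+x\<in>{a + h..b + h}. ennreal (\<bar>f x - g x\<bar> powr p) \<partial>lborel)"
      unfolding I1_def by (rule nn_integral_Icc_shift[of "\<lambda>x. ennreal (\<bar>f x - g x\<bar> powr p)"]) measurable
    also have "\<dots> \<le> (\<integral>\<^sup>+x\<in>{a-1..b+1}. ennreal (\<bar>f x - g x\<bar> powr p) \<partial>lborel)"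
      using h by (intro nn_integral_mono) (auto simp: indicator_def)
    finally have I1: "I1 \<le> ennreal d" using fg by simp
    have "I3 \<le> (\<integral>\<^sup>+x\<in>{a-1..b+1}. ennreal (\<bar>f x - g x\<bar> powr p) \<partial>lborel)"
      unfolding I3_def by (intro nn_integral_mono) (auto simp: indicator_def abs_minus_commute)
    then have I3: "I3 \<le> ennreal d" using fg by simp
    have "I2 \<le> (\<integral>\<^sup>+x\<in>{a..b}. ennreal d \<partial>lborel)"
      unfolding I2_def
    proof (rule nn_integral_mono)
      fix x
      have "\<bar>g (x + h) - g x\<bar> powr p \<le> d" if "x \<in> {a..b}"
      proof -
        have "\<bar>g (x + h) - g x\<bar> < d powr (1 / p)"
        proof -
          have "x \<in> {a-1..b+1}" "x + h \<in> {a-1..b+1}" using that h by (auto simp: abs_less_iff)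
          then show ?thesis using \<delta>(2)[of x "x + h"] h by (simp add: dist_real_def)
        qed
        then have "\<bar>g (x + h) - g x\<bar> powr p \<le> (d powr (1 / p)) powr p"
          using \<open>1 \<le> p\<close> by (intro powr_mono2) auto
        then show ?thesis using \<open>1 \<le> p\<close> d by (simp add: powr_powr)
      qed
      then show "ennreal (\<bar>g (x + h) - g x\<bar> powr p) * indicator {a..b} x \<le> ennreal d * indicator {a..b} x"
        by (auto simp: indicator_def intro!: ennreal_leI)
    qed
    also have "\<dots> = ennreal d * emeasure lborel {a..b}"
      by (subst nn_integral_cmult_indicator) auto
    also have "\<dots> \<le> ennreal d * ennreal L"
      using L by (intro mult_left_mono) (auto simp: emeasure_lborel_Icc_eq intro!: ennreal_leI)
    finally have I2: "I2 \<le> ennreal (d * L)" using d L by (simp add: ennreal_mult)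
    have "(\<integral>\<^sup>+x\<in>{a..b}. ennreal (\<bar>f (x + h) - f x\<bar> powr p) \<partial>lborel) \<le>
        (\<integral>\<^sup>+x. ennreal C * (ennreal (\<bar>f (x + h) - g (x + h)\<bar> powr p) * indicator {a..b} x +
          ennreal C * (ennreal (\<bar>g (x + h) - g x\<bar> powr p) * indicator {a..b} x + ennreal (\<bar>g x - f x\<bar> powr p) * indicator {a..b} x)) \<partial>lborel)"
    proof (rule nn_integral_mono)
      fix x
      have "ennreal (\<bar>f (x + h) - f x\<bar> powr p) \<le> ennreal C * (ennreal (\<bar>f (x + h) - g (x + h)\<bar> powr p) + ennreal (\<bar>(g (x + h) - g x) + (g x - f x)\<bar> powr p))"
        unfolding C_def using powr_add_le[OF \<open>1 \<le> p\<close>, of "f (x + h) - g (x + h)" "(g (x + h) - g x) + (g x - f x)"] by simp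
      also have "\<dots> \<le> ennreal C * (ennreal (\<bar>f (x + h) - g (x + h)\<bar> powr p) + ennreal C * (ennreal (\<bar>g (x + h) - g x\<bar> powr p) + ennreal (\<bar>g x - f x\<bar> powr p)))"
        unfolding C_def by (intro mult_left_mono add_left_mono powr_add_le \<open>1 \<le> p\<close>) auto
      finally show "ennreal (\<bar>f (x + h) - f x\<bar> powr p) * indicator {a..b} x \<le>
         ennreal C * (ennreal (\<bar>f (x + h) - g (x + h)\<bar> powr p) * indicator {a..b} x +
          ennreal C * (ennreal (\<bar>g (x + h) - g x\<bar> powr p) * indicator {a..b} x + ennreal (\<bar>g x - f x\<bar> powr p) * indicator {a..b} x))"
        by (auto simp: indicator_def)
    qed
    also have "\<dots> = ennreal C * (I1 + ennreal C * (I2 + I3))"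
      unfolding I1_def I2_def I3_def by (simp add: nn_integral_cmult nn_integral_add)
    also have "\<dots> \<le> ennreal C * (ennreal d + ennreal C * (ennreal (d * L) + ennreal d))"
      by (intro mult_left_mono add_mono I1 I2 I3) auto
    also have "\<dots> = ennreal (C * (d + C * (d * L + d)))"
      using C d L by (simp add: ennreal_mult[symmetric] ennreal_plus[symmetric] del: ennreal_plus)
    also have "C * (d + C * (d * L + d)) = d * (C * (1 + C * (1 + L)))"
      by (simp add: algebra_simps)
    also have "\<dots> = e"
      unfolding d_def using C pos by simp
    finally show ?thesis .
  qed
  show "\<forall>\<^sub>F h in at 0. (\<integral>\<^sup>+x\<in>{a..b}. ennreal (\<bar>f (x + h) - f x\<bar> powr p) \<partial>lborel) \<le> ennreal e"
    unfolding eventually_at using \<delta>(1) main by (intro exI[of _ "min 1 \<delta>"]) (auto simp: dist_real_def)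
qed

section \<open>Null sets and characteristics\<close>

text \<open>
  A null set of characteristics fills a null set of the \<open>(t,x)\<close>-plane, because each
  of its sections at a fixed time is a translate.
\<close>

lemma AE_lborel_pair_shear:
  assumes "AE q in lborel. P (q :: real)"
  shows "AE (t, x) in (lborel :: (real \<times> real) measure). P (x + \<sigma> * t)"
proof -
  obtain N where N: "N \<in> null_sets lborel" "{q. \<not> P q} \<subseteq> N"
    using assms by (auto simp: eventually_ae_filter)
  have [measurable]: "N \<in> sets borel" using N by auto
  have N0: "AE q in lborel. q \<notin> N" using N(1) by (rule AE_not_in)
  have "AE (t, x) in lborel \<Otimes>\<^sub>M lborel. x + \<sigma> * t \<notin> N"
  proof (rule lborel_pair.AE_pair_measure)
    show "AE t in lborel. AE x in lborel. case (t, x) of (t, x) \<Rightarrow> x + \<sigma> * t \<notin> N"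
    proof (rule AE_I2)
      fix t
      have "AE x in lborel. \<sigma> * t + 1 * x \<notin> N"
        by (rule AE_borel_affine[OF _ _ N0]) auto
      then show "AE x in lborel. case (t, x) of (t, x) \<Rightarrow> x + \<sigma> * t \<notin> N" by (simp add: add.commute)
    qed
  qed measurable
  then show ?thesis unfolding lborel_prod using N(2) by (auto elim!: eventually_mono)
qed

text \<open>
  Conversely, by Fubini after a shear, a property that holds almost everywhere in the plane
  holds almost everywhere along almost all characteristics of slope \<open>\<sigma>\<close>.
  This makes sense of integrals of a coefficient that is only given up to null sets.
\<close>

lemma AE_lborel_pair_characteristics:
  assumes "AE (s, x) in (lborel :: (real \<times> real) measure). P s (x :: real)"
  shows "AE q in lborel. AE s in lborel. P s (q + \<sigma> * s)"
proof -
  obtain N where N: "N \<in> null_sets (lborel :: (real \<times> real) measure)" "{z. \<not> (case z of (s, x) \<Rightarrow> P s x)} \<subseteq> N"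
    using assms by (auto simp: eventually_ae_filter)
  have "N \<in> sets borel" using null_setsD2[OF N(1)] by simp
  then have [measurable]: "N \<in> sets (borel \<Otimes>\<^sub>M borel)" by (simp only: borel_prod)
  have "AE z in lborel \<Otimes>\<^sub>M lborel. z \<notin> N"
    unfolding lborel_prod using N(1) by (rule AE_not_in)
  then have "AE s in lborel. AE x in lborel. (s, x) \<notin> N"
    by (rule lborel_pair.AE_pair)
  then have "AE s in lborel. AE q in lborel. (s, q + \<sigma> * s) \<notin> N"
  proof eventually_elim
    case (elim s)
    have "AE q in lborel. (s, \<sigma> * s + 1 * q) \<notin> N"
      by (rule AE_borel_affine[OF _ _ elim]) auto
    then show ?case by (simp add: add.commute)
  qed
  moreover have "{x \<in> space (lborel \<Otimes>\<^sub>M lborel). (snd x, fst x + \<sigma> * snd x) \<notin> N} \<in> sets (lborel \<Otimes>\<^sub>M lborel)"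
    by measurable
  ultimately have "AE q in lborel. AE s in lborel. (s, q + \<sigma> * s) \<notin> N"
    using lborel_pair.AE_commute[of "\<lambda>q s. (s, q + \<sigma> * s) \<notin> N"] by simp
  then show ?thesis
    using N(2) by (auto elim!: eventually_mono)
qed

lemma AE_lebesgue_on_iff:
  fixes A :: "'a::euclidean_space set"
  assumes "A \<in> sets borel"
  shows "(AE x in lebesgue_on A. P x) \<longleftrightarrow> (AE x in lborel. x \<in> A \<longrightarrow> P x)"
  using assms by (subst AE_restrict_space_iff) (auto simp: AE_completion_iff)

lemma borel_measurable_lebesgue_on:
  fixes f :: "'a::euclidean_space \<Rightarrow> 'b::topological_space"
  assumes "f \<in> borel_measurable borel"
  shows "f \<in> borel_measurable (lebesgue_on A)"
  using assms by (intro measurable_restrict_space1 measurable_completion) simp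

lemma borel_measurable_lebesgue_AE:
  fixes f g :: "'a::euclidean_space \<Rightarrow> real"
  assumes g: "g \<in> borel_measurable borel" and "AE x in lborel. x \<in> A \<longrightarrow> f x = g x" and A: "A \<in> sets borel"
  shows "(\<lambda>x. indicator A x * f x) \<in> borel_measurable lebesgue"
proof (rule borel_measurable_AE)
  show "(\<lambda>x. indicator A x * g x) \<in> borel_measurable lebesgue"
    using g A by (intro measurable_completion) auto
  show "AE x in lebesgue. indicator A x * g x = indicator A x * f x"
    using assms(2) unfolding AE_completion_iff by eventually_elim (auto simp: indicator_def)
qed

lemma LINT_lebesgue_on_cong:
  fixes f g :: "'a::euclidean_space \<Rightarrow> real"
  assumes g: "g \<in> borel_measurable borel" and ae: "AE x in lborel. x \<in> A \<longrightarrow> f x = g x" and A: "A \<in> sets borel"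
  shows "(LINT x|lebesgue_on A. f x) = (LINT x:A|lborel. g x)"
proof -
  have "(LINT x|lebesgue_on A. f x) = (LINT x|lebesgue. indicator A x * f x)"
    using A by (subst integral_restrict_space) auto
  also have "\<dots> = (LINT x|lebesgue. indicator A x * g x)"
  proof (rule integral_cong_AE)
    show "(\<lambda>x. indicator A x * f x) \<in> borel_measurable lebesgue" by (rule borel_measurable_lebesgue_AE[OF g ae A])
    show "(\<lambda>x. indicator A x * g x) \<in> borel_measurable lebesgue" using g A by (intro measurable_completion) auto
    show "AE x in lebesgue. indicator A x * f x = indicator A x * g x"
      using ae unfolding AE_completion_iff by eventually_elim (auto simp: indicator_def)
  qed
  also have "\<dots> = (LINT x|lborel. indicator A x * g x)"
    using g A by (subst integral_completion) auto
  finally show ?thesis by (simp add: set_lebesgue_integral_def)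
qed

lemma locally_Lp_mono:
  assumes f: "locally_Lp p f" and [measurable]: "g \<in> borel_measurable borel"
    and "0 \<le> p" "\<And>x. \<bar>g x\<bar> \<le> \<bar>f x\<bar>"
  shows "locally_Lp p g"
  unfolding locally_Lp_def
proof (intro conjI allI)
  fix a b
  have "(\<integral>\<^sup>+x\<in>{a..b}. ennreal (\<bar>g x\<bar> powr p) \<partial>lborel) \<le> (\<integral>\<^sup>+x\<in>{a..b}. ennreal (\<bar>f x\<bar> powr p) \<partial>lborel)"
    using assms(3,4) by (intro nn_integral_mono mult_right_mono ennreal_leI powr_mono2) auto
  also have "\<dots> < \<infinity>" using f by (auto simp: locally_Lp_def)
  finally show "(\<integral>\<^sup>+x\<in>{a..b}. ennreal (\<bar>g x\<bar> powr p) \<partial>lborel) < \<infinity>" .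
qed simp

lemma locally_Lp_affine:
  assumes f: "locally_Lp p f" and "1 \<le> p"
  shows "locally_Lp p (\<lambda>x. K * (\<bar>f x\<bar> + M))"
  unfolding locally_Lp_def
proof (intro conjI allI)
  have [measurable]: "f \<in> borel_measurable borel" using f by (auto simp: locally_Lp_def)
  show "(\<lambda>x. K * (\<bar>f x\<bar> + M)) \<in> borel_measurable borel" by measurable
  fix a b :: real
  have fin: "(\<integral>\<^sup>+x\<in>{a..b}. ennreal (\<bar>f x\<bar> powr p) \<partial>lborel) < \<infinity>" using f by (auto simp: locally_Lp_def)
  have "(\<integral>\<^sup>+x\<in>{a..b}. ennreal (\<bar>K * (\<bar>f x\<bar> + M)\<bar> powr p) \<partial>lborel) \<le>
    (\<integral>\<^sup>+x. ennreal (\<bar>K\<bar> powr p) * (ennreal (2 powr p) * (ennreal (\<bar>f x\<bar> powr p) * indicator {a..b} x + ennreal (\<bar>M\<bar> powr p) * indicator {a..b} x)) \<partial>lborel)"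
  proof (rule nn_integral_mono)
    fix x
    have "ennreal (\<bar>K * (\<bar>f x\<bar> + M)\<bar> powr p) = ennreal (\<bar>K\<bar> powr p) * ennreal (\<bar>\<bar>f x\<bar> + M\<bar> powr p)"
      by (simp add: abs_mult powr_mult ennreal_mult)
    also have "\<dots> \<le> ennreal (\<bar>K\<bar> powr p) * (ennreal (2 powr p) * (ennreal (\<bar>f x\<bar> powr p) + ennreal (\<bar>M\<bar> powr p)))"
      using powr_add_le[OF \<open>1 \<le> p\<close>, of "\<bar>f x\<bar>" M] by (intro mult_left_mono) auto
    finally show "ennreal (\<bar>K * (\<bar>f x\<bar> + M)\<bar> powr p) * indicator {a..b} x \<le>
      ennreal (\<bar>K\<bar> powr p) * (ennreal (2 powr p) * (ennreal (\<bar>f x\<bar> powr p) * indicator {a..b} x + ennreal (\<bar>M\<bar> powr p) * indicator {a..b} x))"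
      by (auto simp: indicator_def)
  qed
  also have "\<dots> = ennreal (\<bar>K\<bar> powr p) * (ennreal (2 powr p) * ((\<integral>\<^sup>+x\<in>{a..b}. ennreal (\<bar>f x\<bar> powr p) \<partial>lborel) + (\<integral>\<^sup>+x\<in>{a..b}. ennreal (\<bar>M\<bar> powr p) \<partial>lborel)))"
    by (simp add: nn_integral_cmult nn_integral_add)
  also have "\<dots> < \<infinity>"
    using fin by (simp add: ennreal_mult_less_top nn_integral_cmult_indicator emeasure_lborel_Icc_eq)
  finally show "(\<integral>\<^sup>+x\<in>{a..b}. ennreal (\<bar>K * (\<bar>f x\<bar> + M)\<bar> powr p) \<partial>lborel) < \<infinity>" .
qed

lemma periodic2_integral:
  assumes f: "f \<in> borel_measurable borel" "periodic2 f"
  shows "(\<integral>\<^sup>+x\<in>{a..<a + 2 * real n}. f x \<partial>lborel) = of_nat n * per f"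
proof (induction n)
  case (Suc n)
  define b where "b = a + 2 * real n"
  have "(\<integral>\<^sup>+x\<in>{a..<a + 2 * real (Suc n)}. f x \<partial>lborel) =
     (\<integral>\<^sup>+x\<in>{a..<b}. f x \<partial>lborel) + (\<integral>\<^sup>+x\<in>{b..<a + 2 * real (Suc n)}. f x \<partial>lborel)"
    by (rule nn_integral_interval_split) (use f in \<open>auto simp: b_def\<close>)
  also have "a + 2 * real (Suc n) = b + 2" by (simp add: b_def)
  also have "(\<integral>\<^sup>+x\<in>{b..<b + 2}. f x \<partial>lborel) = per f" by (rule per_interval[OF f])
  also have "(\<integral>\<^sup>+x\<in>{a..<b}. f x \<partial>lborel) = of_nat n * per f" unfolding b_def by (rule Suc)
  finally show ?case by (simp add: b_def algebra_simps)
qed simp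

lemma periodic2_integral_finite:
  assumes f: "f \<in> borel_measurable borel" "periodic2 f" "per f < \<infinity>"
  shows "(\<integral>\<^sup>+x\<in>{a..b}. f x \<partial>lborel) < \<infinity>"
proof -
  define n where "n = Suc (nat \<lceil>b - a\<rceil>)"
  have "b < a + 2 * real n" unfolding n_def using real_nat_ceiling_ge[of "b - a"] by simp
  then have "(\<integral>\<^sup>+x\<in>{a..b}. f x \<partial>lborel) \<le> (\<integral>\<^sup>+x\<in>{a..<a + 2 * real n}. f x \<partial>lborel)"
    by (intro nn_integral_mono) (auto simp: indicator_def)
  also have "\<dots> = of_nat n * per f" by (rule periodic2_integral[OF f(1,2)])
  also have "\<dots> < \<infinity>" using f(3) by (simp add: ennreal_mult_less_top of_nat_less_top)
  finally show ?thesis .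
qed

section \<open>The wave on the circle\<close>

definition Lp_datum :: "real \<Rightarrow> (real \<Rightarrow> real) \<Rightarrow> bool" where
  "Lp_datum p f \<longleftrightarrow> datum f \<and> per (\<lambda>z. ennreal (\<bar>f z\<bar> powr p)) < \<infinity>"

lemma Lp_datum_locally:
  assumes "Lp_datum p f"
  shows "locally_Lp p f"
  using assms periodic2_integral_finite[of "\<lambda>z. ennreal (\<bar>f z\<bar> powr p)"]
  by (auto simp: Lp_datum_def datum_def periodic2_def locally_Lp_def)

lemma LINT_Ioo_eq_Icc:
  fixes g :: "real \<Rightarrow> real"
  assumes [measurable]: "g \<in> borel_measurable borel" and "AE s in lborel. \<tau> < s \<and> s < t \<longrightarrow> S s = g s"
  shows "(LINT s|lebesgue_on {\<tau><..<t}. S s) = (LINT s:{\<tau>..t}|lborel. g s)"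
proof -
  have "(LINT s|lebesgue_on {\<tau><..<t}. S s) = (LINT s:{\<tau><..<t}|lborel. g s)"
    by (rule LINT_lebesgue_on_cong) (use assms in auto)
  also have "\<dots> = (LINT s:{\<tau>..t}|lborel. g s)"
    unfolding set_lebesgue_integral_def
  proof (rule integral_cong_AE)
    show "AE s in lborel. indicator {\<tau><..<t} s *\<^sub>R g s = indicator {\<tau>..t} s *\<^sub>R g s"
      using AE_lborel_singleton[of \<tau>] AE_lborel_singleton[of t] by eventually_elim (auto simp: indicator_def)
  qed auto
  finally show ?thesis .
qed

lemma LINT_Icc_split:
  fixes g :: "real \<Rightarrow> real"
  assumes int: "set_integrable lborel {0..t} g" and "0 \<le> \<tau>" "\<tau> \<le> t"
  shows "(LINT r:{0..t}|lborel. g r) = (LINT r:{0..\<tau>}|lborel. g r) + (LINT r:{\<tau>..t}|lborel. g r)"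
proof -
  have int2: "set_integrable lborel {\<tau>..t} g" "set_integrable lborel {0..\<tau>} g"
    by (rule set_integrable_subset[OF int]; use assms in auto)+
  have "integral {0..\<tau>} g + integral {\<tau>..t} g = integral {0..t} g"
    by (rule Henstock_Kurzweil_Integration.integral_combine)
       (use assms set_borel_integral_eq_integral(1)[OF int] in auto)
  then show ?thesis
    by (simp add: set_borel_integral_eq_integral(2)[OF int] set_borel_integral_eq_integral(2)[OF int2(1)] set_borel_integral_eq_integral(2)[OF int2(2)])
qed

lemma nn_integral_Icc_reflect:
  fixes g :: "real \<Rightarrow> ennreal"
  assumes [measurable]: "g \<in> borel_measurable borel"
  shows "(\<integral>\<^sup>+t\<in>{a..b}. g (q - t) \<partial>lborel) = (\<integral>\<^sup>+z\<in>{q - b..q - a}. g z \<partial>lborel)"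
  by (subst nn_integral_real_affine[of "\<lambda>z. g z * indicator {q - b..q - a} z" "-1" q])
     (auto intro!: nn_integral_cong simp: indicator_def)

context exchange
begin

definition jump :: "(real \<Rightarrow> real \<Rightarrow> real) \<Rightarrow> real \<Rightarrow> real \<Rightarrow> real" where
  "jump w r z = k r z * (w r (- z - 2 * r) - w r z)"

lemma jump_measurable:
  assumes "case_prod w \<in> borel_measurable (borel \<Otimes>\<^sub>M borel)"
  shows "case_prod (jump w) \<in> borel_measurable (borel \<Otimes>\<^sub>M borel)"
proof -
  note [measurable] = borel_pair_compose[OF assms]
  show ?thesis unfolding jump_def by measurable
qed

lemma flow_increment:
  assumes "datum f" "0 \<le> \<tau>" "\<tau> \<le> t"
  shows "set_integrable lborel {\<tau>..t} (\<lambda>r. jump (flow f) r z)"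
    and "flow f t z = flow f \<tau> z + (LINT r:{\<tau>..t}|lborel. jump (flow f) r z)"
proof -
  note I = flow_eq[OF assms(1), folded jump_def]
  have int: "set_integrable lborel {0..t} (\<lambda>r. jump (flow f) r z)" using assms by (intro I(1)) auto
  show "set_integrable lborel {\<tau>..t} (\<lambda>r. jump (flow f) r z)"
    by (rule set_integrable_subset[OF int]) (use assms in auto)
  have "(LINT r:{0..t}|lborel. jump (flow f) r z) = (LINT r:{0..\<tau>}|lborel. jump (flow f) r z) + (LINT r:{\<tau>..t}|lborel. jump (flow f) r z)"
    by (rule LINT_Icc_split[OF int]) (use assms in auto)
  then show "flow f t z = flow f \<tau> z + (LINT r:{\<tau>..t}|lborel. jump (flow f) r z)"
    using I(2)[of t z] I(2)[of \<tau> z] assms by simp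
qed

text \<open>
  The flow is an indefinite integral in time for each \<open>z\<close>, not only for almost
  every one, as \<open>flow_eq\<close> holds at every point.
\<close>

lemma flow_isCont:
  assumes "datum f"
  shows "isCont (\<lambda>t. flow f t z) t"
proof -
  define T where "T = \<bar>t\<bar> + 1"
  note I = flow_eq[OF assms, folded jump_def]
  have int: "set_integrable lborel {0..s} (\<lambda>r. jump (flow f) r z)" if "0 \<le> s" for s using that by (intro I(1)) auto
  have "continuous_on {0..T} (\<lambda>s. f z + integral {0..s} (\<lambda>r. jump (flow f) r z))"
    using set_borel_integral_eq_integral(1)[OF int[of T]]
    by (intro continuous_intros indefinite_integral_continuous_1) (auto simp: T_def)
  then have 1: "continuous_on {0..T} (\<lambda>s. flow f s z)"
    by (rule continuous_on_eq) (simp add: I(2) set_borel_integral_eq_integral(2)[OF int])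
  have 2: "continuous_on {-T..0} (\<lambda>s. flow f s z)"
    by (rule continuous_on_eq[of _ "\<lambda>s. f z"]) (auto simp: flow_start[OF assms])
  have "continuous_on ({-T..0} \<union> {0..T}) (\<lambda>s. flow f s z)"
    by (intro continuous_on_closed_Un 1 2) auto
  then have "continuous_on {-T<..<T} (\<lambda>s. flow f s z)"
    by (rule continuous_on_subset) auto
  then show ?thesis
    by (rule continuous_on_interior) (auto simp: T_def interior_open)
qed

text \<open>
  The flow seen at a fixed point \<open>y\<close> of the circle instead of along a
  characteristic.
\<close>

definition wave :: "(real \<Rightarrow> real) \<Rightarrow> real \<Rightarrow> real \<Rightarrow> real" where
  "wave f t y = flow f t (y - t)"

lemma wave_measurable:
  assumes "datum f"
  shows "case_prod (wave f) \<in> borel_measurable (borel \<Otimes>\<^sub>M borel)"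
proof -
  note [measurable] = borel_pair_compose[OF flow_measurable[OF assms]]
  show ?thesis unfolding wave_def by measurable
qed

lemma wave_periodic: "datum f \<Longrightarrow> wave f t (y + 2) = wave f t y"
  using flow_periodic[of f t, unfolded periodic2_def, rule_format, of "y - t"] by (simp add: wave_def algebra_simps)

text \<open>
  The pointwise bound gives one dominating function for a whole range of times, which is what
  dominated convergence asks for.
\<close>

lemma flow_Lp_dominated:
  assumes f: "Lp_datum p f" and "1 \<le> p"
  obtains D where "locally_Lp p D" "\<And>z. 0 \<le> D z" "\<And>t z. t \<le> T \<Longrightarrow> \<bar>flow f t z\<bar> \<le> D z"
proof -
  have d: "datum f" using f by (simp add: Lp_datum_def)
  have "0 \<le> max 0 T" by simp
  obtain K M where KM: "1 \<le> K" "0 \<le> M" "\<And>t z. t \<le> max 0 T \<Longrightarrow> \<bar>flow f t z\<bar> \<le> K * (\<bar>f z\<bar> + M)"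
    using flow_bound[OF d \<open>0 \<le> max 0 T\<close>] by blast
  show ?thesis
    by (rule that[of "\<lambda>z. K * (\<bar>f z\<bar> + M)"]) (use KM Lp_datum_locally[OF f] \<open>1 \<le> p\<close> in \<open>auto intro!: locally_Lp_affine\<close>)
qed

lemma flow_locally_Lp:
  assumes f: "Lp_datum p f" and "1 \<le> p"
  shows "locally_Lp p (flow f t)"
proof -
  have d: "datum f" using f by (simp add: Lp_datum_def)
  obtain D where D: "locally_Lp p D" "\<And>z. 0 \<le> D z" "\<And>s z. s \<le> t \<Longrightarrow> \<bar>flow f s z\<bar> \<le> D z"
    using flow_Lp_dominated[OF assms] by blast
  note [measurable] = borel_pair_compose[OF flow_measurable[OF d]]
  show ?thesis by (rule locally_Lp_mono[OF D(1)]) (use D \<open>1 \<le> p\<close> in \<open>auto intro: order_trans[OF D(3)]\<close>)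
qed

lemma wave_fixed_position_locally_Lp:
  assumes f: "Lp_datum p f" and "1 \<le> p"
  shows "locally_Lp p (\<lambda>t. wave f t y)"
  unfolding locally_Lp_def
proof (intro conjI allI)
  have d: "datum f" using f by (simp add: Lp_datum_def)
  note [measurable] = borel_pair_compose[OF wave_measurable[OF d]]
  show "(\<lambda>t. wave f t y) \<in> borel_measurable borel" by measurable
  fix a b :: real
  obtain D where D: "locally_Lp p D" "\<And>z. 0 \<le> D z" "\<And>s z. s \<le> b \<Longrightarrow> \<bar>flow f s z\<bar> \<le> D z"
    using flow_Lp_dominated[OF assms] by blast
  have [measurable]: "D \<in> borel_measurable borel" using D by (auto simp: locally_Lp_def)
  have "(\<integral>\<^sup>+t\<in>{a..b}. ennreal (\<bar>wave f t y\<bar> powr p) \<partial>lborel) \<le> (\<integral>\<^sup>+t\<in>{a..b}. ennreal (\<bar>D (y - t)\<bar> powr p) \<partial>lborel)"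
  proof (rule nn_integral_mono)
    fix t
    have "\<bar>wave f t y\<bar> powr p \<le> \<bar>D (y - t)\<bar> powr p" if "t \<le> b"
      using D(3)[OF that, of "y - t"] \<open>1 \<le> p\<close> by (intro powr_mono2) (auto simp: wave_def)
    then show "ennreal (\<bar>wave f t y\<bar> powr p) * indicator {a..b} t \<le> ennreal (\<bar>D (y - t)\<bar> powr p) * indicator {a..b} t"
      by (auto simp: indicator_def intro!: ennreal_leI)
  qed
  also have "\<dots> = (\<integral>\<^sup>+z\<in>{y - b..y - a}. ennreal (\<bar>D z\<bar> powr p) \<partial>lborel)"
    by (rule nn_integral_Icc_reflect[of "\<lambda>z. ennreal (\<bar>D z\<bar> powr p)"]) measurable
  also have "\<dots> < \<infinity>" using D(1) by (auto simp: locally_Lp_def)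
  finally show "(\<integral>\<^sup>+t\<in>{a..b}. ennreal (\<bar>wave f t y\<bar> powr p) \<partial>lborel) < \<infinity>" .
qed

lemma nn_integral_powr_add_le:
  fixes f g :: "real \<Rightarrow> real"
  assumes [measurable]: "f \<in> borel_measurable borel" "g \<in> borel_measurable borel" "A \<in> sets borel" and "1 \<le> p"
    and h: "\<And>x. h x = f x + g x"
  shows "(\<integral>\<^sup>+x\<in>A. ennreal (\<bar>h x\<bar> powr p) \<partial>lborel) \<le>
    ennreal (2 powr p) * ((\<integral>\<^sup>+x\<in>A. ennreal (\<bar>f x\<bar> powr p) \<partial>lborel) + (\<integral>\<^sup>+x\<in>A. ennreal (\<bar>g x\<bar> powr p) \<partial>lborel))"
proof -
  have "(\<integral>\<^sup>+x\<in>A. ennreal (\<bar>h x\<bar> powr p) \<partial>lborel) \<le>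
     (\<integral>\<^sup>+x. ennreal (2 powr p) * (ennreal (\<bar>f x\<bar> powr p) * indicator A x + ennreal (\<bar>g x\<bar> powr p) * indicator A x) \<partial>lborel)"
    using powr_add_le[OF \<open>1 \<le> p\<close>] unfolding h by (intro nn_integral_mono) (auto simp: indicator_def)
  also have "\<dots> = ennreal (2 powr p) * ((\<integral>\<^sup>+x\<in>A. ennreal (\<bar>f x\<bar> powr p) \<partial>lborel) + (\<integral>\<^sup>+x\<in>A. ennreal (\<bar>g x\<bar> powr p) \<partial>lborel))"
    by (simp add: nn_integral_cmult nn_integral_add)
  finally show ?thesis .
qed

lemma tendsto_zero_sum_bound:
  fixes F :: "nat \<Rightarrow> ennreal"
  assumes "\<And>n. F n \<le> ennreal C * (G n + H n)" "G \<longlonglongrightarrow> 0" "H \<longlonglongrightarrow> 0"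
  shows "F \<longlonglongrightarrow> 0"
proof (rule tendsto_sandwich[of "\<lambda>_. 0"])
  have "(\<lambda>n. ennreal C * (G n + H n)) \<longlonglongrightarrow> ennreal C * (0 + 0)"
    by (intro tendsto_intros ennreal_tendsto_cmult assms) auto
  then show "(\<lambda>n. ennreal C * (G n + H n)) \<longlonglongrightarrow> 0" by simp
qed (use assms in auto)

text \<open>
  \<open>wave f r y - wave f t y\<close> is split at \<open>flow f t (y - r)\<close>. The first
  part tends to zero by continuity along characteristics and dominated convergence, the second
  one by continuity of translations.
\<close>

lemma wave_continuous_in_time:
  assumes f: "Lp_datum p f" and "1 \<le> p"
  shows "((\<lambda>r. \<integral>\<^sup>+y\<in>{-1..1}. ennreal (\<bar>wave f r y - wave f t y\<bar> powr p) \<partial>lborel) \<longlongrightarrow> 0) (at t)"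
  unfolding tendsto_at_iff_sequentially comp_def
proof (intro allI impI)
  fix X :: "nat \<Rightarrow> real" assume Xt: "\<forall>i. X i \<in> UNIV - {t}" and X: "X \<longlonglongrightarrow> t"
  have d: "datum f" using f by (simp add: Lp_datum_def)
  obtain B where B: "\<And>n. \<bar>X n\<bar> \<le> B" using convergent_imp_Bseq[OF convergentI[OF X]] by (auto simp: Bseq_def)
  note [measurable] = borel_pair_compose[OF flow_measurable[OF d]]
  obtain D where D: "locally_Lp p D" "\<And>z. 0 \<le> D z" "\<And>s z. s \<le> max B t \<Longrightarrow> \<bar>flow f s z\<bar> \<le> D z"
    using flow_Lp_dominated[OF assms] by blast
  have [measurable]: "D \<in> borel_measurable borel" using D by (auto simp: locally_Lp_def)
  define G where "G n = (\<integral>\<^sup>+z\<in>{-1 - B..1 + B}. ennreal (\<bar>flow f (X n) z - flow f t z\<bar> powr p) \<partial>lborel)" for n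
  define H where "H n = (\<integral>\<^sup>+z\<in>{-1 - t..1 - t}. ennreal (\<bar>flow f t (z + (t - X n)) - flow f t z\<bar> powr p) \<partial>lborel)" for n
  have "G \<longlonglongrightarrow> 0"
    unfolding G_def
  proof (rule Lp_dominated_convergence[where g = D])
    show "AE z in lborel. z \<in> {-1 - B..1 + B} \<longrightarrow> (\<lambda>n. flow f (X n) z) \<longlonglongrightarrow> flow f t z"
      by (intro AE_I2 impI isCont_tendsto_compose[OF flow_isCont[OF d] X])
    show "\<bar>flow f (X n) z\<bar> \<le> D z" for n z
      by (rule D(3)) (use B[of n] in auto)
  qed (use D \<open>1 \<le> p\<close> in \<open>auto simp: locally_Lp_def\<close>)
  moreover have "H \<longlonglongrightarrow> 0"
  proof -
    have "filterlim (\<lambda>n. t - X n) (at 0) sequentially"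
    proof -
      have "t - X n \<noteq> 0" for n using Xt[rule_format, of n] by auto
      then show ?thesis using tendsto_diff[OF tendsto_const X, of t] by (simp add: filterlim_at)
    qed
    then show ?thesis
      unfolding H_def
      by (rule filterlim_compose[OF Lp_translation_continuous[OF flow_locally_Lp[OF f \<open>1 \<le> p\<close>] \<open>1 \<le> p\<close>]])
  qed
  moreover have "(\<integral>\<^sup>+y\<in>{-1..1}. ennreal (\<bar>wave f (X n) y - wave f t y\<bar> powr p) \<partial>lborel) \<le> ennreal (2 powr p) * (G n + H n)" for n
  proof -
    have "(\<integral>\<^sup>+y\<in>{-1..1}. ennreal (\<bar>flow f (X n) (y - X n) - flow f t (y - X n)\<bar> powr p) \<partial>lborel) =
        (\<integral>\<^sup>+y\<in>{-1..1}. (\<lambda>z. ennreal (\<bar>flow f (X n) z - flow f t z\<bar> powr p)) (y + (- X n)) \<partial>lborel)" by simp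
    also have "\<dots> = (\<integral>\<^sup>+z\<in>{-1 + (- X n)..1 + (- X n)}. ennreal (\<bar>flow f (X n) z - flow f t z\<bar> powr p) \<partial>lborel)"
      by (rule nn_integral_Icc_shift) measurable
    also have "\<dots> \<le> G n"
      unfolding G_def using B[of n] by (intro nn_integral_mono) (auto simp: indicator_def abs_le_iff)
    finally have 1: "(\<integral>\<^sup>+y\<in>{-1..1}. ennreal (\<bar>flow f (X n) (y - X n) - flow f t (y - X n)\<bar> powr p) \<partial>lborel) \<le> G n" .
    have "(\<integral>\<^sup>+y\<in>{-1..1}. ennreal (\<bar>flow f t (y - X n) - flow f t (y - t)\<bar> powr p) \<partial>lborel) =
        (\<integral>\<^sup>+y\<in>{-1..1}. (\<lambda>z. ennreal (\<bar>flow f t (z + (t - X n)) - flow f t z\<bar> powr p)) (y + (- t)) \<partial>lborel)" by simp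
    also have "\<dots> = (\<integral>\<^sup>+z\<in>{-1 + (- t)..1 + (- t)}. ennreal (\<bar>flow f t (z + (t - X n)) - flow f t z\<bar> powr p) \<partial>lborel)"
      by (rule nn_integral_Icc_shift) measurable
    finally have 2: "(\<integral>\<^sup>+y\<in>{-1..1}. ennreal (\<bar>flow f t (y - X n) - flow f t (y - t)\<bar> powr p) \<partial>lborel) = H n"
      by (simp add: H_def)
    have "(\<integral>\<^sup>+y\<in>{-1..1}. ennreal (\<bar>wave f (X n) y - wave f t y\<bar> powr p) \<partial>lborel) \<le> ennreal (2 powr p) *
       ((\<integral>\<^sup>+y\<in>{-1..1}. ennreal (\<bar>flow f (X n) (y - X n) - flow f t (y - X n)\<bar> powr p) \<partial>lborel) +
        (\<integral>\<^sup>+y\<in>{-1..1}. ennreal (\<bar>flow f t (y - X n) - flow f t (y - t)\<bar> powr p) \<partial>lborel))"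
      by (rule nn_integral_powr_add_le) (use \<open>1 \<le> p\<close> in \<open>auto simp: wave_def\<close>)
    also have "\<dots> \<le> ennreal (2 powr p) * (G n + H n)"
      using 1 2 by (intro mult_left_mono add_mono) auto
    finally show ?thesis .
  qed
  ultimately show "(\<lambda>n. \<integral>\<^sup>+y\<in>{-1..1}. ennreal (\<bar>wave f (X n) y - wave f t y\<bar> powr p) \<partial>lborel) \<longlonglongrightarrow> 0"
    by (rule tendsto_zero_sum_bound[rotated])
qed

text \<open>
  The values at \<open>(t, y)\<close> and at \<open>(t + y0 - y, y0)\<close> lie on one
  characteristic and differ by a short piece of it. What remains is a translation in time at the
  fixed position \<open>y0\<close>.
\<close>

lemma wave_continuous_in_space:
  assumes f: "Lp_datum p f" and "1 \<le> p"
  shows "((\<lambda>y. \<integral>\<^sup>+t\<in>{0..T}. ennreal (\<bar>wave f t y - wave f t y0\<bar> powr p) \<partial>lborel) \<longlongrightarrow> 0) (at y0)"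
  unfolding tendsto_at_iff_sequentially comp_def
proof (intro allI impI)
  fix X :: "nat \<Rightarrow> real" assume Xy: "\<forall>i. X i \<in> UNIV - {y0}" and X: "X \<longlonglongrightarrow> y0"
  have d: "datum f" using f by (simp add: Lp_datum_def)
  obtain B where B: "\<And>n. \<bar>X n\<bar> \<le> B" using convergent_imp_Bseq[OF convergentI[OF X]] by (auto simp: Bseq_def)
  note [measurable] = borel_pair_compose[OF flow_measurable[OF d]]
  define S where "S = \<bar>B\<bar> + \<bar>y0\<bar> + (\<bar>B\<bar> + \<bar>T\<bar>)"
  obtain D where D: "locally_Lp p D" "\<And>z. 0 \<le> D z" "\<And>s z. s \<le> S \<Longrightarrow> \<bar>flow f s z\<bar> \<le> D z"
    using flow_Lp_dominated[OF assms] by blast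
  have [measurable]: "D \<in> borel_measurable borel" using D by (auto simp: locally_Lp_def)
  define G where "G n = (\<integral>\<^sup>+z\<in>{- \<bar>B\<bar> - \<bar>T\<bar>..\<bar>B\<bar>}. ennreal (\<bar>flow f (X n - z) z - flow f (y0 - z) z\<bar> powr p) \<partial>lborel)" for n
  define H where "H n = (\<integral>\<^sup>+t\<in>{0..T}. ennreal (\<bar>wave f (t + (y0 - X n)) y0 - wave f t y0\<bar> powr p) \<partial>lborel)" for n
  have "G \<longlonglongrightarrow> 0"
    unfolding G_def
  proof (rule Lp_dominated_convergence[where g = D])
    show "AE z in lborel. z \<in> {- \<bar>B\<bar> - \<bar>T\<bar>..\<bar>B\<bar>} \<longrightarrow> (\<lambda>n. flow f (X n - z) z) \<longlonglongrightarrow> flow f (y0 - z) z"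
      by (intro AE_I2 impI isCont_tendsto_compose[OF flow_isCont[OF d]] tendsto_intros X)
    show "\<bar>flow f (X n - z) z\<bar> \<le> D z" if "z \<in> {- \<bar>B\<bar> - \<bar>T\<bar>..\<bar>B\<bar>}" for n z
      by (rule D(3)) (use B[of n] that in \<open>auto simp: S_def\<close>)
    show "\<bar>flow f (y0 - z) z\<bar> \<le> D z" if "z \<in> {- \<bar>B\<bar> - \<bar>T\<bar>..\<bar>B\<bar>}" for z
      by (rule D(3)) (use that in \<open>auto simp: S_def\<close>)
  qed (use D \<open>1 \<le> p\<close> in \<open>auto simp: locally_Lp_def\<close>)
  moreover have "H \<longlonglongrightarrow> 0"
  proof -
    have "filterlim (\<lambda>n. y0 - X n) (at 0) sequentially"
    proof -
      have "y0 - X n \<noteq> 0" for n using Xy[rule_format, of n] by auto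
      then show ?thesis using tendsto_diff[OF tendsto_const X, of y0] by (simp add: filterlim_at)
    qed
    then show ?thesis
      unfolding H_def
      by (rule filterlim_compose[OF Lp_translation_continuous[OF wave_fixed_position_locally_Lp[OF f \<open>1 \<le> p\<close>] \<open>1 \<le> p\<close>]])
  qed
  moreover have "(\<integral>\<^sup>+t\<in>{0..T}. ennreal (\<bar>wave f t (X n) - wave f t y0\<bar> powr p) \<partial>lborel) \<le> ennreal (2 powr p) * (G n + H n)" for n
  proof -
    note [measurable] = borel_pair_compose[OF wave_measurable[OF d]]
    have "(\<integral>\<^sup>+t\<in>{0..T}. ennreal (\<bar>wave f t (X n) - wave f (t + (y0 - X n)) y0\<bar> powr p) \<partial>lborel) =
        (\<integral>\<^sup>+t\<in>{0..T}. (\<lambda>z. ennreal (\<bar>flow f (X n - z) z - flow f (y0 - z) z\<bar> powr p)) (X n - t) \<partial>lborel)"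
      by (intro nn_integral_cong) (simp add: wave_def algebra_simps)
    also have "\<dots> = (\<integral>\<^sup>+z\<in>{X n - T..X n - 0}. ennreal (\<bar>flow f (X n - z) z - flow f (y0 - z) z\<bar> powr p) \<partial>lborel)"
      by (rule nn_integral_Icc_reflect) measurable
    also have "\<dots> \<le> G n"
      unfolding G_def using B[of n] by (intro nn_integral_mono) (auto simp: indicator_def abs_le_iff)
    finally have 1: "(\<integral>\<^sup>+t\<in>{0..T}. ennreal (\<bar>wave f t (X n) - wave f (t + (y0 - X n)) y0\<bar> powr p) \<partial>lborel) \<le> G n" .
    have "(\<integral>\<^sup>+t\<in>{0..T}. ennreal (\<bar>wave f t (X n) - wave f t y0\<bar> powr p) \<partial>lborel) \<le> ennreal (2 powr p) *
       ((\<integral>\<^sup>+t\<in>{0..T}. ennreal (\<bar>wave f t (X n) - wave f (t + (y0 - X n)) y0\<bar> powr p) \<partial>lborel) + H n)"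
      unfolding H_def by (rule nn_integral_powr_add_le) (use \<open>1 \<le> p\<close> in auto)
    also have "\<dots> \<le> ennreal (2 powr p) * (G n + H n)"
      using 1 by (intro mult_left_mono add_mono) auto
    finally show ?thesis .
  qed
  ultimately show "(\<lambda>n. \<integral>\<^sup>+t\<in>{0..T}. ennreal (\<bar>wave f t (X n) - wave f t y0\<bar> powr p) \<partial>lborel) \<longlonglongrightarrow> 0"
    by (rule tendsto_zero_sum_bound[rotated])
qed

end

section \<open>Existence of broad solutions\<close>

lemma Lp2_norm_lebesgue_on:
  fixes f g :: "real \<Rightarrow> real"
  assumes [measurable]: "f \<in> borel_measurable borel" "g \<in> borel_measurable borel" and A [measurable]: "A \<in> sets borel"
  shows "Lp2_norm p (lebesgue_on A) f g =
    enn2real ((\<integral>\<^sup>+x\<in>A. ennreal (\<bar>f x\<bar> powr p) \<partial>lborel) + (\<integral>\<^sup>+x\<in>A. ennreal (\<bar>g x\<bar> powr p) \<partial>lborel)) powr (1 / p)"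
proof -
  have "(LINT x|lebesgue_on A. \<bar>f x\<bar> powr p + \<bar>g x\<bar> powr p) = (LINT x:A|lborel. \<bar>f x\<bar> powr p + \<bar>g x\<bar> powr p)"
    by (rule LINT_lebesgue_on_cong) auto
  also have "\<dots> = enn2real (\<integral>\<^sup>+x. ennreal (indicator A x * (\<bar>f x\<bar> powr p + \<bar>g x\<bar> powr p)) \<partial>lborel)"
    unfolding set_lebesgue_integral_def by (subst integral_eq_nn_integral) auto
  also have "(\<integral>\<^sup>+x. ennreal (indicator A x * (\<bar>f x\<bar> powr p + \<bar>g x\<bar> powr p)) \<partial>lborel) =
      (\<integral>\<^sup>+x. ennreal (\<bar>f x\<bar> powr p) * indicator A x + ennreal (\<bar>g x\<bar> powr p) * indicator A x \<partial>lborel)"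
    by (intro nn_integral_cong) (auto simp: indicator_def)
  also have "\<dots> = (\<integral>\<^sup>+x\<in>A. ennreal (\<bar>f x\<bar> powr p) \<partial>lborel) + (\<integral>\<^sup>+x\<in>A. ennreal (\<bar>g x\<bar> powr p) \<partial>lborel)"
    by (rule nn_integral_add) auto
  finally show ?thesis by (simp add: Lp2_norm_def)
qed

lemma tendsto_Lp2_norm:
  fixes u v :: "real \<Rightarrow> real \<Rightarrow> real"
  assumes [measurable]: "\<And>r. u r \<in> borel_measurable borel" "\<And>r. v r \<in> borel_measurable borel" and A [measurable]: "A \<in> sets borel"
    and "0 < p"
    and u: "((\<lambda>r. \<integral>\<^sup>+x\<in>A. ennreal (\<bar>u r x\<bar> powr p) \<partial>lborel) \<longlongrightarrow> 0) F"
    and v: "((\<lambda>r. \<integral>\<^sup>+x\<in>A. ennreal (\<bar>v r x\<bar> powr p) \<partial>lborel) \<longlongrightarrow> 0) F"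
  shows "((\<lambda>r. Lp2_norm p (lebesgue_on A) (u r) (v r)) \<longlongrightarrow> 0) F"
proof -
  have "((\<lambda>r. (\<integral>\<^sup>+x\<in>A. ennreal (\<bar>u r x\<bar> powr p) \<partial>lborel) + (\<integral>\<^sup>+x\<in>A. ennreal (\<bar>v r x\<bar> powr p) \<partial>lborel)) \<longlongrightarrow> 0 + 0) F"
    by (intro tendsto_add u v)
  then have "((\<lambda>r. enn2real ((\<integral>\<^sup>+x\<in>A. ennreal (\<bar>u r x\<bar> powr p) \<partial>lborel) + (\<integral>\<^sup>+x\<in>A. ennreal (\<bar>v r x\<bar> powr p) \<partial>lborel))) \<longlongrightarrow> 0) F"
    by (intro tendsto_enn2real) auto
  then show ?thesis
    unfolding Lp2_norm_lebesgue_on[OF assms(1,2) A]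
    by (rule tendsto_zero_powrI[OF _ tendsto_const]) (use \<open>0 < p\<close> in auto)
qed

lemma in_Lp_lebesgue_on:
  fixes f :: "real \<Rightarrow> real"
  assumes [measurable]: "f \<in> borel_measurable borel" and A [measurable]: "A \<in> sets borel"
    and fin: "(\<integral>\<^sup>+x\<in>A. ennreal (\<bar>f x\<bar> powr p) \<partial>lborel) < \<infinity>"
  shows "in_Lp p (lebesgue_on A) f"
proof -
  have "set_integrable lborel A (\<lambda>x. \<bar>f x\<bar> powr p)"
    by (rule set_lebesgue_integral_eq_nn(1)[OF _ A _ fin]) auto
  then have "integrable lebesgue (\<lambda>x. indicator A x * \<bar>f x\<bar> powr p)"
    unfolding set_integrable_def by (subst integrable_completion) auto
  then have "integrable (lebesgue_on A) (\<lambda>x. \<bar>f x\<bar> powr p)"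
    by (subst integrable_restrict_space) auto
  then show ?thesis
    unfolding in_Lp_def by (simp add: borel_measurable_lebesgue_on)
qed

text \<open>
  The coefficient extended to the circle as an even function of period \<open>2\<close>.
\<close>

locale transport =
  fixes A :: real and \<alpha> :: "real \<Rightarrow> real \<Rightarrow> real"
  assumes alpha_measurable: "case_prod \<alpha> \<in> borel_measurable (borel \<Otimes>\<^sub>M borel)"
    and alpha_nonneg: "0 \<le> \<alpha> t y" and alpha_le: "\<alpha> t y \<le> A"
    and alpha_even: "\<alpha> t (- y) = \<alpha> t y" and alpha_periodic: "\<alpha> t (y + 2) = \<alpha> t y"

sublocale transport \<subseteq> exchange "A / 2" "\<lambda>r z. \<alpha> r (z + r) / 2"
proof
  note [measurable] = borel_pair_compose[OF alpha_measurable]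
  show "(\<lambda>(r, z). \<alpha> r (z + r) / 2) \<in> borel_measurable (borel \<Otimes>\<^sub>M borel)" by measurable
  show "0 \<le> \<alpha> r (z + r) / 2" "\<alpha> r (z + r) / 2 \<le> A / 2" for r z
    using alpha_nonneg alpha_le by auto
  show "\<alpha> r (- z - 2 * r + r) / 2 = \<alpha> r (z + r) / 2" for r z
  proof -
    have "- z - 2 * r + r = - (z + r)" by simp
    then show ?thesis by (simp only: alpha_even)
  qed
  show "\<alpha> r (z + 2 + r) / 2 = \<alpha> r (z + r) / 2" for r z
  proof -
    have "z + 2 + r = (z + r) + 2" by simp
    then show ?thesis by (simp only: alpha_periodic)
  qed
qed

context transport
begin

text \<open>
  On a piece of the characteristic that stays on one side of the boundary, \<open>\<sigma> =
  1\<close> for \<open>\<xi>\<close> and \<open>\<sigma> = -1\<close> for \<open>\<rho>\<close>,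
  the increment of the flow is the integral of the source of the system.
\<close>

lemma wave_along_characteristic:
  assumes d: "datum f" and "0 \<le> \<tau>"
    and ae: "AE s in lborel. 0 < s \<and> \<bar>z + s\<bar> \<in> {0<..<1} \<longrightarrow> a s \<bar>z + s\<bar> = \<alpha> s \<bar>z + s\<bar>"
    and range: "\<And>s. \<tau> < s \<Longrightarrow> s < t \<Longrightarrow> \<bar>z + s\<bar> \<in> {0<..<1} \<and> sgn (z + s) = \<sigma>"
    and \<sigma>: "\<sigma> = 1 \<or> \<sigma> = -1" and "\<tau> \<le> t"
    and S: "\<And>s. S s = \<sigma> * (1 / 2) * a s \<bar>z + s\<bar> * (wave f s (- \<bar>z + s\<bar>) - wave f s \<bar>z + s\<bar>)"
  shows "wave f t (z + t) = wave f \<tau> (z + \<tau>) + (LINT s|lebesgue_on {\<tau><..<t}. S s)"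
proof -
  note [measurable] = borel_pair_compose[OF jump_measurable[OF flow_measurable[OF d]]]
  have "(LINT s|lebesgue_on {\<tau><..<t}. S s) = (LINT s:{\<tau>..t}|lborel. jump (flow f) s z)"
  proof (rule LINT_Ioo_eq_Icc)
    show "AE s in lborel. \<tau> < s \<and> s < t \<longrightarrow> S s = jump (flow f) s z"
      using ae
    proof eventually_elim
      case (elim s)
      show ?case
      proof
        assume s: "\<tau> < s \<and> s < t"
        then have r: "\<bar>z + s\<bar> \<in> {0<..<1}" "sgn (z + s) = \<sigma>" using range[of s] by auto
        then have a: "a s \<bar>z + s\<bar> = \<alpha> s \<bar>z + s\<bar>" using elim s \<open>0 \<le> \<tau>\<close> by auto
        have al: "\<alpha> s \<bar>z + s\<bar> = \<alpha> s (z + s)" using alpha_even[of s "z + s"] by (cases "0 \<le> z + s") auto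
        have e1: "z + s - s = z" and e2: "- (z + s) - s = - z - 2 * s" by auto
        show "S s = jump (flow f) s z"
        proof (cases "\<sigma> = 1")
          case True
          then have "\<bar>z + s\<bar> = z + s" using r by (auto simp: sgn_if split: if_splits)
          then show ?thesis using S[of s] a al True unfolding jump_def wave_def by (simp only: e1 e2)
        next
          case False
          then have "\<sigma> = -1" "\<bar>z + s\<bar> = - (z + s)" using r \<sigma> by (auto simp: sgn_if split: if_splits)
          then show ?thesis using S[of s] a al unfolding jump_def wave_def
            by (simp only: e1 e2 minus_minus) (simp add: algebra_simps)
        qed
      qed
    qed
  qed measurable
  then show ?thesis
    using flow_increment(2)[OF d \<open>0 \<le> \<tau>\<close> \<open>\<tau> \<le> t\<close>, of z] by (simp add: wave_def)
qed

text \<open>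
  The four characteristic rules are the increment of the flow over the time since the
  characteristic left the initial line or the boundary. The boundary conditions hold because
  \<open>0 = -0\<close> and because \<open>-1\<close> and \<open>1\<close> are the same point of
  the circle.
\<close>

lemma wave_broad_solution:
  assumes f: "Lp_datum p f" and "1 < p"
    and rho0: "AE x in lborel. 0 < x \<and> x < 1 \<longrightarrow> f (- x) = \<rho>0 x"
    and xi0: "AE x in lborel. 0 < x \<and> x < 1 \<longrightarrow> f x = \<xi>0 x"
    and a: "AE (t, x) in lborel. 0 < t \<and> 0 < x \<and> x < 1 \<longrightarrow> a t x = \<alpha> t x"
  shows "broad_solution p T a \<rho>0 \<xi>0 (\<lambda>t x. wave f t (- x)) (\<lambda>t x. wave f t x)"
proof -
  have d: "datum f" using f by (simp add: Lp_datum_def)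
  have p: "1 \<le> p" "0 < p" using \<open>1 < p\<close> by auto
  note [measurable] = borel_pair_compose[OF wave_measurable[OF d]]
  have meas: "(\<lambda>(t, x). wave f t (- x)) \<in> borel_measurable (lebesgue_on S)"
    "(\<lambda>(t, x). wave f t x) \<in> borel_measurable (lebesgue_on S)" for S
  proof -
    have "(\<lambda>(t, x). wave f t (- x)) \<in> borel_measurable (borel \<Otimes>\<^sub>M borel)"
      "(\<lambda>(t, x). wave f t x) \<in> borel_measurable (borel \<Otimes>\<^sub>M borel)"
      by measurable
    then show "(\<lambda>(t, x). wave f t (- x)) \<in> borel_measurable (lebesgue_on S)"
      "(\<lambda>(t, x). wave f t x) \<in> borel_measurable (lebesgue_on S)"
      unfolding borel_prod by (auto intro: borel_measurable_lebesgue_on)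
  qed
  have reflect: "(\<integral>\<^sup>+x\<in>{0<..<1}. ennreal (\<bar>h (- x)\<bar> powr p) \<partial>lborel) \<le> (\<integral>\<^sup>+y\<in>{-1..1}. ennreal (\<bar>h y\<bar> powr p) \<partial>lborel)"
    if [measurable]: "h \<in> borel_measurable borel" for h :: "real \<Rightarrow> real"
  proof -
    have "(\<integral>\<^sup>+x\<in>{0<..<1}. ennreal (\<bar>h (- x)\<bar> powr p) \<partial>lborel) \<le> (\<integral>\<^sup>+x\<in>{-1..1}. ennreal (\<bar>h (0 - x)\<bar> powr p) \<partial>lborel)"
      by (intro nn_integral_mono) (auto simp: indicator_def)
    also have "\<dots> = (\<integral>\<^sup>+y\<in>{0-1..0-(-1)}. ennreal (\<bar>h y\<bar> powr p) \<partial>lborel)"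
      by (rule nn_integral_Icc_reflect[of "\<lambda>y. ennreal (\<bar>h y\<bar> powr p)"]) measurable
    finally show ?thesis by simp
  qed
  have restrict: "(\<integral>\<^sup>+x\<in>{0<..<1}. ennreal (\<bar>h x\<bar> powr p) \<partial>lborel) \<le> (\<integral>\<^sup>+y\<in>{-1..1}. ennreal (\<bar>h y\<bar> powr p) \<partial>lborel)"
    for h :: "real \<Rightarrow> real"
    by (intro nn_integral_mono) (auto simp: indicator_def)
  have time_restrict: "(\<integral>\<^sup>+t\<in>{0<..<T}. ennreal (\<bar>h t\<bar> powr p) \<partial>lborel) \<le> (\<integral>\<^sup>+t\<in>{0..T}. ennreal (\<bar>h t\<bar> powr p) \<partial>lborel)"
    for h :: "real \<Rightarrow> real"
    by (intro nn_integral_mono) (auto simp: indicator_def)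
  have slice: "(\<integral>\<^sup>+y\<in>{-1..1}. ennreal (\<bar>wave f t y\<bar> powr p) \<partial>lborel) < \<infinity>" for t
  proof -
    note [measurable] = borel_pair_compose[OF flow_measurable[OF d]]
    have "(\<integral>\<^sup>+y\<in>{-1..1}. ennreal (\<bar>wave f t y\<bar> powr p) \<partial>lborel) =
        (\<integral>\<^sup>+y\<in>{-1..1}. (\<lambda>z. ennreal (\<bar>flow f t z\<bar> powr p)) (y + - t) \<partial>lborel)"
      by (simp add: wave_def)
    also have "\<dots> = (\<integral>\<^sup>+z\<in>{-1 + - t..1 + - t}. ennreal (\<bar>flow f t z\<bar> powr p) \<partial>lborel)"
      by (rule nn_integral_Icc_shift) measurable
    also have "\<dots> < \<infinity>" using flow_locally_Lp[OF f p(1), of t] by (auto simp: locally_Lp_def)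
    finally show ?thesis .
  qed
  have "cont_Lp2 p {0..T} (lebesgue_on {0<..<1}) (\<lambda>t x. wave f t (- x)) (\<lambda>t x. wave f t x)"
    unfolding cont_Lp2_def
  proof (intro conjI ballI)
    fix t
    show "in_Lp p (lebesgue_on {0<..<1}) (\<lambda>x. wave f t (- x))"
      by (rule in_Lp_lebesgue_on) (auto intro: order_le_less_trans[OF reflect slice[unfolded infinity_ennreal_def]])
    show "in_Lp p (lebesgue_on {0<..<1}) (\<lambda>x. wave f t x)"
      by (rule in_Lp_lebesgue_on) (auto intro: order_le_less_trans[OF restrict slice[unfolded infinity_ennreal_def]])
    have lim: "((\<lambda>r. \<integral>\<^sup>+y\<in>{-1..1}. ennreal (\<bar>wave f r y - wave f t y\<bar> powr p) \<partial>lborel) \<longlongrightarrow> 0) (at t within {0..T})"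
      by (rule tendsto_within_subset[OF wave_continuous_in_time[OF f p(1)]]) auto
    show "((\<lambda>r. Lp2_norm p (lebesgue_on {0<..<1}) (\<lambda>x. wave f r (- x) - wave f t (- x)) (\<lambda>x. wave f r x - wave f t x)) \<longlongrightarrow> 0) (at t within {0..T})"
    proof (rule tendsto_Lp2_norm)
      show "((\<lambda>r. \<integral>\<^sup>+x\<in>{0<..<1}. ennreal (\<bar>wave f r (- x) - wave f t (- x)\<bar> powr p) \<partial>lborel) \<longlongrightarrow> 0) (at t within {0..T})"
        by (rule tendsto_sandwich[OF _ _ tendsto_const lim])
           (auto intro!: always_eventually reflect[of "\<lambda>y. wave f _ y - wave f t y"])
      show "((\<lambda>r. \<integral>\<^sup>+x\<in>{0<..<1}. ennreal (\<bar>wave f r x - wave f t x\<bar> powr p) \<partial>lborel) \<longlongrightarrow> 0) (at t within {0..T})"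
        by (rule tendsto_sandwich[OF _ _ tendsto_const lim]) (auto intro!: always_eventually restrict)
    qed (use p in auto)
  qed
  moreover have "cont_Lp2 p {0..1} (lebesgue_on {0<..<T}) (\<lambda>x t. wave f t (- x)) (\<lambda>x t. wave f t x)"
    unfolding cont_Lp2_def
  proof (intro conjI ballI)
    fix x
    have fin: "(\<integral>\<^sup>+t\<in>{0..T}. ennreal (\<bar>wave f t y\<bar> powr p) \<partial>lborel) < \<infinity>" for y
      using wave_fixed_position_locally_Lp[OF f p(1), of y] by (auto simp: locally_Lp_def)
    show "in_Lp p (lebesgue_on {0<..<T}) (\<lambda>t. wave f t (- x))"
      by (rule in_Lp_lebesgue_on) (auto intro: order_le_less_trans[OF time_restrict fin[unfolded infinity_ennreal_def]])
    show "in_Lp p (lebesgue_on {0<..<T}) (\<lambda>t. wave f t x)"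
      by (rule in_Lp_lebesgue_on) (auto intro: order_le_less_trans[OF time_restrict fin[unfolded infinity_ennreal_def]])
    have lim: "((\<lambda>y. \<integral>\<^sup>+t\<in>{0..T}. ennreal (\<bar>wave f t y - wave f t y0\<bar> powr p) \<partial>lborel) \<longlongrightarrow> 0) (at y0)" for y0
      by (rule wave_continuous_in_space[OF f p(1)])
    show "((\<lambda>r. Lp2_norm p (lebesgue_on {0<..<T}) (\<lambda>t. wave f t (- r) - wave f t (- x)) (\<lambda>t. wave f t r - wave f t x)) \<longlongrightarrow> 0) (at x within {0..1})"
    proof (rule tendsto_Lp2_norm)
      have "filterlim uminus (at (- x)) (at x within {0..1})"
        by (auto simp: filterlim_at eventually_at_filter intro!: tendsto_intros)
      from filterlim_compose[OF lim this]
      show "((\<lambda>r. \<integral>\<^sup>+t\<in>{0<..<T}. ennreal (\<bar>wave f t (- r) - wave f t (- x)\<bar> powr p) \<partial>lborel) \<longlongrightarrow> 0) (at x within {0..1})"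
        by (rule tendsto_sandwich[OF _ _ tendsto_const, rotated 2]) (auto intro!: always_eventually time_restrict)
      show "((\<lambda>r. \<integral>\<^sup>+t\<in>{0<..<T}. ennreal (\<bar>wave f t r - wave f t x\<bar> powr p) \<partial>lborel) \<longlongrightarrow> 0) (at x within {0..1})"
        by (rule tendsto_sandwich[OF _ _ tendsto_const tendsto_within_subset[OF lim]]) (auto intro!: always_eventually time_restrict)
    qed (use p in auto)
  qed
  moreover have "AE (t, x) in lebesgue_on ({0<..<T} \<times> {0<..<1}).
     characteristic_rules a \<rho>0 \<xi>0 (\<lambda>t x. wave f t (- x)) (\<lambda>t x. wave f t x) t x"
  proof -
    \<comment> \<open>Almost every point (t, x) lies on a left-moving and a right-moving
      characteristic along which a agrees with \<alpha> for almost all times, and whose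
      starting points carry the right initial values.\<close>
    define P1 where "P1 q \<longleftrightarrow> (AE s in lborel. 0 < s \<and> 0 < q - s \<and> q - s < 1 \<longrightarrow> a s (q - s) = \<alpha> s (q - s))" for q
    define P2 where "P2 q \<longleftrightarrow> (AE s in lborel. 0 < s \<and> 0 < q + s \<and> q + s < 1 \<longrightarrow> a s (q + s) = \<alpha> s (q + s))" for q
    have "AE q in lborel. P1 q"
      unfolding P1_def using AE_lborel_pair_characteristics[OF a, of "-1"] by simp
    then have 1: "AE (t, x) in lborel. P1 (x + 1 * t)" by (rule AE_lborel_pair_shear)
    have "AE q in lborel. P2 q"
      unfolding P2_def using AE_lborel_pair_characteristics[OF a, of 1] by simp
    then have 2: "AE (t, x) in lborel. P2 (x + (-1) * t)" by (rule AE_lborel_pair_shear)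
    have 3: "AE (t, x) in lborel. 0 < x + 1 * t \<and> x + 1 * t < 1 \<longrightarrow> f (- (x + 1 * t)) = \<rho>0 (x + 1 * t)"
      by (rule AE_lborel_pair_shear[OF rho0])
    have 4: "AE (t, x) in lborel. 0 < x + (-1) * t \<and> x + (-1) * t < 1 \<longrightarrow> f (x + (-1) * t) = \<xi>0 (x + (-1) * t)"
      by (rule AE_lborel_pair_shear[OF xi0])
    have "AE (t, x) in lborel. (t, x) \<in> {0<..<T} \<times> {0<..<1} \<longrightarrow>
      characteristic_rules a \<rho>0 \<xi>0 (\<lambda>t x. wave f t (- x)) (\<lambda>t x. wave f t x) t x"
      using 1 2 3 4
    proof eventually_elim
      case (elim tx)
      obtain t x where tx: "tx = (t, x)" by force
      have e: "P1 (x + t)" "P2 (x - t)" "0 < x + t \<and> x + t < 1 \<longrightarrow> f (- (x + t)) = \<rho>0 (x + t)"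
        "0 < x - t \<and> x - t < 1 \<longrightarrow> f (x - t) = \<xi>0 (x - t)"
        using elim by (auto simp: tx)
      have L: "AE s in lborel. 0 < s \<and> \<bar>- (x + t) + s\<bar> \<in> {0<..<1} \<and> s < x + t \<longrightarrow> a s \<bar>- (x + t) + s\<bar> = \<alpha> s \<bar>- (x + t) + s\<bar>"
        using e(1) unfolding P1_def
      proof eventually_elim
        case (elim s)
        show ?case
        proof
          assume s: "0 < s \<and> \<bar>- (x + t) + s\<bar> \<in> {0<..<1} \<and> s < x + t"
          then have "\<bar>- (x + t) + s\<bar> = x + t - s" by simp
          then show "a s \<bar>- (x + t) + s\<bar> = \<alpha> s \<bar>- (x + t) + s\<bar>"
            using elim s by (simp only:) auto
        qed
      qed
      have R: "AE s in lborel. 0 < s \<and> \<bar>(x - t) + s\<bar> \<in> {0<..<1} \<and> t - x < s \<longrightarrow> a s \<bar>(x - t) + s\<bar> = \<alpha> s \<bar>(x - t) + s\<bar>"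
        using e(2) unfolding P2_def by eventually_elim (auto simp: abs_if)
      show ?case
        unfolding tx prod.case
      proof
        assume "(t, x) \<in> {0<..<T} \<times> {0<..<1}"
        then have t: "0 < t" "t < T" and x: "0 < x" "x < 1" by auto
        let ?F = "F_term a (\<lambda>t x. wave f t (- x)) (\<lambda>t x. wave f t x)"
        let ?G = "G_term a (\<lambda>t x. wave f t (- x)) (\<lambda>t x. wave f t x)"
        have left: "wave f t (- (x + t) + t) = wave f \<tau> (- (x + t) + \<tau>) + (LINT s|lebesgue_on {\<tau><..<t}. ?F s (x + t - s))"
          if \<tau>: "0 \<le> \<tau>" "\<tau> \<le> t" "x + t - 1 \<le> \<tau>" for \<tau>
        proof -
          \<comment> \<open>L compares a with \<alpha> only before time x + t, when the
            characteristic leaves the left half of the circle; from time t on, a is replaced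
            by \<alpha>.\<close>
          define a' where "a' s y = (if s < t then a s y else \<alpha> s y)" for s y
          have cong: "(LINT s|lebesgue_on {\<tau><..<t}. ?F s (x + t - s)) =
             (LINT s|lebesgue_on {\<tau><..<t}. (- 1) * (1 / 2) * a' s \<bar>- (x + t) + s\<bar> * (wave f s (- \<bar>- (x + t) + s\<bar>) - wave f s \<bar>- (x + t) + s\<bar>))"
            using x by (intro Bochner_Integration.integral_cong) (auto simp: F_term_def a'_def abs_if algebra_simps)
          show ?thesis
            unfolding cong
          proof (rule wave_along_characteristic[OF d \<tau>(1) _ _ _ \<tau>(2) refl])
            show "AE s in lborel. 0 < s \<and> \<bar>- (x + t) + s\<bar> \<in> {0<..<1} \<longrightarrow> a' s \<bar>- (x + t) + s\<bar> = \<alpha> s \<bar>- (x + t) + s\<bar>"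
              using L by eventually_elim (use x in \<open>auto simp: a'_def\<close>)
            show "\<bar>- (x + t) + s\<bar> \<in> {0<..<1} \<and> sgn (- (x + t) + s) = - 1" if "\<tau> < s" "s < t" for s
              using that \<tau> x by (auto simp: abs_if sgn_if)
          qed simp
        qed
        have right: "wave f t ((x - t) + t) = wave f \<tau> ((x - t) + \<tau>) + (LINT s|lebesgue_on {\<tau><..<t}. ?G s (x - t + s))"
          if \<tau>: "0 \<le> \<tau>" "\<tau> \<le> t" "t - x \<le> \<tau>" for \<tau>
        proof -
          \<comment> \<open>Likewise R compares the two only after time t - x, when the
            characteristic enters the right half.\<close>
          define a' where "a' s y = (if t - x < s then a s y else \<alpha> s y)" for s y
          have cong: "(LINT s|lebesgue_on {\<tau><..<t}. ?G s (x - t + s)) =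
             (LINT s|lebesgue_on {\<tau><..<t}. 1 * (1 / 2) * a' s \<bar>(x - t) + s\<bar> * (wave f s (- \<bar>(x - t) + s\<bar>) - wave f s \<bar>(x - t) + s\<bar>))"
            using x \<tau> by (intro Bochner_Integration.integral_cong) (auto simp: G_term_def a'_def abs_if algebra_simps)
          show ?thesis
            unfolding cong
          proof (rule wave_along_characteristic[OF d \<tau>(1) _ _ _ \<tau>(2) refl])
            show "AE s in lborel. 0 < s \<and> \<bar>(x - t) + s\<bar> \<in> {0<..<1} \<longrightarrow> a' s \<bar>(x - t) + s\<bar> = \<alpha> s \<bar>(x - t) + s\<bar>"
              using R by eventually_elim (auto simp: a'_def)
            show "\<bar>(x - t) + s\<bar> \<in> {0<..<1} \<and> sgn ((x - t) + s) = 1" if "\<tau> < s" "s < t" for s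
              using that \<tau> x by (auto simp: abs_if sgn_if)
          qed simp
        qed
        have start: "wave f 0 y = f y" for y by (simp add: wave_def flow_start[OF d])
        show "characteristic_rules a \<rho>0 \<xi>0 (\<lambda>t x. wave f t (- x)) (\<lambda>t x. wave f t x) t x"
          unfolding characteristic_rules_def
        proof (intro conjI impI)
          assume "x + t < 1"
          then show "wave f t (- x) = \<rho>0 (x + t) + (LINT s|lebesgue_on {0<..<t}. ?F s (x + t - s))"
            using left[of 0] e(3) t x by (simp add: start)
        next
          assume "1 < x + t"
          then show "wave f t (- x) = wave f (t + x - 1) (- 1) + (LINT s|lebesgue_on {t + x - 1<..<t}. ?F s (x + t - s))"
            using left[of "t + x - 1"] t x by simp
        next
          assume "t < x"
          then show "wave f t x = \<xi>0 (x - t) + (LINT s|lebesgue_on {0<..<t}. ?G s (x - t + s))"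
            using right[of 0] e(4) t x by (simp add: start)
        next
          assume "x < t"
          then show "wave f t x = wave f (t - x) 0 + (LINT s|lebesgue_on {t - x<..<t}. ?G s (x - t + s))"
            using right[of "t - x"] t x by simp
        qed
      qed
    qed
    moreover have "{0<..<T} \<times> {0<..<1::real} \<in> sets borel"
      by (intro borel_open open_Times) auto
    ultimately show ?thesis
      by (subst AE_lebesgue_on_iff) (auto elim!: eventually_mono)
  qed
  moreover have "AE t in lebesgue_on {0<..<T}. wave f t (- 0) = wave f t 0 \<and> wave f t (- 1) = wave f t 1"
    using wave_periodic[OF d, of _ "- 1"] by (intro AE_I2) simp
  ultimately show ?thesis
    unfolding broad_solution_def using meas by simp
qed

end

section \<open>Uniqueness along complete characteristics\<close>

lemma per_mono_AE:
  assumes "AE z in lborel. f z \<le> g z"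
  shows "per f \<le> per g"
  unfolding per_def using assms
  by (intro nn_integral_mono_AE) (auto elim!: eventually_mono intro: mult_right_mono)

lemma AE_periodic2_finite:
  assumes f [measurable]: "f \<in> borel_measurable borel" and "periodic2 f" "per f < \<infinity>"
  shows "AE z in lborel. f z < \<infinity>"
proof -
  have "AE z in lborel. f z * indicator {- real n..real n} z \<noteq> \<infinity>" for n
    using periodic2_integral_finite[OF assms, of "- real n" "real n"]
    by (intro nn_integral_noteq_infinite) (auto simp: less_top)
  then have "AE z in lborel. \<forall>n. f z * indicator {- real n..real n} z \<noteq> \<infinity>"
    by (simp add: AE_all_countable)
  then show ?thesis
  proof eventually_elim
    case (elim z)
    obtain n where "\<bar>z\<bar> \<le> real n" using real_arch_simple by blast
    then have "z \<in> {- real n..real n}" by auto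
    then show ?case using elim[rule_format, of n] by (simp add: less_top)
  qed
qed

lemma AE_periodic2_zero:
  assumes f [measurable]: "f \<in> borel_measurable borel" and "periodic2 f" "per f = 0"
  shows "AE z in lborel. f z = 0"
proof -
  have "(\<lambda>z. top * f z) \<in> borel_measurable borel" by measurable
  moreover have "periodic2 (\<lambda>z. top * f z)" using assms(2) by (simp add: periodic2_def)
  moreover have "per (\<lambda>z. top * f z) = 0" using assms(3) per_cmult[OF f] by simp
  ultimately have "AE z in lborel. top * f z < \<infinity>" by (intro AE_periodic2_finite) auto
  then show ?thesis by eventually_elim (auto simp: ennreal_mult_less_top)
qed

text \<open>
  A property that holds almost everywhere can be used along a sequence tending to zero.
\<close>

lemma AE_lborel_ex_in_interval:
  assumes "AE h in lborel. P h" "0 < (d :: real)"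
  shows "\<exists>h. 0 < h \<and> h < d \<and> P h"
proof (rule ccontr)
  assume "\<not> (\<exists>h. 0 < h \<and> h < d \<and> P h)"
  with assms(1) have "AE h in lborel. h \<notin> {0<..<d}" by (auto elim!: eventually_mono)
  then have "emeasure lborel {0<..<d} = 0"
    by (subst (asm) AE_iff_measurable[of "{0<..<d}"]) auto
  then show False using assms(2) by simp
qed

lemma AE_lborel_reflect:
  assumes "AE q in lborel. P (q :: real)"
  shows "AE h in lborel. P (x - h)"
proof -
  obtain N where N: "N \<in> null_sets lborel" "{q. \<not> P q} \<subseteq> N"
    using assms by (auto simp: eventually_ae_filter)
  have [measurable]: "N \<in> sets borel" using N by auto
  have "AE h in lborel. x + (-1) * h \<notin> N"
    by (rule AE_borel_affine[OF _ _ AE_not_in[OF N(1)]]) auto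
  then show ?thesis using N(2) by (auto elim!: eventually_mono)
qed

lemma nn_integral_power:
  fixes b C :: real
  assumes "0 \<le> b" "0 \<le> C" "0 \<le> t"
  shows "(\<integral>\<^sup>+r\<in>{0..t}. ennreal b * ennreal (C * (b * r) ^ n / fact n) \<partial>lborel) = ennreal (C * (b * t) ^ Suc n / fact (Suc n))"
proof -
  have "(\<integral>\<^sup>+r\<in>{0..t}. ennreal b * ennreal (C * (b * r) ^ n / fact n) \<partial>lborel) =
      (\<integral>\<^sup>+r\<in>{0..t}. ennreal (b * (C * (b * r) ^ n / fact n)) \<partial>lborel)"
    using assms by (intro nn_integral_cong) (auto simp: indicator_def ennreal_mult[symmetric])
  also have "\<dots> = ennreal (C * (b * t) ^ Suc n / fact (Suc n) - C * (b * 0) ^ Suc n / fact (Suc n))"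
  proof (rule nn_integral_FTC_Icc)
    fix r assume "r \<in> {0..t}"
    show "((\<lambda>r. C * (b * r) ^ Suc n / fact (Suc n)) has_real_derivative b * (C * (b * r) ^ n / fact n)) (at r)"
      by (rule derivative_eq_intros refl | simp)+
  qed (use assms in auto)
  finally show ?thesis by simp
qed

context exchange
begin

lemma jump_periodic:
  assumes "\<And>t. periodic2 (w t)"
  shows "jump w r (z + 2) = jump w r z"
proof -
  have "w r (- (z + 2) - 2 * r) = w r (- z - 2 * r)"
    using assms[of r, unfolded periodic2_def, rule_format, of "- (z + 2) - 2 * r"] by (simp add: algebra_simps)
  then show ?thesis using assms[of r] by (simp add: jump_def rate_periodic periodic2_def)
qed

text \<open>
  The reflection \<open>z \<mapsto> -z-2r\<close> preserves the mass, so both terms of the jump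
  contribute at most \<open>c\<close> times the mass of \<open>w\<close>.
\<close>

lemma per_jump_le:
  assumes [measurable]: "w r \<in> borel_measurable borel" and "periodic2 (w r)"
  shows "per (\<lambda>z. ennreal \<bar>jump w r z\<bar>) \<le> ennreal (2 * c) * per (\<lambda>z. ennreal \<bar>w r z\<bar>)"
proof -
  define W where "W t z = ennreal \<bar>w t z\<bar>" for t z
  have [measurable]: "W r \<in> borel_measurable borel" unfolding W_def[abs_def] by measurable
  have P: "periodic2 (W r)" using assms(2) by (simp add: W_def periodic2_def)
  have "gain W r = (\<lambda>z. ennreal (c - k r z) * W r z + ennreal (k r z) * W r (- z - 2 * r))"
    by (simp add: gain_def fun_eq_iff)
  then have [measurable]: "gain W r \<in> borel_measurable borel" by simp
  have "per (\<lambda>z. ennreal \<bar>jump w r z\<bar>) \<le> per (\<lambda>z. gain W r z + ennreal c * W r z)"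
  proof (rule per_mono)
    fix z
    have "\<bar>jump w r z\<bar> \<le> k r z * \<bar>w r (- z - 2 * r)\<bar> + k r z * \<bar>w r z\<bar>"
      unfolding jump_def abs_mult using rate_nonneg[of r z]
      by (simp add: distrib_left[symmetric] mult_left_mono abs_triangle_ineq4)
    also have "\<dots> \<le> (c - k r z) * \<bar>w r z\<bar> + k r z * \<bar>w r (- z - 2 * r)\<bar> + c * \<bar>w r z\<bar>"
      using rate_le[of r z] mult_right_mono[OF rate_le[of r z], of "\<bar>w r z\<bar>"] by (simp add: add_increasing)
    finally have "ennreal \<bar>jump w r z\<bar> \<le> ennreal ((c - k r z) * \<bar>w r z\<bar> + k r z * \<bar>w r (- z - 2 * r)\<bar> + c * \<bar>w r z\<bar>)"
      by (rule ennreal_leI)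
    also have "\<dots> = gain W r z + ennreal c * W r z"
      using rate_nonneg[of r z] rate_le[of r z] bound_nonneg
      by (simp add: gain_def W_def ennreal_mult)
    finally show "ennreal \<bar>jump w r z\<bar> \<le> gain W r z + ennreal c * W r z" .
  qed
  also have "\<dots> = ennreal c * per (W r) + ennreal c * per (W r)"
    by (subst per_add) (auto simp: per_gain[where w = W and r = r, OF _ P] per_cmult)
  also have "\<dots> = ennreal (2 * c) * per (W r)"
  proof -
    have "ennreal (2 * c) = ennreal c + ennreal c" using bound_nonneg by (simp add: ennreal_plus[symmetric] del: ennreal_plus)
    then show ?thesis by (simp only: distrib_right)
  qed
  finally show ?thesis by (simp add: W_def[abs_def])
qed

lemma per_integral_jump_le:
  assumes w: "case_prod w \<in> borel_measurable (borel \<Otimes>\<^sub>M borel)" and per: "\<And>t. periodic2 (w t)"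
  shows "per (\<lambda>z. \<integral>\<^sup>+r\<in>{0..t}. ennreal \<bar>jump w r z\<bar> \<partial>lborel) \<le>
    (\<integral>\<^sup>+r\<in>{0..t}. ennreal (2 * c) * per (\<lambda>z. ennreal \<bar>w r z\<bar>) \<partial>lborel)"
proof -
  note [measurable] = borel_pair_compose[OF jump_measurable[OF w]] borel_pair_compose[OF w]
  have "case_prod (\<lambda>r z. ennreal \<bar>jump w r z\<bar>) \<in> borel_measurable (borel \<Otimes>\<^sub>M borel)" by measurable
  then have "per (\<lambda>z. \<integral>\<^sup>+r\<in>{0..t}. ennreal \<bar>jump w r z\<bar> \<partial>lborel) = (\<integral>\<^sup>+r\<in>{0..t}. per (\<lambda>z. ennreal \<bar>jump w r z\<bar>) \<partial>lborel)"
    by (rule per_integral)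
  also have "\<dots> \<le> (\<integral>\<^sup>+r\<in>{0..t}. ennreal (2 * c) * per (\<lambda>z. ennreal \<bar>w r z\<bar>) \<partial>lborel)"
    by (intro nn_integral_mono mult_right_mono per_jump_le per) auto
  finally show ?thesis .
qed

text \<open>
  The mass of the time integral is finite, so the time integral is finite for almost every
  characteristic. A countable set of end times suffices by monotonicity.
\<close>

lemma jump_integrable:
  assumes w: "case_prod w \<in> borel_measurable (borel \<Otimes>\<^sub>M borel)" and per: "\<And>t. periodic2 (w t)"
    and bound: "\<And>T. \<exists>C. AE t in lborel. 0 < t \<and> t < T \<longrightarrow> per (\<lambda>z. ennreal \<bar>w t z\<bar>) \<le> ennreal C"
  shows "per (\<lambda>z. \<integral>\<^sup>+r\<in>{0..T}. ennreal \<bar>jump w r z\<bar> \<partial>lborel) < \<infinity>"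
    and "AE z in lborel. \<forall>n. (\<integral>\<^sup>+r\<in>{0..real n}. ennreal \<bar>jump w r z\<bar> \<partial>lborel) < \<infinity>"
proof -
  note [measurable] = borel_pair_compose[OF jump_measurable[OF w]] borel_pair_compose[OF w]
  show fin: "per (\<lambda>z. \<integral>\<^sup>+r\<in>{0..T}. ennreal \<bar>jump w r z\<bar> \<partial>lborel) < \<infinity>" for T
  proof -
    obtain C where C: "AE t in lborel. 0 < t \<and> t < T \<longrightarrow> per (\<lambda>z. ennreal \<bar>w t z\<bar>) \<le> ennreal C"
      using bound by blast
    note per_integral_jump_le[OF w per, of T]
    also have "(\<integral>\<^sup>+r\<in>{0..T}. ennreal (2 * c) * per (\<lambda>z. ennreal \<bar>w r z\<bar>) \<partial>lborel) \<le> (\<integral>\<^sup>+r\<in>{0..T}. ennreal (2 * c) * ennreal C \<partial>lborel)"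
    proof (rule nn_integral_mono_AE)
      show "AE r in lborel. ennreal (2 * c) * per (\<lambda>z. ennreal \<bar>w r z\<bar>) * indicator {0..T} r \<le> ennreal (2 * c) * ennreal C * indicator {0..T} r"
        using C AE_lborel_singleton[of "0::real"] AE_lborel_singleton[of T]
        by eventually_elim (auto simp: indicator_def intro!: mult_left_mono)
    qed
    also have "\<dots> < \<infinity>"
      by (subst nn_integral_cmult_indicator) (auto simp: ennreal_mult_less_top emeasure_lborel_Icc_eq)
    finally show ?thesis .
  qed
  have "AE z in lborel. (\<integral>\<^sup>+r\<in>{0..real n}. ennreal \<bar>jump w r z\<bar> \<partial>lborel) < \<infinity>" for n
  proof (rule AE_periodic2_finite[OF _ _ fin])
    show "periodic2 (\<lambda>z. \<integral>\<^sup>+r\<in>{0..real n}. ennreal \<bar>jump w r z\<bar> \<partial>lborel)"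
      using jump_periodic[OF per] by (simp add: periodic2_def)
  qed measurable
  then show "AE z in lborel. \<forall>n. (\<integral>\<^sup>+r\<in>{0..real n}. ennreal \<bar>jump w r z\<bar> \<partial>lborel) < \<infinity>"
    by (simp add: AE_all_countable)
qed

lemma jump_set_integrable:
  assumes w: "case_prod w \<in> borel_measurable (borel \<Otimes>\<^sub>M borel)"
    and fin: "\<forall>n. (\<integral>\<^sup>+r\<in>{0..real n}. ennreal \<bar>jump w r z\<bar> \<partial>lborel) < \<infinity>"
  shows "set_integrable lborel {0..t} (\<lambda>r. jump w r z)"
proof -
  note [measurable] = borel_pair_compose[OF jump_measurable[OF w]]
  obtain n where n: "t \<le> real n" using real_arch_simple by blast
  have "set_integrable lborel {0..real n} (\<lambda>r. \<bar>jump w r z\<bar>)"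
    by (rule set_lebesgue_integral_eq_nn(1)) (use fin in auto)
  then have "set_integrable lborel {0..t} (\<lambda>r. \<bar>jump w r z\<bar>)"
    by (rule set_integrable_subset) (use n in auto)
  then show ?thesis
    by (rule set_integrable_bound) (auto simp: set_borel_measurable_def)
qed

text \<open>
  The mass \<open>e\<close> of the difference to the flow satisfies \<open>e(t) \<le> 2c
  \<integral> e\<close> and is bounded on bounded intervals. Iterating the inequality bounds it
  by \<open>C (2ct)\<^sup>n / n!\<close> for every \<open>n\<close>, hence it vanishes.
\<close>

lemma lagrangian_unique:
  assumes d: "datum f" and w: "case_prod w \<in> borel_measurable (borel \<Otimes>\<^sub>M borel)" and per: "\<And>t. periodic2 (w t)"
    and bound: "\<And>T. \<exists>C. AE t in lborel. 0 < t \<and> t < T \<longrightarrow> per (\<lambda>z. ennreal \<bar>w t z\<bar>) \<le> ennreal C"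
    and eq: "AE (t, z) in lborel. 0 < t \<longrightarrow> w t z = f z + (LINT r:{0..t}|lborel. jump w r z)"
  shows "AE t in lborel. 0 < t \<longrightarrow> (AE z in lborel. w t z = flow f t z)"
proof -
  define D where "D t z = w t z - flow f t z" for t z
  define e where "e t = per (\<lambda>z. ennreal \<bar>D t z\<bar>)" for t
  note fm = flow_measurable[OF d]
  note [measurable] = borel_pair_compose[OF w] borel_pair_compose[OF fm]
  have D: "case_prod D \<in> borel_measurable (borel \<Otimes>\<^sub>M borel)" unfolding D_def by measurable
  note [measurable] = borel_pair_compose[OF D] borel_pair_compose[OF jump_measurable[OF D]]
  have Dper: "periodic2 (D t)" for t
    using per[of t] flow_periodic[OF d, of t] by (simp add: D_def periodic2_def)
  have step: "AE t in lborel. 0 < t \<longrightarrow> e t \<le> (\<integral>\<^sup>+r\<in>{0..t}. ennreal (2 * c) * e r \<partial>lborel)"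
  proof -
    have "AE z in lborel. \<forall>n. (\<integral>\<^sup>+r\<in>{0..real n}. ennreal \<bar>jump w r z\<bar> \<partial>lborel) < \<infinity>"
      by (rule jump_integrable(2)[OF w per bound])
    then have "AE (t, z) in lborel. \<forall>n. (\<integral>\<^sup>+r\<in>{0..real n}. ennreal \<bar>jump w r (z + 0 * t)\<bar> \<partial>lborel) < \<infinity>"
      by (rule AE_lborel_pair_shear)
    with eq have "AE (t, z) in lborel. 0 < t \<longrightarrow> ennreal \<bar>D t z\<bar> \<le> (\<integral>\<^sup>+r\<in>{0..t}. ennreal \<bar>jump D r z\<bar> \<partial>lborel)"
    proof eventually_elim
      case (elim tz)
      obtain t z where tz: "tz = (t, z)" by force
      show ?case
        unfolding tz prod.case
      proof
        assume t: "0 < t"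
        have int: "set_integrable lborel {0..t} (\<lambda>r. jump w r z)" "set_integrable lborel {0..t} (\<lambda>r. jump (flow f) r z)"
          using elim(2) jump_set_integrable[OF w, of z] flow_increment(1)[OF d, of 0 t z] t by (auto simp: tz)
        have D_jump: "jump D r z = jump w r z - jump (flow f) r z" for r
          by (simp add: jump_def D_def algebra_simps)
        have "D t z = (LINT r:{0..t}|lborel. jump w r z) - (LINT r:{0..t}|lborel. jump (flow f) r z)"
          using elim(1) t flow_increment(2)[OF d, of 0 t z] flow_start[OF d, of 0 z] by (simp add: tz D_def)
        also have "\<dots> = (LINT r:{0..t}|lborel. jump D r z)"
          unfolding D_jump using int by (intro set_integral_diff(2)[symmetric])
        finally have Dt: "D t z = (LINT r:{0..t}|lborel. jump D r z)" .
        have "ennreal (norm (LINT r:{0..t}|lborel. jump D r z)) \<le> (\<integral>\<^sup>+r. ennreal (norm (indicator {0..t} r *\<^sub>R jump D r z)) \<partial>lborel)"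
          unfolding set_lebesgue_integral_def by (rule integral_norm_bound_ennreal)
             (use set_integral_diff(1)[OF int] in \<open>simp add: D_jump set_integrable_def\<close>)
        also have "\<dots> = (\<integral>\<^sup>+r\<in>{0..t}. ennreal \<bar>jump D r z\<bar> \<partial>lborel)"
          by (intro nn_integral_cong) (auto simp: indicator_def)
        finally show "ennreal \<bar>D t z\<bar> \<le> (\<integral>\<^sup>+r\<in>{0..t}. ennreal \<bar>jump D r z\<bar> \<partial>lborel)"
          unfolding Dt by simp
      qed
    qed
    then have "AE t in lborel. AE z in lborel. 0 < t \<longrightarrow> ennreal \<bar>D t z\<bar> \<le> (\<integral>\<^sup>+r\<in>{0..t}. ennreal \<bar>jump D r z\<bar> \<partial>lborel)"
      unfolding lborel_prod[symmetric] by (auto dest: lborel_pair.AE_pair)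
    then show ?thesis
    proof eventually_elim
      case (elim t)
      show ?case
      proof
        assume "0 < t"
        with elim have "AE z in lborel. ennreal \<bar>D t z\<bar> \<le> (\<integral>\<^sup>+r\<in>{0..t}. ennreal \<bar>jump D r z\<bar> \<partial>lborel)" by simp
        then have "e t \<le> per (\<lambda>z. \<integral>\<^sup>+r\<in>{0..t}. ennreal \<bar>jump D r z\<bar> \<partial>lborel)"
          unfolding e_def by (rule per_mono_AE)
        also have "\<dots> \<le> (\<integral>\<^sup>+r\<in>{0..t}. ennreal (2 * c) * e r \<partial>lborel)"
          unfolding e_def by (rule per_integral_jump_le[OF D Dper])
        finally show "e t \<le> (\<integral>\<^sup>+r\<in>{0..t}. ennreal (2 * c) * e r \<partial>lborel)" .
      qed
    qed
  qed
  have bounded: "\<exists>C\<ge>0. AE t in lborel. 0 < t \<and> t < T \<longrightarrow> e t \<le> ennreal C" if T: "0 \<le> T" for T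
  proof -
    obtain C where C: "AE t in lborel. 0 < t \<and> t < T \<longrightarrow> per (\<lambda>z. ennreal \<bar>w t z\<bar>) \<le> ennreal C"
      using bound by blast
    obtain K M where KM: "1 \<le> K" "0 \<le> M" "\<And>t z. t \<le> T \<Longrightarrow> \<bar>flow f t z\<bar> \<le> K * (\<bar>f z\<bar> + M)"
      using flow_bound[OF d T] by blast
    have [measurable]: "f \<in> borel_measurable borel" using d by (simp add: datum_def)
    define X where "X = ennreal K * (per (\<lambda>z. ennreal \<bar>f z\<bar>) + 2 * ennreal M)"
    have X: "X < \<infinity>" unfolding X_def using d by (auto simp: datum_def ennreal_mult_less_top)
    have flow: "per (\<lambda>z. ennreal \<bar>flow f t z\<bar>) \<le> X" if "t \<le> T" for t
    proof -
      have "per (\<lambda>z. ennreal \<bar>flow f t z\<bar>) \<le> per (\<lambda>z. ennreal K * (ennreal \<bar>f z\<bar> + ennreal M))"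
        using KM that by (intro per_mono) (simp add: ennreal_mult[symmetric] ennreal_plus[symmetric] ennreal_leI del: ennreal_plus)
      also have "\<dots> = X" unfolding X_def by (simp add: per_cmult per_add per_const)
      finally show ?thesis .
    qed
    have "AE t in lborel. 0 < t \<and> t < T \<longrightarrow> e t \<le> ennreal (max 0 C + enn2real X)"
      using C
    proof eventually_elim
      case (elim t)
      show ?case
      proof
        assume t: "0 < t \<and> t < T"
        have "e t \<le> per (\<lambda>z. ennreal \<bar>w t z\<bar> + ennreal \<bar>flow f t z\<bar>)"
          unfolding e_def D_def by (intro per_mono) (simp add: ennreal_plus[symmetric] ennreal_leI del: ennreal_plus)
        also have "\<dots> = per (\<lambda>z. ennreal \<bar>w t z\<bar>) + per (\<lambda>z. ennreal \<bar>flow f t z\<bar>)"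
          by (rule per_add) auto
        also have "\<dots> \<le> ennreal (max 0 C) + ennreal (enn2real X)"
          using elim t flow[of t] X by (intro add_mono) (auto simp: max_def ennreal_neg)
        finally show "e t \<le> ennreal (max 0 C + enn2real X)" by (simp add: ennreal_plus)
      qed
    qed
    then show ?thesis by (intro exI[of _ "max 0 C + enn2real X"]) auto
  qed
  have zero: "AE t in lborel. 0 < t \<and> t < real N \<longrightarrow> e t = 0" for N
  proof -
    obtain C where C: "0 \<le> C" "AE t in lborel. 0 < t \<and> t < real N \<longrightarrow> e t \<le> ennreal C"
      using bounded[of "real N"] by auto
    have "AE t in lborel. 0 < t \<and> t < real N \<longrightarrow> e t \<le> ennreal (C * ((2 * c) * t) ^ n / fact n)" for n
    proof (induction n)
      case 0
      then show ?case using C(2) by simp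
    next
      case (Suc n)
      from step show ?case
      proof eventually_elim
        case (elim t)
        show ?case
        proof
          assume t: "0 < t \<and> t < real N"
          have "e t \<le> (\<integral>\<^sup>+r\<in>{0..t}. ennreal (2 * c) * e r \<partial>lborel)" using elim t by simp
          also have "\<dots> \<le> (\<integral>\<^sup>+r\<in>{0..t}. ennreal (2 * c) * ennreal (C * ((2 * c) * r) ^ n / fact n) \<partial>lborel)"
          proof (rule nn_integral_mono_AE)
            show "AE r in lborel. ennreal (2 * c) * e r * indicator {0..t} r \<le> ennreal (2 * c) * ennreal (C * ((2 * c) * r) ^ n / fact n) * indicator {0..t} r"
              using Suc AE_lborel_singleton[of "0::real"]
              by eventually_elim (use t in \<open>auto simp: indicator_def intro!: mult_left_mono\<close>)
          qed
          also have "\<dots> = ennreal (C * ((2 * c) * t) ^ Suc n / fact (Suc n))"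
            using t C bound_nonneg by (intro nn_integral_power) auto
          finally show "e t \<le> ennreal (C * ((2 * c) * t) ^ Suc n / fact (Suc n))" .
        qed
      qed
    qed
    then have "AE t in lborel. \<forall>n. 0 < t \<and> t < real N \<longrightarrow> e t \<le> ennreal (C * ((2 * c) * t) ^ n / fact n)"
      unfolding AE_all_countable by blast
    then show ?thesis
    proof eventually_elim
      case (elim t)
      show ?case
      proof
        assume t: "0 < t \<and> t < real N"
        have "(\<lambda>n. ((2 * c) * t) ^ n / fact n) \<longlonglongrightarrow> 0"
          using summable_LIMSEQ_zero[OF sums_summable[OF exp_converges[of "(2 * c) * t"]]] by (simp add: field_simps)
        then have "(\<lambda>n. C * (((2 * c) * t) ^ n / fact n)) \<longlonglongrightarrow> C * 0"
          by (intro tendsto_mult tendsto_const)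
        then have "(\<lambda>n. ennreal (C * ((2 * c) * t) ^ n / fact n)) \<longlonglongrightarrow> ennreal 0"
          by (intro tendsto_ennrealI) simp
        then have "e t \<le> ennreal 0"
          by (rule tendsto_lowerbound) (use elim t in auto)
        then show "e t = 0" by simp
      qed
    qed
  qed
  then have "AE t in lborel. \<forall>N. 0 < t \<and> t < real N \<longrightarrow> e t = 0"
    unfolding AE_all_countable by blast
  then show ?thesis
  proof eventually_elim
    case (elim t)
    show ?case
    proof
      assume "0 < t"
      obtain N where "t < real N" using reals_Archimedean2 by blast
      with elim \<open>0 < t\<close> have "per (\<lambda>z. ennreal \<bar>D t z\<bar>) = 0" by (auto simp: e_def)
      then have "AE z in lborel. ennreal \<bar>D t z\<bar> = 0"
        using Dper[of t] by (intro AE_periodic2_zero) (auto simp: periodic2_def)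
      then show "AE z in lborel. w t z = flow f t z"
        by eventually_elim (simp add: D_def)
    qed
  qed
qed

text \<open>
  Along almost every characteristic \<open>w\<close> agrees, before the time \<open>n -
  z\<close> at which the integer point \<open>n\<close> is reached, with a function
  \<open>W\<close> that is continuous in time. At the points \<open>n - h\<close> the function
  \<open>w\<close> tends to the trace \<open>g\<close> in \<open>L\<^sup>1\<close> as \<open>h
  \<rightarrow> 0\<close>, and \<open>W\<close> tends to its value at \<open>n\<close>.
  Comparing the two limits identifies the trace with \<open>W\<close>.

  The number \<open>k'\<close> counts the integer points that the characteristic has crossed
  already. The distance \<open>\<eta>\<close> from the right end of the unit interval ensures
  that positions \<open>n - h\<close> with \<open>h < \<eta>\<close> are reached at positive
  times.
\<close>

lemma trace_from_inside:
  fixes m :: int and k' :: nat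
  defines "n \<equiv> m + int k' + 1"
  assumes f: "datum f" and w: "case_prod w \<in> borel_measurable (borel \<Otimes>\<^sub>M borel)" and per: "\<And>t. periodic2 (w t)"
    and bound: "\<And>T. \<exists>C. AE t in lborel. 0 < t \<and> t < T \<longrightarrow> per (\<lambda>z. ennreal \<bar>w t z\<bar>) \<le> ennreal C"
    and g: "locally_Lp 1 g"
    and trace: "\<And>T e. 0 < e \<Longrightarrow> \<exists>d>0. AE h in lborel. 0 < h \<and> h < d \<longrightarrow>
       (\<integral>\<^sup>+t\<in>{0..T}. ennreal \<bar>w t (real_of_int n - h - t) - g t\<bar> \<partial>lborel) \<le> ennreal e"
    and inside: "AE (t, z) in lborel. 0 < t \<and> \<lfloor>z + t\<rfloor> = \<lfloor>z\<rfloor> + int k' \<longrightarrow>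
       w t z = f z + (LINT r:{0..t}|lborel. jump w r z)"
    and \<eta>: "0 < \<eta>" "\<eta> \<le> 1"
  shows "AE z in lborel. z \<in> {real_of_int m..real_of_int m + 1 - \<eta>} \<longrightarrow>
    g (real_of_int n - z) = f z + (LINT r:{0..real_of_int n - z}|lborel. jump w r z)"
proof -
  note [measurable] = borel_pair_compose[OF w] borel_pair_compose[OF jump_measurable[OF w]]
  have [measurable]: "f \<in> borel_measurable borel" and fper: "periodic2 f" and ffin: "per (\<lambda>z. ennreal \<bar>f z\<bar>) < \<infinity>"
    using f by (auto simp: datum_def)
  have [measurable]: "g \<in> borel_measurable borel" using g by (simp add: locally_Lp_def)
  define Q where "Q z = (\<integral>\<^sup>+r\<in>{0..real k' + 1}. ennreal \<bar>jump w r z\<bar> \<partial>lborel)" for z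
  have [measurable]: "Q \<in> borel_measurable borel" unfolding Q_def[abs_def] by measurable
  have Qper: "periodic2 Q" using jump_periodic[OF per] by (simp add: periodic2_def Q_def)
  have Qfin: "per Q < \<infinity>" unfolding Q_def[abs_def] by (rule jump_integrable(1)[OF w per bound])
  define S where "S = {real_of_int m..real_of_int m + 1 - \<eta>}"
  define Z where "Z = {z \<in> S. Q z < \<infinity>}"
  have [measurable]: "S \<in> sets borel" "Z \<in> sets borel" unfolding S_def Z_def by measurable
  have AEZ: "AE z in lborel. z \<in> S \<longrightarrow> z \<in> Z"
    using AE_periodic2_finite[OF _ Qper Qfin] by (auto simp: Z_def elim!: eventually_mono)
  \<comment> \<open>Written as an integral over the whole line so that joint measurability is
    evident.\<close>
  define W where "W t z = f z + (LINT r|lborel. (if 0 \<le> r \<and> r \<le> t then jump w r z else 0))" for t z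
  have W: "W t z = f z + (LINT r:{0..t}|lborel. jump w r z)" for t z
    unfolding W_def set_lebesgue_integral_def by (intro arg_cong[of _ _ "\<lambda>x. f z + x"] Bochner_Integration.integral_cong) auto
  have Wm: "case_prod W \<in> borel_measurable (borel \<Otimes>\<^sub>M borel)" unfolding W_def by measurable
  note [measurable] = borel_pair_compose[OF Wm]
  have int: "set_integrable lborel {0..real k' + 1} (\<lambda>r. jump w r z)" if "z \<in> Z" for z
  proof -
    have "set_integrable lborel {0..real k' + 1} (\<lambda>r. \<bar>jump w r z\<bar>)"
      by (rule set_lebesgue_integral_eq_nn(1)) (use that in \<open>auto simp: Z_def Q_def\<close>)
    then show ?thesis by (rule set_integrable_bound) (auto simp: set_borel_measurable_def)
  qed
  have int': "set_integrable lborel {0..t} (\<lambda>r. jump w r z)" if "z \<in> Z" "t \<le> real k' + 1" for z t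
    by (rule set_integrable_subset[OF int[OF that(1)]]) (use that in auto)
  have Wcont: "continuous_on {0..real k' + 1} (\<lambda>t. W t z)" if "z \<in> Z" for z
  proof -
    have "continuous_on {0..real k' + 1} (\<lambda>s. f z + integral {0..s} (\<lambda>r. jump w r z))"
      using set_borel_integral_eq_integral(1)[OF int[OF that]]
      by (intro continuous_intros indefinite_integral_continuous_1)
    then show ?thesis
      by (rule continuous_on_eq) (use that in \<open>simp add: W set_borel_integral_eq_integral(2)[OF int'[OF that]]\<close>)
  qed
  have Wbound: "\<bar>W t z\<bar> \<le> \<bar>f z\<bar> + enn2real (Q z)" if "z \<in> Z" "t \<le> real k' + 1" for z t
  proof -
    have "ennreal (norm (LINT r:{0..t}|lborel. jump w r z)) \<le> (\<integral>\<^sup>+r. ennreal (norm (indicator {0..t} r *\<^sub>R jump w r z)) \<partial>lborel)"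
      unfolding set_lebesgue_integral_def by (rule integral_norm_bound_ennreal)
         (use int'[OF that] in \<open>simp add: set_integrable_def\<close>)
    also have "\<dots> \<le> Q z"
      unfolding Q_def using that(2) by (intro nn_integral_mono) (auto simp: indicator_def)
    also have "Q z = ennreal (enn2real (Q z))" using that(1) by (simp add: Z_def)
    finally have "\<bar>LINT r:{0..t}|lborel. jump w r z\<bar> \<le> enn2real (Q z)" by (simp add: ennreal_le_iff)
    then show ?thesis unfolding W by linarith
  qed
  have "AE q in lborel. AE t in lborel. 0 < t \<and> \<lfloor>(q + (-1) * t) + t\<rfloor> = \<lfloor>q + (-1) * t\<rfloor> + int k' \<longrightarrow> w t (q + (-1) * t) = W t (q + (-1) * t)"
    using AE_lborel_pair_characteristics[OF inside, of "-1"] unfolding W .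
  then have "AE q in lborel. AE t in lborel. 0 < t \<and> \<lfloor>q\<rfloor> = \<lfloor>q - t\<rfloor> + int k' \<longrightarrow> w t (q - t) = W t (q - t)" by simp
  then have good: "AE h in lborel. AE t in lborel. 0 < t \<and> \<lfloor>real_of_int n - h\<rfloor> = \<lfloor>real_of_int n - h - t\<rfloor> + int k' \<longrightarrow>
      w t (real_of_int n - h - t) = W t (real_of_int n - h - t)"
    by (rule AE_lborel_reflect)
  \<comment> \<open>A sequence of positions tending to n, at each of which w equals W for
    almost all times and the trace is approximated up to 1 / (j + 1).\<close>
  define R1 where "R1 h \<longleftrightarrow> (AE t in lborel. 0 < t \<and> \<lfloor>real_of_int n - h\<rfloor> = \<lfloor>real_of_int n - h - t\<rfloor> + int k' \<longrightarrow>
         w t (real_of_int n - h - t) = W t (real_of_int n - h - t))" for h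
  define R2 where "R2 j h \<longleftrightarrow> (\<integral>\<^sup>+t\<in>{0..real k' + 1}. ennreal \<bar>w t (real_of_int n - h - t) - g t\<bar> \<partial>lborel) \<le> ennreal (1 / real (Suc j))" for j h
  have "\<exists>h. 0 < h \<and> h < min \<eta> (1 / real (Suc j)) \<and> R1 h \<and> R2 j h" for j
  proof -
    obtain d where d: "0 < d" "AE h in lborel. 0 < h \<and> h < d \<longrightarrow> R2 j h"
      unfolding R2_def using trace[of "1 / real (Suc j)" "real k' + 1"] by auto
    have "0 < min d (min \<eta> (1 / real (Suc j)))" using d \<eta> by simp
    from AE_lborel_ex_in_interval[OF AE_conjI[OF good[folded R1_def] d(2)] this] show ?thesis by auto
  qed
  then have "\<forall>j. \<exists>h. 0 < h \<and> h < min \<eta> (1 / real (Suc j)) \<and> R1 h \<and> R2 j h" by blast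
  from choice[OF this] obtain h where hh: "\<forall>j. 0 < h j \<and> h j < min \<eta> (1 / real (Suc j)) \<and> R1 (h j) \<and> R2 j (h j)" ..
  then have h: "\<And>j. 0 < h j" "\<And>j. h j < min \<eta> (1 / real (Suc j))" and R12: "\<And>j. R1 (h j)" "\<And>j. R2 j (h j)"
    by blast+
  note h1 = R12(1)[unfolded R1_def] and h2 = R12(2)[unfolded R2_def]
  have inv0: "(\<lambda>j. 1 / real (Suc j)) \<longlonglongrightarrow> 0" using LIMSEQ_inverse_real_of_nat by (simp add: inverse_eq_divide)
  have hlim: "h \<longlonglongrightarrow> 0"
    by (rule tendsto_sandwich[OF _ _ tendsto_const inv0]) (use h in \<open>auto intro!: always_eventually less_imp_le\<close>)
  have h3: "AE z in lborel. z \<in> S \<longrightarrow> w (real_of_int n - h j - z) z = W (real_of_int n - h j - z) z" for j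
  proof -
    have "AE z in lborel. 0 < real_of_int n - h j - z \<and> \<lfloor>real_of_int n - h j\<rfloor> = \<lfloor>real_of_int n - h j - (real_of_int n - h j - z)\<rfloor> + int k' \<longrightarrow>
         w (real_of_int n - h j - z) (real_of_int n - h j - (real_of_int n - h j - z)) = W (real_of_int n - h j - z) (real_of_int n - h j - (real_of_int n - h j - z))"
      using h1[of j] by (rule AE_lborel_reflect)
    then show ?thesis
    proof eventually_elim
      case (elim z)
      show ?case
      proof
        assume z: "z \<in> S"
        have "\<lfloor>z\<rfloor> = m" using z \<eta> by (intro floor_unique) (auto simp: S_def)
        moreover have "\<lfloor>real_of_int n - h j\<rfloor> = n - 1" using h[of j] \<eta> by (intro floor_unique) auto
        moreover have "0 < real_of_int n - h j - z" using z h(2)[of j] by (auto simp: S_def n_def)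
        ultimately show "w (real_of_int n - h j - z) z = W (real_of_int n - h j - z) z"
          using elim by (simp add: n_def)
      qed
    qed
  qed
  \<comment> \<open>The distance of g to W is split at the trace shifted by h j and at w in
    the position n - h j.\<close>
  define D1 where "D1 j = (\<integral>\<^sup>+z\<in>S. ennreal \<bar>g (real_of_int n - z) - g (real_of_int n - h j - z)\<bar> \<partial>lborel)" for j
  define D2 where "D2 j = (\<integral>\<^sup>+z\<in>S. ennreal \<bar>g (real_of_int n - h j - z) - w (real_of_int n - h j - z) z\<bar> \<partial>lborel)" for j
  define D3 where "D3 j = (\<integral>\<^sup>+z\<in>Z. ennreal \<bar>W (real_of_int n - h j - z) z - W (real_of_int n - z) z\<bar> \<partial>lborel)" for j
  have D1: "D1 \<longlonglongrightarrow> 0"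
  proof -
    have "filterlim (\<lambda>j. - h j) (at 0) sequentially"
      using tendsto_minus[OF hlim] h(1) by (auto simp: filterlim_at less_imp_neq[symmetric] intro!: always_eventually)
    then have L: "(\<lambda>j. \<integral>\<^sup>+t\<in>{real_of_int n - (real_of_int m + 1 - \<eta>)..real_of_int n - real_of_int m}. ennreal (\<bar>g (t + - h j) - g t\<bar> powr 1) \<partial>lborel) \<longlonglongrightarrow> 0"
      by (rule filterlim_compose[OF Lp_translation_continuous[OF g order_refl]])
    have eq: "D1 j = (\<integral>\<^sup>+t\<in>{real_of_int n - (real_of_int m + 1 - \<eta>)..real_of_int n - real_of_int m}. ennreal (\<bar>g (t + - h j) - g t\<bar> powr 1) \<partial>lborel)" for j
    proof -
      have "D1 j = (\<integral>\<^sup>+z\<in>S. (\<lambda>t. ennreal (\<bar>g (t + - h j) - g t\<bar> powr 1)) (real_of_int n - z) \<partial>lborel)"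
        unfolding D1_def by (intro nn_integral_cong) (simp add: abs_minus_commute algebra_simps)
      then show ?thesis
        unfolding S_def by (simp only:) (rule nn_integral_Icc_reflect, measurable)
    qed
    show ?thesis by (rule Lim_transform_eventually[OF L always_eventually]) (simp only: eq simp_thms)
  qed
  have D2: "D2 \<longlonglongrightarrow> 0"
  proof (rule tendsto_sandwich[of "\<lambda>_. 0"])
    have "D2 j \<le> ennreal (1 / real (Suc j))" for j
    proof -
      have "D2 j = (\<integral>\<^sup>+z\<in>S. (\<lambda>t. ennreal \<bar>w t (real_of_int n - h j - t) - g t\<bar>) (real_of_int n - h j - z) \<partial>lborel)"
        unfolding D2_def by (intro nn_integral_cong) (simp add: abs_minus_commute)
      also have "\<dots> = (\<integral>\<^sup>+t\<in>{real_of_int n - h j - (real_of_int m + 1 - \<eta>)..real_of_int n - h j - real_of_int m}. ennreal \<bar>w t (real_of_int n - h j - t) - g t\<bar> \<partial>lborel)"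
        unfolding S_def by (rule nn_integral_Icc_reflect) measurable
      also have "\<dots> \<le> (\<integral>\<^sup>+t\<in>{0..real k' + 1}. ennreal \<bar>w t (real_of_int n - h j - t) - g t\<bar> \<partial>lborel)"
        using h[of j] by (intro nn_integral_mono) (auto simp: indicator_def n_def)
      also note h2
      finally show ?thesis .
    qed
    then show "\<forall>\<^sub>F j in sequentially. D2 j \<le> ennreal (1 / real (Suc j))" by (intro always_eventually) auto
    show "(\<lambda>j. ennreal (1 / real (Suc j))) \<longlonglongrightarrow> 0" using tendsto_ennrealI[OF inv0] by simp
  qed auto
  have D3: "D3 \<longlonglongrightarrow> 0"
  proof -
    have "(\<lambda>j. \<integral>\<^sup>+z\<in>Z. ennreal (\<bar>W (real_of_int n - h j - z) z - W (real_of_int n - z) z\<bar> powr 1) \<partial>lborel) \<longlonglongrightarrow> 0"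
    proof (rule Lp_dominated_convergence[where g = "\<lambda>z. \<bar>f z\<bar> + enn2real (Q z)"])
      show "\<bar>W (real_of_int n - h j - z) z\<bar> \<le> \<bar>f z\<bar> + enn2real (Q z)" if "z \<in> Z" for j z
        by (rule Wbound[OF that]) (use that h(1)[of j] in \<open>auto simp: Z_def S_def n_def\<close>)
      show "\<bar>W (real_of_int n - z) z\<bar> \<le> \<bar>f z\<bar> + enn2real (Q z)" if "z \<in> Z" for z
        by (rule Wbound[OF that]) (use that in \<open>auto simp: Z_def S_def n_def\<close>)
      show "AE z in lborel. z \<in> Z \<longrightarrow> (\<lambda>j. W (real_of_int n - h j - z) z) \<longlonglongrightarrow> W (real_of_int n - z) z"
      proof (intro AE_I2 impI)
        fix z assume z: "z \<in> Z"
        then have zS: "real_of_int m \<le> z" "z \<le> real_of_int m + 1 - \<eta>" by (auto simp: Z_def S_def)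
        have lim: "(\<lambda>j. real_of_int n - h j - z) \<longlonglongrightarrow> real_of_int n - 0 - z" by (intro tendsto_intros hlim)
        have "(\<lambda>j. W (real_of_int n - h j - z) z) \<longlonglongrightarrow> W (real_of_int n - 0 - z) z"
        proof (rule continuous_on_tendsto_compose[OF Wcont[OF z] lim])
          show "real_of_int n - 0 - z \<in> {0..real k' + 1}" using zS \<eta> by (auto simp: n_def)
          show "\<forall>\<^sub>F j in sequentially. real_of_int n - h j - z \<in> {0..real k' + 1}"
          proof (rule always_eventually, rule allI)
            fix j
            show "real_of_int n - h j - z \<in> {0..real k' + 1}" using zS h(1)[of j] h(2)[of j] by (auto simp: n_def)
          qed
        qed
        then show "(\<lambda>j. W (real_of_int n - h j - z) z) \<longlonglongrightarrow> W (real_of_int n - z) z" by simp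
      qed
      have "(\<integral>\<^sup>+z\<in>Z. ennreal (\<bar>\<bar>f z\<bar> + enn2real (Q z)\<bar> powr 1) \<partial>lborel) \<le>
          (\<integral>\<^sup>+z. ennreal \<bar>f z\<bar> * indicator S z + Q z * indicator S z \<partial>lborel)"
        by (intro nn_integral_mono) (auto simp: indicator_def Z_def ennreal_plus)
      also have "\<dots> = (\<integral>\<^sup>+z\<in>S. ennreal \<bar>f z\<bar> \<partial>lborel) + (\<integral>\<^sup>+z\<in>S. Q z \<partial>lborel)"
        by (rule nn_integral_add) auto
      also have "\<dots> < \<infinity>"
        using periodic2_integral_finite[of "\<lambda>z. ennreal \<bar>f z\<bar>"] periodic2_integral_finite[OF _ Qper Qfin] ffin fper
        by (auto simp: S_def periodic2_def)
      finally show "(\<integral>\<^sup>+z\<in>Z. ennreal (\<bar>\<bar>f z\<bar> + enn2real (Q z)\<bar> powr 1) \<partial>lborel) < \<infinity>" .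
    qed auto
    then show ?thesis unfolding D3_def by simp
  qed
  have le: "(\<integral>\<^sup>+z\<in>Z. ennreal \<bar>g (real_of_int n - z) - W (real_of_int n - z) z\<bar> \<partial>lborel) \<le> D1 j + (D2 j + D3 j)" for j
  proof -
    have "(\<integral>\<^sup>+z\<in>Z. ennreal \<bar>g (real_of_int n - z) - W (real_of_int n - z) z\<bar> \<partial>lborel) \<le>
      (\<integral>\<^sup>+z. ennreal \<bar>g (real_of_int n - z) - g (real_of_int n - h j - z)\<bar> * indicator S z +
        (ennreal \<bar>g (real_of_int n - h j - z) - w (real_of_int n - h j - z) z\<bar> * indicator S z +
         ennreal \<bar>W (real_of_int n - h j - z) z - W (real_of_int n - z) z\<bar> * indicator Z z) \<partial>lborel)"
    proof (rule nn_integral_mono_AE)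
      show "AE z in lborel. ennreal \<bar>g (real_of_int n - z) - W (real_of_int n - z) z\<bar> * indicator Z z \<le>
         ennreal \<bar>g (real_of_int n - z) - g (real_of_int n - h j - z)\<bar> * indicator S z +
        (ennreal \<bar>g (real_of_int n - h j - z) - w (real_of_int n - h j - z) z\<bar> * indicator S z +
         ennreal \<bar>W (real_of_int n - h j - z) z - W (real_of_int n - z) z\<bar> * indicator Z z)"
        using h3[of j]
      proof eventually_elim
        case (elim z)
        show ?case
        proof (cases "z \<in> Z")
          case True
          then have "z \<in> S" by (simp add: Z_def)
          have "\<bar>g (real_of_int n - z) - W (real_of_int n - z) z\<bar> \<le> \<bar>g (real_of_int n - z) - g (real_of_int n - h j - z)\<bar> +
            (\<bar>g (real_of_int n - h j - z) - w (real_of_int n - h j - z) z\<bar> + \<bar>W (real_of_int n - h j - z) z - W (real_of_int n - z) z\<bar>)"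
            using elim \<open>z \<in> S\<close> by linarith
          then show ?thesis
            using True \<open>z \<in> S\<close> by (simp add: ennreal_plus[symmetric] ennreal_leI del: ennreal_plus)
        qed simp
      qed
    qed
    also have "\<dots> = D1 j + (D2 j + D3 j)"
      unfolding D1_def D2_def D3_def by (simp add: nn_integral_add)
    finally show ?thesis .
  qed
  have "(\<lambda>j. D1 j + (D2 j + D3 j)) \<longlonglongrightarrow> 0 + (0 + 0)"
    by (intro tendsto_add D1 D2 D3)
  then have "(\<integral>\<^sup>+z\<in>Z. ennreal \<bar>g (real_of_int n - z) - W (real_of_int n - z) z\<bar> \<partial>lborel) \<le> 0"
    using le by (intro tendsto_lowerbound[where F = sequentially and f = "\<lambda>j. D1 j + (D2 j + D3 j)"]) auto
  then have "(\<integral>\<^sup>+z. ennreal \<bar>g (real_of_int n - z) - W (real_of_int n - z) z\<bar> * indicator Z z \<partial>lborel) = 0" by simp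
  then have "AE z in lborel. ennreal \<bar>g (real_of_int n - z) - W (real_of_int n - z) z\<bar> * indicator Z z = 0"
    by (subst (asm) nn_integral_0_iff_AE) auto
  with AEZ show ?thesis
  proof eventually_elim
    case (elim z)
    then show ?case unfolding W[symmetric] S_def[symmetric] by auto
  qed
qed

text \<open>
  By induction on the number of integer points crossed: on each unit segment the equation
  restarts from the trace \<open>g\<close> on its left end, and \<open>trace_from_inside\<close>
  says that this trace is what the equation on the previous segments predicts.
\<close>

lemma lagrangian_from_segments:
  assumes f: "datum f" and w: "case_prod w \<in> borel_measurable (borel \<Otimes>\<^sub>M borel)" and per: "\<And>t. periodic2 (w t)"
    and bound: "\<And>T. \<exists>C. AE t in lborel. 0 < t \<and> t < T \<longrightarrow> per (\<lambda>z. ennreal \<bar>w t z\<bar>) \<le> ennreal C"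
    and g: "\<And>n. locally_Lp 1 (g n)"
    and trace: "\<And>n T e. 0 < e \<Longrightarrow> \<exists>d>0. AE h in lborel. 0 < h \<and> h < d \<longrightarrow>
       (\<integral>\<^sup>+t\<in>{0..T}. ennreal \<bar>w t (real_of_int n - h - t) - g n t\<bar> \<partial>lborel) \<le> ennreal e"
    and initial: "AE (t, z) in lborel. 0 < t \<and> real_of_int \<lfloor>z + t\<rfloor> < z \<longrightarrow>
       w t z = f z + (LINT r:{0..t}|lborel. jump w r z)"
    and inflow: "AE (t, z) in lborel. 0 < t \<and> z < real_of_int \<lfloor>z + t\<rfloor> \<longrightarrow>
       w t z = g \<lfloor>z + t\<rfloor> (real_of_int \<lfloor>z + t\<rfloor> - z) + (LINT r:{real_of_int \<lfloor>z + t\<rfloor> - z..t}|lborel. jump w r z)"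
  shows "AE (t, z) in lborel. 0 < t \<longrightarrow> w t z = f z + (LINT r:{0..t}|lborel. jump w r z)"
proof -
  have noint: "AE (t, z) in (lborel :: (real \<times> real) measure). z \<notin> range real_of_int"
  proof -
    have "AE z in lborel. z \<notin> range real_of_int"
      by (intro AE_not_in countable_imp_null_set_lborel) auto
    then have "AE (t, z) in (lborel :: (real \<times> real) measure). z + 0 * t \<notin> range real_of_int"
      by (rule AE_lborel_pair_shear)
    then show ?thesis by simp
  qed
  \<comment> \<open>The characteristic z has crossed j integer points at time t.\<close>
  have seg: "AE (t, z) in lborel. 0 < t \<and> \<lfloor>z + t\<rfloor> = \<lfloor>z\<rfloor> + int j \<longrightarrow>
       w t z = f z + (LINT r:{0..t}|lborel. jump w r z)" for j
  proof (induction j)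
    case 0
    from initial noint show ?case
    proof eventually_elim
      case (elim tz)
      obtain t z where tz: "tz = (t, z)" by force
      have "z \<noteq> real_of_int \<lfloor>z\<rfloor>" using elim(2) unfolding tz by auto
      then have "real_of_int \<lfloor>z\<rfloor> < z" using of_int_floor_le[of z] by linarith
      then show ?case using elim(1) unfolding tz by auto
    qed
  next
    case (Suc j)
    have "AE z in lborel. z \<in> {real_of_int m..real_of_int m + 1 - 1 / real (Suc i)} \<longrightarrow>
        g (m + int j + 1) (real_of_int (m + int j + 1) - z) = f z + (LINT r:{0..real_of_int (m + int j + 1) - z}|lborel. jump w r z)" for m i
      by (rule trace_from_inside[OF f w per bound g trace Suc.IH]) auto
    then have "AE z in lborel. \<forall>m i. z \<in> {real_of_int m..real_of_int m + 1 - 1 / real (Suc i)} \<longrightarrow>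
        g (m + int j + 1) (real_of_int (m + int j + 1) - z) = f z + (LINT r:{0..real_of_int (m + int j + 1) - z}|lborel. jump w r z)"
      unfolding AE_all_countable by blast
    then have tr: "AE z in lborel. g (\<lfloor>z\<rfloor> + int j + 1) (real_of_int (\<lfloor>z\<rfloor> + int j + 1) - z) =
        f z + (LINT r:{0..real_of_int (\<lfloor>z\<rfloor> + int j + 1) - z}|lborel. jump w r z)"
    proof eventually_elim
      case (elim z)
      \<comment> \<open>Every z lies in one of the intervals with \<eta> = 1 / (i + 1).\<close>
      have "0 < real_of_int \<lfloor>z\<rfloor> + 1 - z" by linarith
      then obtain i where "1 / real (Suc i) < real_of_int \<lfloor>z\<rfloor> + 1 - z"
        using reals_Archimedean[of "real_of_int \<lfloor>z\<rfloor> + 1 - z"] unfolding inverse_eq_divide by blast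
      then have "z \<in> {real_of_int \<lfloor>z\<rfloor>..real_of_int \<lfloor>z\<rfloor> + 1 - 1 / real (Suc i)}" by auto
      then show ?case using elim by blast
    qed
    then have tr2: "AE (t, z) in lborel. g (\<lfloor>z + 0 * t\<rfloor> + int j + 1) (real_of_int (\<lfloor>z + 0 * t\<rfloor> + int j + 1) - (z + 0 * t)) =
        f (z + 0 * t) + (LINT r:{0..real_of_int (\<lfloor>z + 0 * t\<rfloor> + int j + 1) - (z + 0 * t)}|lborel. jump w r (z + 0 * t))"
      by (rule AE_lborel_pair_shear)
    have fin: "AE (t, z) in lborel. \<forall>n. (\<integral>\<^sup>+r\<in>{0..real n}. ennreal \<bar>jump w r (z + 0 * t)\<bar> \<partial>lborel) < \<infinity>"
      by (rule AE_lborel_pair_shear[OF jump_integrable(2)[OF w per bound]])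
    from inflow tr2 fin show ?case
    proof eventually_elim
      case (elim tz)
      obtain t z where tz: "tz = (t, z)" by force
      show ?case
        unfolding tz prod.case
      proof
        assume t: "0 < t \<and> \<lfloor>z + t\<rfloor> = \<lfloor>z\<rfloor> + int (Suc j)"
        define n where "n = \<lfloor>z\<rfloor> + int j + 1"
        have n: "\<lfloor>z + t\<rfloor> = n" using t by (simp add: n_def)
        have zn: "z < real_of_int n" unfolding n_def by linarith
        have nt: "real_of_int n \<le> z + t" using n by linarith
        have eq1: "w t z = g n (real_of_int n - z) + (LINT r:{real_of_int n - z..t}|lborel. jump w r z)"
          using elim(1) t zn n by (simp add: tz)
        have eq2: "g n (real_of_int n - z) = f z + (LINT r:{0..real_of_int n - z}|lborel. jump w r z)"
          using elim(2) by (simp add: tz n_def)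
        have "set_integrable lborel {0..t} (\<lambda>r. jump w r z)"
          using elim(3) by (intro jump_set_integrable[OF w]) (simp add: tz)
        from LINT_Icc_split[OF this, of "real_of_int n - z"] zn nt eq1 eq2
        show "w t z = f z + (LINT r:{0..t}|lborel. jump w r z)" by simp
      qed
    qed
  qed
  have "AE tz in lborel. \<forall>j. case tz of (t, z) \<Rightarrow> 0 < t \<and> \<lfloor>z + t\<rfloor> = \<lfloor>z\<rfloor> + int j \<longrightarrow>
       w t z = f z + (LINT r:{0..t}|lborel. jump w r z)"
    unfolding AE_all_countable using seg by auto
  then show ?thesis
  proof eventually_elim
    case (elim tz)
    obtain t z where tz: "tz = (t, z)" by force
    show ?case
      unfolding tz prod.case
    proof
      assume "0 < t"
      then have "\<lfloor>z\<rfloor> \<le> \<lfloor>z + t\<rfloor>" by (intro floor_mono) simp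
      then have "\<lfloor>z + t\<rfloor> = \<lfloor>z\<rfloor> + int (nat (\<lfloor>z + t\<rfloor> - \<lfloor>z\<rfloor>))" by simp
      then show "w t z = f z + (LINT r:{0..t}|lborel. jump w r z)"
        using elim[rule_format, of "nat (\<lfloor>z + t\<rfloor> - \<lfloor>z\<rfloor>)"] \<open>0 < t\<close> unfolding tz by simp
    qed
  qed
qed

end

section \<open>Unfolding the unit interval to the circle\<close>

text \<open>
  The representative in \<open>[-1,1)\<close> of a point of the circle.
\<close>

definition fold2 :: "real \<Rightarrow> real" where
  "fold2 y = y - 2 * real_of_int \<lfloor>(y + 1) / 2\<rfloor>"

text \<open>
  The function \<open>u\<close> on the right half of the circle and the reflection of
  \<open>v\<close> on the left half.
\<close>

definition unfold2 :: "(real \<Rightarrow> 'a) \<Rightarrow> (real \<Rightarrow> 'a) \<Rightarrow> real \<Rightarrow> 'a" where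
  "unfold2 u v y = (if 0 < fold2 y then u (fold2 y) else v (- fold2 y))"

lemma fold2_measurable [measurable]: "fold2 \<in> borel_measurable borel"
  unfolding fold2_def[abs_def] by measurable

lemma fold2_periodic: "fold2 (y + 2 * real_of_int j) = fold2 y"
proof -
  have "(y + 2 * real_of_int j + 1) / 2 = (y + 1) / 2 + real_of_int j" by (simp add: field_simps)
  then have "\<lfloor>(y + 2 * real_of_int j + 1) / 2\<rfloor> = \<lfloor>(y + 1) / 2\<rfloor> + j" by (simp only: floor_add_int)
  then show ?thesis by (simp add: fold2_def)
qed

lemma fold2_eq: "-1 \<le> y \<Longrightarrow> y < 1 \<Longrightarrow> fold2 y = y"
proof -
  assume "-1 \<le> y" "y < 1"
  then have "\<lfloor>(y + 1) / 2\<rfloor> = 0" by (intro floor_unique) auto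
  then show ?thesis by (simp add: fold2_def)
qed

lemma unfold2_periodic: "unfold2 u v (y + 2) = unfold2 u v y"
  using fold2_periodic[of y 1] by (simp add: unfold2_def)

lemma unfold2_shift: "unfold2 u v (y + 2 * real_of_int j) = unfold2 u v y"
  by (simp add: unfold2_def fold2_periodic)

lemma unfold2_pos: "0 < x \<Longrightarrow> x < 1 \<Longrightarrow> unfold2 u v x = u x"
  by (simp add: unfold2_def fold2_eq)

lemma unfold2_neg: "0 < x \<Longrightarrow> x < 1 \<Longrightarrow> unfold2 u v (- x) = v x"
  by (simp add: unfold2_def fold2_eq)

lemma per_halves:
  assumes [measurable]: "g \<in> borel_measurable borel"
  shows "per g = (\<integral>\<^sup>+x\<in>{0<..<1}. g x \<partial>lborel) + (\<integral>\<^sup>+x\<in>{0<..<1}. g (- x) \<partial>lborel)"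
proof -
  have "(\<integral>\<^sup>+x\<in>{0<..<1}. g (- x) \<partial>lborel) = (\<integral>\<^sup>+x. g (0 + (-1) * x) * indicator {-1<..<0} (0 + (-1) * x) \<partial>lborel)"
    by (intro nn_integral_cong) (auto simp: indicator_def)
  also have "\<dots> = (\<integral>\<^sup>+x\<in>{-1<..<0}. g x \<partial>lborel)"
    by (subst (2) nn_integral_real_affine[of _ "-1" 0]) auto
  finally have 1: "(\<integral>\<^sup>+x\<in>{0<..<1}. g (- x) \<partial>lborel) = (\<integral>\<^sup>+x\<in>{-1<..<0}. g x \<partial>lborel)" .
  have "per g = (\<integral>\<^sup>+x. g x * indicator {0<..<1} x + g x * indicator {-1<..<0} x \<partial>lborel)"
    unfolding per_def
  proof (rule nn_integral_cong_AE)
    show "AE x in lborel. g x * indicator {-1..<1} x = g x * indicator {0<..<1} x + g x * indicator {-1<..<0} x"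
      using AE_lborel_singleton[of "0::real"] AE_lborel_singleton[of "-1::real"]
      by eventually_elim (auto simp: indicator_def)
  qed
  also have "\<dots> = (\<integral>\<^sup>+x\<in>{0<..<1}. g x \<partial>lborel) + (\<integral>\<^sup>+x\<in>{-1<..<0}. g x \<partial>lborel)"
    by (rule nn_integral_add) auto
  finally show ?thesis unfolding 1 .
qed

text \<open>
  For each fixed \<open>t\<close> the map is an affine bijection of the line, and these preserve
  null sets.
\<close>

lemma AE_lborel_pair_affine:
  assumes "AE (t, x) in (lborel :: (real \<times> real) measure). P t x" and "\<sigma> \<noteq> 0"
  shows "AE (t, z) in lborel. P t (b + \<sigma> * z + \<tau> * t)"
proof -
  obtain N where N: "N \<in> null_sets (lborel :: (real \<times> real) measure)" "{z. \<not> (case z of (s, x) \<Rightarrow> P s x)} \<subseteq> N"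
    using assms by (auto simp: eventually_ae_filter)
  have "N \<in> sets borel" using null_setsD2[OF N(1)] by simp
  then have [measurable]: "N \<in> sets (borel \<Otimes>\<^sub>M borel)" by (simp only: borel_prod)
  have "AE z in lborel \<Otimes>\<^sub>M lborel. z \<notin> N"
    unfolding lborel_prod using N(1) by (rule AE_not_in)
  then have "AE t in lborel. AE x in lborel. (t, x) \<notin> N"
    by (rule lborel_pair.AE_pair)
  then have ae: "AE t in lborel. AE z in lborel. (t, b + \<sigma> * z + \<tau> * t) \<notin> N"
  proof eventually_elim
    case (elim t)
    have "AE z in lborel. (t, (b + \<tau> * t) + \<sigma> * z) \<notin> N"
      by (rule AE_borel_affine[OF \<open>\<sigma> \<noteq> 0\<close> _ elim]) auto
    then show ?case by (simp add: algebra_simps)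
  qed
  have "AE (t, z) in lborel \<Otimes>\<^sub>M lborel. (t, b + \<sigma> * z + \<tau> * t) \<notin> N"
  proof (rule lborel_pair.AE_pair_measure)
    show "{x \<in> space (lborel \<Otimes>\<^sub>M lborel). case x of (t, z) \<Rightarrow> (t, b + \<sigma> * z + \<tau> * t) \<notin> N} \<in> sets (lborel \<Otimes>\<^sub>M lborel)"
      by measurable
  qed (use ae in simp)
  then show ?thesis unfolding lborel_prod using N(2) by (auto elim!: eventually_mono)
qed

section \<open>Continuity and boundedness in \<open>L\<^sup>1\<close>\<close>

lemma nn_integral_lebesgue_on:
  fixes A :: "'a::euclidean_space set"
  assumes "A \<in> sets borel"
  shows "(\<integral>\<^sup>+x. f x \<partial>lebesgue_on A) = (\<integral>\<^sup>+x\<in>A. f x \<partial>lborel)"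
  using assms by (subst nn_integral_restrict_space) (auto simp: nn_integral_completion)

lemma nn_integral_lebesgue_on_Ioo:
  "(\<integral>\<^sup>+x. f x \<partial>lebesgue_on {a<..<b::real}) = (\<integral>\<^sup>+x\<in>{a<..<b}. f x \<partial>lborel)"
  by (rule nn_integral_lebesgue_on) simp

lemma emeasure_lborel_Ioo_max: "emeasure lborel {a<..<b} = ennreal (max 0 (b - a))"
  by (cases "a \<le> b") auto

text \<open>
  Broad solutions and coefficients are only Lebesgue measurable, while Fubini's theorem is used
  for Borel measurable functions on the product.
\<close>

lemma borel_version:
  fixes f :: "'a::euclidean_space \<Rightarrow> real"
  assumes f: "f \<in> borel_measurable (lebesgue_on S)" and S: "S \<in> sets borel"
  obtains g where "g \<in> borel_measurable borel" "AE x in lborel. x \<in> S \<longrightarrow> g x = f x" "\<And>x. x \<notin> S \<Longrightarrow> g x = 0"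
proof -
  have "(\<lambda>x. indicator S x *\<^sub>R f x) \<in> borel_measurable lebesgue"
    using f S by (subst (asm) borel_measurable_restrict_space_iff) auto
  from completion_ex_borel_measurable_real[OF this]
  obtain h where h: "h \<in> borel_measurable borel" "AE x in lborel. indicator S x *\<^sub>R f x = h x" by auto
  show ?thesis
  proof (rule that[of "\<lambda>x. indicator S x * h x"])
    show "(\<lambda>x. indicator S x * h x) \<in> borel_measurable borel" using h S by auto
    show "AE x in lborel. x \<in> S \<longrightarrow> indicator S x * h x = f x" using h(2) by eventually_elim auto
  qed auto
qed

lemma borel_measurable_lebesgue_on_UN:
  fixes f :: "'a::euclidean_space \<Rightarrow> real"
  assumes f: "\<And>n::nat. f \<in> borel_measurable (lebesgue_on (S n))" and S: "\<And>n. S n \<in> sets borel" and "incseq S"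
  shows "f \<in> borel_measurable (lebesgue_on (\<Union>n. S n))"
proof -
  have "(\<lambda>x. indicator (\<Union>n. S n) x *\<^sub>R f x) \<in> borel_measurable lebesgue"
  proof (rule borel_measurable_LIMSEQ_real)
    show "(\<lambda>x. indicator (S n) x *\<^sub>R f x) \<in> borel_measurable lebesgue" for n
      using f[of n] S[of n] by (subst (asm) borel_measurable_restrict_space_iff) auto
    fix x
    show "(\<lambda>n. indicator (S n) x *\<^sub>R f x) \<longlonglongrightarrow> indicator (\<Union>n. S n) x *\<^sub>R f x"
    proof (cases "x \<in> (\<Union>n. S n)")
      case True
      then obtain n where n: "x \<in> S n" by auto
      have "indicator (S m) x *\<^sub>R f x = indicator (\<Union>n. S n) x *\<^sub>R f x" if "n \<le> m" for m
        using n that True incseqD[OF \<open>incseq S\<close> that] by (auto simp: indicator_def)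
      then show ?thesis
        by (intro tendsto_eventually) (auto simp: eventually_sequentially)
    qed auto
  qed
  then show ?thesis using S by (subst borel_measurable_restrict_space_iff) auto
qed

text \<open>
  Young's inequality \<open>|H| \<le> r\<^sup>1\<^sup>-\<^sup>p |H|\<^sup>p / p + (1 - 1/p)
  r\<close> bounds the \<open>L\<^sup>1\<close> norm on a bounded interval; the parameter
  \<open>r\<close> is chosen so that the second term contributes at most \<open>e/2\<close>.
\<close>

lemma Lp2_norm_small_imp_L1_small:
  fixes a b e p :: real
  assumes "1 < p" "0 < e"
  obtains \<eta> where "0 < \<eta>" "\<And>F G. in_Lp p (lebesgue_on {a<..<b}) F \<Longrightarrow> in_Lp p (lebesgue_on {a<..<b}) G \<Longrightarrow>
     Lp2_norm p (lebesgue_on {a<..<b}) F G < \<eta> \<Longrightarrow>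
     (\<integral>\<^sup>+x\<in>{a<..<b}. ennreal \<bar>F x\<bar> \<partial>lborel) \<le> ennreal e \<and> (\<integral>\<^sup>+x\<in>{a<..<b}. ennreal \<bar>G x\<bar> \<partial>lborel) \<le> ennreal e"
proof -
  define M where "M = lebesgue_on {a<..<b}"
  define m where "m = max 0 (b - a)"
  define r where "r = e / (2 * (m + 1))"
  have m: "0 \<le> m" by (simp add: m_def)
  have r: "0 < r" using assms m by (simp add: r_def)
  define q where "q = r powr (1 - p) / p"
  have q: "0 < q" using r assms by (simp add: q_def)
  define \<eta> where "\<eta> = (e / (2 * q)) powr (1 / p)"
  have \<eta>: "0 < \<eta>" using q assms by (simp add: \<eta>_def)
  have space: "(\<integral>\<^sup>+x. ennreal r \<partial>M) \<le> ennreal (e / 2)"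
  proof -
    have "(\<integral>\<^sup>+x. ennreal r \<partial>M) = ennreal r * emeasure lborel {a<..<b}"
      unfolding M_def nn_integral_lebesgue_on_Ioo by (subst nn_integral_cmult_indicator) auto
    also have "emeasure lborel {a<..<b} = ennreal m" by (simp add: m_def emeasure_lborel_Ioo_max)
    also have "ennreal r * ennreal m = ennreal (r * m)" using r m by (simp add: ennreal_mult)
    also have "\<dots> \<le> ennreal (e / 2)"
    proof (rule ennreal_leI)
      have "r * m \<le> r * (m + 1)" using r by simp
      also have "\<dots> = e / 2" using m by (simp add: r_def field_simps)
      finally show "r * m \<le> e / 2" .
    qed
    finally show ?thesis .
  qed
  have one: "(\<integral>\<^sup>+x. ennreal \<bar>H x\<bar> \<partial>M) \<le> ennreal e"
    if H: "in_Lp p M H" and small: "(LINT x|M. \<bar>H x\<bar> powr p) \<le> e / (2 * q)" for H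
  proof -
    have [measurable]: "H \<in> borel_measurable M" and int: "integrable M (\<lambda>x. \<bar>H x\<bar> powr p)"
      using H by (auto simp: in_Lp_def)
    have "(\<integral>\<^sup>+x. ennreal \<bar>H x\<bar> \<partial>M) \<le> (\<integral>\<^sup>+x. ennreal q * ennreal (\<bar>H x\<bar> powr p) + ennreal r \<partial>M)"
    proof (rule nn_integral_mono)
      fix x
      have "\<bar>H x\<bar> \<le> q * \<bar>H x\<bar> powr p + (1 - 1 / p) * r"
        unfolding q_def using le_powr_affine[of "\<bar>H x\<bar>" r p] r assms by simp
      also have "\<dots> \<le> q * \<bar>H x\<bar> powr p + 1 * r"
        using r assms by (intro add_left_mono mult_right_mono) auto
      finally show "ennreal \<bar>H x\<bar> \<le> ennreal q * ennreal (\<bar>H x\<bar> powr p) + ennreal r"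
        using q r by (simp add: ennreal_mult[symmetric] ennreal_plus[symmetric] ennreal_leI del: ennreal_plus)
    qed
    also have "\<dots> = ennreal q * (\<integral>\<^sup>+x. ennreal (\<bar>H x\<bar> powr p) \<partial>M) + (\<integral>\<^sup>+x. ennreal r \<partial>M)"
      by (subst nn_integral_add) (auto simp: nn_integral_cmult)
    also have "(\<integral>\<^sup>+x. ennreal (\<bar>H x\<bar> powr p) \<partial>M) = ennreal (LINT x|M. \<bar>H x\<bar> powr p)"
      using int by (intro nn_integral_eq_integral) auto
    also have "ennreal q * \<dots> \<le> ennreal (e / 2)"
    proof -
      have "q * (LINT x|M. \<bar>H x\<bar> powr p) \<le> q * (e / (2 * q))" using small q by (intro mult_left_mono) auto
      also have "\<dots> = e / 2" using q by simp
      finally show ?thesis using q by (simp add: ennreal_mult'[symmetric] ennreal_leI)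
    qed
    also note space
    also have "ennreal (e / 2) + ennreal (e / 2) = ennreal e"
      using assms by (simp add: ennreal_plus[symmetric] del: ennreal_plus)
    finally show ?thesis by (simp add: add_left_mono add_right_mono)
  qed
  show ?thesis
  proof (rule that[OF \<eta>])
    fix F G
    assume F: "in_Lp p (lebesgue_on {a<..<b}) F" and G: "in_Lp p (lebesgue_on {a<..<b}) G"
      and small: "Lp2_norm p (lebesgue_on {a<..<b}) F G < \<eta>"
    have iF: "integrable M (\<lambda>x. \<bar>F x\<bar> powr p)" and iG: "integrable M (\<lambda>x. \<bar>G x\<bar> powr p)"
      using F G by (auto simp: in_Lp_def M_def)
    define I where "I = (LINT x|M. \<bar>F x\<bar> powr p + \<bar>G x\<bar> powr p)"
    have I: "I = (LINT x|M. \<bar>F x\<bar> powr p) + (LINT x|M. \<bar>G x\<bar> powr p)"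
      unfolding I_def using iF iG by simp
    have nn: "0 \<le> (LINT x|M. \<bar>F x\<bar> powr p)" "0 \<le> (LINT x|M. \<bar>G x\<bar> powr p)" by auto
    have "I powr (1 / p) < \<eta>" using small by (simp add: Lp2_norm_def I_def M_def)
    then have "(I powr (1 / p)) powr p < \<eta> powr p" using assms by (intro powr_less_mono2) auto
    then have "I < e / (2 * q)"
      using I nn q assms by (simp add: powr_powr \<eta>_def)
    then have "(LINT x|M. \<bar>F x\<bar> powr p) \<le> e / (2 * q)" "(LINT x|M. \<bar>G x\<bar> powr p) \<le> e / (2 * q)"
      using I nn by linarith+
    then show "(\<integral>\<^sup>+x\<in>{a<..<b}. ennreal \<bar>F x\<bar> \<partial>lborel) \<le> ennreal e \<and> (\<integral>\<^sup>+x\<in>{a<..<b}. ennreal \<bar>G x\<bar> \<partial>lborel) \<le> ennreal e"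
      using one[of F] one[of G] F G unfolding M_def nn_integral_lebesgue_on_Ioo by simp
  qed
qed

lemma in_Lp_diff:
  assumes "in_Lp p M F" "in_Lp p M G" "1 \<le> p"
  shows "in_Lp p M (\<lambda>x. F x - G x)"
proof -
  have [measurable]: "F \<in> borel_measurable M" "G \<in> borel_measurable M" using assms by (auto simp: in_Lp_def)
  have "integrable M (\<lambda>x. \<bar>F x - G x\<bar> powr p)"
  proof (rule Bochner_Integration.integrable_bound)
    show "integrable M (\<lambda>x. 2 powr p * (\<bar>F x\<bar> powr p + \<bar>G x\<bar> powr p))"
      using assms by (auto simp: in_Lp_def)
    show "AE x in M. norm (\<bar>F x - G x\<bar> powr p) \<le> norm (2 powr p * (\<bar>F x\<bar> powr p + \<bar>G x\<bar> powr p))"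
    proof (rule AE_I2)
      fix x
      have "ennreal (\<bar>F x - G x\<bar> powr p) \<le> ennreal (2 powr p * (\<bar>F x\<bar> powr p + \<bar>G x\<bar> powr p))"
        using powr_add_le[OF \<open>1 \<le> p\<close>, of "F x" "- G x"] by (simp add: ennreal_mult ennreal_plus)
      then show "norm (\<bar>F x - G x\<bar> powr p) \<le> norm (2 powr p * (\<bar>F x\<bar> powr p + \<bar>G x\<bar> powr p))"
        by (simp add: ennreal_le_iff)
    qed
  qed measurable
  then show ?thesis by (simp add: in_Lp_def)
qed

lemma cont_Lp2_L1:
  fixes a b :: real
  assumes c: "cont_Lp2 p S (lebesgue_on {a<..<b}) u v" and "1 < p" "s \<in> S" "0 < (e::real)"
  shows "\<exists>\<delta>>0. \<forall>r\<in>S. \<bar>r - s\<bar> < \<delta> \<longrightarrow>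
    (\<integral>\<^sup>+x\<in>{a<..<b}. ennreal \<bar>u r x - u s x\<bar> \<partial>lborel) \<le> ennreal e \<and> (\<integral>\<^sup>+x\<in>{a<..<b}. ennreal \<bar>v r x - v s x\<bar> \<partial>lborel) \<le> ennreal e"
proof -
  obtain \<eta> where \<eta>: "0 < \<eta>" "\<And>F G. in_Lp p (lebesgue_on {a<..<b}) F \<Longrightarrow> in_Lp p (lebesgue_on {a<..<b}) G \<Longrightarrow>
     Lp2_norm p (lebesgue_on {a<..<b}) F G < \<eta> \<Longrightarrow>
     (\<integral>\<^sup>+x\<in>{a<..<b}. ennreal \<bar>F x\<bar> \<partial>lborel) \<le> ennreal e \<and> (\<integral>\<^sup>+x\<in>{a<..<b}. ennreal \<bar>G x\<bar> \<partial>lborel) \<le> ennreal e"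
    using Lp2_norm_small_imp_L1_small[OF assms(2,4), where a = a and b = b] by blast
  have Lp: "in_Lp p (lebesgue_on {a<..<b}) (u r)" "in_Lp p (lebesgue_on {a<..<b}) (v r)" if "r \<in> S" for r
    using c that by (auto simp: cont_Lp2_def)
  have "((\<lambda>r. Lp2_norm p (lebesgue_on {a<..<b}) (\<lambda>y. u r y - u s y) (\<lambda>y. v r y - v s y)) \<longlongrightarrow> 0) (at s within S)"
    using c \<open>s \<in> S\<close> by (auto simp: cont_Lp2_def)
  from order_tendstoD(2)[OF this \<eta>(1)]
  obtain \<delta> where \<delta>: "0 < \<delta>" "\<And>r. r \<in> S \<Longrightarrow> r \<noteq> s \<Longrightarrow> dist r s < \<delta> \<Longrightarrow>
      Lp2_norm p (lebesgue_on {a<..<b}) (\<lambda>y. u r y - u s y) (\<lambda>y. v r y - v s y) < \<eta>"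
    unfolding eventually_at by blast
  show ?thesis
  proof (intro exI[of _ \<delta>] conjI ballI impI \<delta>(1))
    fix r assume r: "r \<in> S" "\<bar>r - s\<bar> < \<delta>"
    have *: "(\<integral>\<^sup>+x\<in>{a<..<b}. ennreal \<bar>u r x - u s x\<bar> \<partial>lborel) \<le> ennreal e \<and> (\<integral>\<^sup>+x\<in>{a<..<b}. ennreal \<bar>v r x - v s x\<bar> \<partial>lborel) \<le> ennreal e"
    proof (cases "r = s")
      case False
      then show ?thesis
        using r \<open>s \<in> S\<close> assms(2) by (intro \<eta>(2) in_Lp_diff Lp \<delta>(2)) (auto simp: dist_real_def)
    qed simp
    then show "(\<integral>\<^sup>+x\<in>{a<..<b}. ennreal \<bar>u r x - u s x\<bar> \<partial>lborel) \<le> ennreal e" "(\<integral>\<^sup>+x\<in>{a<..<b}. ennreal \<bar>v r x - v s x\<bar> \<partial>lborel) \<le> ennreal e"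
      by auto
  qed
qed

lemma in_Lp_imp_L1:
  fixes a b :: real
  assumes "in_Lp p (lebesgue_on {a<..<b}) F" "1 \<le> p"
  shows "(\<integral>\<^sup>+x\<in>{a<..<b}. ennreal \<bar>F x\<bar> \<partial>lborel) < \<infinity>"
proof -
  define M where "M = lebesgue_on {a<..<b}"
  have [measurable]: "F \<in> borel_measurable M" and int: "integrable M (\<lambda>x. \<bar>F x\<bar> powr p)"
    using assms by (auto simp: in_Lp_def M_def)
  have "(\<integral>\<^sup>+x. ennreal \<bar>F x\<bar> \<partial>M) \<le> (\<integral>\<^sup>+x. ennreal (\<bar>F x\<bar> powr p) + ennreal 1 \<partial>M)"
  proof (rule nn_integral_mono)
    fix x
    have "\<bar>F x\<bar> \<le> \<bar>F x\<bar> powr p + 1"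
    proof (cases "\<bar>F x\<bar> \<le> 1")
      case False
      then have "\<bar>F x\<bar> powr 1 \<le> \<bar>F x\<bar> powr p" using assms by (intro powr_mono) auto
      then show ?thesis by simp
    qed (simp add: add_increasing)
    then have "ennreal \<bar>F x\<bar> \<le> ennreal (\<bar>F x\<bar> powr p + 1)" by (rule ennreal_leI)
    then show "ennreal \<bar>F x\<bar> \<le> ennreal (\<bar>F x\<bar> powr p) + ennreal 1" by (simp add: ennreal_plus)
  qed
  also have "\<dots> = (\<integral>\<^sup>+x. ennreal (\<bar>F x\<bar> powr p) \<partial>M) + (\<integral>\<^sup>+x. ennreal 1 \<partial>M)"
    by (rule nn_integral_add) auto
  also have "\<dots> < \<infinity>"
  proof -
    have "(\<integral>\<^sup>+x. ennreal (\<bar>F x\<bar> powr p) \<partial>M) = ennreal (LINT x|M. \<bar>F x\<bar> powr p)"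
      using int by (intro nn_integral_eq_integral) auto
    moreover have "(\<integral>\<^sup>+x. ennreal 1 \<partial>M) < \<infinity>"
      unfolding M_def nn_integral_lebesgue_on_Ioo by (simp add: emeasure_lborel_Ioo_max)
    ultimately show ?thesis by simp
  qed
  finally show ?thesis unfolding M_def nn_integral_lebesgue_on_Ioo .
qed

text \<open>
  A continuous function on a compact interval is bounded. Continuity is only known in the form
  of \<open>cont_Lp2_L1\<close>, so finitely many neighbourhoods are taken by compactness.
\<close>

lemma cont_Lp2_bounded:
  fixes a b :: real
  assumes c: "cont_Lp2 p {0..T} (lebesgue_on {a<..<b}) u v" and "1 < p"
  shows "\<exists>C::real. \<forall>t\<in>{0..T}. (\<integral>\<^sup>+x\<in>{a<..<b}. ennreal \<bar>u t x\<bar> \<partial>lborel) \<le> ennreal C \<and>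
     (\<integral>\<^sup>+x\<in>{a<..<b}. ennreal \<bar>v t x\<bar> \<partial>lborel) \<le> ennreal C"
proof -
  define N where "N t = enn2real (\<integral>\<^sup>+x\<in>{a<..<b}. ennreal \<bar>u t x\<bar> \<partial>lborel) + enn2real (\<integral>\<^sup>+x\<in>{a<..<b}. ennreal \<bar>v t x\<bar> \<partial>lborel)" for t
  have Lp: "in_Lp p (lebesgue_on {a<..<b}) (u r)" "in_Lp p (lebesgue_on {a<..<b}) (v r)" if "r \<in> {0..T}" for r
    using c that by (auto simp: cont_Lp2_def)
  have fin: "(\<integral>\<^sup>+x\<in>{a<..<b}. ennreal \<bar>u t x\<bar> \<partial>lborel) < \<infinity>" "(\<integral>\<^sup>+x\<in>{a<..<b}. ennreal \<bar>v t x\<bar> \<partial>lborel) < \<infinity>"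
    if "t \<in> {0..T}" for t
    using in_Lp_imp_L1[OF Lp(1)[OF that]] in_Lp_imp_L1[OF Lp(2)[OF that]] \<open>1 < p\<close> by auto
  have tri: "(\<integral>\<^sup>+x\<in>{a<..<b}. ennreal \<bar>f x\<bar> \<partial>lborel) \<le> (\<integral>\<^sup>+x\<in>{a<..<b}. ennreal \<bar>g x\<bar> \<partial>lborel) + (\<integral>\<^sup>+x\<in>{a<..<b}. ennreal \<bar>f x - g x\<bar> \<partial>lborel)"
    if fg: "in_Lp p (lebesgue_on {a<..<b}) f" "in_Lp p (lebesgue_on {a<..<b}) g" for f g
  proof -
    have [measurable]: "f \<in> borel_measurable (lebesgue_on {a<..<b})" "g \<in> borel_measurable (lebesgue_on {a<..<b})"
      using fg by (auto simp: in_Lp_def)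
    have "(\<integral>\<^sup>+x. ennreal \<bar>f x\<bar> \<partial>lebesgue_on {a<..<b}) \<le> (\<integral>\<^sup>+x. ennreal \<bar>g x\<bar> + ennreal \<bar>f x - g x\<bar> \<partial>lebesgue_on {a<..<b})"
      by (intro nn_integral_mono) (auto simp: ennreal_plus[symmetric] intro!: ennreal_leI simp del: ennreal_plus)
    also have "\<dots> = (\<integral>\<^sup>+x. ennreal \<bar>g x\<bar> \<partial>lebesgue_on {a<..<b}) + (\<integral>\<^sup>+x. ennreal \<bar>f x - g x\<bar> \<partial>lebesgue_on {a<..<b})"
      by (rule nn_integral_add) auto
    finally show ?thesis unfolding nn_integral_lebesgue_on_Ioo .
  qed
  have "\<forall>s\<in>{0..T}. \<exists>\<delta>>0. \<forall>r\<in>{0..T}. \<bar>r - s\<bar> < \<delta> \<longrightarrow>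
    (\<integral>\<^sup>+x\<in>{a<..<b}. ennreal \<bar>u r x - u s x\<bar> \<partial>lborel) \<le> ennreal 1 \<and> (\<integral>\<^sup>+x\<in>{a<..<b}. ennreal \<bar>v r x - v s x\<bar> \<partial>lborel) \<le> ennreal 1"
    using cont_Lp2_L1[OF c \<open>1 < p\<close> _ zero_less_one] by blast
  from bchoice[OF this] obtain \<delta> where \<delta>: "\<And>s. s \<in> {0..T} \<Longrightarrow> 0 < \<delta> s" "\<And>s r. s \<in> {0..T} \<Longrightarrow> r \<in> {0..T} \<Longrightarrow> \<bar>r - s\<bar> < \<delta> s \<Longrightarrow>
    (\<integral>\<^sup>+x\<in>{a<..<b}. ennreal \<bar>u r x - u s x\<bar> \<partial>lborel) \<le> ennreal 1 \<and> (\<integral>\<^sup>+x\<in>{a<..<b}. ennreal \<bar>v r x - v s x\<bar> \<partial>lborel) \<le> ennreal 1"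
    by blast
  have cover: "{0..T} \<subseteq> (\<Union>s\<in>{0..T}. ball s (\<delta> s))" using \<delta>(1) by (auto intro!: bexI)
  obtain D where D: "D \<subseteq> {0..T}" "finite D" "{0..T} \<subseteq> (\<Union>s\<in>D. ball s (\<delta> s))"
    by (rule compactE_image[OF compact_Icc _ cover]) auto
  define C where "C = (\<Sum>s\<in>D. N s) + 1"
  have Nnn: "0 \<le> N s" for s by (simp add: N_def)
  have "(\<integral>\<^sup>+x\<in>{a<..<b}. ennreal \<bar>u t x\<bar> \<partial>lborel) \<le> ennreal C \<and> (\<integral>\<^sup>+x\<in>{a<..<b}. ennreal \<bar>v t x\<bar> \<partial>lborel) \<le> ennreal C"
    if t: "t \<in> {0..T}" for t
  proof -
    obtain s where s: "s \<in> D" "t \<in> ball s (\<delta> s)" using D t by auto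
    then have sT: "s \<in> {0..T}" using D by auto
    have small: "(\<integral>\<^sup>+x\<in>{a<..<b}. ennreal \<bar>u t x - u s x\<bar> \<partial>lborel) \<le> ennreal 1" "(\<integral>\<^sup>+x\<in>{a<..<b}. ennreal \<bar>v t x - v s x\<bar> \<partial>lborel) \<le> ennreal 1"
      using \<delta>(2)[OF sT t] s by (auto simp: dist_real_def abs_minus_commute)
    have le: "N s + 1 \<le> C"
      unfolding C_def using s D(2) Nnn by (intro add_right_mono member_le_sum) auto
    have us: "(\<integral>\<^sup>+x\<in>{a<..<b}. ennreal \<bar>u s x\<bar> \<partial>lborel) \<le> ennreal (N s)" "(\<integral>\<^sup>+x\<in>{a<..<b}. ennreal \<bar>v s x\<bar> \<partial>lborel) \<le> ennreal (N s)"
      using fin[OF sT] by (auto simp: N_def ennreal_plus)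
    have "ennreal (N s) + ennreal 1 \<le> ennreal C"
      using le Nnn by (simp add: ennreal_plus[symmetric] ennreal_leI del: ennreal_plus ennreal_1)
    then show ?thesis
      using tri[OF Lp(1)[OF t] Lp(1)[OF sT]] tri[OF Lp(2)[OF t] Lp(2)[OF sT]] us small
      by (meson add_mono order_trans)
  qed
  then show ?thesis by blast
qed

section \<open>Broad solutions along complete characteristics\<close>

lemma joint_borel_version:
  fixes \<rho> :: "real \<Rightarrow> real \<Rightarrow> real"
  assumes "\<And>T. 0 < T \<Longrightarrow> (\<lambda>(t, x). \<rho> t x) \<in> borel_measurable (lebesgue_on ({0<..<T} \<times> {0<..<1}))"
  obtains R where "case_prod R \<in> borel_measurable (borel \<Otimes>\<^sub>M borel)"
    "AE (t, x) in lborel. 0 < t \<and> 0 < x \<and> x < 1 \<longrightarrow> R t x = \<rho> t x"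
proof -
  define S where "S n = {0<..<real (Suc n)} \<times> {0<..<1::real}" for n
  have S: "S n \<in> sets borel" for n unfolding S_def by (intro borel_open open_Times) auto
  have U: "(\<Union>n. S n) = {0<..} \<times> {0<..<1}"
  proof (intro set_eqI iffI)
    fix tx :: "real \<times> real" assume tx: "tx \<in> {0<..} \<times> {0<..<1}"
    obtain n where "fst tx < real n" using reals_Archimedean2 by blast
    then have "tx \<in> S n" using tx by (auto simp: S_def)
    then show "tx \<in> (\<Union>n. S n)" by blast
  qed (auto simp: S_def)
  have "(\<lambda>(t, x). \<rho> t x) \<in> borel_measurable (lebesgue_on (\<Union>n. S n))"
  proof (rule borel_measurable_lebesgue_on_UN)
    show "(\<lambda>(t, x). \<rho> t x) \<in> borel_measurable (lebesgue_on (S n))" for n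
      unfolding S_def by (rule assms) simp
    show "incseq S" by (auto simp: incseq_def S_def)
  qed (rule S)
  moreover have "(\<Union>n. S n) \<in> sets borel" using S by auto
  ultimately obtain g where g: "g \<in> borel_measurable borel" "AE tx in lborel. tx \<in> (\<Union>n. S n) \<longrightarrow> g tx = (\<lambda>(t, x). \<rho> t x) tx"
    using borel_version by blast
  show ?thesis
  proof (rule that[of "\<lambda>t x. g (t, x)"])
    show "(\<lambda>(t, x). g (t, x)) \<in> borel_measurable (borel \<Otimes>\<^sub>M borel)"
      using g(1) by (simp add: borel_prod)
    show "AE (t, x) in lborel. 0 < t \<and> 0 < x \<and> x < 1 \<longrightarrow> g (t, x) = \<rho> t x"
      using g(2) unfolding U by (auto elim!: eventually_mono)
  qed
qed

lemma trace_borel_version: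
  fixes h :: "real \<Rightarrow> real"
  assumes h: "\<And>T. 0 < T \<Longrightarrow> in_Lp p (lebesgue_on {0<..<T}) h" and "1 \<le> p"
  obtains g where "locally_Lp 1 g" "AE t in lborel. 0 < t \<longrightarrow> g t = h t"
proof -
  define S where "S n = {0<..<real (Suc n)}" for n
  have U: "(\<Union>n. S n) = {0<..}"
  proof (intro set_eqI iffI)
    fix t :: real assume t: "t \<in> {0<..}"
    obtain n where "t < real n" using reals_Archimedean2 by blast
    then have "t \<in> S n" using t by (auto simp: S_def)
    then show "t \<in> (\<Union>n. S n)" by blast
  qed (auto simp: S_def)
  have "h \<in> borel_measurable (lebesgue_on (\<Union>n. S n))"
  proof (rule borel_measurable_lebesgue_on_UN)
    show "h \<in> borel_measurable (lebesgue_on (S n))" for n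
      using h[of "real (Suc n)"] unfolding S_def by (auto simp: in_Lp_def)
    show "incseq S" by (auto simp: incseq_def S_def)
  qed (auto simp: S_def)
  then have "h \<in> borel_measurable (lebesgue_on {0<..})" unfolding U .
  from borel_version[OF this] obtain g where g: "g \<in> borel_measurable borel"
    "AE t in lborel. t \<in> {0<..} \<longrightarrow> g t = h t" "\<And>t. t \<notin> {0<..} \<Longrightarrow> g t = 0"
    by auto
  have [measurable]: "g \<in> borel_measurable borel" by (rule g(1))
  have "(\<integral>\<^sup>+t\<in>{a..b}. ennreal (\<bar>g t\<bar> powr 1) \<partial>lborel) < \<infinity>" for a b
  proof -
    define T where "T = max 0 b + 1"
    have "(\<integral>\<^sup>+t\<in>{a..b}. ennreal (\<bar>g t\<bar> powr 1) \<partial>lborel) \<le> (\<integral>\<^sup>+t\<in>{0<..<T}. ennreal \<bar>h t\<bar> \<partial>lborel)"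
    proof (rule nn_integral_mono_AE)
      show "AE t in lborel. ennreal (\<bar>g t\<bar> powr 1) * indicator {a..b} t \<le> ennreal \<bar>h t\<bar> * indicator {0<..<T} t"
        using g(2)
      proof eventually_elim
        case (elim t)
        then show ?case using g(3)[of t] by (cases "0 < t") (auto simp: indicator_def T_def)
      qed
    qed
    also have "\<dots> < \<infinity>"
      by (rule in_Lp_imp_L1[OF h \<open>1 \<le> p\<close>]) (simp add: T_def)
    finally show ?thesis .
  qed
  then show ?thesis using g(2) by (intro that[of g]) (auto simp: locally_Lp_def)
qed

context transport
begin

lemma alpha_shift: "\<alpha> s (y + 2 * real_of_int j) = \<alpha> s y"
  by (rule periodic2_int) (simp add: periodic2_def alpha_periodic)

text \<open>
  A pair \<open>(\<rho>, \<xi>)\<close> as a function of time and of the characteristic.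
\<close>

definition unfolded :: "(real \<Rightarrow> real \<Rightarrow> real) \<Rightarrow> (real \<Rightarrow> real \<Rightarrow> real) \<Rightarrow> real \<Rightarrow> real \<Rightarrow> real" where
  "unfolded R X t z = unfold2 (X t) (R t) (z + t)"

lemma unfolded_measurable:
  assumes "case_prod R \<in> borel_measurable (borel \<Otimes>\<^sub>M borel)" "case_prod X \<in> borel_measurable (borel \<Otimes>\<^sub>M borel)"
  shows "case_prod (unfolded R X) \<in> borel_measurable (borel \<Otimes>\<^sub>M borel)"
proof -
  note [measurable] = borel_pair_compose[OF assms(1)] borel_pair_compose[OF assms(2)]
  show ?thesis unfolding unfolded_def unfold2_def by measurable
qed

lemma unfolded_periodic: "periodic2 (unfolded R X t)"
proof -
  have "z + 2 + t = z + t + 2" for z by simp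
  then show ?thesis unfolding periodic2_def unfolded_def by (simp only: unfold2_periodic) simp
qed

lemma unfolded_right: "0 < x \<Longrightarrow> x < 1 \<Longrightarrow> z + s = 2 * real_of_int j + x \<Longrightarrow> unfolded R X s z = X s x"
  using unfold2_shift[of "X s" "R s" x j] by (simp add: unfolded_def unfold2_pos add.commute)

lemma unfolded_left: "0 < x \<Longrightarrow> x < 1 \<Longrightarrow> z + s = 2 * real_of_int j - x \<Longrightarrow> unfolded R X s z = R s x"
  using unfold2_shift[of "X s" "R s" "- x" j] by (simp add: unfolded_def unfold2_neg)

lemma jump_unfolded_right:
  assumes "0 < x" "x < 1" "z + s = 2 * real_of_int j + x"
  shows "jump (unfolded R X) s z = \<alpha> s x / 2 * (R s x - X s x)"
proof -
  have "\<alpha> s (z + s) = \<alpha> s x" using alpha_shift[of s x j] assms(3) by (simp add: add.commute)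
  moreover have "unfolded R X s (- z - 2 * s) = R s x"
    by (rule unfolded_left[of _ _ _ "- j"]) (use assms in auto)
  ultimately show ?thesis
    using unfolded_right[OF assms, of R X] by (simp add: jump_def)
qed

lemma jump_unfolded_left:
  assumes "0 < x" "x < 1" "z + s = 2 * real_of_int j - x"
  shows "jump (unfolded R X) s z = \<alpha> s x / 2 * (X s x - R s x)"
proof -
  have "\<alpha> s (z + s) = \<alpha> s x" using alpha_shift[of s "- x" j] assms(3) by (simp add: alpha_even)
  moreover have "unfolded R X s (- z - 2 * s) = X s x"
    by (rule unfolded_right[of _ _ _ "- j"]) (use assms in auto)
  ultimately show ?thesis
    using unfolded_left[OF assms, of R X] by (simp add: jump_def)
qed

text \<open>
  Between two integer points the unfolded solution satisfies the integral equation, which is one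
  of the four characteristic rules. At an even integer the characteristic arrives as
  \<open>\<rho>\<close> at \<open>x = 0\<close> and leaves as \<open>\<xi>\<close>, at an odd
  one it arrives as \<open>\<xi>\<close> at \<open>x = 1\<close> and leaves as
  \<open>\<rho>\<close>. By the boundary condition the trace is the same on both sides, and by
  continuity in \<open>x\<close> it is the limit from the inside.
\<close>

lemma broad_solution_lagrangian:
  assumes f: "datum f" and "1 < p"
    and rho0: "AE x in lborel. 0 < x \<and> x < 1 \<longrightarrow> f (- x) = \<rho>0 x"
    and xi0: "AE x in lborel. 0 < x \<and> x < 1 \<longrightarrow> f x = \<xi>0 x"
    and a: "AE (t, x) in lborel. 0 < t \<and> 0 < x \<and> x < 1 \<longrightarrow> a t x = \<alpha> t x"
    and sol: "\<And>T. 0 < T \<Longrightarrow> broad_solution p T a \<rho>0 \<xi>0 \<rho> \<xi>"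
    and R: "case_prod R \<in> borel_measurable (borel \<Otimes>\<^sub>M borel)" "AE (t, x) in lborel. 0 < t \<and> 0 < x \<and> x < 1 \<longrightarrow> R t x = \<rho> t x"
    and X: "case_prod X \<in> borel_measurable (borel \<Otimes>\<^sub>M borel)" "AE (t, x) in lborel. 0 < t \<and> 0 < x \<and> x < 1 \<longrightarrow> X t x = \<xi> t x"
  shows "AE t in lborel. 0 < t \<longrightarrow> (AE z in lborel. unfolded R X t z = flow f t z)"
proof (rule lagrangian_unique[OF f])
  define w where "w = unfolded R X"
  have w: "case_prod w \<in> borel_measurable (borel \<Otimes>\<^sub>M borel)" unfolding w_def by (rule unfolded_measurable[OF R(1) X(1)])
  have per: "periodic2 (w t)" for t unfolding w_def by (rule unfolded_periodic)
  show "case_prod (unfolded R X) \<in> borel_measurable (borel \<Otimes>\<^sub>M borel)" "\<And>t. periodic2 (unfolded R X t)"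
    using w per by (auto simp: w_def)
  note [measurable] = borel_pair_compose[OF w] borel_pair_compose[OF R(1)] borel_pair_compose[OF X(1)]
    borel_pair_compose[OF jump_measurable[OF w]]
  have p: "1 \<le> p" using \<open>1 < p\<close> by simp
  have contt: "cont_Lp2 p {0..T} (lebesgue_on {0<..<1}) \<rho> \<xi>"
    and contx: "cont_Lp2 p {0..1} (lebesgue_on {0<..<T}) (\<lambda>x t. \<rho> t x) (\<lambda>x t. \<xi> t x)" if "0 < T" for T
    using sol[OF that] by (auto simp: broad_solution_def)
  have bc: "AE t in lborel. 0 < t \<longrightarrow> \<rho> t 0 = \<xi> t 0 \<and> \<rho> t 1 = \<xi> t 1"
  proof -
    have "AE t in lborel. t \<in> {0<..<real (Suc n)} \<longrightarrow> \<rho> t 0 = \<xi> t 0 \<and> \<rho> t 1 = \<xi> t 1" for n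
      using sol[of "real (Suc n)"] unfolding broad_solution_def by (subst AE_lebesgue_on_iff[symmetric]) auto
    then have "AE t in lborel. \<forall>n. t \<in> {0<..<real (Suc n)} \<longrightarrow> \<rho> t 0 = \<xi> t 0 \<and> \<rho> t 1 = \<xi> t 1"
      unfolding AE_all_countable by blast
    then show ?thesis
    proof eventually_elim
      case (elim t)
      obtain n where "t < real n" using reals_Archimedean2 by blast
      then show ?case using elim[rule_format, of n] by auto
    qed
  qed
  have rules: "AE (t, x) in lborel. 0 < t \<and> 0 < x \<and> x < 1 \<longrightarrow> characteristic_rules a \<rho>0 \<xi>0 \<rho> \<xi> t x"
  proof -
    have "AE tx in lborel. tx \<in> {0<..<real (Suc n)} \<times> {0<..<1} \<longrightarrow> (case tx of (t, x) \<Rightarrow> characteristic_rules a \<rho>0 \<xi>0 \<rho> \<xi> t x)" for n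
    proof -
      have "{0<..<real (Suc n)} \<times> {0<..<1::real} \<in> sets borel" by (intro borel_open open_Times) auto
      then show ?thesis
        using sol[of "real (Suc n)"] unfolding broad_solution_def by (subst AE_lebesgue_on_iff[symmetric]) auto
    qed
    then have "AE tx in lborel. \<forall>n. tx \<in> {0<..<real (Suc n)} \<times> {0<..<1} \<longrightarrow> (case tx of (t, x) \<Rightarrow> characteristic_rules a \<rho>0 \<xi>0 \<rho> \<xi> t x)"
      unfolding AE_all_countable by blast
    then show ?thesis
    proof eventually_elim
      case (elim tx)
      obtain n where "fst tx < real n" using reals_Archimedean2 by blast
      then show ?case using elim[rule_format, of n] by (cases tx) auto
    qed
  qed
  show bound: "\<exists>C. AE t in lborel. 0 < t \<and> t < T \<longrightarrow> per (\<lambda>z. ennreal \<bar>unfolded R X t z\<bar>) \<le> ennreal C" for T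
  proof -
    have "0 < max T 1" by simp
    then obtain C where C: "\<forall>t\<in>{0..max T 1}. (\<integral>\<^sup>+x\<in>{0<..<1}. ennreal \<bar>\<rho> t x\<bar> \<partial>lborel) \<le> ennreal C \<and>
       (\<integral>\<^sup>+x\<in>{0<..<1}. ennreal \<bar>\<xi> t x\<bar> \<partial>lborel) \<le> ennreal C"
      using cont_Lp2_bounded[OF contt[of "max T 1"] \<open>1 < p\<close>] by blast
    have aeR: "AE t in lborel. AE x in lborel. 0 < t \<and> 0 < x \<and> x < 1 \<longrightarrow> R t x = \<rho> t x"
      using lborel_pair.AE_pair[OF R(2)[folded lborel_prod]] by simp
    have aeX: "AE t in lborel. AE x in lborel. 0 < t \<and> 0 < x \<and> x < 1 \<longrightarrow> X t x = \<xi> t x"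
      using lborel_pair.AE_pair[OF X(2)[folded lborel_prod]] by simp
    have "AE t in lborel. 0 < t \<and> t < T \<longrightarrow> per (\<lambda>z. ennreal \<bar>unfolded R X t z\<bar>) \<le> ennreal (2 * max 0 C)"
      using aeR aeX
    proof eventually_elim
      case (elim t)
      show ?case
      proof
        assume t: "0 < t \<and> t < T"
        define u where "u y = ennreal \<bar>unfold2 (X t) (R t) y\<bar>" for y
        have um: "u \<in> borel_measurable borel" unfolding u_def unfold2_def by measurable
        have "per (\<lambda>z. ennreal \<bar>unfolded R X t z\<bar>) = per (\<lambda>z. u (z + t))" by (simp add: u_def unfolded_def)
        also have "\<dots> = per u" by (rule per_shift[OF um]) (simp add: periodic2_def u_def unfold2_periodic)
        also have "\<dots> = (\<integral>\<^sup>+x\<in>{0<..<1}. u x \<partial>lborel) + (\<integral>\<^sup>+x\<in>{0<..<1}. u (- x) \<partial>lborel)"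
          by (rule per_halves[OF um])
        also have "(\<integral>\<^sup>+x\<in>{0<..<1}. u x \<partial>lborel) = (\<integral>\<^sup>+x\<in>{0<..<1}. ennreal \<bar>\<xi> t x\<bar> \<partial>lborel)"
        proof (rule nn_integral_cong_AE)
          show "AE x in lborel. u x * indicator {0<..<1} x = ennreal \<bar>\<xi> t x\<bar> * indicator {0<..<1} x"
            using elim(2) by eventually_elim (use t in \<open>auto simp: indicator_def u_def unfold2_pos\<close>)
        qed
        also have "(\<integral>\<^sup>+x\<in>{0<..<1}. u (- x) \<partial>lborel) = (\<integral>\<^sup>+x\<in>{0<..<1}. ennreal \<bar>\<rho> t x\<bar> \<partial>lborel)"
        proof (rule nn_integral_cong_AE)
          show "AE x in lborel. u (- x) * indicator {0<..<1} x = ennreal \<bar>\<rho> t x\<bar> * indicator {0<..<1} x"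
            using elim(1) by eventually_elim (use t in \<open>auto simp: indicator_def u_def unfold2_neg\<close>)
        qed
        also have "(\<integral>\<^sup>+x\<in>{0<..<1}. ennreal \<bar>\<xi> t x\<bar> \<partial>lborel) + (\<integral>\<^sup>+x\<in>{0<..<1}. ennreal \<bar>\<rho> t x\<bar> \<partial>lborel) \<le> ennreal (max 0 C) + ennreal (max 0 C)"
          using C t by (intro add_mono) (auto simp: max_def ennreal_neg)
        also have "\<dots> = ennreal (2 * max 0 C)" by (simp add: ennreal_plus[symmetric] del: ennreal_plus)
        finally show "per (\<lambda>z. ennreal \<bar>unfolded R X t z\<bar>) \<le> ennreal (2 * max 0 C)" .
      qed
    qed
    then show ?thesis by blast
  qed
  have Lp: "in_Lp p (lebesgue_on {0<..<T}) (\<lambda>t. \<rho> t 1)" "in_Lp p (lebesgue_on {0<..<T}) (\<lambda>t. \<xi> t 0)" if "0 < T" for T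
    using contx[OF that] by (auto simp: cont_Lp2_def)
  obtain g1 where g1: "locally_Lp 1 g1" "AE t in lborel. 0 < t \<longrightarrow> g1 t = \<rho> t 1"
    using trace_borel_version[OF Lp(1) p] by blast
  obtain g0 where g0: "locally_Lp 1 g0" "AE t in lborel. 0 < t \<longrightarrow> g0 t = \<xi> t 0"
    using trace_borel_version[OF Lp(2) p] by blast
  \<comment> \<open>The value with which a characteristic leaves the integer point n.\<close>
  define g where "g n = (if even n then g0 else g1)" for n :: int
  have gL: "locally_Lp 1 (g n)" for n using g0 g1 by (simp add: g_def)
  have gm [measurable]: "g n \<in> borel_measurable borel" for n using gL by (simp add: locally_Lp_def)
  have gval: "AE t in lborel. 0 < t \<longrightarrow> g n t = (if even n then \<xi> t 0 else \<rho> t 1)" for n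
    using g0(2) g1(2) by eventually_elim (auto simp: g_def)
  have sliceR: "AE h in lborel. AE t in lborel. 0 < t \<and> 0 < h \<and> h < 1 \<longrightarrow> R t h = \<rho> t h"
    using AE_lborel_pair_characteristics[OF R(2), of 0] by simp
  have "AE h in lborel. AE t in lborel. 0 < t \<and> 0 < h \<and> h < 1 \<longrightarrow> X t h = \<xi> t h"
    using AE_lborel_pair_characteristics[OF X(2), of 0] by simp
  then have sliceX: "AE h in lborel. AE t in lborel. 0 < t \<and> 0 < 1 - h \<and> 1 - h < 1 \<longrightarrow> X t (1 - h) = \<xi> t (1 - h)"
    by (rule AE_lborel_reflect)
  have trace: "\<exists>d>0. AE h in lborel. 0 < h \<and> h < d \<longrightarrow>
       (\<integral>\<^sup>+t\<in>{0..T}. ennreal \<bar>unfolded R X t (real_of_int n - h - t) - g n t\<bar> \<partial>lborel) \<le> ennreal e" if "0 < e" for n T e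
  proof -
    define T' where "T' = max T 0 + 1"
    have T': "0 < T'" "T < T'" by (auto simp: T'_def)
    show ?thesis
    proof (cases "even n")
      case True
      then obtain j where j: "n = 2 * j" by (auto elim: evenE)
      obtain \<delta> where \<delta>: "0 < \<delta>" "\<And>r. r \<in> {0..1} \<Longrightarrow> \<bar>r - 0\<bar> < \<delta> \<Longrightarrow> (\<integral>\<^sup>+t\<in>{0<..<T'}. ennreal \<bar>\<rho> t r - \<rho> t 0\<bar> \<partial>lborel) \<le> ennreal e"
        using cont_Lp2_L1[OF contx[OF T'(1)] \<open>1 < p\<close> _ \<open>0 < e\<close>, of 0] by auto
      have "AE h in lborel. 0 < h \<and> h < min \<delta> 1 \<longrightarrow>
         (\<integral>\<^sup>+t\<in>{0..T}. ennreal \<bar>unfolded R X t (real_of_int n - h - t) - g n t\<bar> \<partial>lborel) \<le> ennreal e"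
        using sliceR
      proof eventually_elim
        case (elim h)
        show ?case
        proof
          assume h: "0 < h \<and> h < min \<delta> 1"
          have "(\<integral>\<^sup>+t\<in>{0..T}. ennreal \<bar>unfolded R X t (real_of_int n - h - t) - g n t\<bar> \<partial>lborel) \<le>
              (\<integral>\<^sup>+t\<in>{0<..<T'}. ennreal \<bar>\<rho> t h - \<rho> t 0\<bar> \<partial>lborel)"
          proof (rule nn_integral_mono_AE)
            show "AE t in lborel. ennreal \<bar>unfolded R X t (real_of_int n - h - t) - g n t\<bar> * indicator {0..T} t \<le>
                ennreal \<bar>\<rho> t h - \<rho> t 0\<bar> * indicator {0<..<T'} t"
              using elim gval[of n] bc AE_lborel_singleton[of "0::real"]
            proof eventually_elim
              case (elim t)
              have "unfolded R X t (real_of_int n - h - t) = R t h"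
                by (rule unfolded_left[of _ _ _ j]) (use h j in auto)
              then show ?case using elim h True T' by (auto simp: indicator_def)
            qed
          qed
          also have "\<dots> \<le> ennreal e" using h by (intro \<delta>(2)) auto
          finally show "(\<integral>\<^sup>+t\<in>{0..T}. ennreal \<bar>unfolded R X t (real_of_int n - h - t) - g n t\<bar> \<partial>lborel) \<le> ennreal e" .
        qed
      qed
      then show ?thesis using \<delta>(1) by (intro exI[of _ "min \<delta> 1"]) auto
    next
      case False
      then obtain j where j: "n = 2 * j + 1" by (auto elim: oddE)
      obtain \<delta> where \<delta>: "0 < \<delta>" "\<And>r. r \<in> {0..1} \<Longrightarrow> \<bar>r - 1\<bar> < \<delta> \<Longrightarrow> (\<integral>\<^sup>+t\<in>{0<..<T'}. ennreal \<bar>\<xi> t r - \<xi> t 1\<bar> \<partial>lborel) \<le> ennreal e"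
        using cont_Lp2_L1[OF contx[OF T'(1)] \<open>1 < p\<close> _ \<open>0 < e\<close>, of 1] by auto
      have "AE h in lborel. 0 < h \<and> h < min \<delta> 1 \<longrightarrow>
         (\<integral>\<^sup>+t\<in>{0..T}. ennreal \<bar>unfolded R X t (real_of_int n - h - t) - g n t\<bar> \<partial>lborel) \<le> ennreal e"
        using sliceX
      proof eventually_elim
        case (elim h)
        show ?case
        proof
          assume h: "0 < h \<and> h < min \<delta> 1"
          have "(\<integral>\<^sup>+t\<in>{0..T}. ennreal \<bar>unfolded R X t (real_of_int n - h - t) - g n t\<bar> \<partial>lborel) \<le>
              (\<integral>\<^sup>+t\<in>{0<..<T'}. ennreal \<bar>\<xi> t (1 - h) - \<xi> t 1\<bar> \<partial>lborel)"
          proof (rule nn_integral_mono_AE)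
            show "AE t in lborel. ennreal \<bar>unfolded R X t (real_of_int n - h - t) - g n t\<bar> * indicator {0..T} t \<le>
                ennreal \<bar>\<xi> t (1 - h) - \<xi> t 1\<bar> * indicator {0<..<T'} t"
              using elim gval[of n] bc AE_lborel_singleton[of "0::real"]
            proof eventually_elim
              case (elim t)
              have "unfolded R X t (real_of_int n - h - t) = X t (1 - h)"
                by (rule unfolded_right[of _ _ _ j]) (use h j in auto)
              then show ?case using elim h False T' by (auto simp: indicator_def)
            qed
          qed
          also have "\<dots> \<le> ennreal e" using h by (intro \<delta>(2)) auto
          finally show "(\<integral>\<^sup>+t\<in>{0..T}. ennreal \<bar>unfolded R X t (real_of_int n - h - t) - g n t\<bar> \<partial>lborel) \<le> ennreal e" .
        qed
      qed
      then show ?thesis using \<delta>(1) by (intro exI[of _ "min \<delta> 1"]) auto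
    qed
  qed
  \<comment> \<open>The null sets on which the coefficient, the Borel versions or the initial
    values disagree are avoided along almost all characteristics of both families.\<close>
  define good where "good s x \<longleftrightarrow> (0 < s \<and> 0 < x \<and> x < 1 \<longrightarrow> a s x = \<alpha> s x \<and> R s x = \<rho> s x \<and> X s x = \<xi> s x)" for s x
  have aegood: "AE (s, x) in lborel. good s x"
    using a R(2) X(2) by eventually_elim (auto simp: good_def)
  define C1 where "C1 q \<longleftrightarrow> (AE s in lborel. good s (q - s))" for q
  define C2 where "C2 q \<longleftrightarrow> (AE s in lborel. good s (q + s))" for q
  have "AE q in lborel. C1 q"
    using AE_lborel_pair_characteristics[OF aegood, of "-1"] by (simp add: C1_def)
  then have c1: "AE (t, x) in lborel. C1 (x + 1 * t)" by (rule AE_lborel_pair_shear)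
  have "AE q in lborel. C2 q"
    using AE_lborel_pair_characteristics[OF aegood, of 1] by (simp add: C2_def)
  then have c2: "AE (t, x) in lborel. C2 (x + (-1) * t)" by (rule AE_lborel_pair_shear)
  have c3: "AE (t, x) in lborel. 0 < x + 1 * t \<and> x + 1 * t < 1 \<longrightarrow> f (- (x + 1 * t)) = \<rho>0 (x + 1 * t)"
    by (rule AE_lborel_pair_shear[OF rho0])
  have c4: "AE (t, x) in lborel. 0 < x + (-1) * t \<and> x + (-1) * t < 1 \<longrightarrow> f (x + (-1) * t) = \<xi>0 (x + (-1) * t)"
    by (rule AE_lborel_pair_shear[OF xi0])
  define full where "full t x \<longleftrightarrow> (0 < t \<and> 0 < x \<and> x < 1 \<longrightarrow> characteristic_rules a \<rho>0 \<xi>0 \<rho> \<xi> t x \<and> good t x \<and> C1 (x + t) \<and> C2 (x - t) \<and>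
    (0 < x + t \<and> x + t < 1 \<longrightarrow> f (- (x + t)) = \<rho>0 (x + t)) \<and> (0 < x - t \<and> x - t < 1 \<longrightarrow> f (x - t) = \<xi>0 (x - t)))" for t x
  have aefull: "AE (t, x) in lborel. full t x"
    using rules aegood c1 c2 c3 c4 by eventually_elim (auto simp: full_def)
  \<comment> \<open>The point (t, z) lies over x = z + t - 2 j on the right half of the circle
    or over x = 2 j - z - t on the left half. Taking all integers j at once allows a choice of
    j that depends on the point.\<close>
  have fullR: "AE tz in lborel. \<forall>j. case tz of (t, z) \<Rightarrow> full t (- (2 * real_of_int j) + 1 * z + 1 * t)"
    unfolding AE_all_countable by (intro allI AE_lborel_pair_affine[OF aefull, where \<sigma> = 1]) simp
  have fullL: "AE tz in lborel. \<forall>j. case tz of (t, z) \<Rightarrow> full t (2 * real_of_int j + (-1) * z + (-1) * t)"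
    unfolding AE_all_countable by (intro allI AE_lborel_pair_affine[OF aefull, where \<sigma> = "-1"]) simp
  have noint: "AE (t, z) in (lborel :: (real \<times> real) measure). z + 1 * t \<notin> range real_of_int"
  proof (rule AE_lborel_pair_shear)
    show "AE z in lborel. z \<notin> range real_of_int"
      by (intro AE_not_in countable_imp_null_set_lborel) auto
  qed
  have gz: "AE (t, z) in (lborel :: (real \<times> real) measure). \<forall>n. 0 < real_of_int n - (z + 0 * t) \<longrightarrow>
      g n (real_of_int n - (z + 0 * t)) = (if even n then \<xi> (real_of_int n - (z + 0 * t)) 0 else \<rho> (real_of_int n - (z + 0 * t)) 1)"
  proof (rule AE_lborel_pair_shear)
    show "AE z in lborel. \<forall>n. 0 < real_of_int n - z \<longrightarrow> g n (real_of_int n - z) = (if even n then \<xi> (real_of_int n - z) 0 else \<rho> (real_of_int n - z) 1)"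
      unfolding AE_all_countable using AE_lborel_reflect[OF gval] by auto
  qed
  have cover: "(\<exists>j x. n = 2 * j \<and> 0 < x \<and> x < 1 \<and> z + t = 2 * real_of_int j + x) \<or>
       (\<exists>j x. n = 2 * j - 1 \<and> 0 < x \<and> x < 1 \<and> z + t = 2 * real_of_int j - x)"
    if n: "n = \<lfloor>z + t\<rfloor>" "z + t \<notin> range real_of_int" for n z t
  proof -
    have "z + t \<noteq> real_of_int n" using n(2) by auto
    then have b: "real_of_int n < z + t" "z + t < real_of_int n + 1" using n(1) by linarith+
    show ?thesis
    proof (cases "even n")
      case True
      then obtain j where "n = 2 * j" by (auto elim: evenE)
      then show ?thesis using b by (intro disjI1 exI[of _ j] exI[of _ "z + t - 2 * real_of_int j"]) auto
    next
      case False
      then obtain j where "n = 2 * j + 1" by (auto elim: oddE)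
      then have "n = 2 * (j + 1) - 1" by simp
      then show ?thesis using b by (intro disjI2 exI[of _ "j + 1"] exI[of _ "2 * real_of_int (j + 1) - (z + t)"]) auto
    qed
  qed
  have right_int: "(LINT s|lebesgue_on {\<tau><..<t}. G_term a \<rho> \<xi> s (x - t + s)) = (LINT s:{\<tau>..t}|lborel. jump w s z)"
    if full: "full t x" and t: "0 < t" and x: "0 < x" "x < 1" and z: "z + t = 2 * real_of_int j + x" and \<tau>: "0 \<le> \<tau>" "t - x \<le> \<tau>" for t x z j \<tau>
  proof (rule LINT_Ioo_eq_Icc)
    have "AE s in lborel. good s (x - t + s)" using full t x by (auto simp: full_def C2_def)
    then show "AE s in lborel. \<tau> < s \<and> s < t \<longrightarrow> G_term a \<rho> \<xi> s (x - t + s) = jump w s z"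
    proof eventually_elim
      case (elim s)
      show ?case
      proof
        assume s: "\<tau> < s \<and> s < t"
        have x': "0 < x - t + s" "x - t + s < 1" "0 < s" using s \<tau> x by auto
        have "jump w s z = \<alpha> s (x - t + s) / 2 * (R s (x - t + s) - X s (x - t + s))"
          unfolding w_def by (rule jump_unfolded_right[OF x'(1,2), of z s j]) (use z in auto)
        then show "G_term a \<rho> \<xi> s (x - t + s) = jump w s z"
          using elim x' by (simp add: good_def G_term_def)
      qed
    qed
  qed measurable
  have left_int: "(LINT s|lebesgue_on {\<tau><..<t}. F_term a \<rho> \<xi> s (x + t - s)) = (LINT s:{\<tau>..t}|lborel. jump w s z)"
    if full: "full t x" and t: "0 < t" and x: "0 < x" "x < 1" and z: "z + t = 2 * real_of_int j - x" and \<tau>: "0 \<le> \<tau>" "t + x - 1 \<le> \<tau>" for t x z j \<tau>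
  proof (rule LINT_Ioo_eq_Icc)
    have "AE s in lborel. good s (x + t - s)" using full t x by (auto simp: full_def C1_def)
    then show "AE s in lborel. \<tau> < s \<and> s < t \<longrightarrow> F_term a \<rho> \<xi> s (x + t - s) = jump w s z"
    proof eventually_elim
      case (elim s)
      show ?case
      proof
        assume s: "\<tau> < s \<and> s < t"
        have x': "0 < x + t - s" "x + t - s < 1" "0 < s" using s \<tau> x by auto
        have "jump w s z = \<alpha> s (x + t - s) / 2 * (X s (x + t - s) - R s (x + t - s))"
          unfolding w_def by (rule jump_unfolded_left[OF x'(1,2), of z s j]) (use z in auto)
        then show "F_term a \<rho> \<xi> s (x + t - s) = jump w s z"
          using elim x' by (simp add: good_def F_term_def algebra_simps)
      qed
    qed
  qed measurable
  have fshift: "f (y + 2 * real_of_int j) = f y" for y j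
    using f by (intro periodic2_int) (auto simp: datum_def)
  show "AE (t, z) in lborel. 0 < t \<longrightarrow> unfolded R X t z = f z + (LINT r:{0..t}|lborel. jump (unfolded R X) r z)"
  proof (rule lagrangian_from_segments[where g = g, OF f])
    show "AE (t, z) in lborel. 0 < t \<and> real_of_int \<lfloor>z + t\<rfloor> < z \<longrightarrow>
       unfolded R X t z = f z + (LINT r:{0..t}|lborel. jump (unfolded R X) r z)"
      using fullR fullL noint
    proof eventually_elim
      case (elim tz)
      obtain t z where tz: "tz = (t, z)" by force
      show ?case
        unfolding tz prod.case
      proof
        assume t: "0 < t \<and> real_of_int \<lfloor>z + t\<rfloor> < z"
        have "z + t \<notin> range real_of_int" using elim(3) by (simp add: tz)
        from cover[OF refl this] show "unfolded R X t z = f z + (LINT r:{0..t}|lborel. jump (unfolded R X) r z)"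
        proof (elim disjE exE conjE)
          fix j x assume j: "\<lfloor>z + t\<rfloor> = 2 * j" and x: "0 < x" "x < 1" and z: "z + t = 2 * real_of_int j + x"
          have "- (2 * real_of_int j) + 1 * z + 1 * t = x" using z by simp
          with elim(1) have fx: "full t x" by (auto simp: tz dest: spec[of _ j])
          have "real_of_int \<lfloor>z + t\<rfloor> = 2 * real_of_int j" unfolding j by simp
          then have tx: "t < x" using t z by linarith
          have "unfolded R X t z = X t x" by (rule unfolded_right[OF x z])
          also have "\<dots> = \<xi> t x" using fx t x by (auto simp: full_def good_def)
          also have "\<dots> = \<xi>0 (x - t) + (LINT s|lebesgue_on {0<..<t}. G_term a \<rho> \<xi> s (x - t + s))"
            using fx t x tx by (auto simp: full_def characteristic_rules_def)
          also have "\<xi>0 (x - t) = f (x - t)" using fx t x tx by (auto simp: full_def)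
          also have "f (x - t) = f z"
          proof -
            have "z = x - t + 2 * real_of_int j" using z by simp
            then show ?thesis using fshift[of "x - t" j] by simp
          qed
          also have "(LINT s|lebesgue_on {0<..<t}. G_term a \<rho> \<xi> s (x - t + s)) = (LINT s:{0..t}|lborel. jump w s z)"
            by (rule right_int[OF fx _ x z]) (use t tx in auto)
          finally show ?thesis by (simp add: w_def)
        next
          fix j x assume j: "\<lfloor>z + t\<rfloor> = 2 * j - 1" and x: "0 < x" "x < 1" and z: "z + t = 2 * real_of_int j - x"
          have "2 * real_of_int j + (-1) * z + (-1) * t = x" using z by simp
          with elim(2) have fx: "full t x" by (auto simp: tz dest: spec[of _ j])
          have "real_of_int \<lfloor>z + t\<rfloor> = 2 * real_of_int j - 1" unfolding j by simp
          then have tx: "x + t < 1" using t z by linarith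
          have "unfolded R X t z = R t x" by (rule unfolded_left[OF x z])
          also have "\<dots> = \<rho> t x" using fx t x by (auto simp: full_def good_def)
          also have "\<dots> = \<rho>0 (x + t) + (LINT s|lebesgue_on {0<..<t}. F_term a \<rho> \<xi> s (x + t - s))"
            using fx t x tx by (auto simp: full_def characteristic_rules_def)
          also have "\<rho>0 (x + t) = f (- (x + t))" using fx t x tx by (auto simp: full_def)
          also have "f (- (x + t)) = f z"
          proof -
            have "z = - (x + t) + 2 * real_of_int j" using z by simp
            then show ?thesis using fshift[of "- (x + t)" j] by simp
          qed
          also have "(LINT s|lebesgue_on {0<..<t}. F_term a \<rho> \<xi> s (x + t - s)) = (LINT s:{0..t}|lborel. jump w s z)"
            by (rule left_int[OF fx _ x z]) (use t tx in auto)
          finally show ?thesis by (simp add: w_def)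
        qed
      qed
    qed
    show "AE (t, z) in lborel. 0 < t \<and> z < real_of_int \<lfloor>z + t\<rfloor> \<longrightarrow>
       unfolded R X t z = g \<lfloor>z + t\<rfloor> (real_of_int \<lfloor>z + t\<rfloor> - z) + (LINT r:{real_of_int \<lfloor>z + t\<rfloor> - z..t}|lborel. jump (unfolded R X) r z)"
      using fullR fullL noint gz
    proof eventually_elim
      case (elim tz)
      obtain t z where tz: "tz = (t, z)" by force
      define n where "n = \<lfloor>z + t\<rfloor>"
      show ?case
        unfolding tz prod.case n_def[symmetric]
      proof
        assume t: "0 < t \<and> z < real_of_int n"
        have gn: "g n (real_of_int n - z) = (if even n then \<xi> (real_of_int n - z) 0 else \<rho> (real_of_int n - z) 1)"
          using elim(4) t by (auto simp: tz)
        have "z + t \<notin> range real_of_int" using elim(3) by (simp add: tz)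
        from cover[OF n_def this] show "unfolded R X t z = g n (real_of_int n - z) + (LINT r:{real_of_int n - z..t}|lborel. jump (unfolded R X) r z)"
        proof (elim disjE exE conjE)
          fix j x assume j: "n = 2 * j" and x: "0 < x" "x < 1" and z: "z + t = 2 * real_of_int j + x"
          have "- (2 * real_of_int j) + 1 * z + 1 * t = x" using z by simp
          with elim(1) have fx: "full t x" by (auto simp: tz dest: spec[of _ j])
          have tx: "x < t" "t - x = real_of_int n - z" using t j z by auto
          have "unfolded R X t z = X t x" by (rule unfolded_right[OF x z])
          also have "\<dots> = \<xi> t x" using fx t x by (auto simp: full_def good_def)
          also have "\<dots> = \<xi> (t - x) 0 + (LINT s|lebesgue_on {t - x<..<t}. G_term a \<rho> \<xi> s (x - t + s))"
            using fx t x tx by (auto simp: full_def characteristic_rules_def)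
          also have "(LINT s|lebesgue_on {t - x<..<t}. G_term a \<rho> \<xi> s (x - t + s)) = (LINT s:{t - x..t}|lborel. jump w s z)"
            by (rule right_int[OF fx _ x z]) (use t tx in auto)
          finally show ?thesis using gn j unfolding tx w_def by simp
        next
          fix j x assume j: "n = 2 * j - 1" and x: "0 < x" "x < 1" and z: "z + t = 2 * real_of_int j - x"
          have "2 * real_of_int j + (-1) * z + (-1) * t = x" using z by simp
          with elim(2) have fx: "full t x" by (auto simp: tz dest: spec[of _ j])
          have tx: "1 < x + t" "t + x - 1 = real_of_int n - z" using t j z by auto
          have "unfolded R X t z = R t x" by (rule unfolded_left[OF x z])
          also have "\<dots> = \<rho> t x" using fx t x by (auto simp: full_def good_def)
          also have "\<dots> = \<rho> (t + x - 1) 1 + (LINT s|lebesgue_on {t + x - 1<..<t}. F_term a \<rho> \<xi> s (x + t - s))"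
            using fx t x tx by (auto simp: full_def characteristic_rules_def)
          also have "(LINT s|lebesgue_on {t + x - 1<..<t}. F_term a \<rho> \<xi> s (x + t - s)) = (LINT s:{t + x - 1..t}|lborel. jump w s z)"
            by (rule left_int[OF fx _ x z]) (use t tx in auto)
          finally show ?thesis using gn j unfolding tx w_def by simp
        qed
      qed
    qed
  qed (use w per bound gL trace in \<open>auto simp: w_def\<close>)
qed

text \<open>
  For almost every \<open>t\<close> this is the uniqueness along characteristics. Both sides are
  continuous in time with values in \<open>L\<^sup>1\<close>, so it extends to all
  \<open>t\<close>.
\<close>

lemma broad_solution_unique:
  assumes f: "Lp_datum p f" and "1 < p"
    and rho0: "AE x in lborel. 0 < x \<and> x < 1 \<longrightarrow> f (- x) = \<rho>0 x"
    and xi0: "AE x in lborel. 0 < x \<and> x < 1 \<longrightarrow> f x = \<xi>0 x"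
    and a: "AE (t, x) in lborel. 0 < t \<and> 0 < x \<and> x < 1 \<longrightarrow> a t x = \<alpha> t x"
    and sol: "\<And>T. 0 < T \<Longrightarrow> broad_solution p T a \<rho>0 \<xi>0 \<rho> \<xi>"
    and "0 \<le> t"
  shows "AE x in lborel. x \<in> {0<..<1} \<longrightarrow> \<rho> t x = wave f t (- x) \<and> \<xi> t x = wave f t x"
proof -
  have d: "datum f" using f by (simp add: Lp_datum_def)
  have meas: "(\<lambda>(t, x). \<rho> t x) \<in> borel_measurable (lebesgue_on ({0<..<T} \<times> {0<..<1}))"
    "(\<lambda>(t, x). \<xi> t x) \<in> borel_measurable (lebesgue_on ({0<..<T} \<times> {0<..<1}))" if "0 < T" for T
    using sol[OF that] by (auto simp: broad_solution_def)
  obtain R where R: "case_prod R \<in> borel_measurable (borel \<Otimes>\<^sub>M borel)" "AE (t, x) in lborel. 0 < t \<and> 0 < x \<and> x < 1 \<longrightarrow> R t x = \<rho> t x"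
    using joint_borel_version[OF meas(1)] by blast
  obtain X where X: "case_prod X \<in> borel_measurable (borel \<Otimes>\<^sub>M borel)" "AE (t, x) in lborel. 0 < t \<and> 0 < x \<and> x < 1 \<longrightarrow> X t x = \<xi> t x"
    using joint_borel_version[OF meas(2)] by blast
  define ok where "ok t \<longleftrightarrow> (0 < t \<longrightarrow> (AE x in lborel. x \<in> {0<..<1} \<longrightarrow> \<rho> t x = wave f t (- x) \<and> \<xi> t x = wave f t x))" for t
  have aeR: "AE t in lborel. AE x in lborel. 0 < t \<and> 0 < x \<and> x < 1 \<longrightarrow> R t x = \<rho> t x"
    using lborel_pair.AE_pair[OF R(2)[folded lborel_prod]] by simp
  have aeX: "AE t in lborel. AE x in lborel. 0 < t \<and> 0 < x \<and> x < 1 \<longrightarrow> X t x = \<xi> t x"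
    using lborel_pair.AE_pair[OF X(2)[folded lborel_prod]] by simp
  have "AE t in lborel. 0 < t \<longrightarrow> (AE z in lborel. unfolded R X t z = flow f t z)"
    by (rule broad_solution_lagrangian[OF d \<open>1 < p\<close> rho0 xi0 a sol R X])
  then have "AE t in lborel. ok t"
    using aeR aeX
  proof eventually_elim
    case (elim t)
    show ?case
      unfolding ok_def
    proof
      assume t: "0 < t"
      with elim(1) have "AE z in lborel. unfolded R X t z = flow f t z" by simp
      then have "AE h in lborel. unfolded R X t (0 - h) = flow f t (0 - h)" by (rule AE_lborel_reflect)
      then have "AE y in lborel. unfolded R X t (0 - (t - y)) = flow f t (0 - (t - y))" by (rule AE_lborel_reflect)
      then have y: "AE y in lborel. unfold2 (X t) (R t) y = wave f t y"
        by (simp add: unfolded_def wave_def)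
      then have "AE x in lborel. unfold2 (X t) (R t) (0 - x) = wave f t (0 - x)" by (rule AE_lborel_reflect)
      with y elim(2,3) show "AE x in lborel. x \<in> {0<..<1} \<longrightarrow> \<rho> t x = wave f t (- x) \<and> \<xi> t x = wave f t x"
      proof eventually_elim
        case (elim x)
        show ?case
        proof
          assume "x \<in> {0<..<1}"
          then show "\<rho> t x = wave f t (- x) \<and> \<xi> t x = wave f t x"
            using elim t unfold2_pos[of x "X t" "R t"] unfold2_neg[of x "X t" "R t"] by simp
        qed
      qed
    qed
  qed
  then have "AE h in lborel. ok (0 - h)" by (rule AE_lborel_reflect)
  \<comment> \<open>Almost every later time is good, in particular some arbitrarily close to
    t.\<close>
  then have "AE h in lborel. ok (0 - (- t - h))" by (rule AE_lborel_reflect)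
  then have later: "AE h in lborel. ok (t + h)" by (simp add: add.commute)
  have "0 < t + 1" using \<open>0 \<le> t\<close> by simp
  have c: "cont_Lp2 p {0..t + 1} (lebesgue_on {0<..<1}) \<rho> \<xi>"
    using sol[OF \<open>0 < t + 1\<close>] by (simp add: broad_solution_def)
  have c': "cont_Lp2 p {0..t + 1} (lebesgue_on {0<..<1}) (\<lambda>t x. wave f t (- x)) (\<lambda>t x. wave f t x)"
    using wave_broad_solution[OF f \<open>1 < p\<close> rho0 xi0 a, of "t + 1"] by (simp add: broad_solution_def)
  have small: "(\<integral>\<^sup>+x\<in>{0<..<1}. ennreal \<bar>\<rho> t x - wave f t (- x)\<bar> \<partial>lborel) \<le> 0 + ennreal e \<and>
      (\<integral>\<^sup>+x\<in>{0<..<1}. ennreal \<bar>\<xi> t x - wave f t x\<bar> \<partial>lborel) \<le> 0 + ennreal e" if "0 < e" for e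
  proof -
    have e2: "0 < e / 2" using that by simp
    have tT: "t \<in> {0..t + 1}" using \<open>0 \<le> t\<close> by simp
    obtain \<delta> where \<delta>: "0 < \<delta>" "\<And>r. r \<in> {0..t + 1} \<Longrightarrow> \<bar>r - t\<bar> < \<delta> \<Longrightarrow>
       (\<integral>\<^sup>+x\<in>{0<..<1}. ennreal \<bar>\<rho> r x - \<rho> t x\<bar> \<partial>lborel) \<le> ennreal (e / 2) \<and> (\<integral>\<^sup>+x\<in>{0<..<1}. ennreal \<bar>\<xi> r x - \<xi> t x\<bar> \<partial>lborel) \<le> ennreal (e / 2)"
      using cont_Lp2_L1[OF c \<open>1 < p\<close> tT e2] by blast
    obtain \<delta>' where \<delta>': "0 < \<delta>'" "\<And>r. r \<in> {0..t + 1} \<Longrightarrow> \<bar>r - t\<bar> < \<delta>' \<Longrightarrow>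
       (\<integral>\<^sup>+x\<in>{0<..<1}. ennreal \<bar>wave f r (- x) - wave f t (- x)\<bar> \<partial>lborel) \<le> ennreal (e / 2) \<and> (\<integral>\<^sup>+x\<in>{0<..<1}. ennreal \<bar>wave f r x - wave f t x\<bar> \<partial>lborel) \<le> ennreal (e / 2)"
      using cont_Lp2_L1[OF c' \<open>1 < p\<close> tT e2] by blast
    have "0 < min 1 (min \<delta> \<delta>')" using \<delta> \<delta>' by simp
    from AE_lborel_ex_in_interval[OF later this] obtain h where h: "0 < h" "h < min 1 (min \<delta> \<delta>')" "ok (t + h)" by blast
    define r where "r = t + h"
    have r: "r \<in> {0..t + 1}" "\<bar>r - t\<bar> < \<delta>" "\<bar>r - t\<bar> < \<delta>'" "0 < r" using h \<open>0 \<le> t\<close> by (auto simp: r_def)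
    have eq: "AE x in lborel. x \<in> {0<..<1} \<longrightarrow> \<rho> r x = wave f r (- x) \<and> \<xi> r x = wave f r x"
      using h r by (simp add: ok_def r_def)
    have tri: "(\<integral>\<^sup>+x\<in>{0<..<1}. ennreal \<bar>u t x - v t x\<bar> \<partial>lborel) \<le> 0 + ennreal e"
      if m: "\<And>s. s \<in> {0..t + 1} \<Longrightarrow> u s \<in> borel_measurable (lebesgue_on {0<..<1})" "\<And>s. s \<in> {0..t + 1} \<Longrightarrow> v s \<in> borel_measurable (lebesgue_on {0<..<1})"
        and ae: "AE x in lborel. x \<in> {0<..<1} \<longrightarrow> u r x = v r x"
        and s: "(\<integral>\<^sup>+x\<in>{0<..<1}. ennreal \<bar>u r x - u t x\<bar> \<partial>lborel) \<le> ennreal (e / 2)" "(\<integral>\<^sup>+x\<in>{0<..<1}. ennreal \<bar>v r x - v t x\<bar> \<partial>lborel) \<le> ennreal (e / 2)"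
      for u v :: "real \<Rightarrow> real \<Rightarrow> real"
    proof -
      note [measurable] = m(1)[OF r(1)] m(1)[OF tT] m(2)[OF r(1)] m(2)[OF tT]
      have "AE x in lebesgue_on {0<..<1}. u r x = v r x"
        using ae by (subst AE_lebesgue_on_iff) auto
      then have "AE x in lebesgue_on {0<..<1}. ennreal \<bar>u t x - v t x\<bar> \<le> ennreal \<bar>u r x - u t x\<bar> + ennreal \<bar>v r x - v t x\<bar>"
        by eventually_elim (auto simp: ennreal_plus[symmetric] intro!: ennreal_leI simp del: ennreal_plus)
      then have "(\<integral>\<^sup>+x. ennreal \<bar>u t x - v t x\<bar> \<partial>lebesgue_on {0<..<1}) \<le> (\<integral>\<^sup>+x. ennreal \<bar>u r x - u t x\<bar> + ennreal \<bar>v r x - v t x\<bar> \<partial>lebesgue_on {0<..<1})"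
        by (rule nn_integral_mono_AE)
      also have "\<dots> = (\<integral>\<^sup>+x. ennreal \<bar>u r x - u t x\<bar> \<partial>lebesgue_on {0<..<1}) + (\<integral>\<^sup>+x. ennreal \<bar>v r x - v t x\<bar> \<partial>lebesgue_on {0<..<1})"
        by (rule nn_integral_add) auto
      also have "\<dots> \<le> ennreal (e / 2) + ennreal (e / 2)"
        unfolding nn_integral_lebesgue_on_Ioo by (intro add_mono s)
      also have "\<dots> = 0 + ennreal e" using \<open>0 < e\<close> by (simp add: ennreal_plus[symmetric] del: ennreal_plus)
      finally show ?thesis unfolding nn_integral_lebesgue_on_Ioo .
    qed
    have cm: "\<rho> s \<in> borel_measurable (lebesgue_on {0<..<1})" "\<xi> s \<in> borel_measurable (lebesgue_on {0<..<1})"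
      "(\<lambda>x. wave f s (- x)) \<in> borel_measurable (lebesgue_on {0<..<1})" "(\<lambda>x. wave f s x) \<in> borel_measurable (lebesgue_on {0<..<1})"
      if "s \<in> {0..t + 1}" for s
      using c c' that by (auto simp: cont_Lp2_def in_Lp_def)
    have "AE x in lborel. x \<in> {0<..<1} \<longrightarrow> \<rho> r x = wave f r (- x)" "AE x in lborel. x \<in> {0<..<1} \<longrightarrow> \<xi> r x = wave f r x"
      using eq by (auto elim!: eventually_mono)
    then show ?thesis
      using tri[of \<rho> "\<lambda>s x. wave f s (- x)"] tri[of \<xi> "\<lambda>s x. wave f s x"] \<delta>(2)[OF r(1,2)] \<delta>'(2)[OF r(1,3)] cm by auto
  qed
  have tT: "t \<in> {0..t + 1}" using \<open>0 \<le> t\<close> by simp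
  have cm: "\<rho> t \<in> borel_measurable (lebesgue_on {0<..<1})" "\<xi> t \<in> borel_measurable (lebesgue_on {0<..<1})"
      "(\<lambda>x. wave f t (- x)) \<in> borel_measurable (lebesgue_on {0<..<1})" "(\<lambda>x. wave f t x) \<in> borel_measurable (lebesgue_on {0<..<1})"
    using c c' tT by (auto simp: cont_Lp2_def in_Lp_def)
  have zero: "AE x in lborel. x \<in> {0<..<1} \<longrightarrow> u x = v x"
    if m [measurable]: "u \<in> borel_measurable (lebesgue_on {0<..<1})" "v \<in> borel_measurable (lebesgue_on {0<..<1})"
      and s: "\<And>e. 0 < e \<Longrightarrow> (\<integral>\<^sup>+x\<in>{0<..<1}. ennreal \<bar>u x - v x\<bar> \<partial>lborel) \<le> 0 + ennreal e" for u v :: "real \<Rightarrow> real"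
  proof -
    have "(\<integral>\<^sup>+x\<in>{0<..<1}. ennreal \<bar>u x - v x\<bar> \<partial>lborel) \<le> 0"
      using s by (rule ennreal_le_epsilon)
    then have "(\<integral>\<^sup>+x. ennreal \<bar>u x - v x\<bar> \<partial>lebesgue_on {0<..<1}) = 0"
      unfolding nn_integral_lebesgue_on_Ioo by simp
    then have "AE x in lebesgue_on {0<..<1}. ennreal \<bar>u x - v x\<bar> = 0"
      by (subst (asm) nn_integral_0_iff_AE) auto
    then show ?thesis by (subst (asm) AE_lebesgue_on_iff) (auto elim!: eventually_mono)
  qed
  have "AE x in lborel. x \<in> {0<..<1} \<longrightarrow> \<rho> t x = wave f t (- x)"
    by (rule zero[OF cm(1,3)]) (use small in auto)
  moreover have "AE x in lborel. x \<in> {0<..<1} \<longrightarrow> \<xi> t x = wave f t x"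
    by (rule zero[OF cm(2,4)]) (use small in auto)
  ultimately show ?thesis by eventually_elim auto
qed

section \<open>Exponential decay\<close>

text \<open>
  The pair at time \<open>t\<close> makes up one period of the wave, which is a translate of the
  flow.
\<close>

lemma Lp2_norm_wave:
  assumes f: "datum f"
  shows "Lp2_norm p (lebesgue_on {0<..<1}) (\<lambda>x. wave f t (- x) - b) (\<lambda>x. wave f t x - b) =
    enn2real (per (\<lambda>z. ennreal (\<bar>flow f t z - b\<bar> powr p))) powr (1 / p)"
proof -
  note [measurable] = borel_pair_compose[OF wave_measurable[OF f]] borel_pair_compose[OF flow_measurable[OF f]]
  have "per (\<lambda>z. ennreal (\<bar>flow f t z - b\<bar> powr p)) = per (\<lambda>y. (\<lambda>z. ennreal (\<bar>flow f t z - b\<bar> powr p)) (y + - t))"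
    by (rule per_shift[symmetric]) (use flow_periodic[OF f, of t] in \<open>auto simp: periodic2_def\<close>)
  also have "\<dots> = per (\<lambda>y. ennreal (\<bar>wave f t y - b\<bar> powr p))" by (simp add: wave_def)
  also have "\<dots> = (\<integral>\<^sup>+x\<in>{0<..<1}. ennreal (\<bar>wave f t x - b\<bar> powr p) \<partial>lborel) + (\<integral>\<^sup>+x\<in>{0<..<1}. ennreal (\<bar>wave f t (- x) - b\<bar> powr p) \<partial>lborel)"
    by (rule per_halves) measurable
  finally show ?thesis
    by (subst Lp2_norm_lebesgue_on) (measurable, simp add: add.commute)
qed

end

lemma Lp2_norm_AE_cong:
  fixes f g u v :: "real \<Rightarrow> real"
  assumes [measurable]: "f \<in> borel_measurable borel" "g \<in> borel_measurable borel" "A \<in> sets borel"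
    and ae: "AE x in lborel. x \<in> A \<longrightarrow> u x = f x \<and> v x = g x"
  shows "Lp2_norm p (lebesgue_on A) u v = Lp2_norm p (lebesgue_on A) f g"
proof -
  have "(LINT x|lebesgue_on A. \<bar>u x\<bar> powr p + \<bar>v x\<bar> powr p) = (LINT x:A|lborel. \<bar>f x\<bar> powr p + \<bar>g x\<bar> powr p)"
    by (rule LINT_lebesgue_on_cong) (use ae in \<open>auto elim!: eventually_mono\<close>)
  also have "\<dots> = (LINT x|lebesgue_on A. \<bar>f x\<bar> powr p + \<bar>g x\<bar> powr p)"
    by (rule LINT_lebesgue_on_cong[symmetric]) auto
  finally show ?thesis by (simp add: Lp2_norm_def)
qed

text \<open>
  \<open>b\<close> is the mean of \<open>f\<close> over the circle, so the positive and the
  negative part of \<open>f - b\<close> have the same integral.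
\<close>

lemma balanced_of_mean:
  assumes f: "datum f"
  defines "b \<equiv> (1 / 2) * (LINT x:{0<..<1}|lborel. f (- x) + f x)"
  shows "per (\<lambda>z. ennreal (f z - b)) = per (\<lambda>z. ennreal (- (f z - b)))"
proof -
  define g where "g z = f z - b" for z
  have [measurable]: "f \<in> borel_measurable borel" using f by (simp add: datum_def)
  have [measurable]: "g \<in> borel_measurable borel" unfolding g_def[abs_def] by measurable
  have g: "datum g" using datum_add[OF f datum_const[of "- b"]] by (simp add: g_def[abs_def])
  define P where "P s x = max 0 (s * g x) + max 0 (s * g (- x))" for s x :: real
  have [measurable]: "P s \<in> borel_measurable borel" for s unfolding P_def[abs_def] by measurable
  have half: "per (\<lambda>z. ennreal (s * g z)) = (\<integral>\<^sup>+x\<in>{0<..<1}. ennreal (P s x) \<partial>lborel)" for s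
  proof -
    have "per (\<lambda>z. ennreal (s * g z)) = (\<integral>\<^sup>+x\<in>{0<..<1}. ennreal (s * g x) \<partial>lborel) + (\<integral>\<^sup>+x\<in>{0<..<1}. ennreal (s * g (- x)) \<partial>lborel)"
      by (rule per_halves) measurable
    also have "\<dots> = (\<integral>\<^sup>+x. ennreal (s * g x) * indicator {0<..<1} x + ennreal (s * g (- x)) * indicator {0<..<1} x \<partial>lborel)"
      by (rule nn_integral_add[symmetric]) auto
    also have "\<dots> = (\<integral>\<^sup>+x\<in>{0<..<1}. ennreal (P s x) \<partial>lborel)"
      by (intro nn_integral_cong) (auto simp: indicator_def P_def ennreal_plus max_def ennreal_neg)
    finally show ?thesis .
  qed
  have fin: "(\<integral>\<^sup>+x\<in>{0<..<1}. ennreal (P 1 x) \<partial>lborel) < \<infinity>" "(\<integral>\<^sup>+x\<in>{0<..<1}. ennreal (P (-1) x) \<partial>lborel) < \<infinity>"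
    using half[of 1] half[of "-1"] datum_per[OF g] datum_per[OF datum_uminus[OF g]] by simp_all
  have nn: "0 \<le> P s x" for s x by (simp add: P_def)
  note I1 = set_lebesgue_integral_eq_nn[OF _ _ nn fin(1)] and I2 = set_lebesgue_integral_eq_nn[OF _ _ nn fin(2)]
  have int: "set_integrable lborel {0<..<1} (\<lambda>x. P 1 x - P (-1) x)"
    using I1(1) I2(1) by (intro set_integral_diff(1)) auto
  have const: "set_integrable lborel {0<..<1::real} (\<lambda>x. 2 * b)"
    by (simp add: set_integrable_def)
  have PD: "P 1 x - P (-1) x = f (- x) + f x - 2 * b" for x by (simp add: P_def g_def max_def)
  have "set_integrable lborel {0<..<1} (\<lambda>x. (P 1 x - P (-1) x) + 2 * b)"
    using int const by (intro set_integral_add(1))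
  then have intf: "set_integrable lborel {0<..<1} (\<lambda>x. f (- x) + f x)" by (simp add: PD)
  have "(LINT x:{0<..<1}|lborel. P 1 x) - (LINT x:{0<..<1}|lborel. P (-1) x) = (LINT x:{0<..<1}|lborel. P 1 x - P (-1) x)"
    using I1(1) I2(1) by (intro set_integral_diff(2)[symmetric]) auto
  also have "\<dots> = (LINT x:{0<..<1}|lborel. f (- x) + f x) - (LINT x:{0<..<1::real}|lborel. 2 * b)"
    unfolding PD by (rule set_integral_diff(2)[OF intf const])
  also have "\<dots> = 0" by (simp add: b_def set_lebesgue_integral_def)
  finally have "(LINT x:{0<..<1}|lborel. P 1 x) = (LINT x:{0<..<1}|lborel. P (-1) x)" by simp
  then have "(\<integral>\<^sup>+x\<in>{0<..<1}. ennreal (P 1 x) \<partial>lborel) = (\<integral>\<^sup>+x\<in>{0<..<1}. ennreal (P (-1) x) \<partial>lborel)"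
    using I1(2) I2(2) by simp
  then show ?thesis using half[of 1] half[of "-1"] by (simp add: g_def)
qed

lemma Lp_datum_of_initial_data:
  assumes "1 < p" and u0: "in_Lp p (lebesgue_on {0<..<1}) u0" and v0: "in_Lp p (lebesgue_on {0<..<1}) v0"
  obtains f where "Lp_datum p f" "AE x in lborel. 0 < x \<and> x < 1 \<longrightarrow> f x = u0 x" "AE x in lborel. 0 < x \<and> x < 1 \<longrightarrow> f (- x) = v0 x"
proof -
  have S: "{0<..<1::real} \<in> sets borel" by simp
  have "u0 \<in> borel_measurable (lebesgue_on {0<..<1})" using u0 by (simp add: in_Lp_def)
  from borel_version[OF this S] obtain u where u: "u \<in> borel_measurable borel" "AE x in lborel. x \<in> {0<..<1} \<longrightarrow> u x = u0 x" by metis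
  have "v0 \<in> borel_measurable (lebesgue_on {0<..<1})" using v0 by (simp add: in_Lp_def)
  from borel_version[OF this S] obtain v where v: "v \<in> borel_measurable borel" "AE x in lborel. x \<in> {0<..<1} \<longrightarrow> v x = v0 x" by metis
  note [measurable] = u(1) v(1)
  define f where "f = unfold2 u v"
  have fm [measurable]: "f \<in> borel_measurable borel" unfolding f_def unfold2_def[abs_def] by measurable
  have fu: "AE x in lborel. 0 < x \<and> x < 1 \<longrightarrow> f x = u0 x"
    using u(2) by eventually_elim (auto simp: f_def unfold2_pos)
  have fv: "AE x in lborel. 0 < x \<and> x < 1 \<longrightarrow> f (- x) = v0 x"
    using v(2) by eventually_elim (auto simp: f_def unfold2_neg)
  have per: "per (\<lambda>z. G (f z)) = (\<integral>\<^sup>+x\<in>{0<..<1}. G (u0 x) \<partial>lborel) + (\<integral>\<^sup>+x\<in>{0<..<1}. G (v0 x) \<partial>lborel)"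
    if [measurable]: "G \<in> borel_measurable borel" for G :: "real \<Rightarrow> ennreal"
  proof -
    have "(\<integral>\<^sup>+x\<in>{0<..<1}. G (f x) \<partial>lborel) = (\<integral>\<^sup>+x\<in>{0<..<1}. G (u0 x) \<partial>lborel)"
      by (rule nn_integral_cong_AE) (use fu in \<open>auto elim!: eventually_mono simp: indicator_def\<close>)
    moreover have "(\<integral>\<^sup>+x\<in>{0<..<1}. G (f (- x)) \<partial>lborel) = (\<integral>\<^sup>+x\<in>{0<..<1}. G (v0 x) \<partial>lborel)"
      by (rule nn_integral_cong_AE) (use fv in \<open>auto elim!: eventually_mono simp: indicator_def\<close>)
    ultimately show ?thesis using per_halves[of "\<lambda>z. G (f z)"] by simp
  qed
  have fin: "(\<integral>\<^sup>+x\<in>{0<..<1}. ennreal (\<bar>h x\<bar> powr p) \<partial>lborel) < \<infinity>" if "in_Lp p (lebesgue_on {0<..<1}) h" for h :: "real \<Rightarrow> real"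
  proof -
    have "(\<integral>\<^sup>+x. ennreal (\<bar>h x\<bar> powr p) \<partial>lebesgue_on {0<..<1}) = ennreal (LINT x|lebesgue_on {0<..<1}. \<bar>h x\<bar> powr p)"
      using that by (intro nn_integral_eq_integral) (auto simp: in_Lp_def)
    then have "(\<integral>\<^sup>+x\<in>{0<..<1}. ennreal (\<bar>h x\<bar> powr p) \<partial>lborel) = ennreal (LINT x|lebesgue_on {0<..<1}. \<bar>h x\<bar> powr p)"
      unfolding nn_integral_lebesgue_on_Ioo .
    then show ?thesis by simp
  qed
  have "periodic2 f" by (simp add: periodic2_def f_def unfold2_periodic)
  moreover have "per (\<lambda>z. ennreal \<bar>f z\<bar>) < \<infinity>"
    using per[of "\<lambda>y. ennreal \<bar>y\<bar>"] in_Lp_imp_L1[OF u0] in_Lp_imp_L1[OF v0] \<open>1 < p\<close> by simp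
  moreover have "per (\<lambda>z. ennreal (\<bar>f z\<bar> powr p)) < \<infinity>"
    using per[of "\<lambda>y. ennreal (\<bar>y\<bar> powr p)"] fin[OF u0] fin[OF v0] by simp
  ultimately show ?thesis using fu fv by (intro that[of f]) (auto simp: Lp_datum_def datum_def)
qed

text \<open>
  The coefficient is given up to null sets. A Borel version is truncated so that the bounds hold
  everywhere, and is extended to the circle by \<open>y \<mapsto> |fold2 y|\<close>. The
  truncation by \<open>A\<close> from above is consistent with the lower bound, since \<open>lam
  \<le> A\<close> whenever both bounds hold on a set of positive measure.
\<close>

lemma transport_of_coefficient:
  fixes a :: "real \<Rightarrow> real \<Rightarrow> real"
  assumes a: "in_Linf (lebesgue_on ({0<..} \<times> {0<..<1})) (\<lambda>(t, x). a t x)"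
    and A: "Linf_norm (lebesgue_on ({0<..} \<times> {0<..<1})) (\<lambda>(t, x). a t x) = A"
    and nonneg: "AE (t, x) in lebesgue_on ({0<..} \<times> {0<..<1}). a t x \<ge> 0"
    and sub: "{x0 - \<epsilon><..<x0 + \<epsilon>} \<subseteq> {0<..<1}"
    and lower: "AE (t, x) in lebesgue_on ({0<..} \<times> {x0 - \<epsilon><..<x0 + \<epsilon>}). a t x \<ge> lam"
    and "0 < \<epsilon>" "0 < lam"
  obtains \<alpha> where "transport A \<alpha>" "AE (t, x) in lborel. 0 < t \<and> 0 < x \<and> x < 1 \<longrightarrow> a t x = \<alpha> t x"
    "\<And>t y. \<bar>y - x0\<bar> < \<epsilon> \<Longrightarrow> lam \<le> \<alpha> t y"
proof -
  define \<Omega> where "\<Omega> = {0::real<..} \<times> {0<..<1::real}"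
  have \<Omega>: "\<Omega> \<in> sets (borel :: (real \<times> real) measure)" unfolding \<Omega>_def by (intro borel_open open_Times) auto
  have \<Omega>': "{0::real<..} \<times> {x0 - \<epsilon><..<x0 + \<epsilon>} \<in> sets (borel :: (real \<times> real) measure)" by (intro borel_open open_Times) auto
  have m: "(\<lambda>(t, x). a t x) \<in> borel_measurable (lebesgue_on \<Omega>)"
    and fin: "esssup (lebesgue_on \<Omega>) (\<lambda>z. ereal \<bar>case z of (t, x) \<Rightarrow> a t x\<bar>) < \<infinity>"
    using a by (auto simp: in_Linf_def \<Omega>_def)
  define E where "E = esssup (lebesgue_on \<Omega>) (\<lambda>z. ereal \<bar>case z of (t, x) \<Rightarrow> a t x\<bar>)"
  have EA: "real_of_ereal E = A" using A by (simp add: Linf_norm_def E_def \<Omega>_def)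
  have "AE z in lebesgue_on \<Omega>. ereal \<bar>case z of (t, x) \<Rightarrow> a t x\<bar> \<le> E"
    unfolding E_def by (rule esssup_AE)
  then have up: "AE z in lborel. z \<in> \<Omega> \<longrightarrow> ereal \<bar>case z of (t, x) \<Rightarrow> a t x\<bar> \<le> E"
    by (subst (asm) AE_lebesgue_on_iff[OF \<Omega>])
  have upA: "AE (t, x) in lborel. 0 < t \<and> 0 < x \<and> x < 1 \<longrightarrow> a t x \<le> A"
    using up
  proof eventually_elim
    case (elim z)
    obtain t x where z: "z = (t, x)" by force
    show ?case
      unfolding z prod.case
    proof
      assume "0 < t \<and> 0 < x \<and> x < 1"
      then have le: "ereal \<bar>a t x\<bar> \<le> E" using elim by (simp add: z \<Omega>_def)
      have "E = ereal A"
        using le fin EA unfolding E_def[symmetric] by (cases E) auto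
      then show "a t x \<le> A" using le by simp
    qed
  qed
  have low0: "AE (t, x) in lborel. 0 < t \<and> 0 < x \<and> x < 1 \<longrightarrow> 0 \<le> a t x"
    using nonneg unfolding AE_lebesgue_on_iff[OF \<Omega>[unfolded \<Omega>_def]] by (auto elim!: eventually_mono)
  have low: "AE (t, x) in lborel. 0 < t \<and> \<bar>x - x0\<bar> < \<epsilon> \<longrightarrow> lam \<le> a t x"
    using lower unfolding AE_lebesgue_on_iff[OF \<Omega>'] by (auto elim!: eventually_mono simp: abs_less_iff)
  have inside: "0 < x \<and> x < 1" if "\<bar>x - x0\<bar> < \<epsilon>" for x
  proof -
    have "x \<in> {x0 - \<epsilon><..<x0 + \<epsilon>}" using that by (auto simp: abs_less_iff)
    then show ?thesis using sub by auto
  qed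
  \<comment> \<open>Both bounds hold at almost every point of the strip around x0, so at one
    point at least.\<close>
  have lamA: "lam \<le> A"
  proof -
    have "AE (t, x) in (lborel :: (real \<times> real) measure). 0 < t \<and> \<bar>x - x0\<bar> < \<epsilon> \<longrightarrow> lam \<le> A"
      using low upA by eventually_elim (auto dest: inside)
    then have "AE q in lborel. AE s in (lborel :: real measure). 0 < s \<and> \<bar>q + 0 * s - x0\<bar> < \<epsilon> \<longrightarrow> lam \<le> A"
      by (rule AE_lborel_pair_characteristics)
    then have "AE q in lborel. AE s in (lborel :: real measure). 0 < s \<and> \<bar>q - x0\<bar> < \<epsilon> \<longrightarrow> lam \<le> A" by simp
    then have "AE h in lborel. AE s in (lborel :: real measure). 0 < s \<and> \<bar>x0 - h - x0\<bar> < \<epsilon> \<longrightarrow> lam \<le> A" by (rule AE_lborel_reflect)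
    from AE_lborel_ex_in_interval[OF this \<open>0 < \<epsilon>\<close>] obtain h where h: "0 < h" "h < \<epsilon>"
      "AE s in (lborel :: real measure). 0 < s \<and> \<bar>x0 - h - x0\<bar> < \<epsilon> \<longrightarrow> lam \<le> A" by blast
    from AE_lborel_ex_in_interval[OF h(3) zero_less_one] h(1,2) show ?thesis by auto
  qed
  obtain a' where a': "a' \<in> borel_measurable borel" "AE z in lborel. z \<in> \<Omega> \<longrightarrow> a' z = (\<lambda>(t, x). a t x) z"
    using borel_version[OF m \<Omega>] by metis
  have [measurable]: "a' \<in> borel_measurable (borel \<Otimes>\<^sub>M borel)" using a'(1) by (simp add: borel_prod)
  define \<beta> where "\<beta> t x = max (if \<bar>x - x0\<bar> < \<epsilon> then lam else 0) (min (a' (t, x)) A)" for t x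
  define \<alpha> where "\<alpha> t y = \<beta> t \<bar>fold2 y\<bar>" for t y
  have fold_even: "\<bar>fold2 (- y)\<bar> = \<bar>fold2 y\<bar>" for y
  proof -
    define j where "j = \<lfloor>(y + 1) / 2\<rfloor>"
    have y: "y = fold2 y + 2 * real_of_int j" by (simp add: fold2_def j_def)
    have b: "-1 \<le> fold2 y" "fold2 y < 1"
      unfolding fold2_def using floor_correct[of "(y + 1) / 2"] by (simp_all add: field_simps)
    have "fold2 (- y) = fold2 (- fold2 y + 2 * real_of_int (- j))" by (subst y) simp
    also have "\<dots> = fold2 (- fold2 y)" by (rule fold2_periodic)
    finally have e: "fold2 (- y) = fold2 (- fold2 y)" .
    show ?thesis
    proof (cases "fold2 y = -1")
      case True
      have "fold2 1 = fold2 (- 1 + 2 * real_of_int 1)" by simp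
      also have "\<dots> = fold2 (- 1)" by (rule fold2_periodic)
      also have "\<dots> = - 1" by (simp add: fold2_eq)
      finally show ?thesis using e True by simp
    next
      case False
      then have "fold2 (- fold2 y) = - fold2 y" using b by (intro fold2_eq) auto
      then show ?thesis using e by simp
    qed
  qed
  have [measurable]: "case_prod \<beta> \<in> borel_measurable (borel \<Otimes>\<^sub>M borel)" unfolding \<beta>_def by measurable
  note [measurable] = borel_pair_compose[OF this]
  show ?thesis
  proof (rule that[of \<alpha>])
    show "transport A \<alpha>"
    proof
      show "case_prod \<alpha> \<in> borel_measurable (borel \<Otimes>\<^sub>M borel)" unfolding \<alpha>_def by measurable
      show "0 \<le> \<alpha> t y" for t y using \<open>0 < lam\<close> by (auto simp: \<alpha>_def \<beta>_def)
      show "\<alpha> t y \<le> A" for t y using \<open>0 < lam\<close> lamA by (auto simp: \<alpha>_def \<beta>_def)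
      show "\<alpha> t (- y) = \<alpha> t y" for t y by (simp add: \<alpha>_def fold_even)
      show "\<alpha> t (y + 2) = \<alpha> t y" for t y using fold2_periodic[of y 1] by (simp add: \<alpha>_def)
    qed
    show "AE (t, x) in lborel. 0 < t \<and> 0 < x \<and> x < 1 \<longrightarrow> a t x = \<alpha> t x"
      using a'(2) upA low0 low
    proof eventually_elim
      case (elim z)
      obtain t x where z: "z = (t, x)" by force
      show ?case
        unfolding z prod.case
      proof
        assume tx: "0 < t \<and> 0 < x \<and> x < 1"
        then have "a' (t, x) = a t x" "a t x \<le> A" "0 \<le> a t x" "\<bar>x - x0\<bar> < \<epsilon> \<longrightarrow> lam \<le> a t x"
          using elim by (auto simp: z \<Omega>_def)
        moreover have "\<bar>fold2 x\<bar> = x" using tx by (simp add: fold2_eq)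
        ultimately show "a t x = \<alpha> t x" by (auto simp: \<alpha>_def \<beta>_def max_def min_def)
      qed
    qed
    show "lam \<le> \<alpha> t y" if y: "\<bar>y - x0\<bar> < \<epsilon>" for t y
    proof -
      have "\<bar>fold2 y\<bar> = y" using inside[OF y] by (simp add: fold2_eq)
      then show ?thesis using y by (simp add: \<alpha>_def \<beta>_def)
    qed
  qed
qed

theorem theorem1p2:
  fixes p \<epsilon>0 lam A :: real
  assumes "1 < p" and "\<epsilon>0 > 0" and "lam > 0"
  shows "\<exists>C \<gamma>. C > 0 \<and> \<gamma> > 0 \<and>
    (\<forall>(a :: real \<Rightarrow> real \<Rightarrow> real) (x0 :: real).
       in_Linf (lebesgue_on ({0<..} \<times> {0<..<1})) (\<lambda>(t, x). a t x) \<and>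
       Linf_norm (lebesgue_on ({0<..} \<times> {0<..<1})) (\<lambda>(t, x). a t x) = A \<and>
       (AE (t, x) in lebesgue_on ({0<..} \<times> {0<..<1}). a t x \<ge> 0) \<and>
       x0 \<in> {0<..<1} \<and>
       {x0 - \<epsilon>0<..<x0 + \<epsilon>0} \<subseteq> {0<..<1} \<and>
       (AE (t, x) in lebesgue_on ({0<..} \<times> {x0 - \<epsilon>0<..<x0 + \<epsilon>0}). a t x \<ge> lam)
       \<longrightarrow>
       (\<forall>\<rho>0 \<xi>0. in_Lp p (lebesgue_on {0<..<1}) \<rho>0 \<and> in_Lp p (lebesgue_on {0<..<1}) \<xi>0 \<longrightarrow>
          (\<exists>\<rho> \<xi>. global_broad_solution p a \<rho>0 \<xi>0 \<rho> \<xi>) \<and>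
          (\<forall>\<rho> \<xi> \<rho>' \<xi>'. global_broad_solution p a \<rho>0 \<xi>0 \<rho> \<xi> \<and>
                       global_broad_solution p a \<rho>0 \<xi>0 \<rho>' \<xi>' \<longrightarrow>
             (\<forall>t\<ge>0. AE x in lebesgue_on {0<..<1}. \<rho> t x = \<rho>' t x \<and> \<xi> t x = \<xi>' t x)) \<and>
          (\<forall>\<rho> \<xi>. global_broad_solution p a \<rho>0 \<xi>0 \<rho> \<xi> \<longrightarrow>
             (let c0 = mean_state \<rho> \<xi> in
              \<forall>t\<ge>0. Lp2_norm p (lebesgue_on {0<..<1}) (\<lambda>x. \<rho> t x - c0) (\<lambda>x. \<xi> t x - c0)
                \<le> C * exp (- \<gamma> * t) *
                  Lp2_norm p (lebesgue_on {0<..<1}) (\<lambda>x. \<rho> 0 x - c0) (\<lambda>x. \<xi> 0 x - c0)))))"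
proof -
  \<comment> \<open>n + 1 rounds of jumps cover the circle; they take the time T0 and give the
    constant \<kappa>. One step of length T0 contracts by 1 - \<theta>, where A / 2 bounds the
    rate. The maximum with 1 / 2 keeps q positive so that it has a logarithm, and the factor 1
    / q pays for the last incomplete step.\<close>
  define n where "n = nat \<lceil>1 / (2 * \<epsilon>0)\<rceil>"
  define \<kappa> where "\<kappa> = ((lam / 2)\<^sup>2 * \<epsilon>0\<^sup>2 / 4) ^ Suc n / \<epsilon>0"
  define T0 where "T0 = 6 * real (Suc n)"
  define \<theta> where "\<theta> = 2 * \<kappa> * exp (- (A / 2) * T0)"
  define q where "q = max (1 - \<theta>) (1 / 2)"
  define C where "C = 1 / q"
  define \<gamma> where "\<gamma> = - ln q / T0"
  have \<kappa>: "0 < \<kappa>" using assms by (simp add: \<kappa>_def)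
  have \<theta>: "0 < \<theta>" using \<kappa> by (simp add: \<theta>_def)
  have T0: "0 < T0" by (simp add: T0_def)
  have q: "0 < q" "q < 1" "1 - \<theta> \<le> q" using \<theta> by (auto simp: q_def)
  have n: "1 \<le> 2 * \<epsilon>0 * real (Suc n)"
  proof -
    have "1 / (2 * \<epsilon>0) \<le> real n" unfolding n_def by (rule real_nat_ceiling_ge)
    then have "1 \<le> real n * (2 * \<epsilon>0)" using assms(2) by (simp add: pos_divide_le_eq)
    also have "\<dots> \<le> real (Suc n) * (2 * \<epsilon>0)" using assms(2) by (intro mult_right_mono) auto
    finally show ?thesis by (simp add: mult.commute)
  qed
  have rate: "q ^ m \<le> C * exp (- \<gamma> * t)" if "t < (real m + 1) * T0" for m t
  proof -
    have "exp (- \<gamma> * t) = q powr (t / T0)" using q by (simp add: powr_def \<gamma>_def)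
    then have "C * exp (- \<gamma> * t) = q powr (t / T0 - 1)" using q by (simp add: C_def powr_diff)
    moreover have "q ^ m = q powr real m" using q by (simp add: powr_realpow)
    moreover have "t / T0 - 1 \<le> real m" using that T0 by (simp add: pos_divide_le_eq algebra_simps)
    ultimately show ?thesis using q by (simp add: powr_mono')
  qed
  show ?thesis
  proof (rule exI[of _ C], rule exI[of _ \<gamma>], intro conjI allI impI)
    show "0 < C" "0 < \<gamma>" using q T0 by (auto simp: C_def \<gamma>_def divide_neg_pos)
  next
    fix a :: "real \<Rightarrow> real \<Rightarrow> real" and x0 :: real and \<rho>0 \<xi>0 :: "real \<Rightarrow> real"
    assume H: "in_Linf (lebesgue_on ({0<..} \<times> {0<..<1})) (\<lambda>(t, x). a t x) \<and>
       Linf_norm (lebesgue_on ({0<..} \<times> {0<..<1})) (\<lambda>(t, x). a t x) = A \<and>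
       (AE (t, x) in lebesgue_on ({0<..} \<times> {0<..<1}). a t x \<ge> 0) \<and>
       x0 \<in> {0<..<1} \<and>
       {x0 - \<epsilon>0<..<x0 + \<epsilon>0} \<subseteq> {0<..<1} \<and>
       (AE (t, x) in lebesgue_on ({0<..} \<times> {x0 - \<epsilon>0<..<x0 + \<epsilon>0}). a t x \<ge> lam)"
      and D: "in_Lp p (lebesgue_on {0<..<1}) \<rho>0 \<and> in_Lp p (lebesgue_on {0<..<1}) \<xi>0"
    obtain \<alpha> where tr: "transport A \<alpha>" and a: "AE (t, x) in lborel. 0 < t \<and> 0 < x \<and> x < 1 \<longrightarrow> a t x = \<alpha> t x"
      and low: "\<And>t y. \<bar>y - x0\<bar> < \<epsilon>0 \<Longrightarrow> lam \<le> \<alpha> t y"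
      using transport_of_coefficient[of a A x0 \<epsilon>0 lam] H assms by blast
    interpret transport A \<alpha> by (rule tr)
    obtain f where f: "Lp_datum p f" and xi0: "AE x in lborel. 0 < x \<and> x < 1 \<longrightarrow> f x = \<xi>0 x"
      and rho0: "AE x in lborel. 0 < x \<and> x < 1 \<longrightarrow> f (- x) = \<rho>0 x"
      using Lp_datum_of_initial_data[OF \<open>1 < p\<close>, of \<xi>0 \<rho>0] D by blast
    have d: "datum f" using f by (simp add: Lp_datum_def)
    have fm [measurable]: "f \<in> borel_measurable borel" using d by (simp add: datum_def)
    note [measurable] = borel_pair_compose[OF wave_measurable[OF d]]
    have unique: "AE x in lborel. x \<in> {0<..<1} \<longrightarrow> \<rho> t x = wave f t (- x) \<and> \<xi> t x = wave f t x"
      if "global_broad_solution p a \<rho>0 \<xi>0 \<rho> \<xi>" "0 \<le> t" for \<rho> \<xi> t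
      using that by (intro broad_solution_unique[OF f \<open>1 < p\<close> rho0 xi0 a]) (auto simp: global_broad_solution_def)
    have start: "wave f 0 y = f y" for y by (simp add: wave_def flow_start[OF d])
    show "\<exists>\<rho> \<xi>. global_broad_solution p a \<rho>0 \<xi>0 \<rho> \<xi>"
    proof (intro exI)
      have "AE x in lebesgue_on {0<..<1}. wave f 0 (- x) = \<rho>0 x \<and> wave f 0 x = \<xi>0 x"
        unfolding start AE_lebesgue_on_iff[OF borel_open[OF open_greaterThanLessThan]]
        using rho0 xi0 by eventually_elim auto
      then show "global_broad_solution p a \<rho>0 \<xi>0 (\<lambda>t x. wave f t (- x)) (\<lambda>t x. wave f t x)"
        unfolding global_broad_solution_def
        using wave_broad_solution[OF f \<open>1 < p\<close> rho0 xi0 a] by auto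
    qed
    show "AE x in lebesgue_on {0<..<1}. \<rho> t x = \<rho>' t x \<and> \<xi> t x = \<xi>' t x"
      if "global_broad_solution p a \<rho>0 \<xi>0 \<rho> \<xi> \<and> global_broad_solution p a \<rho>0 \<xi>0 \<rho>' \<xi>'" "0 \<le> t" for \<rho> \<xi> \<rho>' \<xi>' t
      unfolding AE_lebesgue_on_iff[OF borel_open[OF open_greaterThanLessThan]]
      using unique[OF conjunct1[OF that(1)] that(2)] unique[OF conjunct2[OF that(1)] that(2)]
      by eventually_elim auto
    fix \<rho> \<xi> assume sol: "global_broad_solution p a \<rho>0 \<xi>0 \<rho> \<xi>"
    define b where "b = (1 / 2) * (LINT x:{0<..<1}|lborel. f (- x) + f x)"
    have mean: "mean_state \<rho> \<xi> = b"
    proof -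
      have "(LINT x|lebesgue_on {0<..<1}. \<rho> 0 x + \<xi> 0 x) = (LINT x:{0<..<1}|lborel. f (- x) + f x)"
        by (rule LINT_lebesgue_on_cong)
           (use unique[OF sol order_refl] in \<open>auto simp: start elim!: eventually_mono\<close>)
      then show ?thesis by (simp add: mean_state_def b_def)
    qed
    define g where "g z = f z - b" for z
    have g: "datum g" using datum_add[OF d datum_const[of "- b"]] by (simp add: g_def[abs_def])
    have [measurable]: "g \<in> borel_measurable borel" using g by (simp add: datum_def)
    have mass: "per (\<lambda>z. ennreal (g z)) = per (\<lambda>z. ennreal (- g z))"
      unfolding g_def b_def by (rule balanced_of_mean[OF d])
    have gfin: "per (\<lambda>z. ennreal (\<bar>g z\<bar> powr p)) < \<infinity>"
    proof -
      have "per (\<lambda>z. ennreal (\<bar>g z\<bar> powr p)) \<le> per (\<lambda>z. ennreal (2 powr p) * (ennreal (\<bar>f z\<bar> powr p) + ennreal (\<bar>b\<bar> powr p)))"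
        using powr_add_le[of p _ "- b"] \<open>1 < p\<close> by (intro per_mono) (simp add: g_def)
      also have "\<dots> = ennreal (2 powr p) * (per (\<lambda>z. ennreal (\<bar>f z\<bar> powr p)) + 2 * ennreal (\<bar>b\<bar> powr p))"
        by (simp add: per_cmult per_add per_const)
      also have "\<dots> < \<infinity>" using f by (auto simp: Lp_datum_def ennreal_mult_less_top)
      finally show ?thesis .
    qed
    have \<epsilon>: "0 < \<epsilon>0" "\<epsilon>0 \<le> 1 / 2"
    proof -
      have sub: "{x0 - \<epsilon>0<..<x0 + \<epsilon>0} \<subseteq> {0<..<1}" using H by blast
      have "0 \<le> x0 - \<epsilon>0 \<and> x0 + \<epsilon>0 \<le> 1"
        using sub assms(2) by (subst (asm) greaterThanLessThan_subseteq_greaterThanLessThan) auto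
      then show "\<epsilon>0 \<le> 1 / 2" by linarith
    qed (use assms in auto)
    have minor: "ennreal \<kappa> * per h \<le> evol s h (s + T0) z" if h: "h \<in> borel_measurable borel" "periodic2 h" for s h z
      unfolding \<kappa>_def T0_def
    proof (rule evol_minorization[OF h \<epsilon> _ _ n])
      show "lam / 2 \<le> \<alpha> r (z + r) / 2" if "\<bar>z + r - x0\<bar> < \<epsilon>0" for r z
        using low[OF that, of r] by simp
    qed (use assms in auto)
    \<comment> \<open>The lower bound for the evolution of the constant 1 cannot exceed its
      value.\<close>
    have \<theta>1: "\<theta> \<le> 1"
    proof -
      have "ennreal \<kappa> * per (\<lambda>z. 1) \<le> evol 0 (\<lambda>z. 1) (0 + T0) 0" by (rule minor) (auto simp: periodic2_def)
      then have "ennreal (2 * \<kappa>) \<le> ennreal (exp (A / 2 * T0))"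
        using \<kappa> T0 evol_one[of 0 T0 0] by (simp add: per_const ennreal_mult mult.commute)
      then have "2 * \<kappa> \<le> exp (A / 2 * T0)" by (simp add: ennreal_le_iff)
      then have "2 * \<kappa> * exp (- (A / 2) * T0) \<le> exp (A / 2 * T0) * exp (- (A / 2) * T0)" by (intro mult_right_mono) auto
      also have "\<dots> = 1" by (simp add: exp_minus)
      finally show ?thesis by (simp add: \<theta>_def)
    qed
    have norm: "Lp2_norm p (lebesgue_on {0<..<1}) (\<lambda>x. \<rho> t x - b) (\<lambda>x. \<xi> t x - b) =
        enn2real (per (\<lambda>z. ennreal (\<bar>flow g t z\<bar> powr p))) powr (1 / p)" if "0 \<le> t" for t
    proof -
      have "Lp2_norm p (lebesgue_on {0<..<1}) (\<lambda>x. \<rho> t x - b) (\<lambda>x. \<xi> t x - b) =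
          Lp2_norm p (lebesgue_on {0<..<1}) (\<lambda>x. wave f t (- x) - b) (\<lambda>x. wave f t x - b)"
        by (rule Lp2_norm_AE_cong) (use unique[OF sol that] in \<open>auto elim!: eventually_mono\<close>)
      then show ?thesis by (simp add: Lp2_norm_wave[OF d] g_def[abs_def] flow_shift[OF d])
    qed
    show "let c0 = mean_state \<rho> \<xi> in
              \<forall>t\<ge>0. Lp2_norm p (lebesgue_on {0<..<1}) (\<lambda>x. \<rho> t x - c0) (\<lambda>x. \<xi> t x - c0)
                \<le> C * exp (- \<gamma> * t) *
                  Lp2_norm p (lebesgue_on {0<..<1}) (\<lambda>x. \<rho> 0 x - c0) (\<lambda>x. \<xi> 0 x - c0)"
      unfolding mean Let_def
    proof (intro allI impI)
      fix t :: real assume t: "0 \<le> t"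
      define m where "m = nat \<lfloor>t / T0\<rfloor>"
      have "0 \<le> t / T0" using t T0 by simp
      then have fl: "real m \<le> t / T0" "t / T0 < real m + 1" unfolding m_def by linarith+
      have m: "real m * T0 \<le> t" "t < (real m + 1) * T0"
        using fl T0 by (simp_all add: pos_le_divide_eq pos_divide_less_eq)
      define N where "N = enn2real (per (\<lambda>z. ennreal (\<bar>g z\<bar> powr p)))"
      have N: "per (\<lambda>z. ennreal (\<bar>g z\<bar> powr p)) = ennreal N" "0 \<le> N" using gfin by (auto simp: N_def)
      have pm: "((1 - \<theta>) powr p) ^ m = ((1 - \<theta>) ^ m) powr p"
        by (induction m) (use \<theta>1 in \<open>simp_all add: powr_mult\<close>)
      have "per (\<lambda>z. ennreal (\<bar>flow g t z\<bar> powr p)) \<le> ennreal (((1 - \<theta>) powr p) ^ m) * per (\<lambda>z. ennreal (\<bar>g z\<bar> powr p))"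
        unfolding \<theta>_def using \<kappa> T0
        by (intro flow_decay[OF g mass \<open>1 < p\<close> _ _ minor gfin m(1)]) auto
      also have "\<dots> = ennreal (((1 - \<theta>) ^ m) powr p * N)"
        using N \<theta>1 by (simp add: ennreal_mult pm)
      finally have "enn2real (per (\<lambda>z. ennreal (\<bar>flow g t z\<bar> powr p))) \<le> ((1 - \<theta>) ^ m) powr p * N"
        using N by (intro enn2real_leI) auto
      then have "enn2real (per (\<lambda>z. ennreal (\<bar>flow g t z\<bar> powr p))) powr (1 / p) \<le> (((1 - \<theta>) ^ m) powr p * N) powr (1 / p)"
        using \<open>1 < p\<close> by (intro powr_mono2) auto
      also have "\<dots> = (1 - \<theta>) ^ m * N powr (1 / p)"
        using \<open>1 < p\<close> \<theta>1 N by (simp add: powr_mult powr_powr)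
      also have "\<dots> \<le> q ^ m * N powr (1 / p)"
        using \<theta>1 q by (intro mult_right_mono power_mono) auto
      also have "\<dots> \<le> C * exp (- \<gamma> * t) * N powr (1 / p)"
        by (intro mult_right_mono rate m) auto
      finally show "Lp2_norm p (lebesgue_on {0<..<1}) (\<lambda>x. \<rho> t x - b) (\<lambda>x. \<xi> t x - b)
          \<le> C * exp (- \<gamma> * t) * Lp2_norm p (lebesgue_on {0<..<1}) (\<lambda>x. \<rho> 0 x - b) (\<lambda>x. \<xi> 0 x - b)"
        unfolding norm[OF t] norm[OF order_refl] by (simp add: N_def flow_start[OF g])
    qed
  qed
qed

end
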